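(* Let $N>p\ge m>1$ and $p<\sigma<p^*$, and let $\Omega$, $V$, $L$, $M$ be as described in the context, with $V(x)\to1$ as $|x|\to\infty$. Assume that $\xi\mapsto L(\xi)$ is $p$-homogeneous, $\xi\mapsto M(\xi)$ is $m$-homogeneous, $L(\xi)\ge p|\xi|^p$ and $M(\xi)\ge m|\xi|^m$ for all $\xi\in\mathbb R^N$, and set $$\mathbb S_\Omega:=\inf_{\|u\|_{L^\sigma(\Omega)}=1}\int_\Omega\frac{L(Du)}{p}+\frac{M(Du)}{m}+\frac{V(x)}{p}|u|^p,$$ the infimum being over $u\in W^{1,p}_0(\Omega)\cap D^{1,m}_0(\Omega)$, and $$\mathbb S_{\mathbb R^N}:=\inf_{\|u\|_{L^\sigma(\mathbb R^N)}=1}\int_{\mathbb R^N}\frac{|Du|^p}{p}+\frac{|u|^p}{p},$$ the infimum being over $u\in W^{1,p}(\mathbb R^N)$. Assume furthermore that $$\mathbb S_\Omega<\Big(\frac{\sigma-p}{\sigma-m}\Big)^{\frac{\sigma-p}{\sigma}}\mathbb S_{\mathbb R^N}.$$ Then the minimization problem defining $\mathbb S_\Omega$ admits a minimizer.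
   Context: $\Omega\subset\mathbb R^N$ is a smooth domain with bounded complement; $D$ denotes the gradient; $p^*=Np/(N-p)$. $W^{1,p}_0(\Omega)\cap D^{1,m}_0(\Omega)$ is the completion of $C^\infty_c(\Omega)$ with respect to the norm $\|u\|_{W^{1,p}(\Omega)}+\|Du\|_{L^m(\Omega)}$. $V$ is a continuous function on $\Omega$ with $\inf_\Omega V>0$. Standing assumptions on $L,M:\mathbb R^N\to\mathbb R$: if $m\ge 2$ they are $C^2$; if $m<2$ they are $C^1$ with $L_\xi,M_\xi\in C^1(\mathbb R^N\setminus\{0\})$. Both are strictly convex, and for some $C>0$ and all $\xi$: $|L(\xi)|\le C|\xi|^p$, $|L_\xi(\xi)|\le C|\xi|^{p-1}$, $|M(\xi)|\le C|\xi|^m$, $|M_\xi(\xi)|\le C|\xi|^{m-1}$. Moreover $|L_{\xi\xi}(\xi)|\le C|\xi|^{p-2}$ if $p\ge2$, while $\sup_{h\ne0,\xi}|L_\xi(\xi+h)-L_\xi(\xi)|/|h|^{p-1}<\infty$ if $p<2$; and $|M_{\xi\xi}(\xi)|\le C|\xi|^{m-2}$ if $m\ge2$, while $\sup_{h\ne0,\xi}|M_\xi(\xi+h)-M_\xi(\xi)|/|h|^{m-1}<\infty$ if $m<2$. *)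

theory Defs
  imports "HOL-Analysis.Analysis"
begin

section \<open>Classical smoothness\<close>

definition grad :: "(real^'n \<Rightarrow> real) \<Rightarrow> real^'n \<Rightarrow> real^'n" where
  "grad f x = (\<chi> i. frechet_derivative f (at x) (axis i 1))"

text \<open>The derivatives are taken in the ambient space, so \<open>S\<close> is meant to be open.\<close>

fun Ck_on :: "nat \<Rightarrow> (real^'n \<Rightarrow> 'b::real_normed_vector) \<Rightarrow> (real^'n) set \<Rightarrow> bool" where
  "Ck_on 0 f S \<longleftrightarrow> continuous_on S f"
| "Ck_on (Suc k) f S \<longleftrightarrow> (\<forall>x\<in>S. f differentiable at x) \<and>
     (\<forall>i. Ck_on k (\<lambda>x. frechet_derivative f (at x) (axis i 1)) S)"

definition smooth_on :: "(real^'n \<Rightarrow> real) \<Rightarrow> (real^'n) set \<Rightarrow> bool" where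
  "smooth_on f S \<longleftrightarrow> (\<forall>k. Ck_on k f S)"

text \<open>\<open>C\<^sub>c\<^sup>\<infinity>(\<Omega>)\<close>; its elements are functions on the whole space, vanishing outside a compact
  subset of \<open>\<Omega>\<close>.\<close>

definition test_functions :: "(real^'n) set \<Rightarrow> (real^'n \<Rightarrow> real) set" where
  "test_functions \<Omega> =
     {\<phi>. smooth_on \<phi> UNIV \<and> compact (closure {x. \<phi> x \<noteq> 0}) \<and> closure {x. \<phi> x \<noteq> 0} \<subseteq> \<Omega>}"

text \<open>Near each boundary point, and in suitable orthonormal coordinates with last axis \<open>e\<close>, the
  domain is the region strictly above the graph of a smooth function of the remaining coordinates.
  Such a function is represented by a smooth \<open>\<gamma>\<close> on the whole space, evaluated only at the
  projection of \<open>x\<close> onto the hyperplane orthogonal to \<open>e\<close>.\<close>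

definition smooth_domain :: "(real^'n) set \<Rightarrow> bool" where
  "smooth_domain \<Omega> \<longleftrightarrow> open \<Omega> \<and> connected \<Omega> \<and> \<Omega> \<noteq> {} \<and>
     (\<forall>x\<^sub>0\<in>frontier \<Omega>. \<exists>r>0. \<exists>e \<gamma>. norm e = 1 \<and> smooth_on \<gamma> UNIV \<and>
        \<Omega> \<inter> ball x\<^sub>0 r = {x \<in> ball x\<^sub>0 r. x \<bullet> e > \<gamma> (x - (x \<bullet> e) *\<^sub>R e)})"


section \<open>Lebesgue and Sobolev spaces\<close>

text \<open>Elements are represented by functions on the whole space, of which only the restriction
  to \<open>\<Omega>\<close>, up to null sets, matters.\<close>

definition Lp :: "real \<Rightarrow> (real^'n) set \<Rightarrow> (real^'n \<Rightarrow> 'b::euclidean_space) set" where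
  "Lp q \<Omega> = {f. f \<in> borel_measurable (lebesgue_on \<Omega>) \<and>
                 integrable (lebesgue_on \<Omega>) (\<lambda>x. norm (f x) powr q)}"

text \<open>Only meaningful for members of \<^term>\<open>Lp q \<Omega>\<close>.\<close>

definition Lp_norm :: "real \<Rightarrow> (real^'n) set \<Rightarrow> (real^'n \<Rightarrow> 'b::euclidean_space) \<Rightarrow> real" where
  "Lp_norm q \<Omega> f = (LINT x|lebesgue_on \<Omega>. norm (f x) powr q) powr (1 / q)"

definition locally_integrable :: "(real^'n) set \<Rightarrow> (real^'n \<Rightarrow> 'b::euclidean_space) \<Rightarrow> bool" where
  "locally_integrable \<Omega> f \<longleftrightarrow> (\<forall>K. compact K \<and> K \<subseteq> \<Omega> \<longrightarrow> f absolutely_integrable_on K)"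

definition has_weak_gradient ::
    "(real^'n) set \<Rightarrow> (real^'n \<Rightarrow> real) \<Rightarrow> (real^'n \<Rightarrow> real^'n) \<Rightarrow> bool" where
  "has_weak_gradient \<Omega> u G \<longleftrightarrow> locally_integrable \<Omega> u \<and> locally_integrable \<Omega> G \<and>
     (\<forall>\<phi>\<in>test_functions \<Omega>.
        (LINT x|lebesgue_on \<Omega>. u x *\<^sub>R grad \<phi> x) = - (LINT x|lebesgue_on \<Omega>. \<phi> x *\<^sub>R G x))"

text \<open>Weak gradients are unique up to null sets, so the choice is immaterial.\<close>

definition weak_grad :: "(real^'n) set \<Rightarrow> (real^'n \<Rightarrow> real) \<Rightarrow> real^'n \<Rightarrow> real^'n" where
  "weak_grad \<Omega> u = (SOME G. has_weak_gradient \<Omega> u G)"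

definition W1p :: "real \<Rightarrow> (real^'n) set \<Rightarrow> (real^'n \<Rightarrow> real) set" where
  "W1p p \<Omega> = {u. (\<exists>G. has_weak_gradient \<Omega> u G) \<and> u \<in> Lp p \<Omega> \<and> weak_grad \<Omega> u \<in> Lp p \<Omega>}"

definition W1p_norm :: "real \<Rightarrow> (real^'n) set \<Rightarrow> (real^'n \<Rightarrow> real) \<Rightarrow> real" where
  "W1p_norm p \<Omega> u =
     (Lp_norm p \<Omega> u powr p + Lp_norm p \<Omega> (weak_grad \<Omega> u) powr p) powr (1 / p)"

text \<open>\<open>W\<^sub>0\<^sup>1\<^sup>,\<^sup>p(\<Omega>) \<inter> D\<^sub>0\<^sup>1\<^sup>,\<^sup>m(\<Omega>)\<close>: the completion of the test functions for the norm below. It is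
  realised as a closure inside the functions in \<^term>\<open>W1p p \<Omega>\<close> whose weak gradient is in
  \<^term>\<open>Lp m \<Omega>\<close>, which form a complete space for that norm.\<close>

definition W1p_D1m_norm :: "real \<Rightarrow> real \<Rightarrow> (real^'n) set \<Rightarrow> (real^'n \<Rightarrow> real) \<Rightarrow> real" where
  "W1p_D1m_norm p m \<Omega> u = W1p_norm p \<Omega> u + Lp_norm m \<Omega> (weak_grad \<Omega> u)"

definition W1p_D1m_0 :: "real \<Rightarrow> real \<Rightarrow> (real^'n) set \<Rightarrow> (real^'n \<Rightarrow> real) set" where
  "W1p_D1m_0 p m \<Omega> = {u. u \<in> W1p p \<Omega> \<and> weak_grad \<Omega> u \<in> Lp m \<Omega> \<and>
     (\<exists>\<phi>. (\<forall>k::nat. \<phi> k \<in> test_functions \<Omega>) \<and>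
          (\<lambda>k. W1p_D1m_norm p m \<Omega> (\<lambda>x. u x - \<phi> k x)) \<longlonglongrightarrow> 0)}"

definition sobolev_exponent :: "real \<Rightarrow> real \<Rightarrow> real" where
  "sobolev_exponent N p = N * p / (N - p)"


section \<open>The integrands\<close>

definition strictly_convex :: "(real^'n \<Rightarrow> real) \<Rightarrow> bool" where
  "strictly_convex f \<longleftrightarrow> (\<forall>x y t. x \<noteq> y \<and> 0 < t \<and> t < 1 \<longrightarrow>
     f ((1 - t) *\<^sub>R x + t *\<^sub>R y) < (1 - t) * f x + t * f y)"

text \<open>The standing assumptions on one integrand with growth exponent \<open>q\<close> (\<open>q = p\<close> for \<open>L\<close> and
  \<open>q = m\<close> for \<open>M\<close>); the regularity is governed by \<open>m\<close> for both integrands. The bound on the second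
  derivative is stated away from the origin, because the Hessian need not exist there if \<open>m < 2\<close>,
  and because \<open>0 powr 0 = 0\<close> would give the wrong bound at the origin if \<open>q = 2\<close>; where the Hessian
  is continuous at the origin, the bound there follows by passing to the limit.\<close>

definition admissible_integrand :: "real \<Rightarrow> real \<Rightarrow> (real^'n \<Rightarrow> real) \<Rightarrow> bool" where
  "admissible_integrand m q F \<longleftrightarrow>
     (2 \<le> m \<longrightarrow> Ck_on 2 F UNIV) \<and>
     (m < 2 \<longrightarrow> Ck_on 1 F UNIV \<and> Ck_on 1 (grad F) (- {0})) \<and>
     strictly_convex F \<and>
     (\<exists>C>0. (\<forall>\<xi>. \<bar>F \<xi>\<bar> \<le> C * norm \<xi> powr q \<and> norm (grad F \<xi>) \<le> C * norm \<xi> powr (q - 1)) \<and>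
            (2 \<le> q \<longrightarrow> (\<forall>\<xi>. \<xi> \<noteq> 0 \<longrightarrow>
               onorm (frechet_derivative (grad F) (at \<xi>)) \<le> C * norm \<xi> powr (q - 2)))) \<and>
     (q < 2 \<longrightarrow> bdd_above {norm (grad F (\<xi> + h) - grad F \<xi>) / norm h powr (q - 1) | \<xi> h. h \<noteq> 0})"

definition pos_homogeneous :: "real \<Rightarrow> (real^'n \<Rightarrow> real) \<Rightarrow> bool" where
  "pos_homogeneous q F \<longleftrightarrow> (\<forall>t>0. \<forall>\<xi>. F (t *\<^sub>R \<xi>) = t powr q * F \<xi>)"


section \<open>The minimization problems\<close>

text \<open>The integrands are nonnegative in the intended setting; the energies take values in
  \<open>[0,\<infinity>]\<close> because \<open>V\<close> may be unbounded near the boundary of \<open>\<Omega>\<close>.\<close>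

definition energy :: "real \<Rightarrow> real \<Rightarrow> (real^'n \<Rightarrow> real) \<Rightarrow> (real^'n \<Rightarrow> real) \<Rightarrow>
    (real^'n \<Rightarrow> real) \<Rightarrow> (real^'n) set \<Rightarrow> (real^'n \<Rightarrow> real) \<Rightarrow> ennreal" where
  "energy p m L M V \<Omega> u = (\<integral>\<^sup>+ x. ennreal (L (weak_grad \<Omega> u x) / p + M (weak_grad \<Omega> u x) / m
                               + V x / p * \<bar>u x\<bar> powr p) \<partial>lebesgue_on \<Omega>)"

definition constraint_set :: "real \<Rightarrow> real \<Rightarrow> real \<Rightarrow> (real^'n) set \<Rightarrow> (real^'n \<Rightarrow> real) set" where
  "constraint_set p m \<sigma> \<Omega> = {u \<in> W1p_D1m_0 p m \<Omega>. u \<in> Lp \<sigma> \<Omega> \<and> Lp_norm \<sigma> \<Omega> u = 1}"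

definition S_Omega :: "real \<Rightarrow> real \<Rightarrow> real \<Rightarrow> (real^'n \<Rightarrow> real) \<Rightarrow> (real^'n \<Rightarrow> real) \<Rightarrow>
    (real^'n \<Rightarrow> real) \<Rightarrow> (real^'n) set \<Rightarrow> ennreal" where
  "S_Omega p m \<sigma> L M V \<Omega> = (INF u\<in>constraint_set p m \<sigma> \<Omega>. energy p m L M V \<Omega> u)"

definition S_RN :: "real \<Rightarrow> real \<Rightarrow> 'n::finite itself \<Rightarrow> ennreal" where
  "S_RN p \<sigma> _ =
     (INF u\<in>{u \<in> W1p p (UNIV :: (real^'n) set). u \<in> Lp \<sigma> UNIV \<and> Lp_norm \<sigma> UNIV u = 1}.
        \<integral>\<^sup>+ x. ennreal (norm (weak_grad UNIV u x) powr p / p + \<bar>u x\<bar> powr p / p) \<partial>lebesgue)"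

end

theory Submission
  imports Defs "HOL-Complex_Analysis.Great_Picard"
begin

text \<open>A minimizing sequence \<open>u\<^sub>k\<close> is bounded in \<open>W\<^sup>1\<^sup>,\<^sup>p\<close>, so by a Rellich argument a subsequence converges
  in \<open>L\<^sup>p\<close> on every ball. Weak limits are avoided: almost minimal convex combinations of the tails
  are Cauchy in the strong norm, since the homogeneous and strictly convex integrands are uniformly
  convex. Their limit \<open>u\<close> lies in the closure of the test functions, is also the local limit of
  \<open>u\<^sub>k\<close>, and satisfies \<open>E(u) \<le> liminf E(u\<^sub>k)\<close> on every subset of \<open>\<Omega>\<close>.

  Put \<open>\<theta> = \<parallel>u\<parallel>\<^sub>\<sigma>\<^sup>\<sigma>\<close>. The part of \<open>u\<^sub>k\<close> outside a large ball carries the mass \<open>1 - \<theta>\<close>, and there \<open>V\<close> is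
  almost \<open>1\<close>; cutting it off and comparing it with the problem on the whole space gives
  \<open>E(u) + (1 - \<theta>) powr (p/\<sigma>) * S\<^sub>R\<^sub>N \<le> S\<^sub>\<Omega>\<close>, while homogeneity and \<open>m \<le> p\<close> give \<open>E(u) \<ge> \<theta> powr (p/\<sigma>) * S\<^sub>\<Omega>\<close>.
  As \<open>p < \<sigma>\<close> and \<open>S\<^sub>\<Omega> < S\<^sub>R\<^sub>N\<close>, this forces \<open>\<theta> = 1\<close>. The constant in the hypothesis is at most \<open>1\<close>,
  and \<open>S\<^sub>R\<^sub>N > 0\<close> is itself a Sobolev inequality, from which scaling yields the interpolation
  inequality needed for convergence in \<open>L\<^sup>\<sigma>\<close> on balls.\<close>

section \<open>Powers of norms and uniform convexity\<close>

text \<open>The two problems are normalised differently: \<open>L \<xi> / p\<close> is at least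
  |\<xi>|^p, whereas the integrand on the whole space is |\<xi>|^p / p. The spare factor p > 1 in
  front of the gradient pays for the cross terms of a cutoff, so the crude inequality |a + b|^p
  \<le> p |a|^p + C |b|^p is enough at infinity. The escaping part is compared with functions on the
  whole space rather than on \<Omega>, which is why cutoffs and approximants are just C^1; smooth
  bumps serve to show that weak gradients are unique, so that the arbitrary choice in
  \<open>weak_grad\<close> can be replaced by explicit pairs (u, Du). Subcriticality enters as the
  sign of one exponent, N p / \<sigma> + p - N: it makes the gradient term of the scaled Sobolev
  inequality as small as desired. Integrals of powers live in [0,\<infinity>]; smallness arguments
  use a triangle inequality with factor 2^q, and a factor 1 + \<epsilon> appears where the value of
  a limit matters.\<close>

lemma powr_above_tangent_strict:
  fixes t a q :: real
  assumes "1 < q" "0 \<le> t" "0 < a" "t \<noteq> a"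
  shows "a powr q + q * a powr (q - 1) * (t - a) < t powr q"
proof (cases "t = 0")
  case True
  have "a powr q = a powr (q - 1) * a"
    using assms by (metis diff_add_cancel powr_add powr_one less_imp_le)
  hence "a powr q + q * a powr (q - 1) * (t - a) = (1 - q) * a powr q"
    using True by (simp add: algebra_simps)
  also have "\<dots> < 0" using assms by (simp add: mult_less_0_iff)
  finally show ?thesis using True by simp
next
  case False
  \<comment> \<open>The derivative of \<open>f\<close> is negative before \<open>a\<close> and
    positive after it, so \<open>f\<close> has its strict minimum at \<open>a\<close>.\<close>
  define f where "f = (\<lambda>x. x powr q - q * a powr (q - 1) * x)"
  have d: "(f has_real_derivative q * x powr (q - 1) - q * a powr (q - 1)) (at x)" if "x > 0" for x
    unfolding f_def using that by (auto intro!: derivative_eq_intros)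
  have mm: "q * x powr (q - 1) < q * y powr (q - 1)" if "0 < x" "x < y" for x y
    using powr_less_mono2[of "q - 1" x y] that assms by simp
  have "f a < f t"
  proof (cases "a < t")
    case True
    have "f a < f t"
    proof (rule DERIV_pos_imp_increasing_open[OF True])
      show "\<exists>y. (f has_real_derivative y) (at x) \<and> 0 < y" if "a < x" "x < t" for x
        using d[of x] mm[of a x] that assms by (intro exI[of _ "q * x powr (q - 1) - q * a powr (q - 1)"]) auto
    qed (use assms in \<open>auto simp: f_def intro!: continuous_intros\<close>)
    thus ?thesis .
  next
    case 2: False
    have ta: "t < a" using 2 assms by auto
    show "f a < f t"
    proof (rule DERIV_neg_imp_decreasing_open[OF ta])
      show "\<exists>y. (f has_real_derivative y) (at x) \<and> y < 0" if "t < x" "x < a" for x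
        using d[of x] mm[of x a] that assms False by (intro exI[of _ "q * x powr (q - 1) - q * a powr (q - 1)"]) auto
    qed (use assms False in \<open>auto simp: f_def intro!: continuous_intros\<close>)
  qed
  thus ?thesis unfolding f_def by (simp add: algebra_simps)
qed

lemma powr_above_tangent:
  fixes t a q :: real
  assumes "1 < q" "0 \<le> t" "0 \<le> a"
  shows "a powr q + q * a powr (q - 1) * (t - a) \<le> t powr q"
  using powr_above_tangent_strict[of q t a] assms
  by (cases "a = 0"; cases "t = a") auto

lemma powr_midpoint_strict:
  fixes s t q :: real
  assumes "1 < q" "0 \<le> s" "0 \<le> t" "s \<noteq> t"
  shows "((s + t) / 2) powr q < s powr q / 2 + t powr q / 2"
  using powr_above_tangent_strict[of q s "(s+t)/2"] powr_above_tangent_strict[of q t "(s+t)/2"] assms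
  by (auto simp: field_simps)

lemma powr_midpoint:
  fixes s t q :: real
  assumes "1 < q" "0 \<le> s" "0 \<le> t"
  shows "((s + t) / 2) powr q \<le> s powr q / 2 + t powr q / 2"
  using powr_midpoint_strict[OF assms] by (cases "s = t") auto

lemma abs_powr_midpoint_strict:
  fixes s t q :: real
  assumes "1 < q" "s \<noteq> t"
  shows "\<bar>(1/2) *\<^sub>R (s + t)\<bar> powr q < \<bar>s\<bar> powr q / 2 + \<bar>t\<bar> powr q / 2"
proof (cases "\<bar>s\<bar> = \<bar>t\<bar>")
  case True
  hence "s = - t" "t \<noteq> 0" using assms by auto
  thus ?thesis using assms by auto
next
  case False
  have "\<bar>(1/2) *\<^sub>R (s + t)\<bar> powr q \<le> ((\<bar>s\<bar> + \<bar>t\<bar>) / 2) powr q"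
    using assms by (intro powr_mono2) auto
  also have "\<dots> < \<bar>s\<bar> powr q / 2 + \<bar>t\<bar> powr q / 2"
    using powr_midpoint_strict[of q "\<bar>s\<bar>" "\<bar>t\<bar>"] assms False by auto
  finally show ?thesis .
qed

lemma norm_add_powr_le:
  fixes a b :: "'a::real_normed_vector"
  assumes "0 < q"
  shows "norm (a + b) powr q \<le> 2 powr q * (norm a powr q + norm b powr q)"
proof -
  have "norm (a + b) powr q \<le> (2 * max (norm a) (norm b)) powr q"
    using assms norm_triangle_ineq[of a b] by (intro powr_mono2) auto
  also have "\<dots> = 2 powr q * (max (norm a) (norm b)) powr q" by (simp add: powr_mult)
  also have "\<dots> \<le> 2 powr q * (norm a powr q + norm b powr q)"
    by (intro mult_left_mono) (auto simp: max_def)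
  finally show ?thesis .
qed

lemma norm_midpoint_powr_le:
  fixes a b :: "'a::real_normed_vector"
  assumes "1 < q"
  shows "norm ((1/2) *\<^sub>R (a + b)) powr q \<le> norm a powr q / 2 + norm b powr q / 2"
proof -
  have "norm ((1/2) *\<^sub>R (a + b)) powr q \<le> ((norm a + norm b) / 2) powr q"
    using assms norm_triangle_ineq[of a b] by (intro powr_mono2) auto
  also have "\<dots> \<le> norm a powr q / 2 + norm b powr q / 2"
    using assms by (intro powr_midpoint) auto
  finally show ?thesis .
qed

text \<open>Either \<open>b\<close> is small relative to \<open>a\<close>, and the sum is at most 1
  + \<delta> times as large as \<open>a\<close>, or \<open>a\<close> is bounded by a multiple of
  \<open>b\<close>. The number \<delta> is chosen with (1 + \<delta>)^q = 1 + \<epsilon>.\<close>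

lemma norm_add_powr_eps:
  fixes \<epsilon> q :: real
  assumes "0 < q" "0 < \<epsilon>"
  obtains C where "0 < C" "\<And>a b :: 'a::real_normed_vector.
    norm (a + b) powr q \<le> (1 + \<epsilon>) * norm a powr q + C * norm b powr q"
proof -
  define \<delta> where "\<delta> = (1 + \<epsilon>) powr (1/q) - 1"
  have d: "\<delta> > 0" unfolding \<delta>_def using assms by simp
  have dq: "(1 + \<delta>) powr q = 1 + \<epsilon>" unfolding \<delta>_def using assms by (simp add: powr_powr)
  show thesis
  proof (rule that)
    show "0 < (1 + 1/\<delta>) powr q" using d by (simp add: add_pos_pos less_imp_neq[symmetric])
    fix a b :: 'a
    show "norm (a + b) powr q \<le> (1 + \<epsilon>) * norm a powr q + (1 + 1/\<delta>) powr q * norm b powr q"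
    proof (cases "norm b \<le> \<delta> * norm a")
      case True
      have "norm (a + b) powr q \<le> ((1 + \<delta>) * norm a) powr q"
        using True norm_triangle_ineq[of a b] assms
        by (intro powr_mono2) (auto simp: algebra_simps)
      also have "\<dots> = (1 + \<epsilon>) * norm a powr q" using d by (simp add: powr_mult dq)
      finally show ?thesis by (smt (verit) mult_nonneg_nonneg powr_ge_zero)
    next
      case False
      hence "norm a \<le> norm b / \<delta>" using d by (simp add: field_simps)
      hence "norm (a + b) powr q \<le> ((1 + 1/\<delta>) * norm b) powr q"
        using norm_triangle_ineq[of a b] assms
        by (intro powr_mono2) (auto simp: algebra_simps)
      also have "\<dots> = (1 + 1/\<delta>) powr q * norm b powr q" using d by (simp add: powr_mult)
      finally show ?thesis using assms by (smt (verit) mult_nonneg_nonneg powr_ge_zero)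
    qed
  qed
qed

text \<open>By homogeneity only pairs on the unit sphere matter. Where the left side exceeds the
  \<epsilon>-term, the two points differ, strict convexity makes the midpoint gap positive, and
  compactness bounds it away from 0. The \<epsilon>-term takes care of a neighbourhood of the
  diagonal, where no such lower bound can hold.\<close>

lemma uniform_convexity:
  fixes F :: "'a::euclidean_space \<Rightarrow> real"
  assumes cont: "continuous_on UNIV F"
    and hom: "\<And>t x. t > 0 \<Longrightarrow> F (t *\<^sub>R x) = t powr q * F x"
    and coer: "\<And>x. F x \<ge> c * norm x powr q" and "c > 0" "q > 0"
    and strict: "\<And>x y. x \<noteq> y \<Longrightarrow> F ((1/2) *\<^sub>R (x + y)) < F x / 2 + F y / 2"
    and "\<epsilon> > 0"
  shows "\<exists>C>0. \<forall>a b. norm (a - b) powr q \<le>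
     \<epsilon> * (F a + F b) + C * (F a / 2 + F b / 2 - F ((1/2) *\<^sub>R (a + b)))"
proof -
  define gap where "gap = (\<lambda>(a, b). F a / 2 + F b / 2 - F ((1/2) *\<^sub>R (a + b)))"
  define K where "K = sphere 0 1 \<inter> {z :: 'a \<times> 'a. norm (fst z - snd z) powr q \<ge> \<epsilon> * (F (fst z) + F (snd z))}"
  have cF: "continuous_on A (\<lambda>x. F (g x))" if "continuous_on A g" for A and g :: "'a \<times> 'a \<Rightarrow> 'a"
    using continuous_on_compose2[OF cont that] by auto
  have F0: "F x \<ge> 0" for x
    using coer[of x] \<open>c > 0\<close> by (smt (verit) mult_nonneg_nonneg powr_ge_zero)
  have Fpos: "F x > 0" if "x \<noteq> 0" for x
    using coer[of x] \<open>c > 0\<close> that by (smt (verit) mult_pos_pos powr_gt_zero zero_less_norm_iff norm_eq_zero)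
  have gap0: "gap (a, b) \<ge> 0" for a b
  proof (cases "a = b")
    case True
    have "(1/2) *\<^sub>R (b + b) = b" by (simp flip: scaleR_2)
    thus ?thesis unfolding gap_def True by simp
  qed (use strict[of a b] in \<open>auto simp: gap_def\<close>)
  have "compact K" unfolding K_def
    by (intro compact_Int_closed compact_sphere closed_Collect_le continuous_intros cF continuous_on_powr')
      (use \<open>q > 0\<close> in auto)
  have gcont: "continuous_on K gap"
    unfolding gap_def case_prod_beta by (intro continuous_intros cF) auto
  have Kpos: "gap z > 0" if "z \<in> K" for z
  proof -
    obtain a b where z: "z = (a, b)" by force
    have "a \<noteq> b"
    proof
      assume "a = b"
      hence "\<epsilon> * (F a + F a) \<le> 0" using that z \<open>q > 0\<close> unfolding K_def by auto
      hence "F a \<le> 0" using \<open>\<epsilon> > 0\<close> by (simp add: mult_le_0_iff)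
      hence "a = 0" using Fpos[of a] by force
      thus False using that z \<open>a = b\<close> unfolding K_def by (auto simp: zero_prod_def[symmetric])
    qed
    thus ?thesis using strict[of a b] z by (auto simp: gap_def)
  qed
  \<comment> \<open>\<open>K\<close> may be empty, for instance if \<epsilon> is large; then any
    positive number serves.\<close>
  obtain \<delta> where \<delta>: "\<delta> > 0" "\<And>z. z \<in> K \<Longrightarrow> gap z \<ge> \<delta>"
  proof (cases "K = {}")
    case True
    thus thesis using that[of 1] by auto
  next
    case False
    then obtain z0 where "z0 \<in> K" "\<forall>z\<in>K. gap z0 \<le> gap z"
      using continuous_attains_inf[OF \<open>compact K\<close> _ gcont] by blast
    thus thesis using that[of "gap z0"] Kpos by auto
  qed
  show ?thesis
  proof (intro exI[of _ "2 powr q / \<delta>"] conjI allI)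
    show "2 powr q / \<delta> > 0" using \<delta> by simp
    fix a b
    show "norm (a - b) powr q \<le>
     \<epsilon> * (F a + F b) + (2 powr q / \<delta>) * (F a / 2 + F b / 2 - F ((1/2) *\<^sub>R (a + b)))"
    proof (cases "norm (a - b) powr q \<le> \<epsilon> * (F a + F b)")
      case True
      thus ?thesis using gap0[of a b] \<delta>(1) unfolding gap_def
        by (smt (verit) case_prod_conv divide_pos_pos mult_nonneg_nonneg powr_gt_zero)
    next
      case False
      define t where "t = norm (a, b)"
      have "(a, b) \<noteq> 0" using False \<open>q > 0\<close> F0[of 0] \<open>\<epsilon> > 0\<close> by (auto simp: zero_prod_def)
      hence t: "t > 0" unfolding t_def by simp
      define a' b' where "a' = (1/t) *\<^sub>R a" and "b' = (1/t) *\<^sub>R b"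
      have ab: "a = t *\<^sub>R a'" "b = t *\<^sub>R b'" unfolding a'_def b'_def using t by auto
      have "(a', b') = (1/t) *\<^sub>R (a, b)" unfolding a'_def b'_def by simp
      hence n1: "norm (a', b') = 1" using t by (simp add: t_def[symmetric] del: scaleR_Pair)
      have e1: "norm (a - b) powr q = t powr q * norm (a' - b') powr q"
        using t unfolding ab scaleR_diff_right[symmetric] norm_scaleR by (simp add: powr_mult)
      have e2: "F a = t powr q * F a'" "F b = t powr q * F b'" using hom[OF t] ab by auto
      have e3: "F ((1/2) *\<^sub>R (a + b)) = t powr q * F ((1/2) *\<^sub>R (a' + b'))"
      proof -
        have "(1/2) *\<^sub>R (a + b) = t *\<^sub>R ((1/2) *\<^sub>R (a' + b'))" unfolding ab by (simp add: algebra_simps)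
        thus ?thesis using hom[OF t] by metis
      qed
      have tq: "t powr q > 0" using t by simp
      have "t powr q * norm (a' - b') powr q > t powr q * (\<epsilon> * (F a' + F b'))"
        using False unfolding e1 e2 by (simp add: algebra_simps)
      hence "norm (a' - b') powr q \<ge> \<epsilon> * (F a' + F b')" using tq by simp
      hence "gap (a', b') \<ge> \<delta>" using \<delta>(2)[of "(a', b')"] n1 unfolding K_def by auto
      moreover have "F a / 2 + F b / 2 - F ((1/2) *\<^sub>R (a + b)) = t powr q * gap (a', b')"
        unfolding gap_def e2 e3 by (simp add: algebra_simps)
      ultimately have g: "F a / 2 + F b / 2 - F ((1/2) *\<^sub>R (a + b)) \<ge> t powr q * \<delta>"
        using tq by simp
      have "norm (a - b) \<le> 2 * t"
        unfolding t_def using norm_triangle_ineq4[of a b] norm_fst_le[of a b] norm_snd_le[of b a] by linarith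
      hence "norm (a - b) powr q \<le> (2 * t) powr q" using \<open>q > 0\<close> by (intro powr_mono2) auto
      also have "\<dots> = (2 powr q / \<delta>) * (t powr q * \<delta>)" using t \<delta> by (simp add: powr_mult)
      also have "\<dots> \<le> (2 powr q / \<delta>) * (F a / 2 + F b / 2 - F ((1/2) *\<^sub>R (a + b)))"
        using g \<delta> by (intro mult_left_mono) auto
      finally show ?thesis using F0 \<open>\<epsilon> > 0\<close> by (smt (verit) mult_nonneg_nonneg)
    qed
  qed
qed

text \<open>The q-th power of the L^q norm, with values in [0,\<infinity>] so that estimates can be
  stated before integrability is known. The constant 2^q in its triangle inequality is harmless for
  convergence.\<close>

definition Npow :: "real \<Rightarrow> 'a measure \<Rightarrow> ('a \<Rightarrow> 'b::real_normed_vector) \<Rightarrow> ennreal" where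
  "Npow q M f = (\<integral>\<^sup>+x. ennreal (norm (f x) powr q) \<partial>M)"

lemma Npow_mono:
  assumes "\<And>x. x \<in> space M \<Longrightarrow> norm (f x) \<le> norm (g x)" "0 \<le> q"
  shows "Npow q M f \<le> Npow q M g"
  unfolding Npow_def using assms by (intro nn_integral_mono ennreal_leI powr_mono2) auto

lemma Npow_cong_AE: "AE x in M. f x = g x \<Longrightarrow> Npow q M f = Npow q M g"
  unfolding Npow_def by (intro nn_integral_cong_AE) auto

lemma Npow_cong: "(\<And>x. x \<in> space M \<Longrightarrow> f x = g x) \<Longrightarrow> Npow q M f = Npow q M g"
  unfolding Npow_def by (intro nn_integral_cong) auto

lemma Npow_commute: "Npow q M (\<lambda>x. f x - g x) = Npow q M (\<lambda>x. g x - f x)"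
  unfolding Npow_def by (simp add: norm_minus_commute)

lemma Npow_add_le:
  fixes f g :: "'a \<Rightarrow> 'b::euclidean_space"
  assumes [measurable]: "f \<in> borel_measurable M" "g \<in> borel_measurable M" and "0 < q"
  shows "Npow q M (\<lambda>x. f x + g x) \<le> ennreal (2 powr q) * (Npow q M f + Npow q M g)"
proof -
  have "Npow q M (\<lambda>x. f x + g x) \<le>
     (\<integral>\<^sup>+x. ennreal (2 powr q) * (ennreal (norm (f x) powr q) + ennreal (norm (g x) powr q)) \<partial>M)"
    unfolding Npow_def using norm_add_powr_le[OF \<open>0 < q\<close>]
    by (intro nn_integral_mono) (auto simp: ennreal_plus[symmetric] ennreal_mult[symmetric] simp del: ennreal_plus)
  also have "\<dots> = ennreal (2 powr q) * (Npow q M f + Npow q M g)"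
    unfolding Npow_def by (simp add: nn_integral_cmult nn_integral_add)
  finally show ?thesis .
qed

lemma Npow_triangle:
  fixes f g h :: "'a \<Rightarrow> 'b::euclidean_space"
  assumes "f \<in> borel_measurable M" "g \<in> borel_measurable M" "h \<in> borel_measurable M" and "0 < q"
  shows "Npow q M (\<lambda>x. f x - h x) \<le>
    ennreal (2 powr q) * (Npow q M (\<lambda>x. f x - g x) + Npow q M (\<lambda>x. g x - h x))"
  using Npow_add_le[of "\<lambda>x. f x - g x" M "\<lambda>x. g x - h x" q] assms by simp

lemma Npow_eps:
  fixes f g :: "'a \<Rightarrow> 'b::euclidean_space"
  assumes [measurable]: "f \<in> borel_measurable M" "g \<in> borel_measurable M"
    and C: "\<And>a b :: 'b. norm (a + b) powr q \<le> A * norm a powr q + C * norm b powr q" "0 \<le> A" "0 \<le> C"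
  shows "Npow q M (\<lambda>x. f x + g x) \<le> ennreal A * Npow q M f + ennreal C * Npow q M g"
proof -
  have "Npow q M (\<lambda>x. f x + g x) \<le>
     (\<integral>\<^sup>+x. ennreal A * ennreal (norm (f x) powr q) + ennreal C * ennreal (norm (g x) powr q) \<partial>M)"
    unfolding Npow_def using C
    by (intro nn_integral_mono) (auto simp: ennreal_plus[symmetric] ennreal_mult[symmetric] simp del: ennreal_plus)
  also have "\<dots> = ennreal A * Npow q M f + ennreal C * Npow q M g"
    unfolding Npow_def by (simp add: nn_integral_cmult nn_integral_add)
  finally show ?thesis .
qed

lemma Npow_scale:
  assumes [measurable]: "f \<in> borel_measurable M"
  shows "Npow q M (\<lambda>x. c *\<^sub>R (f x :: 'b::euclidean_space)) = ennreal (\<bar>c\<bar> powr q) * Npow q M f"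
  unfolding Npow_def by (simp add: powr_mult ennreal_mult nn_integral_cmult)

text \<open>Convexity of the power makes sublevel sets stable under midpoints; this is how bounds
  pass to the midpoint hulls further down.\<close>

lemma Npow_midpoint:
  fixes f g :: "'a \<Rightarrow> 'b::euclidean_space"
  assumes "f \<in> borel_measurable M" "g \<in> borel_measurable M" "1 < q"
    and "Npow q M f \<le> B" "Npow q M g \<le> B"
  shows "Npow q M (\<lambda>x. (1/2) *\<^sub>R (f x + g x)) \<le> B"
proof -
  note [measurable] = assms(1,2)
  have "Npow q M (\<lambda>x. (1/2) *\<^sub>R (f x + g x)) \<le>
     (\<integral>\<^sup>+x. ennreal (1/2) * ennreal (norm (f x) powr q) + ennreal (1/2) * ennreal (norm (g x) powr q) \<partial>M)"
    unfolding Npow_def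
    by (intro nn_integral_mono, subst ennreal_mult[symmetric], simp, simp, subst ennreal_mult[symmetric],
        simp, simp, subst ennreal_plus[symmetric], simp, simp, intro ennreal_leI)
      (use norm_midpoint_powr_le[OF \<open>1 < q\<close>] in \<open>simp add: field_simps\<close>)
  also have "\<dots> = ennreal (1/2) * Npow q M f + ennreal (1/2) * Npow q M g"
    unfolding Npow_def by (simp add: nn_integral_cmult nn_integral_add)
  also have "\<dots> \<le> ennreal (1/2) * B + ennreal (1/2) * B"
    using assms by (intro add_mono mult_left_mono) auto
  also have "\<dots> = (ennreal (1/2) + ennreal (1/2)) * B" by (simp add: distrib_right)
  also have "ennreal (1/2) + ennreal (1/2) = 1"
    by (subst ennreal_plus[symmetric]) auto
  finally show ?thesis by simp
qed

section \<open>Fatou's lemma and almost everywhere convergent subsequences\<close>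

lemma ex_strict_mono_above: "\<exists>r. strict_mono r \<and> (\<forall>k. n0 k \<le> r k)" for n0 :: "nat \<Rightarrow> nat"
proof (intro exI conjI allI)
  show "strict_mono (\<lambda>k. \<Sum>i\<le>k. Suc (n0 i))" by (rule strict_monoI_Suc) auto
  show "n0 k \<le> (\<Sum>i\<le>k. Suc (n0 i))" for k
    using member_le_sum[of k "{..k}" "\<lambda>i. Suc (n0 i)"] by auto
qed

text \<open>Fatou's lemma, in the form behind both the semicontinuity of \<open>Npow\<close> and
  that of the energy.\<close>

lemma nn_integral_AE_limit_le:
  fixes f :: "nat \<Rightarrow> 'a \<Rightarrow> real"
  assumes [measurable]: "\<And>k. f k \<in> borel_measurable M"
    and "AE x in M. (\<lambda>k. f k x) \<longlonglongrightarrow> g x"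
    and B: "\<And>k. (\<integral>\<^sup>+x. ennreal (f k x) \<partial>M) \<le> B"
  shows "(\<integral>\<^sup>+x. ennreal (g x) \<partial>M) \<le> B"
proof -
  have "(\<integral>\<^sup>+x. ennreal (g x) \<partial>M) \<le> (\<integral>\<^sup>+x. liminf (\<lambda>k. ennreal (f k x)) \<partial>M)"
  proof (rule nn_integral_mono_AE, use assms(2) in eventually_elim)
    case (elim x)
    hence "(\<lambda>k. ennreal (f k x)) \<longlonglongrightarrow> ennreal (g x)" by (intro tendsto_ennrealI)
    thus ?case by (simp add: lim_imp_Liminf)
  qed
  also have "\<dots> \<le> liminf (\<lambda>k. \<integral>\<^sup>+x. ennreal (f k x) \<partial>M)" by (intro nn_integral_liminf) auto
  also have "\<dots> \<le> limsup (\<lambda>k. \<integral>\<^sup>+x. ennreal (f k x) \<partial>M)" by (intro Liminf_le_Limsup) auto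
  also have "\<dots> \<le> B" using B by (intro Limsup_bounded always_eventually) auto
  finally show ?thesis .
qed

lemma Npow_AE_limit_le:
  fixes f :: "nat \<Rightarrow> 'a \<Rightarrow> 'b::euclidean_space"
  assumes [measurable]: "\<And>k. f k \<in> borel_measurable M"
    and "AE x in M. (\<lambda>k. f k x) \<longlonglongrightarrow> g x" and "0 < q"
    and B: "\<And>k. Npow q M (f k) \<le> B"
  shows "Npow q M g \<le> B"
  unfolding Npow_def
proof (rule nn_integral_AE_limit_le)
  show "(\<integral>\<^sup>+x. ennreal (norm (f k x) powr q) \<partial>M) \<le> B" for k using B unfolding Npow_def by auto
  show "AE x in M. (\<lambda>k. norm (f k x) powr q) \<longlonglongrightarrow> norm (g x) powr q"
    using assms(2) by eventually_elim (use \<open>0 < q\<close> in \<open>auto intro!: tendsto_powr2 tendsto_norm\<close>)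
qed auto

text \<open>The Riesz-Fischer argument: along a subsequence the increments decay geometrically in
  mean, hence are summable at almost every point.\<close>

lemma Npow_Cauchy_AE_subseq:
  fixes f :: "nat \<Rightarrow> 'a \<Rightarrow> 'b::euclidean_space"
  assumes [measurable]: "\<And>k. f k \<in> borel_measurable M" and "0 < q"
    and cau: "\<And>\<delta>. \<delta> > 0 \<Longrightarrow> \<exists>n0. \<forall>i\<ge>n0. \<forall>j\<ge>n0. Npow q M (\<lambda>x. f i x - f j x) \<le> ennreal \<delta>"
  obtains r g where "strict_mono r" "g \<in> borel_measurable M" "AE x in M. (\<lambda>k. f (r k) x) \<longlonglongrightarrow> g x"
proof -
  \<comment> \<open>The second factor cancels the weight \<open>2 powr (q * k)\<close> in the series
    below, whose finiteness at \<open>x\<close> forces the increments at \<open>x\<close> below 2^-k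
    eventually; the first factor makes that series summable.\<close>
  define \<delta> where "\<delta> = (\<lambda>k::nat. (1/2) ^ k * (1/2) powr (q * k))"
  have dpos: "\<delta> k > 0" for k unfolding \<delta>_def by simp
  have "\<forall>k. \<exists>n0. \<forall>i\<ge>n0. \<forall>j\<ge>n0. Npow q M (\<lambda>x. f i x - f j x) \<le> ennreal (\<delta> k)"
    using cau[OF dpos] by blast
  from choice[OF this] obtain n0 where
    n0: "\<And>k i j. i \<ge> n0 k \<Longrightarrow> j \<ge> n0 k \<Longrightarrow> Npow q M (\<lambda>x. f i x - f j x) \<le> ennreal (\<delta> k)"
    by blast
  obtain r where r: "strict_mono r" "\<And>k. n0 k \<le> r k"
    using ex_strict_mono_above[of n0] by blast
  define d where "d = (\<lambda>k x. f (r (Suc k)) x - f (r k) x)"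
  have [measurable]: "d k \<in> borel_measurable M" for k unfolding d_def by measurable
  have dle: "Npow q M (d k) \<le> ennreal (\<delta> k)" for k
    unfolding d_def using r(2)[of k] strict_mono_leD[OF r(1), of k "Suc k"]
    by (intro n0) auto
  have "(\<integral>\<^sup>+x. (\<Sum>k. ennreal (2 powr (q * k) * norm (d k x) powr q)) \<partial>M) =
     (\<Sum>k. ennreal (2 powr (q * k)) * Npow q M (d k))"
    unfolding Npow_def by (subst nn_integral_suminf) (auto simp: ennreal_mult nn_integral_cmult)
  also have "\<dots> \<le> (\<Sum>k. ennreal ((1/2) ^ k))"
  proof (rule suminf_le)
    fix k
    have "ennreal (2 powr (q * k)) * Npow q M (d k) \<le> ennreal (2 powr (q * k)) * ennreal (\<delta> k)"
      using dle by (intro mult_left_mono) auto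
    also have "\<dots> = ennreal (2 powr (q * k) * \<delta> k)" by (simp add: ennreal_mult less_imp_le[OF dpos])
    also have "2 powr (q * k) * \<delta> k = (1/2)^k"
      unfolding \<delta>_def by (simp add: powr_divide field_simps)
    finally show "ennreal (2 powr (q * k)) * Npow q M (d k) \<le> ennreal ((1/2) ^ k)" .
  qed auto
  also have "\<dots> = ennreal (\<Sum>k. (1/2)^k)" by (intro suminf_ennreal2) (auto intro!: summable_geometric)
  also have "\<dots> < top" by simp
  finally have "(\<integral>\<^sup>+x. (\<Sum>k. ennreal (2 powr (q * k) * norm (d k x) powr q)) \<partial>M) \<noteq> \<infinity>" by simp
  hence "AE x in M. (\<Sum>k. ennreal (2 powr (q * k) * norm (d k x) powr q)) \<noteq> \<infinity>"
    by (intro nn_integral_PInf_AE) auto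
  hence conv: "AE x in M. convergent (\<lambda>k. f (r k) x)"
  proof eventually_elim
    case (elim x)
    have "summable (\<lambda>k. 2 powr (q * k) * norm (d k x) powr q)"
      using elim by (intro summable_suminf_not_top) auto
    hence "(\<lambda>k. 2 powr (q * k) * norm (d k x) powr q) \<longlonglongrightarrow> 0" by (rule summable_LIMSEQ_zero)
    hence ev: "\<forall>\<^sub>F k in sequentially. 2 powr (q * k) * norm (d k x) powr q < 1"
      by (rule order_tendstoD) simp
    have "\<forall>\<^sub>F k in sequentially. norm (d k x) \<le> (1/2)^k"
      using ev
    proof eventually_elim
      case (elim k)
      have "2 powr (q * k) = (2 ^ k) powr q" by (simp add: powr_realpow[symmetric] powr_powr mult.commute)
      hence "(2 ^ k * norm (d k x)) powr q < 1 powr q" using elim by (simp add: powr_mult)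
      hence "2 ^ k * norm (d k x) < 1" using \<open>0 < q\<close>
        by (smt (verit) powr_mono2)
      thus ?case by (simp add: field_simps)
    qed
    hence "summable (\<lambda>k. d k x)"
      by (rule summable_comparison_test_ev) (auto intro!: summable_geometric)
    hence "convergent (\<lambda>n. (\<Sum>k<n. d k x) + f (r 0) x)"
      by (simp add: summable_iff_convergent convergent_add_const_right_iff)
    moreover have "(\<Sum>k<n. d k x) + f (r 0) x = f (r n) x" for n
      unfolding d_def using sum_lessThan_telescope[of "\<lambda>k. f (r k) x" n] by simp
    ultimately show ?case by simp
  qed
  show thesis
  proof (rule that[OF r(1)])
    show "(\<lambda>x. lim (\<lambda>k. f (r k) x)) \<in> borel_measurable M" by (rule borel_measurable_lim_metric) auto
    show "AE x in M. (\<lambda>k. f (r k) x) \<longlonglongrightarrow> lim (\<lambda>k. f (r k) x)"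
      using conv by eventually_elim (simp add: convergent_LIMSEQ_iff)
  qed
qed

lemma Npow_eq_0_AE:
  fixes f :: "'a \<Rightarrow> 'b::euclidean_space"
  assumes [measurable]: "f \<in> borel_measurable M" and "Npow q M f = 0" "0 < q"
  shows "AE x in M. f x = 0"
proof -
  have "AE x in M. ennreal (norm (f x) powr q) = 0"
    using assms(2) unfolding Npow_def by (subst (asm) nn_integral_0_iff_AE) auto
  thus ?thesis by eventually_elim auto
qed

text \<open>A subsequence converges almost everywhere to some \<open>h\<close>; Fatou applied to the
  differences with \<open>g\<close> shows that \<open>h\<close> and \<open>g\<close> agree.\<close>

lemma Npow_tendsto_AE_subseq:
  fixes f :: "nat \<Rightarrow> 'a \<Rightarrow> 'b::euclidean_space"
  assumes [measurable]: "\<And>k. f k \<in> borel_measurable M" "g \<in> borel_measurable M" and "0 < q"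
    and lim: "(\<lambda>k. Npow q M (\<lambda>x. f k x - g x)) \<longlonglongrightarrow> 0"
  obtains r where "strict_mono r" "AE x in M. (\<lambda>k. f (r k) x) \<longlonglongrightarrow> g x"
proof -
  have ev: "\<exists>n0. \<forall>i\<ge>n0. Npow q M (\<lambda>x. f i x - g x) \<le> ennreal \<delta>" if "\<delta> > 0" for \<delta>
    using order_tendstoD(2)[OF lim, of "ennreal \<delta>"] that
    by (auto simp: eventually_sequentially intro: less_imp_le)
  have cau: "\<exists>n0. \<forall>i\<ge>n0. \<forall>j\<ge>n0. Npow q M (\<lambda>x. f i x - f j x) \<le> ennreal \<delta>" if "\<delta> > 0" for \<delta>
  proof -
    have "\<delta> / 2 / 2 powr q > 0" using that by simp
    from ev[OF this] obtain n0 where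
      n0: "\<And>i. i \<ge> n0 \<Longrightarrow> Npow q M (\<lambda>x. f i x - g x) \<le> ennreal (\<delta> / 2 / 2 powr q)" by auto
    have "Npow q M (\<lambda>x. f i x - f j x) \<le> ennreal \<delta>" if "i \<ge> n0" "j \<ge> n0" for i j
    proof -
      have "Npow q M (\<lambda>x. f i x - f j x) \<le>
          ennreal (2 powr q) * (Npow q M (\<lambda>x. f i x - g x) + Npow q M (\<lambda>x. g x - f j x))"
        using \<open>0 < q\<close> by (intro Npow_triangle) auto
      also have "\<dots> \<le> ennreal (2 powr q) * (ennreal (\<delta> / 2 / 2 powr q) + ennreal (\<delta> / 2 / 2 powr q))"
        using n0 that Npow_commute[of q M g "f j"] by (intro mult_left_mono add_mono) auto
      also have "\<dots> = ennreal \<delta>"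
        using \<open>\<delta> > 0\<close> by (simp add: ennreal_plus[symmetric] ennreal_mult[symmetric] field_simps del: ennreal_plus)
      finally show ?thesis .
    qed
    thus ?thesis by blast
  qed
  obtain r h where r: "strict_mono r" "h \<in> borel_measurable M" "AE x in M. (\<lambda>k. f (r k) x) \<longlonglongrightarrow> h x"
    using Npow_Cauchy_AE_subseq[OF assms(1) \<open>0 < q\<close> cau] by metis
  note [measurable] = r(2)
  have "Npow q M (\<lambda>x. h x - g x) \<le> ennreal \<delta>" if "\<delta> > 0" for \<delta>
  proof -
    from ev[OF that] obtain n0 where
      n0: "\<And>i. i \<ge> n0 \<Longrightarrow> Npow q M (\<lambda>x. f i x - g x) \<le> ennreal \<delta>" by blast
    show ?thesis
    proof (rule Npow_AE_limit_le[where f = "\<lambda>k x. f (r (k + n0)) x - g x"])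
      show "AE x in M. (\<lambda>k. f (r (k + n0)) x - g x) \<longlonglongrightarrow> h x - g x"
        using r(3)
        by eventually_elim (intro tendsto_diff tendsto_const LIMSEQ_ignore_initial_segment[where f = "\<lambda>k. f (r k) _"])
      show "Npow q M (\<lambda>x. f (r (k + n0)) x - g x) \<le> ennreal \<delta>" for k
        using n0 seq_suble[OF r(1), of "k + n0"] by auto
    qed (use \<open>0 < q\<close> in auto)
  qed
  hence "Npow q M (\<lambda>x. h x - g x) \<le> 0"
    using ennreal_le_epsilon[of 0 "Npow q M (\<lambda>x. h x - g x)"] by simp
  hence "AE x in M. h x - g x = 0" using \<open>0 < q\<close> by (intro Npow_eq_0_AE) auto
  with r(3) have "AE x in M. (\<lambda>k. f (r k) x) \<longlonglongrightarrow> g x" by eventually_elim auto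
  thus thesis using r(1) that by blast
qed

section \<open>Continuously differentiable functions with compact support\<close>

lemma grad_inner:
  fixes f :: "real^'n \<Rightarrow> real"
  assumes "f differentiable (at x)"
  shows "(f has_derivative (\<lambda>h. grad f x \<bullet> h)) (at x)"
proof -
  let ?D = "frechet_derivative f (at x)"
  have D: "(f has_derivative ?D) (at x)" using assms by (simp add: frechet_derivative_works)
  hence lin: "linear ?D" by (rule has_derivative_linear)
  have "?D h = grad f x \<bullet> h" for h
  proof -
    have "?D h = ?D (\<Sum>i\<in>UNIV. h $ i *\<^sub>R axis i 1)"
      using basis_expansion[of h] by (simp add: scalar_mult_eq_scaleR)
    also have "\<dots> = (\<Sum>i\<in>UNIV. h $ i * ?D (axis i 1))"
      by (simp add: linear_sum[OF lin] linear_cmul[OF lin])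
    also have "\<dots> = grad f x \<bullet> h" by (simp add: grad_def inner_vec_def mult.commute)
    finally show ?thesis .
  qed
  hence "?D = (\<lambda>h. grad f x \<bullet> h)" by auto
  thus ?thesis using D by simp
qed

lemma grad_eqI:
  fixes f :: "real^'n \<Rightarrow> real"
  assumes "(f has_derivative (\<lambda>h. g \<bullet> h)) (at x)"
  shows "grad f x = g"
  by (simp add: grad_def vec_eq_iff inner_axis flip: frechet_derivative_at[OF assms])

definition C1_on_space :: "(real^'n \<Rightarrow> real) set" where
  "C1_on_space = {f. (\<forall>x. f differentiable (at x)) \<and> continuous_on UNIV (grad f)}"

text \<open>This class contains the test functions and, unlike them, is stable under products with
  the C^1 cutoffs used later.\<close>

definition C1c :: "(real^'n \<Rightarrow> real) set" where
  "C1c = {f \<in> C1_on_space. \<exists>R. \<forall>x. R < norm x \<longrightarrow> f x = 0}"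

text \<open>A function and its gradient are treated as a single function with values in pairs.\<close>

definition jet :: "(real^'n \<Rightarrow> real) \<Rightarrow> real^'n \<Rightarrow> real \<times> (real^'n)" where
  "jet f x = (f x, grad f x)"

lemma C1_has_derivative: "f \<in> C1_on_space \<Longrightarrow> (f has_derivative (\<lambda>h. grad f x \<bullet> h)) (at x)"
  using grad_inner[of f x] by (auto simp: C1_on_space_def)

lemma C1I:
  fixes f :: "real^'n \<Rightarrow> real"
  assumes "\<And>x. (f has_derivative (\<lambda>h. g x \<bullet> h)) (at x)" "continuous_on UNIV g"
  shows "f \<in> C1_on_space" "grad f = g"
proof -
  show g: "grad f = g" using grad_eqI[OF assms(1)] by auto
  show "f \<in> C1_on_space" unfolding C1_on_space_def using assms g by (auto simp: differentiable_def)
qed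

lemma C1_continuous:
  assumes "f \<in> C1_on_space"
  shows "continuous_on UNIV f" "continuous_on UNIV (grad f)"
proof -
  show "continuous_on UNIV f"
    by (rule has_derivative_continuous_on[where f'="\<lambda>x h. grad f x \<bullet> h"]) (rule C1_has_derivative[OF assms])
  show "continuous_on UNIV (grad f)" using assms by (simp add: C1_on_space_def)
qed

lemma C1_measurable:
  assumes "f \<in> C1_on_space"
  shows "f \<in> borel_measurable borel" "grad f \<in> borel_measurable borel" "jet f \<in> borel_measurable borel"
  using C1_continuous[OF assms] unfolding jet_def[abs_def]
  by (auto intro!: borel_measurable_continuous_onI continuous_intros)

lemma C1_measurable_lebesgue:
  assumes "f \<in> C1_on_space"
  shows "f \<in> borel_measurable lebesgue" "grad f \<in> borel_measurable lebesgue" "jet f \<in> borel_measurable lebesgue"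
  using C1_measurable[OF assms] by (auto intro!: measurable_completion)

lemma C1c_C1: "f \<in> C1c \<Longrightarrow> f \<in> C1_on_space" by (simp add: C1c_def)

lemma C1_lincomb:
  assumes "f \<in> C1_on_space" "g \<in> C1_on_space"
  shows "(\<lambda>x. a * f x + b * g x) \<in> C1_on_space"
    "grad (\<lambda>x. a * f x + b * g x) = (\<lambda>x. a *\<^sub>R grad f x + b *\<^sub>R grad g x)"
proof -
  have "((\<lambda>x. a * f x + b * g x) has_derivative (\<lambda>h. (a *\<^sub>R grad f x + b *\<^sub>R grad g x) \<bullet> h)) (at x)" for x
    using C1_has_derivative[OF assms(1), of x] C1_has_derivative[OF assms(2), of x]
    by (auto intro!: derivative_eq_intros simp: inner_add_left)
  note C1I[OF this]
  moreover have "continuous_on UNIV (\<lambda>x. a *\<^sub>R grad f x + b *\<^sub>R grad g x)"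
    using assms C1_continuous by (auto intro!: continuous_intros)
  ultimately show "(\<lambda>x. a * f x + b * g x) \<in> C1_on_space"
    "grad (\<lambda>x. a * f x + b * g x) = (\<lambda>x. a *\<^sub>R grad f x + b *\<^sub>R grad g x)" by auto
qed

lemma C1_mult:
  assumes "f \<in> C1_on_space" "g \<in> C1_on_space"
  shows "(\<lambda>x. f x * g x) \<in> C1_on_space"
    "grad (\<lambda>x. f x * g x) = (\<lambda>x. f x *\<^sub>R grad g x + g x *\<^sub>R grad f x)"
proof -
  have "((\<lambda>x. f x * g x) has_derivative (\<lambda>h. (f x *\<^sub>R grad g x + g x *\<^sub>R grad f x) \<bullet> h)) (at x)" for x
    using C1_has_derivative[OF assms(1), of x] C1_has_derivative[OF assms(2), of x]
    by (auto intro!: derivative_eq_intros simp: inner_add_left)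
  note C1I[OF this]
  moreover have "continuous_on UNIV (\<lambda>x. f x *\<^sub>R grad g x + g x *\<^sub>R grad f x)"
    using assms C1_continuous by (auto intro!: continuous_intros)
  ultimately show "(\<lambda>x. f x * g x) \<in> C1_on_space"
    "grad (\<lambda>x. f x * g x) = (\<lambda>x. f x *\<^sub>R grad g x + g x *\<^sub>R grad f x)" by auto
qed

lemma C1_scaled:
  assumes "f \<in> C1_on_space"
  shows "(\<lambda>x. f (c *\<^sub>R x)) \<in> C1_on_space"
    "grad (\<lambda>x. f (c *\<^sub>R x)) = (\<lambda>x. c *\<^sub>R grad f (c *\<^sub>R x))"
proof -
  have "((\<lambda>x. f (c *\<^sub>R x)) has_derivative (\<lambda>h. (c *\<^sub>R grad f (c *\<^sub>R x)) \<bullet> h)) (at x)" for x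
  proof -
    have "((\<lambda>x. f (c *\<^sub>R x)) has_derivative (\<lambda>h. grad f (c *\<^sub>R x) \<bullet> (c *\<^sub>R h))) (at x)"
      by (rule has_derivative_compose[where f="\<lambda>x. c *\<^sub>R x", OF _ C1_has_derivative[OF assms]])
        (auto intro!: derivative_eq_intros)
    thus ?thesis by simp
  qed
  note C1I[OF this]
  moreover have "continuous_on UNIV (\<lambda>x. c *\<^sub>R grad f (c *\<^sub>R x))"
    by (intro continuous_intros continuous_on_compose2[OF C1_continuous(2)[OF assms]]) auto
  ultimately show "(\<lambda>x. f (c *\<^sub>R x)) \<in> C1_on_space"
    "grad (\<lambda>x. f (c *\<^sub>R x)) = (\<lambda>x. c *\<^sub>R grad f (c *\<^sub>R x))" by auto
qed

lemma C1c_lincomb: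
  assumes "f \<in> C1c" "g \<in> C1c" shows "(\<lambda>x. a * f x + b * g x) \<in> C1c"
proof -
  obtain R S where "\<forall>x. R < norm x \<longrightarrow> f x = 0" "\<forall>x. S < norm x \<longrightarrow> g x = 0"
    using assms unfolding C1c_def by blast
  hence "\<forall>x. max R S < norm x \<longrightarrow> a * f x + b * g x = 0" by auto
  thus ?thesis using C1_lincomb(1)[of f g] assms unfolding C1c_def by blast
qed

lemma C1c_mult:
  assumes "f \<in> C1_on_space" "g \<in> C1c" shows "(\<lambda>x. f x * g x) \<in> C1c"
  using assms C1_mult(1)[of f g] unfolding C1c_def by auto

lemma C1c_scaled:
  assumes "f \<in> C1c" "c > 0" shows "(\<lambda>x. f (c *\<^sub>R x)) \<in> C1c"
proof -
  obtain R where "\<forall>x. R < norm x \<longrightarrow> f x = 0" using assms unfolding C1c_def by blast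
  hence "\<forall>x. R / c < norm x \<longrightarrow> f (c *\<^sub>R x) = 0" using assms(2) by (simp add: field_simps)
  thus ?thesis using C1_scaled(1)[of f c] assms unfolding C1c_def by blast
qed

lemma C1c_support:
  fixes f :: "real^'n \<Rightarrow> real"
  assumes "f \<in> C1c"
  shows "\<exists>R>0. \<forall>x. R < norm x \<longrightarrow> f x = 0 \<and> grad f x = 0"
proof -
  obtain R where R: "\<forall>x. R < norm x \<longrightarrow> f x = 0" using assms unfolding C1c_def by blast
  show ?thesis
  proof (intro exI[of _ "max R 1"] conjI allI impI)
    fix x :: "real^'n" assume x: "max R 1 < norm x"
    show "f x = 0" using R x by auto
    have ev: "\<forall>\<^sub>F y in nhds x. f y = 0"
    proof -
      have "\<forall>\<^sub>F y in nhds x. norm y > R"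
        using x by (intro order_tendstoD(1)[OF tendsto_norm[OF filterlim_ident]]) auto
      thus ?thesis using R by (auto elim: eventually_mono)
    qed
    have "(f has_derivative (\<lambda>h. 0)) (at x)"
      by (rule has_derivative_transform_eventually[where f="\<lambda>_. 0"])
        (use ev x R in \<open>auto simp: eventually_at_filter elim!: eventually_mono\<close>)
    hence "(f has_derivative (\<lambda>h. 0 \<bullet> h)) (at x)" by simp
    thus "grad f x = 0" by (rule grad_eqI)
  qed auto
qed

lemma norm_jet_ge: "\<bar>f x\<bar> \<le> norm (jet f x)" "norm (grad f x) \<le> norm (jet f x)"
  using norm_fst_le[of "f x" "grad f x"] norm_snd_le[of "grad f x" "f x"] by (auto simp: jet_def)

lemma C1c_bounded:
  assumes "f \<in> C1c"
  shows "\<exists>B>0. \<forall>x. norm (jet f x) \<le> B \<and> \<bar>f x\<bar> \<le> B \<and> norm (grad f x) \<le> B"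
proof -
  obtain R where R: "R > 0" "\<And>x. R < norm x \<Longrightarrow> f x = 0" "\<And>x. R < norm x \<Longrightarrow> grad f x = 0"
    using C1c_support[OF assms] by blast
  have "continuous_on (cball 0 R) (jet f)"
    using C1_continuous[OF C1c_C1[OF assms]] unfolding jet_def[abs_def]
    by (auto intro!: continuous_intros intro: continuous_on_subset)
  hence "bounded (jet f ` cball 0 R)"
    by (intro compact_imp_bounded compact_continuous_image) auto
  then obtain B where B: "B > 0" "\<And>x. x \<in> cball 0 R \<Longrightarrow> norm (jet f x) \<le> B"
    unfolding bounded_pos by auto
  have "norm (jet f x) \<le> B" for x
    using B R by (cases "norm x \<le> R") (auto simp: jet_def)
  thus ?thesis using B(1) norm_jet_ge[of f] by (meson order_trans)
qed

lemma C1c_jet_outside: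
  assumes "f \<in> C1c"
  shows "\<exists>R>0. \<forall>x. R < norm x \<longrightarrow> jet f x = 0"
  using C1c_support[OF assms] by (auto simp: jet_def zero_prod_def)

lemma integrable_indicator_cball:
  "integrable lborel (\<lambda>x. c * indicator (cball a r) x :: real)" for a :: "real^'n"
proof -
  have "emeasure lborel (cball a r) < \<infinity>" by (rule emeasure_lborel_cball_finite)
  thus ?thesis by auto
qed

lemma bounded_support_integrable:
  fixes g :: "real^'n \<Rightarrow> 'b::euclidean_space"
  assumes [measurable]: "g \<in> borel_measurable borel" and "\<And>x. norm (g x) \<le> B" "\<And>x. R < norm x \<Longrightarrow> g x = 0"
  shows "integrable lborel g"
proof (rule Bochner_Integration.integrable_bound[of _ "\<lambda>x. B * indicator (cball 0 R) x"])
  show "integrable lborel (\<lambda>x::real^'n. B * indicator (cball 0 R) x)"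
    by (rule integrable_indicator_cball)
  have "B \<ge> 0" using assms(2)[of 0] norm_ge_zero order_trans by blast
  thus "AE x in lborel. norm (g x) \<le> norm (B * indicator (cball 0 R) x)"
    using assms(2,3) by (auto simp: indicator_def)
qed auto

lemma C1c_Npow_finite:
  assumes "f \<in> C1c" "q > 0"
  shows "Npow q lebesgue (jet f) < \<infinity>" "Npow q lebesgue f < \<infinity>" "Npow q lebesgue (grad f) < \<infinity>"
proof -
  obtain B where B: "B > 0" "\<And>x. norm (jet f x) \<le> B" using C1c_bounded[OF assms(1)] by blast
  obtain R where R: "R > 0" "\<And>x. R < norm x \<Longrightarrow> jet f x = 0" using C1c_jet_outside[OF assms(1)] by blast
  note [measurable] = C1_measurable[OF C1c_C1[OF assms(1)]]
  have "integrable lborel (\<lambda>x. norm (jet f x) powr q)"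
    by (rule bounded_support_integrable[of _ "B powr q" R])
      (use B R assms in \<open>auto intro!: powr_mono2\<close>)
  hence 1: "Npow q lborel (jet f) < \<infinity>"
    unfolding Npow_def by (auto simp: integrable_iff_bounded)
  show "Npow q lebesgue (jet f) < \<infinity>" using 1 by (simp add: Npow_def nn_integral_completion)
  moreover have "Npow q lebesgue f \<le> Npow q lebesgue (jet f)" "Npow q lebesgue (grad f) \<le> Npow q lebesgue (jet f)"
    using assms by (auto intro!: Npow_mono norm_jet_ge)
  ultimately show "Npow q lebesgue f < \<infinity>" "Npow q lebesgue (grad f) < \<infinity>" by auto
qed

lemma C1_lipschitz:
  fixes f :: "real^'n \<Rightarrow> real"
  assumes "f \<in> C1_on_space" "\<And>x. norm (grad f x) \<le> B"
  shows "\<bar>f y - f x\<bar> \<le> B * norm (y - x)"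
proof -
  have "norm (f y - f x) \<le> B * norm (y - x)"
  proof (rule differentiable_bound[where S=UNIV and f'="\<lambda>x h. grad f x \<bullet> h"])
    show "onorm (\<lambda>h. grad f x \<bullet> h) \<le> B" for x
    proof (rule onorm_le)
      fix h :: "real^'n"
      have "\<bar>grad f x \<bullet> h\<bar> \<le> norm (grad f x) * norm h" by (rule Cauchy_Schwarz_ineq2)
      also have "\<dots> \<le> B * norm h" using assms(2) by (intro mult_right_mono) auto
      finally show "norm (grad f x \<bullet> h) \<le> B * norm h" by simp
    qed
  qed (use C1_has_derivative[OF assms(1)] in auto)
  thus ?thesis by simp
qed

section \<open>Translations, difference quotients and integration by parts\<close>

lemma nn_integral_lborel_translate:
  fixes g :: "real^'n \<Rightarrow> ennreal"
  assumes [measurable]: "g \<in> borel_measurable borel"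
  shows "(\<integral>\<^sup>+x. g (x + c) \<partial>lborel) = (\<integral>\<^sup>+x. g x \<partial>lborel)"
proof -
  have "(\<integral>\<^sup>+x. g x \<partial>lborel) = (\<integral>\<^sup>+x. g x \<partial>distr lborel borel ((+) c))" by (simp add: lborel_distr_plus)
  also have "\<dots> = (\<integral>\<^sup>+x. g (c + x) \<partial>lborel)" by (subst nn_integral_distr) auto
  finally show ?thesis by (simp add: add.commute)
qed

lemma integral_lborel_translate:
  fixes g :: "real^'n \<Rightarrow> real"
  assumes [measurable]: "g \<in> borel_measurable borel"
  shows "(LINT x|lborel. g (x + c)) = (LINT x|lborel. g x)"
proof -
  have "(LINT x|lborel. g x) = (LINT x|distr lborel borel ((+) c). g x)" by (simp add: lborel_distr_plus)
  also have "\<dots> = (LINT x|lborel. g (c + x))" by (subst integral_distr) auto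
  finally show ?thesis by (simp add: add.commute)
qed

lemma difference_quotient_tendsto:
  fixes f :: "real^'n \<Rightarrow> real"
  assumes "f \<in> C1_on_space" "s \<longlonglongrightarrow> 0" "\<And>k. s k > 0"
  shows "(\<lambda>k. (f (x + s k *\<^sub>R h) - f x) / s k) \<longlonglongrightarrow> grad f x \<bullet> h"
proof -
  have "((\<lambda>t. f (x + t *\<^sub>R h)) has_derivative (\<lambda>t. grad f (x + 0 *\<^sub>R h) \<bullet> (t *\<^sub>R h))) (at 0)"
    by (rule has_derivative_compose[OF _ C1_has_derivative[OF assms(1)]])
      (auto intro!: derivative_eq_intros)
  hence "((\<lambda>t. f (x + t *\<^sub>R h)) has_field_derivative (grad f x \<bullet> h)) (at 0)"
    by (simp add: has_field_derivative_def mult_commute_abs)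
  hence "((\<lambda>t. (f (x + t *\<^sub>R h) - f x) / t) \<longlongrightarrow> grad f x \<bullet> h) (at 0)"
    by (simp add: DERIV_def)
  thus ?thesis
    by (rule filterlim_compose) (use assms(2,3) in \<open>auto simp: filterlim_at less_imp_neq[symmetric]\<close>)
qed

lemma difference_quotient_bound:
  fixes f :: "real^'n \<Rightarrow> real"
  assumes "f \<in> C1_on_space" "\<And>x. norm (grad f x) \<le> B" "\<And>x. R < norm x \<Longrightarrow> f x = 0"
    and "0 < t" "t \<le> 1"
  shows "\<bar>(f (x + t *\<^sub>R h) - f x) / t\<bar> \<le> B * norm h * indicator (cball 0 (R + norm h)) x"
proof (cases "norm x \<le> R + norm h")
  case True
  have "\<bar>f (x + t *\<^sub>R h) - f x\<bar> \<le> B * norm (t *\<^sub>R h)" using C1_lipschitz[OF assms(1,2), of "x + t *\<^sub>R h" x] by simp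
  thus ?thesis using True assms by (simp add: field_simps)
next
  case False
  have "norm x \<le> norm (x + t *\<^sub>R h) + norm (t *\<^sub>R h)" using norm_triangle_ineq4[of "x + t *\<^sub>R h" "t *\<^sub>R h"] by simp
  moreover have "norm (t *\<^sub>R h) \<le> norm h" using assms by (simp add: mult_left_le_one_le)
  ultimately have "f (x + t *\<^sub>R h) = 0" "f x = 0" using False assms(3) by (auto simp: not_le)
      (smt (verit) norm_ge_zero)+
  thus ?thesis using False by simp
qed

text \<open>Difference quotients have integral 0 by translation invariance, and they converge
  boundedly, with supports in a fixed ball, to the directional derivative.\<close>

lemma integral_grad_eq_0:
  fixes f :: "real^'n \<Rightarrow> real"
  assumes f: "f \<in> C1c"
  shows "(LINT x|lborel. grad f x) = 0"
proof (rule euclidean_eqI)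
  fix b :: "real^'n" assume b: "b \<in> Basis"
  obtain R where R: "R > 0" "\<And>x. R < norm x \<Longrightarrow> f x = 0" "\<And>x. R < norm x \<Longrightarrow> grad f x = 0"
    using C1c_support[OF assms] by blast
  obtain B where B: "B > 0" "\<And>x. norm (grad f x) \<le> B" "\<And>x. \<bar>f x\<bar> \<le> B" using C1c_bounded[OF f] by blast
  note f1 = C1c_C1[OF f]
  note [measurable] = C1_measurable[OF f1]
  have int: "integrable lborel (grad f)" "integrable lborel f"
    using bounded_support_integrable[OF C1_measurable(2)[OF f1] B(2) R(3)]
      bounded_support_integrable[OF C1_measurable(1)[OF f1], of B R] B(3) R(2) by auto
  define s where "s = (\<lambda>k. inverse (real (Suc k)))"
  have s: "s \<longlonglongrightarrow> 0" "\<And>k. s k > 0" "\<And>k. s k \<le> 1" unfolding s_def using LIMSEQ_inverse_real_of_nat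
    by (auto simp: field_simps)
  have L: "(\<lambda>k. LINT x|lborel. (f (x + s k *\<^sub>R b) - f x) / s k) \<longlonglongrightarrow> (LINT x|lborel. grad f x \<bullet> b)"
  proof (rule integral_dominated_convergence[where w="\<lambda>x. B * norm b * indicator (cball 0 (R + norm b)) x"])
    show "integrable lborel (\<lambda>x::real^'n. B * norm b * indicator (cball 0 (R + norm b)) x)"
      by (rule integrable_indicator_cball)
    show "AE x in lborel. (\<lambda>k. (f (x + s k *\<^sub>R b) - f x) / s k) \<longlonglongrightarrow> grad f x \<bullet> b"
      using difference_quotient_tendsto[OF f1 s(1,2)] by auto
    show "AE x in lborel. norm ((f (x + s k *\<^sub>R b) - f x) / s k) \<le> B * norm b * indicator (cball 0 (R + norm b)) x" for k
      using difference_quotient_bound[OF f1 B(2) R(2) s(2,3)] by auto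
  qed auto
  have Z: "(LINT x|lborel. (f (x + s k *\<^sub>R b) - f x) / s k) = 0" for k
  proof -
    have "integrable lborel (\<lambda>x. f (x + s k *\<^sub>R b))"
      by (rule bounded_support_integrable[of _ B "R + norm (s k *\<^sub>R b)"])
        (use B(3) R(2) in \<open>auto intro!: R(2)\<close>, smt (verit) norm_diff_ineq norm_scaleR)
    thus ?thesis using int(2) integral_lborel_translate[of f "s k *\<^sub>R b"] by simp
  qed
  from L have "(LINT x|lborel. grad f x \<bullet> b) = 0" unfolding Z
    by (simp add: LIMSEQ_const_iff)
  thus "(LINT x|lborel. grad f x) \<bullet> b = 0 \<bullet> b" using int(1) by simp
qed

text \<open>The product \<open>f x * g x\<close> has bounded support, so the previous lemma applies
  to it.\<close>

lemma integration_by_parts_C1c: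
  fixes f g :: "real^'n \<Rightarrow> real"
  assumes f: "f \<in> C1_on_space" and g: "g \<in> C1c"
  shows "(LINT x|lborel. f x *\<^sub>R grad g x) = - (LINT x|lborel. g x *\<^sub>R grad f x)"
proof -
  have fg: "(\<lambda>x. f x * g x) \<in> C1c" by (rule C1c_mult[OF f g])
  obtain R where R: "R > 0" "\<And>x. R < norm x \<Longrightarrow> g x = 0" "\<And>x. R < norm x \<Longrightarrow> grad g x = 0"
    using C1c_support[OF g] by blast
  note C = C1_continuous[OF f] C1_continuous[OF C1c_C1[OF g]]
  have int: "integrable lborel h" if "continuous_on UNIV h" "\<And>x. R < norm x \<Longrightarrow> h x = 0" for h :: "real^'n \<Rightarrow> real^'n"
  proof -
    have "bounded (h ` cball 0 R)" using that by (intro compact_imp_bounded compact_continuous_image) (auto intro: continuous_on_subset)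
    then obtain B where B: "B > 0" "\<And>x. x \<in> cball 0 R \<Longrightarrow> norm (h x) \<le> B" unfolding bounded_pos by auto
    show ?thesis
      by (rule bounded_support_integrable[of _ B R])
        (use that B in \<open>auto intro!: borel_measurable_continuous_onI\<close>, metis B(1) less_imp_le linorder_not_le norm_zero)
  qed
  have i: "integrable lborel (\<lambda>x. f x *\<^sub>R grad g x)" "integrable lborel (\<lambda>x. g x *\<^sub>R grad f x)"
    using C R by (auto intro!: int continuous_intros)
  have "0 = (LINT x|lborel. f x *\<^sub>R grad g x + g x *\<^sub>R grad f x)"
    using integral_grad_eq_0[OF fg] by (simp add: C1_mult(2)[OF f C1c_C1[OF g]])
  also have "\<dots> = (LINT x|lborel. f x *\<^sub>R grad g x) + (LINT x|lborel. g x *\<^sub>R grad f x)"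
    using i by (rule Bochner_Integration.integral_add)
  finally show ?thesis by (simp add: eq_neg_iff_add_eq_0)
qed

text \<open>The inequality for \<open>h\<close> follows from the one for \<open>h / 2\<close> by convexity of the power, so
  it suffices to let the increment tend to zero.\<close>

lemma translation_estimate:
  fixes f :: "real^'n \<Rightarrow> real"
  assumes f: "f \<in> C1c" and p: "1 < p"
  shows "(\<integral>\<^sup>+x. ennreal (\<bar>f (x + h) - f x\<bar> powr p) \<partial>lborel) \<le> ennreal (norm h powr p) * Npow p lborel (grad f)"
proof -
  note f1 = C1c_C1[OF f]
  note [measurable] = C1_measurable[OF f1]
  define D where "D = (\<lambda>k x. (f (x + (1/2)^k *\<^sub>R h) - f x) / (1/2)^k)"
  have [measurable]: "D k \<in> borel_measurable borel" for k unfolding D_def by measurable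
  have step: "(\<integral>\<^sup>+x. ennreal (\<bar>D k x\<bar> powr p) \<partial>lborel) \<le> (\<integral>\<^sup>+x. ennreal (\<bar>D (Suc k) x\<bar> powr p) \<partial>lborel)" for k
  proof -
    \<comment> \<open>The quotient over a step is the mean of the quotients over its two halves, and
      the second of these is a translate of the first. Hence the norm of \<open>D k\<close> does not
      decrease in \<open>k\<close>.\<close>
    have eq: "D k x = (1/2) *\<^sub>R (D (Suc k) x + D (Suc k) (x + (1/2)^Suc k *\<^sub>R h))" for x
    proof -
      have "x + (1/2)^Suc k *\<^sub>R h + (1/2)^Suc k *\<^sub>R h = x + (1/2)^k *\<^sub>R h"
        by (simp flip: scaleR_add_left add: add.assoc)
      thus ?thesis unfolding D_def by (simp add: field_simps)
    qed
    have "(\<integral>\<^sup>+x. ennreal (\<bar>D k x\<bar> powr p) \<partial>lborel) = Npow p lborel (\<lambda>x. (1/2) *\<^sub>R (D (Suc k) x + D (Suc k) (x + (1/2)^Suc k *\<^sub>R h)))"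
      unfolding Npow_def eq[symmetric] by simp
    also have "\<dots> \<le> Npow p lborel (D (Suc k))"
    proof (rule Npow_midpoint[OF _ _ p])
      show "Npow p lborel (\<lambda>x. D (Suc k) (x + (1/2)^Suc k *\<^sub>R h)) \<le> Npow p lborel (D (Suc k))"
        unfolding Npow_def
        by (subst nn_integral_lborel_translate[of "\<lambda>x. ennreal (norm (D (Suc k) x) powr p)"]) auto
    qed auto
    finally show ?thesis by (simp add: Npow_def)
  qed
  have mono: "(\<integral>\<^sup>+x. ennreal (\<bar>D 0 x\<bar> powr p) \<partial>lborel) \<le> (\<integral>\<^sup>+x. ennreal (\<bar>D k x\<bar> powr p) \<partial>lborel)" for k
    by (induction k) (auto intro: order_trans step)
  obtain R where R: "R > 0" "\<And>x. R < norm x \<Longrightarrow> f x = 0" using C1c_support[OF f] by blast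
  obtain B where B: "B > 0" "\<And>x. norm (grad f x) \<le> B" using C1c_bounded[OF f] by blast
  have lim: "(\<lambda>k. \<integral>\<^sup>+x. ennreal (\<bar>D k x\<bar> powr p) \<partial>lborel) \<longlonglongrightarrow> (\<integral>\<^sup>+x. ennreal (\<bar>grad f x \<bullet> h\<bar> powr p) \<partial>lborel)"
  proof (rule nn_integral_dominated_convergence[where w="\<lambda>x. ennreal ((B * norm h) powr p) * indicator (cball 0 (R + norm h)) x"])
    show "(\<integral>\<^sup>+x. ennreal ((B * norm h) powr p) * indicator (cball 0 (R + norm h)) (x::real^'n) \<partial>lborel) < \<infinity>"
      using emeasure_lborel_cball_finite[of "0::real^'n" "R + norm h"]
      by (subst nn_integral_cmult_indicator) (auto simp: ennreal_mult_less_top)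
    show "AE x in lborel. ennreal (\<bar>D k x\<bar> powr p) \<le> ennreal ((B * norm h) powr p) * indicator (cball 0 (R + norm h)) x" for k
    proof (rule AE_I2)
      fix x
      have "\<bar>D k x\<bar> \<le> B * norm h * indicator (cball 0 (R + norm h)) x"
        unfolding D_def using difference_quotient_bound[OF f1 B(2) R(2), where t="(1/2)^k" and x=x and h=h] by (simp add: power_le_one)
      hence "\<bar>D k x\<bar> powr p \<le> (B * norm h * indicator (cball 0 (R + norm h)) x) powr p" using p by (intro powr_mono2) auto
      also have "\<dots> = (B * norm h) powr p * indicator (cball 0 (R + norm h)) x" using p by (auto simp: indicator_def)
      finally show "ennreal (\<bar>D k x\<bar> powr p) \<le> ennreal ((B * norm h) powr p) * indicator (cball 0 (R + norm h)) x"
        by (auto simp: indicator_def split: if_splits)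
    qed
    show "AE x in lborel. (\<lambda>k. ennreal (\<bar>D k x\<bar> powr p)) \<longlonglongrightarrow> ennreal (\<bar>grad f x \<bullet> h\<bar> powr p)"
    proof (rule AE_I2)
      fix x
      have "(\<lambda>k. D k x) \<longlonglongrightarrow> grad f x \<bullet> h"
        unfolding D_def by (rule difference_quotient_tendsto[OF f1]) (auto intro!: LIMSEQ_realpow_zero)
      thus "(\<lambda>k. ennreal (\<bar>D k x\<bar> powr p)) \<longlonglongrightarrow> ennreal (\<bar>grad f x \<bullet> h\<bar> powr p)"
        using p by (auto intro!: tendsto_ennrealI tendsto_powr2 tendsto_rabs)
    qed
    show "(\<lambda>x. ennreal (\<bar>D k x\<bar> powr p)) \<in> borel_measurable lborel" for k by measurable
    show "(\<lambda>x. ennreal (\<bar>grad f x \<bullet> h\<bar> powr p)) \<in> borel_measurable lborel" by measurable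
    show "(\<lambda>x. ennreal ((B * norm h) powr p) * indicator (cball 0 (R + norm h)) x) \<in> borel_measurable (lborel :: (real^'n) measure)"
      by (intro borel_measurable_times_ennreal borel_measurable_const borel_measurable_indicator) simp
  qed
  have "(\<integral>\<^sup>+x. ennreal (\<bar>f (x + h) - f x\<bar> powr p) \<partial>lborel) \<le> (\<integral>\<^sup>+x. ennreal (\<bar>grad f x \<bullet> h\<bar> powr p) \<partial>lborel)"
  proof -
    have "D 0 = (\<lambda>x. f (x + h) - f x)" by (simp add: D_def)
    moreover have "(\<integral>\<^sup>+x. ennreal (\<bar>D 0 x\<bar> powr p) \<partial>lborel) \<le> (\<integral>\<^sup>+x. ennreal (\<bar>grad f x \<bullet> h\<bar> powr p) \<partial>lborel)"
      by (rule LIMSEQ_le_const[OF lim]) (use mono in blast)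
    ultimately show ?thesis by simp
  qed
  also have "\<dots> \<le> (\<integral>\<^sup>+x. ennreal (norm h powr p) * ennreal (norm (grad f x) powr p) \<partial>lborel)"
  proof (rule nn_integral_mono)
    fix x :: "real^'n"
    have "\<bar>grad f x \<bullet> h\<bar> powr p \<le> (norm h * norm (grad f x)) powr p"
      using p Cauchy_Schwarz_ineq2[of "grad f x" h] by (intro powr_mono2) (auto simp: mult.commute)
    thus "ennreal (\<bar>grad f x \<bullet> h\<bar> powr p) \<le> ennreal (norm h powr p) * ennreal (norm (grad f x) powr p)"
      by (simp add: ennreal_mult[symmetric] powr_mult)
  qed
  also have "\<dots> = ennreal (norm h powr p) * Npow p lborel (grad f)"
    unfolding Npow_def by (subst nn_integral_cmult) auto
  finally show ?thesis .
qed

section \<open>Smooth bumps and the fundamental lemma\<close>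

text \<open>For \<open>k = 0\<close> this is the classical flat function exp(-c/t). Differentiation
  produces powers of 1/t, and with them the family is closed under derivatives up to linear
  combinations.\<close>

definition flat_exp :: "nat \<Rightarrow> real \<Rightarrow> real \<Rightarrow> real" where
  "flat_exp k c t = (if t > 0 then (1 / t) ^ k * exp (- c / t) else 0)"

lemma flat_exp_tendsto_0:
  assumes "c > 0"
  shows "(flat_exp k c \<longlongrightarrow> 0) (at 0)"
proof -
  have "((\<lambda>t. (c / t) ^ k / exp (c / t) / c ^ k) \<longlongrightarrow> 0 / c ^ k) (at_right 0)"
  proof (intro tendsto_divide tendsto_const)
    have "filterlim (\<lambda>t. c * inverse t) at_top (at_right (0::real))"
      by (rule filterlim_tendsto_pos_mult_at_top[OF tendsto_const assms filterlim_inverse_at_top_right])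
    hence "filterlim (\<lambda>t. c / t) at_top (at_right (0::real))" by (simp add: divide_inverse)
    thus "((\<lambda>t. (c / t) ^ k / exp (c / t)) \<longlongrightarrow> 0) (at_right 0)"
      by (rule filterlim_compose[OF tendsto_power_div_exp_0])
  qed (use assms in auto)
  moreover have "\<forall>\<^sub>F t in at_right 0. (c / t) ^ k / exp (c / t) / c ^ k = flat_exp k c t"
    unfolding eventually_at_right_field
    by (intro exI[of _ 1]) (use assms in \<open>auto simp: flat_exp_def exp_minus power_divide field_simps\<close>)
  ultimately have r: "(flat_exp k c \<longlongrightarrow> 0) (at_right 0)"
    by (auto intro: Lim_transform_eventually)
  have "(flat_exp k c \<longlongrightarrow> 0) (at_left 0)"
    by (rule Lim_transform_eventually[OF tendsto_const])
      (auto simp: flat_exp_def eventually_at_left_field intro!: exI[of _ "-1"])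
  with r show ?thesis by (simp add: filterlim_split_at)
qed

lemma flat_exp_deriv:
  assumes "c > 0"
  shows "(flat_exp k c has_field_derivative c * flat_exp (k + 2) c t - k * flat_exp (k + 1) c t) (at t)"
proof (cases t "0 :: real" rule: linorder_cases)
  case greater
  have "((\<lambda>t. (1 / t) ^ k * exp (- c / t)) has_field_derivative
      c * flat_exp (k + 2) c t - k * flat_exp (k + 1) c t) (at t)"
    using greater
    by (cases k) (auto intro!: derivative_eq_intros simp: flat_exp_def power2_eq_square field_simps,
      metis power_eq_if One_nat_def)
  thus ?thesis
    by (rule has_field_derivative_transform_within_open[of _ _ _ "{0<..}"])
      (use greater in \<open>auto simp: flat_exp_def\<close>)
next
  case less
  have "((\<lambda>t. 0) has_field_derivative 0) (at t)" by simp
  hence "(flat_exp k c has_field_derivative 0) (at t)"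
    by (rule has_field_derivative_transform_within_open[of _ _ _ "{..<0}"])
      (use less in \<open>auto simp: flat_exp_def\<close>)
  thus ?thesis using less by (simp add: flat_exp_def)
next
  case equal
  \<comment> \<open>At 0 the difference quotient is \<open>flat_exp (Suc k) c\<close> itself, which
    tends to 0.\<close>
  have "((\<lambda>h. (flat_exp k c (0 + h) - flat_exp k c 0) / h) \<longlongrightarrow> 0) (at 0)"
    by (rule Lim_transform_eventually[OF flat_exp_tendsto_0[OF assms, of "Suc k"]])
      (auto simp: flat_exp_def eventually_at_filter)
  thus ?thesis using equal by (simp add: DERIV_def flat_exp_def)
qed

text \<open>Stable under partial differentiation, hence consisting of smooth functions.\<close>

inductive_set bump_algebra :: "(real^'n \<Rightarrow> real) set" where
  const: "(\<lambda>x. a) \<in> bump_algebra"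
| gen: "c > 0 \<Longrightarrow> (\<lambda>x. flat_exp k c (s * (x $ i) + a)) \<in> bump_algebra"
| add: "f \<in> bump_algebra \<Longrightarrow> g \<in> bump_algebra \<Longrightarrow> (\<lambda>x. f x + g x) \<in> bump_algebra"
| mult: "f \<in> bump_algebra \<Longrightarrow> g \<in> bump_algebra \<Longrightarrow> (\<lambda>x. f x * g x) \<in> bump_algebra"

lemma bump_algebra_derivative:
  fixes f :: "real^'n \<Rightarrow> real"
  assumes "f \<in> bump_algebra"
  shows "\<exists>D. \<forall>x. (f has_derivative D x) (at x) \<and> (\<forall>v. (\<lambda>x. D x v) \<in> bump_algebra)"
  using assms
proof induction
  case (const a)
  show ?case by (intro exI[of _ "\<lambda>x v. 0"] allI conjI has_derivative_const bump_algebra.const)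
next
  case (gen c k s i a)
  define d where "d = (\<lambda>t. c * flat_exp (k + 2) c t + (- real k) * flat_exp (k + 1) c t)"
  define D where "D = (\<lambda>(x::real^'n) (v::real^'n). d (s * (x $ i) + a) * (s * (v $ i)))"
  have d: "(flat_exp k c has_field_derivative d t) (at t)" for t
    unfolding d_def using flat_exp_deriv[OF gen, of k t] by simp
  have "((\<lambda>x. flat_exp k c (s * (x $ i) + a)) has_derivative D x) (at x)" for x :: "real^'n"
  proof -
    have "((\<lambda>x::real^'n. x $ i) has_derivative (\<lambda>v. v $ i)) (at x)"
      by (rule bounded_linear_imp_has_derivative) (rule bounded_linear_vec_nth)
    hence "((\<lambda>x::real^'n. s * (x $ i) + a) has_derivative (\<lambda>v. s * (v $ i))) (at x)"
      by (auto intro!: derivative_eq_intros)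
    from has_derivative_compose[OF this d[unfolded has_field_derivative_def]]
    show ?thesis unfolding D_def by (simp add: mult_ac)
  qed
  moreover have "(\<lambda>x. D x v) \<in> bump_algebra" for v
    unfolding D_def d_def using gen by (intro bump_algebra.intros)
  ultimately show ?case by blast
next
  case (add f g)
  then obtain D E where DE: "\<forall>x. (f has_derivative D x) (at x) \<and> (\<forall>v. (\<lambda>x. D x v) \<in> bump_algebra)"
    "\<forall>x. (g has_derivative E x) (at x) \<and> (\<forall>v. (\<lambda>x. E x v) \<in> bump_algebra)" by blast
  have "((\<lambda>x. f x + g x) has_derivative (\<lambda>v. D x v + E x v)) (at x)" for x
    using DE by (intro has_derivative_add) auto
  moreover have "(\<lambda>x. D x v + E x v) \<in> bump_algebra" for v
    using DE by (intro bump_algebra.add) auto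
  ultimately show ?case by (intro exI[of _ "\<lambda>x v. D x v + E x v"]) blast
next
  case (mult f g)
  then obtain D E where DE: "\<forall>x. (f has_derivative D x) (at x) \<and> (\<forall>v. (\<lambda>x. D x v) \<in> bump_algebra)"
    "\<forall>x. (g has_derivative E x) (at x) \<and> (\<forall>v. (\<lambda>x. E x v) \<in> bump_algebra)" by blast
  have "((\<lambda>x. f x * g x) has_derivative (\<lambda>v. f x * E x v + D x v * g x)) (at x)" for x
    using DE by (intro has_derivative_mult) auto
  moreover have "(\<lambda>x. f x * E x v + D x v * g x) \<in> bump_algebra" for v
    using DE mult.hyps by (intro bump_algebra.add bump_algebra.mult) auto
  ultimately show ?case by (intro exI[of _ "\<lambda>x v. f x * E x v + D x v * g x"]) blast
qed

lemma bump_algebra_Ck_on: "f \<in> bump_algebra \<Longrightarrow> Ck_on k f UNIV"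
proof (induction k arbitrary: f)
  case 0
  then obtain D where "\<forall>x. (f has_derivative D x) (at x)" using bump_algebra_derivative by blast
  hence "continuous_on UNIV f"
    by (intro has_derivative_continuous_on[where f' = D]) auto
  thus ?case by simp
next
  case (Suc k)
  obtain D where D: "\<forall>x. (f has_derivative D x) (at x) \<and> (\<forall>v. (\<lambda>x. D x v) \<in> bump_algebra)"
    using bump_algebra_derivative[OF Suc.prems] by blast
  hence "frechet_derivative f (at x) = D x" for x by (metis frechet_derivative_at)
  thus ?case using D Suc.IH by (auto simp: differentiable_def)
qed

definition box_bump :: "real^'n \<Rightarrow> real^'n \<Rightarrow> nat \<Rightarrow> real^'n \<Rightarrow> real" where
  "box_bump a b n x = (\<Prod>i\<in>UNIV. flat_exp 0 (1 / Suc n) (1 * (x $ i) + (- a $ i)) *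
     flat_exp 0 (1 / Suc n) ((- 1) * (x $ i) + b $ i))"

lemma box_bump_algebra: "box_bump a b n \<in> bump_algebra"
proof -
  have "(\<lambda>x. \<Prod>i\<in>A. flat_exp 0 (1 / Suc n) (1 * (x $ i) + (- a $ i)) *
     flat_exp 0 (1 / Suc n) ((- 1) * (x $ i) + b $ i)) \<in> bump_algebra" if "finite A" for A
    using that
  proof induction
    case empty
    show ?case using bump_algebra.const[of 1] by simp
  next
    case (insert j A)
    have "(\<lambda>x. (flat_exp 0 (1 / Suc n) (1 * (x $ j) + (- a $ j)) *
     flat_exp 0 (1 / Suc n) ((- 1) * (x $ j) + b $ j)) * (\<Prod>i\<in>A. flat_exp 0 (1 / Suc n) (1 * (x $ i) + (- a $ i)) *
     flat_exp 0 (1 / Suc n) ((- 1) * (x $ i) + b $ i))) \<in> bump_algebra"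
      using insert by (intro bump_algebra.mult bump_algebra.gen) auto
    thus ?case using insert by simp
  qed
  thus ?thesis unfolding box_bump_def[abs_def] by simp
qed

lemma box_bump_outside: "x \<notin> box a b \<Longrightarrow> box_bump a b n x = 0"
  unfolding box_bump_def mem_box_cart by (auto intro!: prod_zero simp: flat_exp_def)

lemma box_bump_range: "0 \<le> box_bump a b n x" "box_bump a b n x \<le> 1"
proof -
  have f: "0 \<le> flat_exp 0 (1 / Suc n) t" "flat_exp 0 (1 / Suc n) t \<le> 1" for t
    by (auto simp: flat_exp_def)
  show "0 \<le> box_bump a b n x" "box_bump a b n x \<le> 1"
    unfolding box_bump_def using f by (auto intro!: prod_nonneg prod_le_1 mult_le_one)
qed

lemma box_bump_tendsto: "(\<lambda>n. box_bump a b n x) \<longlonglongrightarrow> indicator (box a b) x"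
proof (cases "x \<in> box a b")
  case True
  have "(\<lambda>n. flat_exp 0 (1 / Suc n) t) \<longlonglongrightarrow> 1" if "t > 0" for t
  proof -
    have "(\<lambda>n. exp (- ((1 / real (Suc n)) / t))) \<longlonglongrightarrow> exp (- (0 / t))"
      by (intro tendsto_intros LIMSEQ_Suc[OF lim_1_over_n]) (use that in auto)
    thus ?thesis using that by (simp add: flat_exp_def)
  qed
  hence "(\<lambda>n. box_bump a b n x) \<longlonglongrightarrow> (\<Prod>i\<in>(UNIV::'a set). 1 * 1)"
    unfolding box_bump_def using True by (intro tendsto_prod tendsto_mult) (auto simp: mem_box_cart)
  thus ?thesis using True by simp
qed (simp add: box_bump_outside)

lemma box_bump_test:
  assumes "cbox a b \<subseteq> \<Omega>"
  shows "box_bump a b n \<in> test_functions \<Omega>"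
proof -
  have "closure {x. box_bump a b n x \<noteq> 0} \<subseteq> cbox a b"
    by (intro closure_minimal) (use box_bump_outside box_subset_cbox in \<open>auto, blast\<close>)
  thus ?thesis unfolding test_functions_def smooth_on_def
    using assms bump_algebra_Ck_on[OF box_bump_algebra]
    by (auto intro: compact_closure[THEN iffD2] bounded_subset[OF bounded_cbox closure_subset[THEN order_trans]])
qed

section \<open>The fundamental lemma of the calculus of variations\<close>

lemma lebesgue_on_supported:
  fixes f :: "real^'n \<Rightarrow> 'b::euclidean_space"
  assumes "\<Omega> \<in> sets lebesgue" "\<And>x. x \<notin> \<Omega> \<Longrightarrow> f x = 0"
  shows "(LINT x|lebesgue_on \<Omega>. f x) = (LINT x|lebesgue. f x)"
    "integrable (lebesgue_on \<Omega>) f \<longleftrightarrow> integrable lebesgue f"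
proof -
  have "(\<lambda>x. indicator \<Omega> x *\<^sub>R f x) = f" using assms(2) by (auto simp: indicator_def)
  thus "(LINT x|lebesgue_on \<Omega>. f x) = (LINT x|lebesgue. f x)"
    "integrable (lebesgue_on \<Omega>) f \<longleftrightarrow> integrable lebesgue f"
    using assms(1) integral_restrict_space[of \<Omega> lebesgue f] integrable_restrict_space[of \<Omega> lebesgue f] by auto
qed

lemma bounded_times_locally_integrable:
  fixes H :: "real^'n \<Rightarrow> 'b::euclidean_space"
  assumes H: "locally_integrable \<Omega> H" and K: "compact K" "K \<subseteq> \<Omega>"
    and \<psi>: "\<psi> \<in> borel_measurable lebesgue" "\<And>x. x \<notin> K \<Longrightarrow> \<psi> x = 0" "\<And>x. \<bar>\<psi> x\<bar> \<le> B"
  shows "integrable lebesgue (\<lambda>x. \<psi> x *\<^sub>R H x)"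
proof -
  note [measurable] = \<psi>(1)
  have int: "integrable lebesgue (\<lambda>x. indicator K x *\<^sub>R H x)"
    using H K unfolding locally_integrable_def set_integrable_def by auto
  have eq: "\<psi> x *\<^sub>R H x = \<psi> x *\<^sub>R (indicator K x *\<^sub>R H x)" for x
    using \<psi>(2)[of x] by (cases "x \<in> K") auto
  have "integrable lebesgue (\<lambda>x. \<psi> x *\<^sub>R (indicator K x *\<^sub>R H x))"
  proof (rule Bochner_Integration.integrable_bound)
    show "integrable lebesgue (\<lambda>x. B *\<^sub>R (indicator K x *\<^sub>R H x))" using int by (rule integrable_scaleR_right)
    show "(\<lambda>x. \<psi> x *\<^sub>R (indicator K x *\<^sub>R H x)) \<in> borel_measurable lebesgue"
      by (rule borel_measurable_scaleR[OF \<psi>(1) borel_measurable_integrable[OF int]])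
    have "\<bar>\<psi> x\<bar> * norm (indicator K x *\<^sub>R H x) \<le> \<bar>B\<bar> * norm (indicator K x *\<^sub>R H x)" for x
      using \<psi>(3)[of x] by (intro mult_right_mono) auto
    thus "AE x in lebesgue. norm (\<psi> x *\<^sub>R (indicator K x *\<^sub>R H x)) \<le> norm (B *\<^sub>R (indicator K x *\<^sub>R H x))"
      by (intro AE_I2) (simp only: norm_scaleR real_norm_def)
  qed
  thus ?thesis using eq by presburger
qed

text \<open>Sets over which \<open>h\<close> has integral 0 form a Dynkin system, and the open boxes
  are an intersection-stable generator of the Borel sets.\<close>

lemma AE_eq_0_if_box_integrals_0:
  fixes h :: "real^'n \<Rightarrow> real"
  assumes int: "integrable lebesgue h" and A: "h = (\<lambda>x. indicator (cbox A B) x * g x)"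
    and box: "\<And>a b. cbox a b \<subseteq> cbox A B \<Longrightarrow> (LINT x|lebesgue. indicator (box a b) x * h x) = 0"
  shows "AE x in lebesgue. h x = 0"
proof -
  note [measurable] = borel_measurable_integrable[OF int]
  have bd: "AE x in lebesgue. x \<notin> cbox A B - box A B"
    using negligible_frontier_interval[of A B] by (intro AE_not_in) (simp add: negligible_iff_null_sets)
  have basic: "(LINT x|lebesgue. indicator (box a b) x * h x) = 0" for a b
  proof -
    \<comment> \<open>The hypothesis only covers boxes inside \<open>cbox A B\<close>. An arbitrary
      box is cut down to such a box; the integral changes at most on the boundary of
      \<open>cbox A B\<close>, a null set.\<close>
    define a' b' where "a' = (\<chi> i. max (a $ i) (A $ i))" and "b' = (\<chi> i. min (b $ i) (B $ i))"
    have ib: "box a b \<inter> box A B = box a' b'" unfolding a'_def b'_def by (auto simp: mem_box_cart)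
    have "(LINT x|lebesgue. indicator (box a b) x * h x) = (LINT x|lebesgue. indicator (box a' b') x * h x)"
    proof (rule integral_cong_AE)
      show "AE x in lebesgue. indicator (box a b) x * h x = indicator (box a' b') x * h x"
        using bd by eventually_elim (auto simp: indicator_def A ib[symmetric])
      show "(\<lambda>x. indicator (box a b) x * h x) \<in> borel_measurable lebesgue"
        "(\<lambda>x. indicator (box a' b') x * h x) \<in> borel_measurable lebesgue"
        by (intro borel_measurable_times borel_measurable_indicator; simp)+
    qed
    also have "\<dots> = 0"
    proof (cases "box a' b' = {}")
      case False
      have "cbox a' b' \<subseteq> cbox A B" unfolding a'_def b'_def by (auto simp: mem_box_cart)
      thus ?thesis by (rule box)
    qed simp
    finally show ?thesis .
  qed
  have total: "(LINT x|lebesgue. h x) = 0"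
  proof -
    have "(LINT x|lebesgue. h x) = (LINT x|lebesgue. indicator (box A B) x * h x)"
    proof (rule integral_cong_AE)
      show "AE x in lebesgue. h x = indicator (box A B) x * h x"
        using bd by eventually_elim (auto simp: indicator_def A)
      show "(\<lambda>x. indicator (box A B) x * h x) \<in> borel_measurable lebesgue"
        by (intro borel_measurable_times borel_measurable_indicator; simp)
    qed simp
    thus ?thesis using basic by simp
  qed
  have intS: "integrable lebesgue (\<lambda>x. indicator S x * h x)" if "S \<in> sets lebesgue" for S :: "(real^'n) set"
    using integrable_mult_indicator[OF that int] by simp
  have G: "sigma_sets UNIV (range (\<lambda>(a, b). box a b :: (real^'n) set)) = sets borel"
    by (subst borel_eq_box) (simp add: sets_measure_of)
  have borel0: "(LINT x|lebesgue. indicator S x * h x) = 0" if "S \<in> sets borel" for S :: "(real^'n) set"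
  proof -
    have "S \<in> sigma_sets UNIV (range (\<lambda>(a, b). box a b :: (real^'n) set))" using that G by simp
    thus ?thesis
    proof (rule sigma_sets_induct_disjoint[rotated 2])
      show "Int_stable (range (\<lambda>(a, b). box a b :: (real^'n) set))"
        by (auto simp: Int_stable_def box_Int_box)
      show "range (\<lambda>(a, b). box a b :: (real^'n) set) \<subseteq> Pow UNIV" by simp
      show "(LINT x|lebesgue. indicator S x * h x) = 0" if "S \<in> range (\<lambda>(a, b). box a b)" for S :: "(real^'n) set"
        using basic that by auto
      show "(LINT x|lebesgue. indicator ({} :: (real^'n) set) x * h x) = 0" by simp
    next
      fix S :: "(real^'n) set" assume comp: "S \<in> sigma_sets UNIV (range (\<lambda>(a, b). box a b :: (real^'n) set))"
        "(LINT x|lebesgue. indicator S x * h x) = 0"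
      have S: "S \<in> sets lebesgue" using comp(1) G by auto
      have "(LINT x|lebesgue. indicator (UNIV - S) x * h x) = (LINT x|lebesgue. h x - indicator S x * h x)"
        by (intro Bochner_Integration.integral_cong) (auto simp: indicator_def)
      also have "\<dots> = 0" using comp(2) total intS[OF S] int by simp
      finally show "(LINT x|lebesgue. indicator (UNIV - S) x * h x) = 0" .
    next
      fix S :: "nat \<Rightarrow> (real^'n) set"
      assume union: "disjoint_family S" "range S \<subseteq> sigma_sets UNIV (range (\<lambda>(a, b). box a b))"
        "\<And>i. (LINT x|lebesgue. indicator (S i) x * h x) = 0"
      have S: "S i \<in> sets lebesgue" for i using union(2) G by auto
      have "(LINT x:(\<Union>i. S i)|lebesgue. h x) = (\<Sum>i. (LINT x:(S i)|lebesgue. h x))"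
        using union(1) S intS[of "\<Union>i. S i"]
        by (intro lebesgue_integral_countable_add) (auto simp: disjoint_family_on_def set_integrable_def)
      thus "(LINT x|lebesgue. indicator (\<Union>i. S i) x * h x) = 0"
        using union(3) by (simp add: set_lebesgue_integral_def)
    qed
  qed
  show ?thesis
  proof (rule density_unique_real[OF int])
    \<comment> \<open>A Lebesgue set differs from a Borel set by a subset of a null set, which does
      not affect the integral.\<close>
    fix S :: "(real^'n) set" assume S: "S \<in> sets lebesgue"
    then obtain S0 N N' where SN: "S = S0 \<union> N" "N \<subseteq> N'" "N' \<in> null_sets lborel" "S0 \<in> sets lborel"
      by (rule sets_completionE)
    have N': "AE x in lebesgue. x \<notin> N'" using SN(3) by (intro AE_completion AE_not_in)
    have "(LINT x|lebesgue. indicator S x * h x) = (LINT x|lebesgue. indicator S0 x * h x)"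
    proof (rule integral_cong_AE)
      show "AE x in lebesgue. indicator S x * h x = indicator S0 x * h x"
        using N' by eventually_elim (use SN in \<open>auto simp: indicator_def\<close>)
    qed (use intS[OF S] intS[of S0] SN(4) in \<open>auto intro!: borel_measurable_integrable\<close>)
    also have "\<dots> = 0" using borel0[of S0] SN(4) by simp
    finally show "(LINT x:S|lebesgue. h x) = (LINT x:S|lebesgue. 0)"
      by (simp add: set_lebesgue_integral_def)
  qed simp
qed

text \<open>Box bumps tend boundedly to the indicator of a box, so each component of
  \<open>H\<close> has integral 0 over every box whose closure lies in \<Omega>. Countably many
  closed boxes cover \<Omega>.\<close>

lemma fundamental_lemma_calculus_of_variations:
  fixes H :: "real^'n \<Rightarrow> real^'m"
  assumes "open \<Omega>" and H: "locally_integrable \<Omega> H"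
    and zero: "\<And>\<psi>. \<psi> \<in> test_functions \<Omega> \<Longrightarrow> (LINT x|lebesgue. \<psi> x *\<^sub>R H x) = 0"
  shows "AE x in lebesgue. x \<in> \<Omega> \<longrightarrow> H x = 0"
proof -
  have local: "AE x in lebesgue. x \<in> cbox A B \<longrightarrow> H x $ j = 0" if AB: "cbox A B \<subseteq> \<Omega>" for A B j
  proof -
    define h where "h = (\<lambda>x. indicator (cbox A B) x * (H x $ j))"
    have "integrable lebesgue (\<lambda>x. indicator (cbox A B) x *\<^sub>R H x)"
      using H AB unfolding locally_integrable_def set_integrable_def by auto
    hence "integrable lebesgue (\<lambda>x. (indicator (cbox A B) x *\<^sub>R H x) \<bullet> axis j 1)" by (intro integrable_inner_left)
    hence int: "integrable lebesgue h" unfolding h_def by (simp add: inner_axis)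
    have "(LINT x|lebesgue. indicator (box a b) x * h x) = 0" if ab: "cbox a b \<subseteq> cbox A B" for a b
    proof -
      have ba: "cbox a b \<subseteq> \<Omega>" using ab AB by blast
      have bm: "box_bump a b n \<in> borel_measurable lebesgue" for n
        using bump_algebra_Ck_on[OF box_bump_algebra, of 0 a b n]
        by (auto intro!: measurable_completion borel_measurable_continuous_onI)
      have "(LINT x|lebesgue. box_bump a b n x * h x) = 0" for n
      proof -
        have i: "integrable lebesgue (\<lambda>x. box_bump a b n x *\<^sub>R H x)"
          by (rule bounded_times_locally_integrable[OF H compact_cbox ba bm, of _ 1])
            (use box_bump_outside box_subset_cbox[of a b] box_bump_range[of a b n] in \<open>force simp: abs_le_iff\<close>)+
        have eq: "box_bump a b n x * h x = (box_bump a b n x *\<^sub>R H x) \<bullet> axis j 1" for x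
        proof (cases "x \<in> cbox A B")
          case False
          hence "x \<notin> box a b" using ab box_subset_cbox by blast
          thus ?thesis by (simp add: box_bump_outside)
        qed (simp add: h_def inner_axis)
        have "(LINT x|lebesgue. box_bump a b n x * h x) = (LINT x|lebesgue. box_bump a b n x *\<^sub>R H x) \<bullet> axis j 1"
          unfolding eq using i by (intro integral_inner_left)
        thus ?thesis using zero[OF box_bump_test[OF ba]] by simp
      qed
      moreover have "(\<lambda>n. LINT x|lebesgue. box_bump a b n x * h x) \<longlonglongrightarrow> (LINT x|lebesgue. indicator (box a b) x * h x)"
      proof (rule integral_dominated_convergence[where w="\<lambda>x. \<bar>h x\<bar>"])
        show "AE x in lebesgue. (\<lambda>n. box_bump a b n x * h x) \<longlonglongrightarrow> indicator (box a b) x * h x"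
          by (intro AE_I2 tendsto_mult_right box_bump_tendsto)
        have "\<bar>box_bump a b n x\<bar> * \<bar>h x\<bar> \<le> 1 * \<bar>h x\<bar>" for n x
          using box_bump_range[of a b n x] by (intro mult_right_mono) auto
        thus "AE x in lebesgue. norm (box_bump a b n x * h x) \<le> \<bar>h x\<bar>" for n by (simp add: abs_mult)
        show "(\<lambda>x. box_bump a b n x * h x) \<in> borel_measurable lebesgue" for n
          using bm int by (intro borel_measurable_times) auto
        show "(\<lambda>x. indicator (box a b) x * h x) \<in> borel_measurable lebesgue"
          using int by (intro borel_measurable_times borel_measurable_indicator) auto
      qed (use int in auto)
      ultimately show ?thesis by (simp add: LIMSEQ_const_iff)
    qed
    from AE_eq_0_if_box_integrals_0[OF int h_def this]
    have "AE x in lebesgue. h x = 0" by blast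
    thus ?thesis by eventually_elim (auto simp: h_def)
  qed
  obtain \<D> where \<D>: "countable \<D>" "\<And>X. X \<in> \<D> \<Longrightarrow> \<exists>a b. X = cbox a b" "\<Union>\<D> = \<Omega>"
    using open_countable_Union_open_cbox[OF \<open>open \<Omega>\<close>] by metis
  have "AE x in lebesgue. x \<in> X \<longrightarrow> H x $ j = 0" if X: "X \<in> \<D>" for X j
  proof -
    obtain a b where "X = cbox a b" using \<D>(2)[OF X] by blast
    thus ?thesis using local[of a b j] that \<D>(3) by blast
  qed
  hence "AE x in lebesgue. \<forall>j. x \<in> X \<longrightarrow> H x $ j = 0" if "X \<in> \<D>" for X
    using that by (intro eventually_all_finite) auto
  hence "AE x in lebesgue. \<forall>X\<in>\<D>. \<forall>j. x \<in> X \<longrightarrow> H x $ j = 0"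
    using \<D>(1) by (subst AE_ball_countable) auto
  thus ?thesis by eventually_elim (use \<D>(3) in \<open>auto simp: vec_eq_iff\<close>)
qed

section \<open>Local compactness\<close>

lemma Npow_triangle_real:
  fixes f g h :: "'a \<Rightarrow> 'b::euclidean_space"
  assumes "f \<in> borel_measurable M" "g \<in> borel_measurable M" "h \<in> borel_measurable M" and "0 < q"
    and "Npow q M (\<lambda>x. f x - g x) \<le> ennreal a" "Npow q M (\<lambda>x. g x - h x) \<le> ennreal b" "0 \<le> a" "0 \<le> b"
  shows "Npow q M (\<lambda>x. f x - h x) \<le> ennreal (2 powr q * (a + b))"
proof -
  have "Npow q M (\<lambda>x. f x - h x) \<le> ennreal (2 powr q) * (Npow q M (\<lambda>x. f x - g x) + Npow q M (\<lambda>x. g x - h x))"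
    using assms by (intro Npow_triangle)
  also have "\<dots> \<le> ennreal (2 powr q) * (ennreal a + ennreal b)"
    using assms by (intro mult_left_mono add_mono) auto
  also have "\<dots> = ennreal (2 powr q * (a + b))"
    using assms by (simp add: ennreal_plus[symmetric] ennreal_mult[symmetric] del: ennreal_plus)
  finally show ?thesis .
qed

text \<open>Integrate the tangent inequality of the power, taken at the mean of |g|.\<close>

lemma jensen_powr:
  fixes g :: "'a \<Rightarrow> real"
  assumes M: "emeasure M (space M) = 1" and [measurable]: "g \<in> borel_measurable M"
    and B: "\<And>x. \<bar>g x\<bar> \<le> B" and q: "1 < q"
  shows "ennreal (\<bar>LINT x|M. g x\<bar> powr q) \<le> (\<integral>\<^sup>+x. ennreal (\<bar>g x\<bar> powr q) \<partial>M)"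
proof -
  interpret finite_measure M by standard (simp add: M)
  have one: "measure M (space M) = 1" using M by (simp add: measure_def)
  define m where "m = (LINT x|M. \<bar>g x\<bar>)"
  have m0: "0 \<le> m" unfolding m_def by simp
  have i1: "integrable M (\<lambda>x. \<bar>g x\<bar>)" by (rule integrable_const_bound[of _ B]) (use B in auto)
  have i2: "integrable M (\<lambda>x. \<bar>g x\<bar> powr q)"
  proof (rule integrable_const_bound[of _ "B powr q"])
    show "AE x in M. norm (\<bar>g x\<bar> powr q) \<le> B powr q" using B q by (auto intro!: powr_mono2)
  qed auto
  have "\<bar>LINT x|M. g x\<bar> \<le> m" unfolding m_def by (rule integral_abs_bound)
  hence "\<bar>LINT x|M. g x\<bar> powr q \<le> m powr q" using q by (intro powr_mono2) auto
  also have "\<dots> = (LINT x|M. m powr q + q * m powr (q - 1) * (\<bar>g x\<bar> - m))"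
    using i1 one by (simp add: m_def[symmetric])
  also have "\<dots> \<le> (LINT x|M. \<bar>g x\<bar> powr q)"
    using i1 i2 powr_above_tangent[OF q _ m0] by (intro integral_mono) auto
  finally have "ennreal (\<bar>LINT x|M. g x\<bar> powr q) \<le> ennreal (LINT x|M. \<bar>g x\<bar> powr q)" by (rule ennreal_leI)
  also have "\<dots> = (\<integral>\<^sup>+x. ennreal (\<bar>g x\<bar> powr q) \<partial>M)"
    using i2 by (intro nn_integral_eq_integral[symmetric]) auto
  finally show ?thesis .
qed

definition ball_measure :: "real \<Rightarrow> (real^'n) measure" where
  "ball_measure \<epsilon> = uniform_measure lborel (cball 0 \<epsilon>)"

text \<open>Mollification with the normalised indicator of a ball as kernel. Along a bounded
  sequence the averages are uniformly bounded and Lipschitz, which is what the compactness argument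
  asks of them.\<close>

definition ball_average :: "real \<Rightarrow> (real^'n \<Rightarrow> real) \<Rightarrow> real^'n \<Rightarrow> real" where
  "ball_average \<epsilon> f x = (LINT h|ball_measure \<epsilon>. f (x + h))"

lemma ball_measure_props:
  fixes \<epsilon> :: real
  assumes "\<epsilon> > 0"
  shows "sets (ball_measure \<epsilon> :: (real^'n) measure) = sets borel" "space (ball_measure \<epsilon> :: (real^'n) measure) = UNIV"
    "emeasure (ball_measure \<epsilon> :: (real^'n) measure) UNIV = 1"
    "AE h in (ball_measure \<epsilon> :: (real^'n) measure). norm h \<le> \<epsilon>"
    "\<exists>c>0. \<forall>g\<in>borel_measurable borel. (\<integral>\<^sup>+h. g h \<partial>(ball_measure \<epsilon> :: (real^'n) measure)) \<le> ennreal c * (\<integral>\<^sup>+h. g h \<partial>lborel)"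
proof -
  let ?A = "cball 0 \<epsilon> :: (real^'n) set"
  show "sets (ball_measure \<epsilon> :: (real^'n) measure) = sets borel" "space (ball_measure \<epsilon> :: (real^'n) measure) = UNIV"
    by (simp_all add: ball_measure_def)
  have fin: "emeasure lborel ?A < \<infinity>" by (rule emeasure_lborel_cball_finite)
  have pos: "measure lborel ?A > 0" using content_cball_pos[of \<epsilon> "0::real^'n"] assms by simp
  define c where "c = measure lborel ?A"
  have c: "emeasure lborel ?A = ennreal c" "c > 0"
    unfolding c_def using fin pos by (auto intro!: emeasure_eq_ennreal_measure)
  show "emeasure (ball_measure \<epsilon> :: (real^'n) measure) UNIV = 1"
    unfolding ball_measure_def using c by (simp add: divide_ennreal)
  show "AE h in (ball_measure \<epsilon> :: (real^'n) measure). norm h \<le> \<epsilon>"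
    unfolding ball_measure_def by (rule AE_uniform_measureI) auto
  have "(\<integral>\<^sup>+h. g h \<partial>(ball_measure \<epsilon> :: (real^'n) measure)) \<le> ennreal (1 / c) * (\<integral>\<^sup>+h. g h \<partial>lborel)"
    if g: "g \<in> borel_measurable borel" for g :: "real^'n \<Rightarrow> ennreal"
  proof -
    have "(\<integral>\<^sup>+h. g h \<partial>(ball_measure \<epsilon> :: (real^'n) measure)) = (\<integral>\<^sup>+h. g h * indicator ?A h \<partial>lborel) / ennreal c"
      unfolding ball_measure_def by (subst nn_integral_uniform_measure) (use g c in auto)
    also have "\<dots> \<le> (\<integral>\<^sup>+h. g h \<partial>lborel) / ennreal c"
      by (intro divide_right_mono_ennreal nn_integral_mono) (auto simp: indicator_def)
    also have "\<dots> = ennreal (1 / c) * (\<integral>\<^sup>+h. g h \<partial>lborel)"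
      using c(2) by (simp add: divide_ennreal_def inverse_ennreal inverse_eq_divide mult.commute)
    finally show ?thesis .
  qed
  thus "\<exists>c>0. \<forall>g\<in>borel_measurable borel. (\<integral>\<^sup>+h. g h \<partial>(ball_measure \<epsilon> :: (real^'n) measure)) \<le> ennreal c * (\<integral>\<^sup>+h. g h \<partial>lborel)"
    using c(2) by (intro exI[of _ "1 / c"]) auto
qed

lemma ball_average_measurable:
  fixes f :: "real^'n \<Rightarrow> real"
  assumes [measurable]: "f \<in> borel_measurable borel" and "\<epsilon> > 0"
  shows "ball_average \<epsilon> f \<in> borel_measurable borel"
proof -
  interpret finite_measure "ball_measure \<epsilon> :: (real^'n) measure"
    by standard (simp add: ball_measure_props[OF assms(2)])
  note [measurable_cong] = ball_measure_props(1)[OF assms(2), where 'n='n]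
  show ?thesis unfolding ball_average_def[abs_def] by measurable
qed

text \<open>Jensen moves the power inside the average, Fubini exchanges the two integrals, and the
  translation estimate is applied to each shift of length at most \<epsilon>.\<close>

lemma ball_average_diff:
  fixes f :: "real^'n \<Rightarrow> real"
  assumes f: "f \<in> C1c" and p: "1 < p" and \<epsilon>: "\<epsilon> > 0"
    and K: "Npow p lborel (grad f) \<le> ennreal K"
  shows "Npow p lborel (\<lambda>x. f x - ball_average \<epsilon> f x) \<le> ennreal (\<epsilon> powr p) * ennreal K"
proof -
  interpret finite_measure "ball_measure \<epsilon> :: (real^'n) measure"
    by standard (simp add: ball_measure_props[OF \<epsilon>])
  interpret pair_sigma_finite "lborel :: (real^'n) measure" "ball_measure \<epsilon> :: (real^'n) measure" ..
  note [measurable_cong] = ball_measure_props(1)[OF \<epsilon>, where 'n='n]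
  note f1 = C1c_C1[OF f]
  note [measurable] = C1_measurable(1)[OF f1]
  obtain B where B: "\<And>x. \<bar>f x\<bar> \<le> B" using C1c_bounded[OF f] by blast
  have "Npow p lborel (\<lambda>x. f x - ball_average \<epsilon> f x) \<le>
     (\<integral>\<^sup>+x. (\<integral>\<^sup>+h. ennreal (\<bar>f (x + h) - f x\<bar> powr p) \<partial>ball_measure \<epsilon>) \<partial>lborel)"
    unfolding Npow_def
  proof (rule nn_integral_mono)
    fix x :: "real^'n"
    have bd: "\<bar>f (x + h) - f x\<bar> \<le> 2 * B" for h using B[of "x + h"] B[of x] by linarith
    have i: "integrable (ball_measure \<epsilon>) (\<lambda>h. f (x + h))"
      by (rule integrable_const_bound[of _ B]) (use B in auto)
    have d: "ball_average \<epsilon> f x - f x = (LINT h|ball_measure \<epsilon>. f (x + h) - f x)"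
      unfolding ball_average_def using i ball_measure_props[OF \<epsilon>, where 'n='n]
      by (simp add: measure_def)
    have j: "ennreal (\<bar>LINT h|ball_measure \<epsilon>. f (x + h) - f x\<bar> powr p)
        \<le> (\<integral>\<^sup>+h. ennreal (\<bar>f (x + h) - f x\<bar> powr p) \<partial>ball_measure \<epsilon>)"
      by (rule jensen_powr[OF _ _ bd p]) (auto simp: ball_measure_props[OF \<epsilon>])
    show "ennreal (norm (f x - ball_average \<epsilon> f x) powr p)
        \<le> (\<integral>\<^sup>+h. ennreal (\<bar>f (x + h) - f x\<bar> powr p) \<partial>ball_measure \<epsilon>)"
      unfolding real_norm_def abs_minus_commute[of "f x"] d by (rule j)
  qed
  also have "\<dots> = (\<integral>\<^sup>+h. (\<integral>\<^sup>+x. ennreal (\<bar>f (x + h) - f x\<bar> powr p) \<partial>lborel) \<partial>ball_measure \<epsilon>)"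
    by (rule Fubini'[symmetric]) measurable
  also have "\<dots> \<le> (\<integral>\<^sup>+(h :: real^'n). ennreal (\<epsilon> powr p) * ennreal K \<partial>ball_measure \<epsilon>)"
  proof (rule nn_integral_mono_AE, use ball_measure_props(4)[OF \<epsilon>] in eventually_elim)
    case (elim h)
    have "(\<integral>\<^sup>+x. ennreal (\<bar>f (x + h) - f x\<bar> powr p) \<partial>lborel) \<le> ennreal (norm h powr p) * Npow p lborel (grad f)"
      by (rule translation_estimate[OF f p])
    also have "\<dots> \<le> ennreal (\<epsilon> powr p) * ennreal K"
      using K elim p by (intro mult_mono ennreal_leI powr_mono2) auto
    finally show ?case .
  qed
  also have "\<dots> = ennreal (\<epsilon> powr p) * ennreal K"
    using ball_measure_props[OF \<epsilon>, where 'n='n] by simp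
  finally show ?thesis .
qed

text \<open>The averaging measure is at most a multiple of Lebesgue measure, so Jensen turns
  integral bounds into pointwise ones. For the Lipschitz bound, the difference of two averages is
  the average of \<open>f n (x + h) - f n (y + h)\<close>, which the translation estimate
  controls.\<close>

lemma ball_average_bounds:
  fixes f :: "nat \<Rightarrow> real^'n \<Rightarrow> real"
  assumes f: "\<And>n. f n \<in> C1c" and p: "1 < p" and \<epsilon>: "\<epsilon> > 0"
    and K: "\<And>n. Npow p lborel (f n) \<le> ennreal K" "\<And>n. Npow p lborel (grad (f n)) \<le> ennreal K" "0 \<le> K"
  shows "\<exists>C>0. \<forall>n x y. \<bar>ball_average \<epsilon> (f n) x\<bar> \<le> C \<and>
    \<bar>ball_average \<epsilon> (f n) x - ball_average \<epsilon> (f n) y\<bar> \<le> C * norm (x - y)"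
proof -
  interpret finite_measure "ball_measure \<epsilon> :: (real^'n) measure"
    by standard (simp add: ball_measure_props[OF \<epsilon>])
  note [measurable_cong] = ball_measure_props(1)[OF \<epsilon>, where 'n='n]
  obtain c where c: "c > 0" "\<And>g. g \<in> borel_measurable borel \<Longrightarrow>
      (\<integral>\<^sup>+h. g h \<partial>(ball_measure \<epsilon> :: (real^'n) measure)) \<le> ennreal c * (\<integral>\<^sup>+h. g h \<partial>lborel)"
    using ball_measure_props(5)[OF \<epsilon>, where 'n='n] by blast
  \<comment> \<open>The summand 1 keeps \<open>C\<close> positive even if
    \<open>K = 0\<close>.\<close>
  define C where "C = (c * K) powr (1 / p) + 1"
  have C: "C > 0" unfolding C_def by (smt (verit) powr_ge_zero)
  have root: "t \<le> C * s" if t: "ennreal (t powr p) \<le> ennreal (c * (s powr p * K))" "0 \<le> t" "0 \<le> s" for t s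
  proof -
    have "t powr p \<le> c * (s powr p * K)" using t(1) c(1) K(3) by (subst (asm) ennreal_le_iff) auto
    hence "(t powr p) powr (1 / p) \<le> (c * (s powr p * K)) powr (1 / p)" using p by (intro powr_mono2) auto
    also have "(t powr p) powr (1 / p) = t" using t(2) p by (simp add: powr_powr)
    also have "(c * (s powr p * K)) powr (1 / p) = (c * K) powr (1 / p) * s"
    proof -
      have "(c * (s powr p * K)) powr (1 / p) = (c * K * s powr p) powr (1 / p)" by (simp add: mult_ac)
      also have "\<dots> = (c * K) powr (1 / p) * (s powr p) powr (1 / p)" by (rule powr_mult)
      also have "(s powr p) powr (1 / p) = s" using t(3) p by (simp add: powr_powr)
      finally show ?thesis .
    qed
    also have "\<dots> \<le> C * s" unfolding C_def using t(3) by (simp add: algebra_simps)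
    finally show ?thesis .
  qed
  have "\<bar>ball_average \<epsilon> (f n) x\<bar> \<le> C \<and> \<bar>ball_average \<epsilon> (f n) x - ball_average \<epsilon> (f n) y\<bar> \<le> C * norm (x - y)" for n x y
  proof -
    note f1 = C1c_C1[OF f[of n]]
    note [measurable] = C1_measurable(1)[OF f1]
    obtain B where B: "\<And>x. \<bar>f n x\<bar> \<le> B" using C1c_bounded[OF f[of n]] by blast
    have sp: "emeasure (ball_measure \<epsilon>) (space (ball_measure \<epsilon> :: (real^'n) measure)) = 1"
      by (simp add: ball_measure_props[OF \<epsilon>])
    have i: "integrable (ball_measure \<epsilon>) (\<lambda>h. f n (z + h))" for z
      by (rule integrable_const_bound[of _ B]) (use B in auto)
    have "ennreal (\<bar>ball_average \<epsilon> (f n) x\<bar> powr p) \<le> (\<integral>\<^sup>+h. ennreal (\<bar>f n (x + h)\<bar> powr p) \<partial>ball_measure \<epsilon>)"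
      unfolding ball_average_def by (rule jensen_powr[OF sp _ B p]) measurable
    also have "\<dots> \<le> ennreal c * (\<integral>\<^sup>+h. ennreal (\<bar>f n (x + h)\<bar> powr p) \<partial>lborel)"
      by (rule c(2)) measurable
    also have "(\<integral>\<^sup>+h. ennreal (\<bar>f n (x + h)\<bar> powr p) \<partial>lborel) = Npow p lborel (f n)"
      using nn_integral_lborel_translate[of "\<lambda>h. ennreal (\<bar>f n h\<bar> powr p)" x]
      by (simp add: add.commute Npow_def)
    also have "ennreal c * Npow p lborel (f n) \<le> ennreal c * ennreal K" by (intro mult_left_mono K) simp
    also have "\<dots> = ennreal (c * (1 powr p * K))" using c(1) K(3) by (simp add: ennreal_mult)
    finally have 1: "\<bar>ball_average \<epsilon> (f n) x\<bar> \<le> C * 1" by (rule root) auto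
    have bd: "\<bar>f n (x + h) - f n (y + h)\<bar> \<le> 2 * B" for h using B[of "x + h"] B[of "y + h"] by linarith
    have d: "ball_average \<epsilon> (f n) x - ball_average \<epsilon> (f n) y = (LINT h|ball_measure \<epsilon>. f n (x + h) - f n (y + h))"
      unfolding ball_average_def using i by simp
    have "(\<integral>\<^sup>+h. ennreal (\<bar>f n (x + h) - f n (y + h)\<bar> powr p) \<partial>lborel)
       = (\<integral>\<^sup>+h. ennreal (\<bar>f n (h + (x - y)) - f n h\<bar> powr p) \<partial>lborel)"
      using nn_integral_lborel_translate[of "\<lambda>h. ennreal (\<bar>f n (h + (x - y)) - f n h\<bar> powr p)" y]
      by (simp add: algebra_simps)
    also have "\<dots> \<le> ennreal (norm (x - y) powr p) * Npow p lborel (grad (f n))"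
      by (rule translation_estimate[OF f p])
    also have "\<dots> \<le> ennreal (norm (x - y) powr p) * ennreal K" by (intro mult_left_mono K) simp
    finally have t: "(\<integral>\<^sup>+h. ennreal (\<bar>f n (x + h) - f n (y + h)\<bar> powr p) \<partial>lborel)
       \<le> ennreal (norm (x - y) powr p) * ennreal K" .
    have "ennreal (\<bar>ball_average \<epsilon> (f n) x - ball_average \<epsilon> (f n) y\<bar> powr p)
       \<le> (\<integral>\<^sup>+h. ennreal (\<bar>f n (x + h) - f n (y + h)\<bar> powr p) \<partial>ball_measure \<epsilon>)"
      unfolding d by (rule jensen_powr[OF sp _ bd p]) measurable
    also have "\<dots> \<le> ennreal c * (\<integral>\<^sup>+h. ennreal (\<bar>f n (x + h) - f n (y + h)\<bar> powr p) \<partial>lborel)"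
      by (rule c(2)) measurable
    also have "\<dots> \<le> ennreal c * (ennreal (norm (x - y) powr p) * ennreal K)"
      using t by (rule mult_left_mono) simp
    also have "\<dots> = ennreal (c * (norm (x - y) powr p * K))"
      using c(1) K(3) by (simp add: ennreal_mult)
    finally have 2: "\<bar>ball_average \<epsilon> (f n) x - ball_average \<epsilon> (f n) y\<bar> \<le> C * norm (x - y)" by (rule root) auto
    show ?thesis using 1 2 by simp
  qed
  thus ?thesis using C by blast
qed

lemma Npow_restrict:
  "A \<in> sets lebesgue \<Longrightarrow> Npow q (lebesgue_on A) f = (\<integral>\<^sup>+x. ennreal (norm (f x) powr q) * indicator A x \<partial>lebesgue)"
  unfolding Npow_def by (subst nn_integral_restrict_space) auto

lemma Npow_restrict_le: "A \<in> sets lebesgue \<Longrightarrow> Npow q (lebesgue_on A) f \<le> Npow q lebesgue f"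
  by (simp add: Npow_restrict) (auto simp: Npow_def indicator_def intro!: nn_integral_mono)

text \<open>The common Lipschitz constant transfers the Cauchy property from a nearby point of the
  dense set.\<close>

lemma equilipschitz_convergent:
  fixes \<psi> :: "nat \<Rightarrow> 'a::real_normed_vector \<Rightarrow> real"
  assumes lip: "\<And>n x y. \<bar>\<psi> n x - \<psi> n y\<bar> \<le> C * norm (x - y)" and "C > 0"
    and dense: "\<And>X. open X \<Longrightarrow> X \<noteq> {} \<Longrightarrow> \<exists>d\<in>D. d \<in> X"
    and conv: "\<And>d. d \<in> D \<Longrightarrow> convergent (\<lambda>n. \<psi> n d)"
  shows "convergent (\<lambda>n. \<psi> n x)"
proof (rule real_Cauchy_convergent, rule CauchyI)
  fix e :: real assume e: "e > 0"
  have "e / (3 * C) > 0" using e \<open>C > 0\<close> by simp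
  hence "ball x (e / (3 * C)) \<noteq> {}" by simp
  then obtain d where d: "d \<in> D" "d \<in> ball x (e / (3 * C))" using dense[of "ball x (e / (3 * C))"] by auto
  have "norm (x - d) < e / (3 * C)" using d(2) by (simp add: dist_norm)
  hence "C * norm (x - d) < e / 3" using \<open>C > 0\<close> by (simp add: field_simps)
  hence l: "\<bar>\<psi> n x - \<psi> n d\<bar> < e / 3" for n using lip[of n x d] by linarith
  obtain N where N: "\<And>m n. m \<ge> N \<Longrightarrow> n \<ge> N \<Longrightarrow> norm (\<psi> m d - \<psi> n d) < e / 3"
    using CauchyD[OF convergent_Cauchy[OF conv[OF d(1)]], of "e / 3"] e by auto
  show "\<exists>M. \<forall>m\<ge>M. \<forall>n\<ge>M. norm (\<psi> m x - \<psi> n x) < e"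
  proof (intro exI allI impI)
    fix m n assume "m \<ge> N" "n \<ge> N"
    from N[OF this] l[of m] l[of n] show "norm (\<psi> m x - \<psi> n x) < e" unfolding real_norm_def by linarith
  qed
qed

lemma Npow_bounded_convergence:
  fixes \<psi> :: "nat \<Rightarrow> real^'n \<Rightarrow> real"
  assumes [measurable]: "\<And>n. \<psi> n \<in> borel_measurable borel" and B: "\<And>n x. \<bar>\<psi> n x\<bar> \<le> B"
    and conv: "\<And>x. (\<lambda>n. \<psi> n x) \<longlonglongrightarrow> \<Psi> x" and p: "0 < p"
  shows "(\<lambda>n. Npow p (lebesgue_on (cball 0 R)) (\<lambda>x. \<psi> n x - \<Psi> x)) \<longlonglongrightarrow> 0"
proof -
  have [measurable]: "\<Psi> \<in> borel_measurable borel"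
    by (rule borel_measurable_LIMSEQ_real[OF conv]) auto
  let ?A = "cball 0 R :: (real^'n) set"
  have eq: "Npow p (lebesgue_on ?A) (\<lambda>x. \<psi> n x - \<Psi> x) = (\<integral>\<^sup>+x. ennreal (norm (\<psi> n x - \<Psi> x) powr p) * indicator ?A x \<partial>lborel)" for n
    by (subst Npow_restrict) (auto simp: nn_integral_completion)
  have \<Psi>B: "\<bar>\<Psi> x\<bar> \<le> B" for x
    using LIMSEQ_le_const2[OF tendsto_rabs[OF conv[of x]], of B] B by blast
  have "(\<lambda>n. \<integral>\<^sup>+x. ennreal (norm (\<psi> n x - \<Psi> x) powr p) * indicator ?A x \<partial>lborel) \<longlonglongrightarrow> (\<integral>\<^sup>+(x::real^'n). 0 \<partial>lborel)"
  proof (rule nn_integral_dominated_convergence[where w="\<lambda>x. ennreal ((2 * B) powr p) * indicator ?A x"])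
    show "(\<lambda>x. ennreal (norm (\<psi> n x - \<Psi> x) powr p) * indicator ?A x) \<in> borel_measurable lborel" for n
      by (intro borel_measurable_times_ennreal borel_measurable_indicator) auto
    show "(\<lambda>x. ennreal ((2 * B) powr p) * indicator ?A x) \<in> borel_measurable lborel"
      by (intro borel_measurable_times_ennreal borel_measurable_const borel_measurable_indicator) auto
    show "(\<integral>\<^sup>+x. ennreal ((2 * B) powr p) * indicator ?A x \<partial>lborel) < \<infinity>"
      using emeasure_lborel_cball_finite[of "0::real^'n" R]
      by (subst nn_integral_cmult_indicator) (auto simp: ennreal_mult_less_top)
    show "AE x in lborel. ennreal (norm (\<psi> n x - \<Psi> x) powr p) * indicator ?A x \<le> ennreal ((2 * B) powr p) * indicator ?A x" for n
    proof (intro AE_I2 mult_right_mono ennreal_leI powr_mono2)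
      show "norm (\<psi> n x - \<Psi> x) \<le> 2 * B" for x using B[of n x] \<Psi>B[of x] by (simp add: abs_le_iff)
    qed (use p in auto)
    show "AE x in lborel. (\<lambda>n. ennreal (norm (\<psi> n x - \<Psi> x) powr p) * indicator ?A x) \<longlonglongrightarrow> 0"
    proof (rule AE_I2)
      fix x :: "real^'n"
      have "(\<lambda>n. norm (\<psi> n x - \<Psi> x)) \<longlonglongrightarrow> norm (\<Psi> x - \<Psi> x)" by (intro tendsto_norm tendsto_diff conv tendsto_const)
      hence "(\<lambda>n. norm (\<psi> n x - \<Psi> x) powr p) \<longlonglongrightarrow> norm (\<Psi> x - \<Psi> x) powr p"
        by (rule tendsto_powr2[OF _ tendsto_const]) (use p in auto)
      hence l: "(\<lambda>n. ennreal (norm (\<psi> n x - \<Psi> x) powr p)) \<longlonglongrightarrow> 0"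
        using tendsto_ennrealI by fastforce
      show "(\<lambda>n. ennreal (norm (\<psi> n x - \<Psi> x) powr p) * indicator ?A x) \<longlonglongrightarrow> 0"
        using l by (cases "x \<in> ?A") simp_all
    qed
  qed simp
  thus ?thesis unfolding eq by simp
qed

text \<open>Averages over small balls are close to the functions in L^p, uniformly along the
  sequence, and for a fixed radius they are bounded and equi-Lipschitz. The point is to find one
  subsequence that serves all radii 1/(k+1) at once.\<close>

proposition rellich_C1c:
  fixes f :: "nat \<Rightarrow> real^'n \<Rightarrow> real"
  assumes f: "\<And>n. f n \<in> C1c" and p: "1 < p"
    and K: "\<And>n. Npow p lebesgue (f n) \<le> ennreal K" "\<And>n. Npow p lebesgue (grad (f n)) \<le> ennreal K" "0 \<le> K"
  shows "\<exists>r :: nat \<Rightarrow> nat. strict_mono r \<and> (\<forall>R \<delta>. \<delta> > 0 \<longrightarrow> (\<exists>n0. \<forall>i\<ge>n0. \<forall>j\<ge>n0.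
     Npow p (lebesgue_on (cball 0 R)) (\<lambda>x. f (r i) x - f (r j) x) \<le> ennreal \<delta>))"
proof -
  have KB: "Npow p lborel (f n) \<le> ennreal K" "Npow p lborel (grad (f n)) \<le> ennreal K" for n
    using K(1,2)[of n] by (auto simp: Npow_def nn_integral_completion)
  define \<epsilon> where "\<epsilon> = (\<lambda>k. inverse (real (Suc k)))"
  have \<epsilon>: "\<epsilon> k > 0" for k unfolding \<epsilon>_def by simp
  have "\<forall>k. \<exists>C>0. \<forall>n x y. \<bar>ball_average (\<epsilon> k) (f n) x\<bar> \<le> C \<and>
    \<bar>ball_average (\<epsilon> k) (f n) x - ball_average (\<epsilon> k) (f n) y\<bar> \<le> C * norm (x - y)"
    using ball_average_bounds[where f=f, OF f p \<epsilon> KB K(3)] by blast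
  from choice[OF this] obtain C where C0: "\<forall>k. C k > 0 \<and> (\<forall>n x y. \<bar>ball_average (\<epsilon> k) (f n) x\<bar> \<le> C k \<and>
    \<bar>ball_average (\<epsilon> k) (f n) x - ball_average (\<epsilon> k) (f n) y\<bar> \<le> C k * norm (x - y))" by blast
  have C: "C k > 0" "\<bar>ball_average (\<epsilon> k) (f n) x\<bar> \<le> C k"
    "\<bar>ball_average (\<epsilon> k) (f n) x - ball_average (\<epsilon> k) (f n) y\<bar> \<le> C k * norm (x - y)" for k n x y
    using C0 by blast+
  obtain D :: "(real^'n) set" where D: "countable D" "\<And>X. open X \<Longrightarrow> X \<noteq> {} \<Longrightarrow> \<exists>d\<in>D. d \<in> X"
    using countable_dense_exists[where 'a="real^'n"] by blast
  have cS: "countable ((UNIV :: nat set) \<times> D)" using D(1) by simp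
  have bS: "norm (ball_average (\<epsilon> (fst z)) (f n) (snd z) / C (fst z)) \<le> 1" for n z
    using C(1)[of "fst z"] C(2)[of "fst z" n "snd z"] by simp
  \<comment> \<open>One diagonal extraction treats all pairs of a radius and a dense point, a
    countable set; division by \<open>C\<close> normalises the bounds to 1.\<close>
  obtain r where r: "strict_mono r" and rc: "\<And>z. z \<in> UNIV \<times> D \<Longrightarrow>
      \<exists>l. (\<lambda>n. ball_average (\<epsilon> (fst z)) (f (r n)) (snd z) / C (fst z)) \<longlonglongrightarrow> l"
    using function_convergent_subsequence[OF cS, of "\<lambda>n z. ball_average (\<epsilon> (fst z)) (f n) (snd z) / C (fst z)" 1] bS
    by metis
  have conv: "convergent (\<lambda>n. ball_average (\<epsilon> k) (f (r n)) x)" for k x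
  proof (rule equilipschitz_convergent[OF C(3) C(1) D(2)])
    fix d assume "d \<in> D"
    then obtain l where "(\<lambda>n. ball_average (\<epsilon> k) (f (r n)) d / C k) \<longlonglongrightarrow> l" using rc[of "(k, d)"] by auto
    hence "(\<lambda>n. C k * (ball_average (\<epsilon> k) (f (r n)) d / C k)) \<longlonglongrightarrow> C k * l" by (rule tendsto_mult_left)
    thus "convergent (\<lambda>n. ball_average (\<epsilon> k) (f (r n)) d)" using C(1)[of k] by (auto simp: convergent_def)
  qed auto
  show ?thesis
  proof (intro exI[of _ r] conjI r allI impI)
    fix R \<delta> :: real assume \<delta>: "\<delta> > 0"
    let ?M = "lebesgue_on (cball (0::real^'n) R)"
    define T where "T = (2::real) powr p"
    have T: "T > 0" unfolding T_def by simp
    \<comment> \<open>The chain from \<open>f (r i)\<close> through \<open>\<psi> i\<close>,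
      \<open>\<Psi>\<close> and \<open>\<psi> j\<close> to \<open>f (r j)\<close> has four links of
      size \<eta> and costs three triangle inequalities with factor \<open>T\<close>; \<eta> is
      chosen so that the nested bound is exactly \<delta>.\<close>
    define \<eta> where "\<eta> = \<delta> / (T + T * T + T * T * T * 2)"
    have den: "T + T * T + T * T * T * 2 > 0" using T by (intro add_pos_pos mult_pos_pos) auto
    have \<eta>: "\<eta> > 0" "T * (\<eta> + T * (\<eta> + T * (\<eta> + \<eta>))) = \<delta>"
    proof -
      show "\<eta> > 0" unfolding \<eta>_def using \<delta> den by simp
      have "T * (\<eta> + T * (\<eta> + T * (\<eta> + \<eta>))) = \<eta> * (T + T * T + T * T * T * 2)" by (simp add: algebra_simps)
      also have "\<dots> = \<delta>" unfolding \<eta>_def using den by simp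
      finally show "T * (\<eta> + T * (\<eta> + T * (\<eta> + \<eta>))) = \<delta>" .
    qed
    have "(\<lambda>k. \<epsilon> k powr p * K) \<longlonglongrightarrow> 0 powr p * K"
      unfolding \<epsilon>_def by (intro tendsto_mult_right tendsto_powr2[OF LIMSEQ_inverse_real_of_nat tendsto_const]) (use p in auto)
    hence "\<forall>\<^sub>F k in sequentially. \<epsilon> k powr p * K < \<eta>" using \<eta>(1) p by (intro order_tendstoD(2)) auto
    then obtain k where k: "\<epsilon> k powr p * K < \<eta>" by (meson eventually_sequentially order_refl)
    define \<psi> where "\<psi> = (\<lambda>n. ball_average (\<epsilon> k) (f (r n)))"
    define \<Psi> where "\<Psi> = (\<lambda>x. lim (\<lambda>n. \<psi> n x))"
    have \<psi>m: "\<psi> n \<in> borel_measurable borel" for n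
      unfolding \<psi>_def by (intro ball_average_measurable \<epsilon> C1_measurable C1c_C1 f)
    have lim: "(\<lambda>n. \<psi> n x) \<longlonglongrightarrow> \<Psi> x" for x
      unfolding \<Psi>_def \<psi>_def using conv convergent_LIMSEQ_iff by blast
    have \<Psi>m: "\<Psi> \<in> borel_measurable borel" by (rule borel_measurable_LIMSEQ_real[OF lim \<psi>m])
    have "(\<lambda>n. Npow p ?M (\<lambda>x. \<psi> n x - \<Psi> x)) \<longlonglongrightarrow> 0"
      by (rule Npow_bounded_convergence[OF \<psi>m _ lim, of "C k"]) (use C(2) p in \<open>auto simp: \<psi>_def\<close>)
    hence "\<forall>\<^sub>F n in sequentially. Npow p ?M (\<lambda>x. \<psi> n x - \<Psi> x) < ennreal \<eta>"
      using \<eta>(1) by (intro order_tendstoD(2)) auto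
    then obtain n0 where n0: "\<And>n. n \<ge> n0 \<Longrightarrow> Npow p ?M (\<lambda>x. \<psi> n x - \<Psi> x) < ennreal \<eta>"
      unfolding eventually_sequentially by blast
    have mM: "g \<in> borel_measurable ?M" if "g \<in> borel_measurable borel" for g :: "real^'n \<Rightarrow> real"
      using that by (intro measurable_restrict_space1 measurable_completion) simp
    note meas = mM[OF C1_measurable(1)[OF C1c_C1[OF f]]] mM[OF \<psi>m] mM[OF \<Psi>m]
    have a: "Npow p ?M (\<lambda>x. f (r n) x - \<psi> n x) \<le> ennreal \<eta>" for n
    proof -
      have "Npow p ?M (\<lambda>x. f (r n) x - \<psi> n x) \<le> Npow p lebesgue (\<lambda>x. f (r n) x - \<psi> n x)" by (rule Npow_restrict_le) simp
      also have "\<dots> = Npow p lborel (\<lambda>x. f (r n) x - \<psi> n x)" by (simp add: Npow_def nn_integral_completion)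
      also have "\<dots> \<le> ennreal (\<epsilon> k powr p) * ennreal K"
        unfolding \<psi>_def by (rule ball_average_diff[OF f p \<epsilon> KB(2)])
      also have "\<dots> = ennreal (\<epsilon> k powr p * K)" using K(3) by (simp add: ennreal_mult)
      also have "\<dots> \<le> ennreal \<eta>" using k by (intro ennreal_leI) simp
      finally show ?thesis .
    qed
    show "\<exists>n0. \<forall>i\<ge>n0. \<forall>j\<ge>n0. Npow p (lebesgue_on (cball 0 R)) (\<lambda>x. f (r i) x - f (r j) x) \<le> ennreal \<delta>"
    proof (intro exI allI impI)
      fix i j assume ij: "i \<ge> n0" "j \<ge> n0"
      have p0: "p > 0" using p by simp
      have \<eta>0: "0 \<le> \<eta>" using \<eta>(1) by simp
      have a': "Npow p ?M (\<lambda>x. \<psi> j x - f (r j) x) \<le> ennreal \<eta>" using a[of j] by (simp add: Npow_commute[of p ?M "\<psi> j"])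
      have b': "Npow p ?M (\<lambda>x. \<Psi> x - \<psi> j x) \<le> ennreal \<eta>" using n0[OF ij(2)] by (simp add: Npow_commute[of p ?M \<Psi>])
      have b: "Npow p ?M (\<lambda>x. \<psi> i x - \<Psi> x) \<le> ennreal \<eta>" using n0[OF ij(1)] by simp
      have 1: "Npow p ?M (\<lambda>x. \<Psi> x - f (r j) x) \<le> ennreal (T * (\<eta> + \<eta>))"
        unfolding T_def by (rule Npow_triangle_real[OF meas(3) meas(2) meas(1) p0 b' a' \<eta>0 \<eta>0])
      have 2: "Npow p ?M (\<lambda>x. \<psi> i x - f (r j) x) \<le> ennreal (T * (\<eta> + T * (\<eta> + \<eta>)))"
        using Npow_triangle_real[OF meas(2) meas(3) meas(1) p0 b 1 \<eta>0] \<eta>0 T unfolding T_def by simp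
      have "Npow p ?M (\<lambda>x. f (r i) x - f (r j) x) \<le> ennreal (T * (\<eta> + T * (\<eta> + T * (\<eta> + \<eta>))))"
        using Npow_triangle_real[OF meas(1) meas(2) meas(1) p0 a 2 \<eta>0] \<eta>0 T unfolding T_def by simp
      thus "Npow p ?M (\<lambda>x. f (r i) x - f (r j) x) \<le> ennreal \<delta>" by (simp only: \<eta>(2))
    qed
  qed
qed

section \<open>Weak gradients\<close>

lemma test_functions_C1c:
  assumes "\<phi> \<in> test_functions \<Omega>"
  shows "\<phi> \<in> C1c"
proof -
  have "Ck_on 1 \<phi> UNIV" using assms by (simp add: test_functions_def smooth_on_def)
  hence d: "\<forall>x. \<phi> differentiable (at x)" and c: "\<forall>i. continuous_on UNIV (\<lambda>x. frechet_derivative \<phi> (at x) (axis i 1))"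
    by auto
  have "continuous_on UNIV (grad \<phi>)"
    unfolding grad_def[abs_def] using c by (intro continuous_on_vec_lambda) auto
  moreover have "bounded (closure {x. \<phi> x \<noteq> 0})"
    using assms by (auto simp: test_functions_def intro: compact_imp_bounded)
  then obtain R where "\<forall>x\<in>closure {x. \<phi> x \<noteq> 0}. norm x \<le> R" unfolding bounded_iff by blast
  hence "\<forall>x. R < norm x \<longrightarrow> \<phi> x = 0" using closure_subset[of "{x. \<phi> x \<noteq> 0}"] by fastforce
  ultimately show ?thesis using d unfolding C1c_def C1_on_space_def by blast
qed

lemma test_functions_jet_eq_0:
  assumes "\<phi> \<in> test_functions \<Omega>" "x \<notin> closure {x. \<phi> x \<noteq> 0}"
  shows "jet \<phi> x = 0"
proof -
  let ?K = "closure {x. \<phi> x \<noteq> 0}"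
  have 0: "\<phi> y = 0" if "y \<notin> ?K" for y using that closure_subset[of "{x. \<phi> x \<noteq> 0}"] by blast
  have "(\<phi> has_derivative (\<lambda>h. 0)) (at x)"
  proof (rule has_derivative_transform_within_open[of "\<lambda>_. 0" _ _ _ "- ?K"])
    show "open (- ?K)" by (intro open_Compl closed_closure)
    show "x \<in> - ?K" using assms(2) by simp
    show "0 = \<phi> y" if "y \<in> - ?K" for y using 0[of y] that by simp
  qed (rule has_derivative_const)
  hence "(\<phi> has_derivative (\<lambda>h. 0 \<bullet> h)) (at x)" by simp
  hence "grad \<phi> x = 0" by (rule grad_eqI)
  thus ?thesis using 0[OF assms(2)] by (simp add: jet_def zero_prod_def)
qed

lemma test_functions_outside: "\<phi> \<in> test_functions \<Omega> \<Longrightarrow> x \<notin> \<Omega> \<Longrightarrow> jet \<phi> x = 0"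
  using test_functions_jet_eq_0[of \<phi> \<Omega> x] unfolding test_functions_def by blast

lemma Ck_on_lincomb:
  fixes f g :: "real^'n \<Rightarrow> real"
  shows "Ck_on k f UNIV \<Longrightarrow> Ck_on k g UNIV \<Longrightarrow> Ck_on k (\<lambda>x. a * f x + b * g x) UNIV"
proof (induction k arbitrary: f g)
  case 0
  thus ?case by (auto intro!: continuous_intros)
next
  case (Suc k)
  have "((\<lambda>x. a * f x + b * g x) has_derivative (\<lambda>v. a * frechet_derivative f (at x) v + b * frechet_derivative g (at x) v)) (at x)" for x
  proof -
    have "(f has_derivative frechet_derivative f (at x)) (at x)" "(g has_derivative frechet_derivative g (at x)) (at x)"
      using Suc.prems by (auto simp: frechet_derivative_works[symmetric])
    thus ?thesis by (auto intro!: derivative_eq_intros)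
  qed
  note D = this
  have "frechet_derivative (\<lambda>x. a * f x + b * g x) (at x) = (\<lambda>v. a * frechet_derivative f (at x) v + b * frechet_derivative g (at x) v)" for x
    using frechet_derivative_at[OF D] by simp
  thus ?case using D Suc by (auto simp: differentiable_def)
qed

lemma test_functions_lincomb:
  assumes "\<phi> \<in> test_functions \<Omega>" "\<psi> \<in> test_functions \<Omega>"
  shows "(\<lambda>x. a * \<phi> x + b * \<psi> x) \<in> test_functions \<Omega>"
proof -
  let ?A = "closure {x. \<phi> x \<noteq> 0}" and ?B = "closure {x. \<psi> x \<noteq> 0}"
  have "{x. a * \<phi> x + b * \<psi> x \<noteq> 0} \<subseteq> {x. \<phi> x \<noteq> 0} \<union> {x. \<psi> x \<noteq> 0}" by auto
  also have "\<dots> \<subseteq> ?A \<union> ?B" by (intro Un_mono closure_subset)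
  finally have s: "closure {x. a * \<phi> x + b * \<psi> x \<noteq> 0} \<subseteq> ?A \<union> ?B" by (rule closure_minimal) auto
  have "compact (?A \<union> ?B)" using assms by (intro compact_Un) (auto simp: test_functions_def)
  hence "compact ((?A \<union> ?B) \<inter> closure {x. a * \<phi> x + b * \<psi> x \<noteq> 0})" by (intro compact_Int_closed) auto
  hence "compact (closure {x. a * \<phi> x + b * \<psi> x \<noteq> 0})" using s by (simp add: Int_absorb1)
  moreover have "smooth_on (\<lambda>x. a * \<phi> x + b * \<psi> x) UNIV"
    using assms unfolding smooth_on_def
    by (intro allI Ck_on_lincomb) (auto simp: test_functions_def smooth_on_def)
  moreover have "closure {x. a * \<phi> x + b * \<psi> x \<noteq> 0} \<subseteq> \<Omega>" using s assms by (auto simp: test_functions_def)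
  ultimately show ?thesis unfolding test_functions_def by blast
qed

lemma jet_lincomb:
  "f \<in> C1_on_space \<Longrightarrow> g \<in> C1_on_space \<Longrightarrow> jet (\<lambda>x. a * f x + b * g x) x = a *\<^sub>R jet f x + b *\<^sub>R jet g x"
  unfolding jet_def C1_lincomb(2) by simp

section \<open>Integrals over bounded sets controlled by powers\<close>

lemma abs_le_add_powr:
  fixes t \<delta> p :: real
  assumes "0 \<le> t" "0 < \<delta>" "1 < p"
  shows "t \<le> \<delta> + \<delta> powr (1 - p) * t powr p"
proof (cases "t \<le> \<delta>")
  case True
  thus ?thesis by (smt (verit) mult_nonneg_nonneg powr_ge_zero)
next
  case False
  \<comment> \<open>The exponent 1 - p is negative, so \<open>t powr (1 - p)\<close> is at most
    \<open>\<delta> powr (1 - p)\<close> beyond \<delta>.\<close>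
  have "t = t powr (1 - p) * t powr p" using False assms by (simp flip: powr_add)
  also have "\<dots> \<le> \<delta> powr (1 - p) * t powr p"
    using False assms by (intro mult_right_mono powr_mono2') auto
  finally show ?thesis using assms by simp
qed

lemma tendsto_0_if_eventually_le:
  fixes f :: "nat \<Rightarrow> ennreal"
  assumes "\<And>e. e > 0 \<Longrightarrow> \<forall>\<^sub>F k in sequentially. f k \<le> ennreal e"
  shows "f \<longlonglongrightarrow> 0"
proof (rule order_tendstoI)
  fix a :: ennreal assume "0 < a"
  then obtain e where e: "e > 0" "ennreal e < a"
    by (metis dense ennreal_cases ennreal_eq_0_iff less_top_ennreal linorder_not_le order_less_imp_triv)
  show "\<forall>\<^sub>F k in sequentially. f k < a"
    using assms[OF e(1)] by eventually_elim (use e(2) in auto)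
qed simp

text \<open>Plays the role of Hoelder's inequality on a ball. The threshold \<delta> is free:
  shrinking it first and the p-th power integral afterwards makes the L^1 norm small.\<close>

lemma nn_integral_norm_ball_le:
  fixes g :: "real^'n \<Rightarrow> 'b::euclidean_space"
  assumes [measurable]: "g \<in> borel_measurable lebesgue" and "0 < \<delta>" "1 < p"
  shows "(\<integral>\<^sup>+x. ennreal (indicator (cball 0 R) x * norm (g x)) \<partial>lebesgue) \<le>
     ennreal (\<delta> * measure lborel (cball (0::real^'n) R)) + ennreal (\<delta> powr (1 - p)) * Npow p lebesgue g"
proof -
  let ?A = "cball (0::real^'n) R"
  have fin: "emeasure lborel ?A = ennreal (measure lborel ?A)"
    using emeasure_lborel_cball_finite[of "0::real^'n" R] by (intro emeasure_eq_ennreal_measure) auto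
  have "(\<integral>\<^sup>+x. ennreal (indicator ?A x * norm (g x)) \<partial>lebesgue) \<le>
     (\<integral>\<^sup>+x. ennreal \<delta> * indicator ?A x + ennreal (\<delta> powr (1 - p)) * ennreal (norm (g x) powr p) \<partial>lebesgue)"
  proof (rule nn_integral_mono)
    fix x :: "real^'n"
    show "ennreal (indicator ?A x * norm (g x)) \<le>
        ennreal \<delta> * indicator ?A x + ennreal (\<delta> powr (1 - p)) * ennreal (norm (g x) powr p)"
    proof (cases "x \<in> ?A")
      case True
      have "ennreal (norm (g x)) \<le> ennreal (\<delta> + \<delta> powr (1 - p) * norm (g x) powr p)"
        by (intro ennreal_leI abs_le_add_powr) (use assms in auto)
      also have "\<dots> = ennreal \<delta> + ennreal (\<delta> powr (1 - p)) * ennreal (norm (g x) powr p)"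
        using assms by (simp add: ennreal_mult)
      finally show ?thesis using True by simp
    qed simp
  qed
  also have "\<dots> = (\<integral>\<^sup>+x. ennreal \<delta> * indicator ?A x \<partial>lebesgue) + (\<integral>\<^sup>+x. ennreal (\<delta> powr (1 - p)) * ennreal (norm (g x) powr p) \<partial>lebesgue)"
    by (intro nn_integral_add borel_measurable_times_ennreal borel_measurable_const borel_measurable_indicator) auto
  also have "(\<integral>\<^sup>+x. ennreal \<delta> * indicator ?A x \<partial>lebesgue) = ennreal (\<delta> * measure lborel ?A)"
    using fin assms by (subst nn_integral_cmult_indicator) (auto simp: ennreal_mult)
  also have "(\<integral>\<^sup>+x. ennreal (\<delta> powr (1 - p)) * ennreal (norm (g x) powr p) \<partial>lebesgue) = ennreal (\<delta> powr (1 - p)) * Npow p lebesgue g"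
    unfolding Npow_def by (subst nn_integral_cmult) auto
  finally show ?thesis .
qed

lemma nn_integral_domination:
  fixes g :: "real^'n \<Rightarrow> 'b::euclidean_space" and P :: "real^'n \<Rightarrow> 'c::euclidean_space"
  assumes "\<And>x. norm (P x) \<le> B * norm (g x)" "\<And>x. R < norm x \<Longrightarrow> P x = 0" "0 \<le> B"
    and [measurable]: "g \<in> borel_measurable lebesgue"
  shows "(\<integral>\<^sup>+x. ennreal (norm (P x)) \<partial>lebesgue) \<le> ennreal B * (\<integral>\<^sup>+x. ennreal (indicator (cball 0 R) x * norm (g x)) \<partial>lebesgue)"
proof -
  have A: "cball (0::real^'n) R \<in> sets lebesgue" by simp
  have "(\<lambda>x. norm (g x)) \<in> borel_measurable lebesgue" by measurable
  hence "(\<lambda>x. indicator (cball 0 R) x * norm (g x)) \<in> borel_measurable lebesgue"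
    by (rule borel_measurable_times[OF borel_measurable_indicator[OF A]])
  hence "(\<lambda>x. ennreal (indicator (cball 0 R) x * norm (g x))) \<in> borel_measurable lebesgue"
    by (rule measurable_compose[OF _ measurable_ennreal])
  hence "ennreal B * (\<integral>\<^sup>+x. ennreal (indicator (cball 0 R) x * norm (g x)) \<partial>lebesgue)
      = (\<integral>\<^sup>+x. ennreal B * ennreal (indicator (cball 0 R) x * norm (g x)) \<partial>lebesgue)"
    by (rule nn_integral_cmult[symmetric])
  moreover have "(\<integral>\<^sup>+x. ennreal (norm (P x)) \<partial>lebesgue) \<le> (\<integral>\<^sup>+x. ennreal B * ennreal (indicator (cball 0 R) x * norm (g x)) \<partial>lebesgue)"
  proof (rule nn_integral_mono)
    fix x :: "real^'n"
    have "norm (P x) \<le> B * (indicator (cball 0 R) x * norm (g x))"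
      using assms(1)[of x] assms(2)[of x] by (cases "x \<in> cball 0 R") auto
    hence "ennreal (norm (P x)) \<le> ennreal (B * (indicator (cball 0 R) x * norm (g x)))" by (rule ennreal_leI)
    also have "\<dots> = ennreal B * ennreal (indicator (cball 0 R) x * norm (g x))"
      using \<open>0 \<le> B\<close> by (intro ennreal_mult) auto
    finally show "ennreal (norm (P x)) \<le> ennreal B * ennreal (indicator (cball 0 R) x * norm (g x))" .
  qed
  ultimately show ?thesis by simp
qed

lemma integrable_Npow_dominated:
  fixes g :: "real^'n \<Rightarrow> 'b::euclidean_space" and P :: "real^'n \<Rightarrow> 'c::euclidean_space"
  assumes "\<And>x. norm (P x) \<le> B * norm (g x)" "\<And>x. R < norm x \<Longrightarrow> P x = 0" "0 \<le> B" "1 < p"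
    and m: "g \<in> borel_measurable lebesgue" "P \<in> borel_measurable lebesgue" and fin: "Npow p lebesgue g < \<infinity>"
  shows "integrable lebesgue P"
proof (rule integrableI_bounded[OF m(2)])
  have "(\<integral>\<^sup>+x. ennreal (indicator (cball 0 R) x * norm (g x)) \<partial>lebesgue) \<le>
      ennreal (1 * measure lborel (cball (0::real^'n) R)) + ennreal (1 powr (1 - p)) * Npow p lebesgue g"
    by (rule nn_integral_norm_ball_le[OF m(1) _ assms(4)]) simp
  also have "\<dots> < \<infinity>" using fin by (simp add: ennreal_mult_less_top)
  finally have f: "(\<integral>\<^sup>+x. ennreal (indicator (cball 0 R) x * norm (g x)) \<partial>lebesgue) < \<infinity>" .
  have "(\<integral>\<^sup>+x. ennreal (norm (P x)) \<partial>lebesgue) \<le> ennreal B * (\<integral>\<^sup>+x. ennreal (indicator (cball 0 R) x * norm (g x)) \<partial>lebesgue)"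
    by (rule nn_integral_domination[OF assms(1-3) m(1)])
  also have "\<dots> < \<infinity>" using f by (simp add: ennreal_mult_less_top)
  finally show "(\<integral>\<^sup>+x. ennreal (norm (P x)) \<partial>lebesgue) < \<infinity>" .
qed

text \<open>Used to pass to the limit in integrals against a fixed bounded function of bounded
  support when the other factor converges in L^p.\<close>

lemma tendsto_integral_Npow_dominated:
  fixes g :: "nat \<Rightarrow> real^'n \<Rightarrow> 'b::euclidean_space" and P :: "nat \<Rightarrow> real^'n \<Rightarrow> 'c::euclidean_space"
  assumes B: "\<And>k x. norm (P k x - Q x) \<le> B * norm (g k x)" "\<And>k x. R < norm x \<Longrightarrow> P k x - Q x = 0" "0 \<le> B" and p: "1 < p"
    and m: "\<And>k. g k \<in> borel_measurable lebesgue" and int: "\<And>k. integrable lebesgue (P k)" "integrable lebesgue Q"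
    and lim: "(\<lambda>k. Npow p lebesgue (g k)) \<longlonglongrightarrow> 0"
  shows "(\<lambda>k. LINT x|lebesgue. P k x) \<longlonglongrightarrow> (LINT x|lebesgue. Q x)"
proof (rule tendsto_L1_int[OF int])
  define v where "v = measure lborel (cball (0::real^'n) R)"
  have v: "v \<ge> 0" unfolding v_def by simp
  show "(\<lambda>k. \<integral>\<^sup>+x. ennreal (norm (P k x - Q x)) \<partial>lebesgue) \<longlonglongrightarrow> 0"
  proof (rule tendsto_0_if_eventually_le)
    fix e :: real assume e: "e > 0"
    \<comment> \<open>With this threshold the volume of the ball contributes at most e/2; the other
      e/2 comes from the convergence of \<open>Npow\<close> once \<delta> is fixed.\<close>
    define \<delta> where "\<delta> = e / (2 * (B * v + 1))"
    have Bv: "B * v + 1 > 0" using B(3) v by (simp add: add_nonneg_pos)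
    have \<delta>: "\<delta> > 0" unfolding \<delta>_def using e Bv by simp
    have \<delta>B: "B * (\<delta> * v) \<le> e / 2"
    proof -
      have "B * (\<delta> * v) = (B * v) * \<delta>" by simp
      also have "\<dots> \<le> (B * v + 1) * \<delta>" using \<delta> by (intro mult_right_mono) auto
      also have "\<dots> = e / 2" unfolding \<delta>_def using Bv by (simp add: field_simps)
      finally show ?thesis .
    qed
    define c where "c = B * \<delta> powr (1 - p) + 1"
    have c: "c > 0" "B * \<delta> powr (1 - p) \<le> c" unfolding c_def using B(3) by (auto intro!: add_nonneg_pos)
    have "\<forall>\<^sub>F k in sequentially. Npow p lebesgue (g k) < ennreal (e / 2 / c)"
      using e c by (intro order_tendstoD(2)[OF lim]) auto
    thus "\<forall>\<^sub>F k in sequentially. (\<integral>\<^sup>+x. ennreal (norm (P k x - Q x)) \<partial>lebesgue) \<le> ennreal e"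
    proof eventually_elim
      case (elim k)
      have "(\<integral>\<^sup>+x. ennreal (norm (P k x - Q x)) \<partial>lebesgue) \<le> ennreal B * (\<integral>\<^sup>+x. ennreal (indicator (cball 0 R) x * norm (g k x)) \<partial>lebesgue)"
        by (rule nn_integral_domination[OF B m])
      also have "\<dots> \<le> ennreal B * (ennreal (\<delta> * v) + ennreal (\<delta> powr (1 - p)) * Npow p lebesgue (g k))"
        unfolding v_def by (intro mult_left_mono nn_integral_norm_ball_le m \<delta> p) simp
      also have "\<dots> \<le> ennreal B * (ennreal (\<delta> * v) + ennreal (\<delta> powr (1 - p)) * ennreal (e / 2 / c))"
        using elim by (intro mult_left_mono add_left_mono) auto
      also have "\<dots> = ennreal (B * (\<delta> * v) + B * \<delta> powr (1 - p) * (e / 2 / c))"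
        using B(3) \<delta> v e c(1) by (simp add: ennreal_mult[symmetric] ennreal_plus[symmetric] distrib_left mult_ac del: ennreal_plus)
      also have "\<dots> \<le> ennreal (e / 2 + c * (e / 2 / c))"
        using \<delta>B c e by (intro ennreal_leI add_mono mult_right_mono) auto
      also have "e / 2 + c * (e / 2 / c) = e" using c(1) by simp
      finally show ?case .
    qed
  qed
qed

lemma Npow_add_finite:
  fixes f g :: "'a \<Rightarrow> 'b::euclidean_space"
  assumes "f \<in> borel_measurable M" "g \<in> borel_measurable M" "0 < q" "Npow q M f < \<infinity>" "Npow q M g < \<infinity>"
  shows "Npow q M (\<lambda>x. f x + g x) < \<infinity>" "Npow q M (\<lambda>x. f x - g x) < \<infinity>"
proof -
  have 1: "Npow q M (\<lambda>x. f x + g x) < \<infinity>" if "g \<in> borel_measurable M" "Npow q M g < \<infinity>" for g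
    using Npow_add_le[OF assms(1) that(1) assms(3)] assms that(2) by (auto intro: le_less_trans simp: ennreal_mult_less_top)
  show "Npow q M (\<lambda>x. f x + g x) < \<infinity>" by (rule 1[OF assms(2,5)])
  have "Npow q M (\<lambda>x. - g x) = Npow q M g" by (simp add: Npow_def)
  thus "Npow q M (\<lambda>x. f x - g x) < \<infinity>" using 1[of "\<lambda>x. - g x"] assms by simp
qed

lemma measurable_fst_comp: "z \<in> borel_measurable M \<Longrightarrow> (\<lambda>x. fst (z x)) \<in> borel_measurable M"
  and measurable_snd_comp: "z \<in> borel_measurable M \<Longrightarrow> (\<lambda>x. snd (z x)) \<in> borel_measurable M"
  for z :: "'a \<Rightarrow> 'b::euclidean_space \<times> 'c::euclidean_space"
  by (erule measurable_compose, intro borel_measurable_continuous_onI continuous_on_fst continuous_on_snd continuous_on_id)+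

lemma Npow_fst_le: "0 \<le> q \<Longrightarrow> Npow q M (\<lambda>x. fst (z x)) \<le> Npow q M z"
  and Npow_snd_le: "0 \<le> q \<Longrightarrow> Npow q M (\<lambda>x. snd (z x)) \<le> Npow q M z"
  by (intro Npow_mono; metis norm_fst_le norm_snd_le prod.collapse)+

lemma Npow_approx_finite:
  fixes z :: "real^'n \<Rightarrow> real \<times> (real^'n)"
  assumes z: "z \<in> borel_measurable lebesgue" and f: "\<And>k::nat. f k \<in> C1c" and p: "0 < p"
    and lim: "(\<lambda>k. Npow p lebesgue (\<lambda>x. z x - jet (f k) x)) \<longlonglongrightarrow> 0"
  shows "Npow p lebesgue z < \<infinity>"
proof -
  have "\<forall>\<^sub>F k in sequentially. Npow p lebesgue (\<lambda>x. z x - jet (f k) x) < 1"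
    by (rule order_tendstoD(2)[OF lim]) simp
  then obtain k where k: "Npow p lebesgue (\<lambda>x. z x - jet (f k) x) < 1" by (meson eventually_sequentially order_refl)
  have "Npow p lebesgue (\<lambda>x. (z x - jet (f k) x) + jet (f k) x) < \<infinity>"
  proof (rule Npow_add_finite(1))
    show "Npow p lebesgue (\<lambda>x. z x - jet (f k) x) < \<infinity>" using k by (rule less_trans) simp
  qed (use z C1_measurable_lebesgue[OF C1c_C1[OF f]] C1c_Npow_finite[OF f p] p in auto)
  thus ?thesis by simp
qed

lemma locally_integrable_Npow:
  fixes g :: "real^'n \<Rightarrow> 'b::euclidean_space"
  assumes [measurable]: "g \<in> borel_measurable lebesgue" and "Npow p lebesgue g < \<infinity>" "1 < p"
  shows "locally_integrable \<Omega> g"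
  unfolding locally_integrable_def
proof (intro allI impI)
  fix K assume K: "compact K \<and> K \<subseteq> \<Omega>"
  then obtain R where R: "\<And>x. x \<in> K \<Longrightarrow> norm x \<le> R" using compact_imp_bounded[of K] unfolding bounded_iff by blast
  have Km: "K \<in> sets lebesgue" using K by (auto intro: lmeasurable_compact fmeasurableD)
  have "integrable lebesgue (\<lambda>x. indicator K x *\<^sub>R g x)"
  proof (rule integrable_Npow_dominated[of _ 1 g R p])
    show "(\<lambda>x. indicator K x *\<^sub>R g x) \<in> borel_measurable lebesgue"
      using Km by (intro borel_measurable_scaleR borel_measurable_indicator) auto
    show "indicator K x *\<^sub>R g x = 0" if "R < norm x" for x using R[of x] that by (auto simp: indicator_def)
  qed (use assms in \<open>auto simp: indicator_def\<close>)
  thus "g absolutely_integrable_on K" by (simp add: set_integrable_def)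
qed

text \<open>Classical integration by parts holds for each approximant, and both sides converge
  because a test function and its gradient are bounded with bounded support.\<close>

proposition weak_gradient_limit:
  fixes z :: "real^'n \<Rightarrow> real \<times> (real^'n)"
  assumes \<Omega>: "open \<Omega>" and z: "z \<in> borel_measurable lebesgue" and f: "\<And>k::nat. f k \<in> C1c" and p: "1 < p"
    and lim: "(\<lambda>k. Npow p lebesgue (\<lambda>x. z x - jet (f k) x)) \<longlonglongrightarrow> 0"
  shows "has_weak_gradient \<Omega> (\<lambda>x. fst (z x)) (\<lambda>x. snd (z x))"
proof -
  have p0: "0 < p" using p by simp
  have fin: "Npow p lebesgue z < \<infinity>" by (rule Npow_approx_finite[OF z f p0 lim])
  note [measurable] = z C1_measurable_lebesgue[OF C1c_C1[OF f]]
  have fin2: "Npow p lebesgue (\<lambda>x. fst (z x)) < \<infinity>" "Npow p lebesgue (\<lambda>x. snd (z x)) < \<infinity>"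
    using Npow_fst_le[of p lebesgue z] Npow_snd_le[of p lebesgue z] fin p0 by (auto intro: le_less_trans)
  have "locally_integrable \<Omega> (\<lambda>x. fst (z x))" "locally_integrable \<Omega> (\<lambda>x. snd (z x))"
    by (rule locally_integrable_Npow[OF _ fin2(1) p] locally_integrable_Npow[OF _ fin2(2) p],
      intro measurable_fst_comp measurable_snd_comp z)+
  moreover have "(LINT x|lebesgue_on \<Omega>. fst (z x) *\<^sub>R grad \<psi> x) = - (LINT x|lebesgue_on \<Omega>. \<psi> x *\<^sub>R snd (z x))"
    if \<psi>: "\<psi> \<in> test_functions \<Omega>" for \<psi>
  proof -
    have \<psi>c: "\<psi> \<in> C1c" by (rule test_functions_C1c[OF \<psi>])
    note [measurable] = C1_measurable_lebesgue[OF C1c_C1[OF \<psi>c]]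
    have out: "\<psi> x = 0" "grad \<psi> x = 0" if "x \<notin> \<Omega>" for x
      using test_functions_outside[OF \<psi> that] by (auto simp: jet_def zero_prod_def)
    have \<Omega>s: "\<Omega> \<in> sets lebesgue" using \<Omega> by auto
    obtain B where B: "B > 0" "\<And>x. \<bar>\<psi> x\<bar> \<le> B" "\<And>x. norm (grad \<psi> x) \<le> B" using C1c_bounded[OF \<psi>c] by blast
    obtain R where R: "\<And>x. R < norm x \<Longrightarrow> \<psi> x = 0" "\<And>x. R < norm x \<Longrightarrow> grad \<psi> x = 0" using C1c_support[OF \<psi>c] by blast
    have nf: "norm (fst y) \<le> norm y" "norm (snd y) \<le> norm y" for y :: "real \<times> (real^'n)"
      by (metis norm_fst_le norm_snd_le prod.collapse)+
    have b1: "norm (fst y *\<^sub>R grad \<psi> x) \<le> B * norm y" "norm (\<psi> x *\<^sub>R snd y) \<le> B * norm y" for x and y :: "real \<times> (real^'n)"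
      using mult_mono[OF B(3) nf(1)[of y], of x] mult_mono[OF B(2) nf(2)[of y], of x] B(1) by (auto simp: mult.commute)
    have B0: "0 \<le> B" using B(1) by simp
    have int: "integrable lebesgue (\<lambda>x. fst (y x) *\<^sub>R grad \<psi> x)" "integrable lebesgue (\<lambda>x. \<psi> x *\<^sub>R snd (y x))"
      if y: "y \<in> borel_measurable lebesgue" "Npow p lebesgue y < \<infinity>" for y :: "real^'n \<Rightarrow> real \<times> (real^'n)"
    proof -
      note [measurable] = measurable_fst_comp[OF y(1)] measurable_snd_comp[OF y(1)]
      show "integrable lebesgue (\<lambda>x. fst (y x) *\<^sub>R grad \<psi> x)"
        by (rule integrable_Npow_dominated[OF b1(1) _ B0 p y(1) _ y(2), where R=R]) (use R in auto)
      show "integrable lebesgue (\<lambda>x. \<psi> x *\<^sub>R snd (y x))"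
        by (rule integrable_Npow_dominated[OF b1(2) _ B0 p y(1) _ y(2), where R=R]) (use R in auto)
    qed
    have jfin: "Npow p lebesgue (jet (f k)) < \<infinity>" for k by (rule C1c_Npow_finite[OF f p0])
    have lim': "(\<lambda>k. Npow p lebesgue (\<lambda>x. jet (f k) x - z x)) \<longlonglongrightarrow> 0"
      using lim by (simp add: Npow_commute[of p lebesgue z])
    have 1: "(\<lambda>k. LINT x|lebesgue. fst (jet (f k) x) *\<^sub>R grad \<psi> x) \<longlonglongrightarrow> (LINT x|lebesgue. fst (z x) *\<^sub>R grad \<psi> x)"
    proof (rule tendsto_integral_Npow_dominated[OF _ _ B0 p _ int(1)[OF _ jfin] int(1)[OF z fin] lim', where R=R])
      show "norm (fst (jet (f k) x) *\<^sub>R grad \<psi> x - fst (z x) *\<^sub>R grad \<psi> x) \<le> B * norm (jet (f k) x - z x)" for k x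
        using b1(1)[of "jet (f k) x - z x" x] by (simp add: scaleR_diff_left)
    qed (use R in auto)
    have 2: "(\<lambda>k. LINT x|lebesgue. \<psi> x *\<^sub>R snd (jet (f k) x)) \<longlonglongrightarrow> (LINT x|lebesgue. \<psi> x *\<^sub>R snd (z x))"
    proof (rule tendsto_integral_Npow_dominated[OF _ _ B0 p _ int(2)[OF _ jfin] int(2)[OF z fin] lim', where R=R])
      show "norm (\<psi> x *\<^sub>R snd (jet (f k) x) - \<psi> x *\<^sub>R snd (z x)) \<le> B * norm (jet (f k) x - z x)" for k x
        using b1(2)[of x "jet (f k) x - z x"] by (simp add: scaleR_diff_right)
    qed (use R in auto)
    have "(LINT x|lebesgue. fst (jet (f k) x) *\<^sub>R grad \<psi> x) = - (LINT x|lebesgue. \<psi> x *\<^sub>R snd (jet (f k) x))" for k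
    proof -
      note [measurable] = C1_measurable[OF C1c_C1[OF f[of k]]] C1_measurable[OF C1c_C1[OF \<psi>c]]
      show ?thesis using integration_by_parts_C1c[OF C1c_C1[OF f[of k]] \<psi>c]
        by (simp add: jet_def integral_completion)
    qed
    hence "(\<lambda>k. LINT x|lebesgue. fst (jet (f k) x) *\<^sub>R grad \<psi> x) \<longlonglongrightarrow> - (LINT x|lebesgue. \<psi> x *\<^sub>R snd (z x))"
      using tendsto_minus[OF 2] by simp
    hence "(LINT x|lebesgue. fst (z x) *\<^sub>R grad \<psi> x) = - (LINT x|lebesgue. \<psi> x *\<^sub>R snd (z x))"
      using LIMSEQ_unique[OF 1] by blast
    thus ?thesis
      using lebesgue_on_supported(1)[OF \<Omega>s, of "\<lambda>x. fst (z x) *\<^sub>R grad \<psi> x"]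
        lebesgue_on_supported(1)[OF \<Omega>s, of "\<lambda>x. \<psi> x *\<^sub>R snd (z x)"] out by simp
  qed
  ultimately show ?thesis unfolding has_weak_gradient_def by blast
qed

section \<open>Uniqueness and calculus of weak gradients\<close>

lemma AE_lebesgue_on:
  "\<Omega> \<in> sets lebesgue \<Longrightarrow> (AE x in lebesgue_on \<Omega>. P x) \<longleftrightarrow> (AE x in lebesgue. x \<in> \<Omega> \<longrightarrow> P x)"
  by (subst AE_restrict_space_iff) auto

lemma Npow_supported:
  assumes "A \<in> sets lebesgue" "\<And>x. x \<notin> A \<Longrightarrow> f x = 0"
  shows "Npow q (lebesgue_on A) f = Npow q lebesgue f"
  unfolding Npow_restrict[OF assms(1)] unfolding Npow_def
  by (intro nn_integral_cong) (use assms(2) in \<open>auto simp: indicator_def\<close>)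

lemma Npow_pair_le:
  fixes f :: "'a \<Rightarrow> 'b::euclidean_space" and g :: "'a \<Rightarrow> 'c::euclidean_space"
  assumes [measurable]: "f \<in> borel_measurable M" "g \<in> borel_measurable M" and q: "0 < q"
  shows "Npow q M (\<lambda>x. (f x, g x)) \<le> ennreal (2 powr q) * (Npow q M f + Npow q M g)"
proof -
  have m: "(\<lambda>x. (f x, 0 :: 'c)) \<in> borel_measurable M" "(\<lambda>x. (0 :: 'b, g x)) \<in> borel_measurable M"
    by measurable
  have "Npow q M (\<lambda>x. (f x, 0 :: 'c) + (0 :: 'b, g x))
      \<le> ennreal (2 powr q) * (Npow q M (\<lambda>x. (f x, 0 :: 'c)) + Npow q M (\<lambda>x. (0 :: 'b, g x)))"
    by (rule Npow_add_le[OF m q])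
  thus ?thesis by (simp add: Npow_def norm_Pair)
qed

lemma Lp_norm_powr:
  fixes f :: "real^'n \<Rightarrow> 'b::euclidean_space"
  assumes [measurable]: "f \<in> borel_measurable (lebesgue_on \<Omega>)" and "0 < q"
  shows "Lp_norm q \<Omega> f = enn2real (Npow q (lebesgue_on \<Omega>) f) powr (1 / q)"
    "Lp_norm q \<Omega> f powr q = enn2real (Npow q (lebesgue_on \<Omega>) f)"
proof -
  have "(LINT x|lebesgue_on \<Omega>. norm (f x) powr q) = enn2real (Npow q (lebesgue_on \<Omega>) f)"
    unfolding Npow_def by (intro integral_eq_nn_integral) auto
  thus 1: "Lp_norm q \<Omega> f = enn2real (Npow q (lebesgue_on \<Omega>) f) powr (1 / q)" by (simp add: Lp_norm_def)
  show "Lp_norm q \<Omega> f powr q = enn2real (Npow q (lebesgue_on \<Omega>) f)"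
    unfolding 1 using assms(2) by (simp add: powr_powr)
qed

lemma Lp_iff:
  fixes f :: "real^'n \<Rightarrow> 'b::euclidean_space"
  shows "f \<in> Lp q \<Omega> \<longleftrightarrow> f \<in> borel_measurable (lebesgue_on \<Omega>) \<and> Npow q (lebesgue_on \<Omega>) f < \<infinity>"
  unfolding Lp_def Npow_def by (auto simp: integrable_iff_bounded)

lemma locally_integrable_scaleR_bounded:
  fixes v :: "real^'n \<Rightarrow> 'b::euclidean_space" and u :: "real^'n \<Rightarrow> real"
  assumes u: "locally_integrable \<Omega> u" and K: "compact K" "K \<subseteq> \<Omega>"
    and v: "v \<in> borel_measurable lebesgue" "\<And>x. x \<notin> K \<Longrightarrow> v x = 0" "\<And>x. norm (v x) \<le> B"
  shows "integrable lebesgue (\<lambda>x. u x *\<^sub>R v x)"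
proof -
  have int: "integrable lebesgue (\<lambda>x. indicator K x *\<^sub>R u x)"
    using u K unfolding locally_integrable_def set_integrable_def by auto
  have eq: "u x *\<^sub>R v x = (indicator K x *\<^sub>R u x) *\<^sub>R v x" for x
    using v(2)[of x] by (cases "x \<in> K") auto
  have "integrable lebesgue (\<lambda>x. (indicator K x *\<^sub>R u x) *\<^sub>R v x)"
  proof (rule Bochner_Integration.integrable_bound)
    show "integrable lebesgue (\<lambda>x. B * (indicator K x *\<^sub>R u x))" using int by (rule integrable_mult_right)
    show "(\<lambda>x. (indicator K x *\<^sub>R u x) *\<^sub>R v x) \<in> borel_measurable lebesgue"
      by (rule borel_measurable_scaleR[OF borel_measurable_integrable[OF int] v(1)])
    have "\<bar>indicator K x *\<^sub>R u x\<bar> * norm (v x) \<le> \<bar>indicator K x *\<^sub>R u x\<bar> * \<bar>B\<bar>" for x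
      using v(3)[of x] by (intro mult_left_mono) auto
    thus "AE x in lebesgue. norm ((indicator K x *\<^sub>R u x) *\<^sub>R v x) \<le> norm (B * (indicator K x *\<^sub>R u x))"
      by (intro AE_I2) (simp only: norm_scaleR abs_mult real_norm_def mult.commute[of "\<bar>B\<bar>"])
  qed
  thus ?thesis using eq by presburger
qed

lemma test_function_support:
  assumes "\<psi> \<in> test_functions \<Omega>"
  obtains K B where "compact K" "K \<subseteq> \<Omega>" "\<forall>x. x \<notin> K \<longrightarrow> \<psi> x = 0 \<and> grad \<psi> x = 0"
    "\<forall>x. \<bar>\<psi> x\<bar> \<le> B \<and> norm (grad \<psi> x) \<le> B"
proof -
  have 1: "\<forall>x. x \<notin> closure {x. \<psi> x \<noteq> 0} \<longrightarrow> \<psi> x = 0 \<and> grad \<psi> x = 0"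
  proof (intro allI impI)
    fix x assume "x \<notin> closure {x. \<psi> x \<noteq> 0}"
    from test_functions_jet_eq_0[OF assms this] show "\<psi> x = 0 \<and> grad \<psi> x = 0"
      by (simp add: jet_def zero_prod_def)
  qed
  obtain B where 2: "\<forall>x. \<bar>\<psi> x\<bar> \<le> B \<and> norm (grad \<psi> x) \<le> B"
    using C1c_bounded[OF test_functions_C1c[OF assms]] by blast
  have 3: "compact (closure {x. \<psi> x \<noteq> 0})" "closure {x. \<psi> x \<noteq> 0} \<subseteq> \<Omega>"
    using assms by (simp_all add: test_functions_def)
  show thesis by (rule that[OF 3 1 2])
qed

lemma locally_integrable_diff:
  "locally_integrable \<Omega> f \<Longrightarrow> locally_integrable \<Omega> g \<Longrightarrow> locally_integrable \<Omega> (\<lambda>x. f x - g x)"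
  unfolding locally_integrable_def
proof (intro allI impI)
  fix K assume "\<forall>K. compact K \<and> K \<subseteq> \<Omega> \<longrightarrow> f absolutely_integrable_on K"
    "\<forall>K. compact K \<and> K \<subseteq> \<Omega> \<longrightarrow> g absolutely_integrable_on K" "compact K \<and> K \<subseteq> \<Omega>"
  hence "f absolutely_integrable_on K" "g absolutely_integrable_on K" by blast+
  thus "(\<lambda>x. f x - g x) absolutely_integrable_on K" by (rule set_integral_diff(1))
qed

text \<open>Bochner integrals of non-integrable functions are 0 by convention, so combining the
  defining identities linearly requires integrability, which is supplied here together with the
  passage to integrals over the whole space.\<close>

lemma weak_gradient_test:
  assumes "has_weak_gradient \<Omega> u G" "open \<Omega>" "\<psi> \<in> test_functions \<Omega>"
  shows "integrable lebesgue (\<lambda>x. u x *\<^sub>R grad \<psi> x)" "integrable lebesgue (\<lambda>x. \<psi> x *\<^sub>R G x)"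
    "(LINT x|lebesgue. u x *\<^sub>R grad \<psi> x) = - (LINT x|lebesgue. \<psi> x *\<^sub>R G x)"
proof -
  obtain K B where K: "compact K" "K \<subseteq> \<Omega>" and out: "\<forall>x. x \<notin> K \<longrightarrow> \<psi> x = 0 \<and> grad \<psi> x = 0"
    and B: "\<forall>x. \<bar>\<psi> x\<bar> \<le> B \<and> norm (grad \<psi> x) \<le> B" by (rule test_function_support[OF assms(3)])
  note m = C1_measurable_lebesgue[OF C1c_C1[OF test_functions_C1c[OF assms(3)]]]
  have l: "locally_integrable \<Omega> u" "locally_integrable \<Omega> G" using assms(1) by (auto simp: has_weak_gradient_def)
  show "integrable lebesgue (\<lambda>x. u x *\<^sub>R grad \<psi> x)"
    by (rule locally_integrable_scaleR_bounded[OF l(1) K m(2)]) (use out B in blast)+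
  show "integrable lebesgue (\<lambda>x. \<psi> x *\<^sub>R G x)"
    by (rule bounded_times_locally_integrable[OF l(2) K m(1)]) (use out B in blast)+
  have \<Omega>: "\<Omega> \<in> sets lebesgue" using assms(2) by auto
  have o: "\<psi> x = 0" "grad \<psi> x = 0" if "x \<notin> \<Omega>" for x
    using test_functions_outside[OF assms(3) that] by (simp_all add: jet_def zero_prod_def)
  have "(LINT x|lebesgue_on \<Omega>. u x *\<^sub>R grad \<psi> x) = (LINT x|lebesgue. u x *\<^sub>R grad \<psi> x)"
    "(LINT x|lebesgue_on \<Omega>. \<psi> x *\<^sub>R G x) = (LINT x|lebesgue. \<psi> x *\<^sub>R G x)"
    by (rule lebesgue_on_supported(1)[OF \<Omega>], use o in simp)+
  thus "(LINT x|lebesgue. u x *\<^sub>R grad \<psi> x) = - (LINT x|lebesgue. \<psi> x *\<^sub>R G x)"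
    using assms(1,3) unfolding has_weak_gradient_def by simp
qed

lemma weak_gradient_unique:
  assumes "open \<Omega>" "has_weak_gradient \<Omega> u G" "has_weak_gradient \<Omega> u G'"
  shows "AE x in lebesgue. x \<in> \<Omega> \<longrightarrow> G x = G' x"
proof -
  have "AE x in lebesgue. x \<in> \<Omega> \<longrightarrow> G x - G' x = 0"
  proof (rule fundamental_lemma_calculus_of_variations[OF assms(1)])
    show "locally_integrable \<Omega> (\<lambda>x. G x - G' x)"
      using assms(2,3) by (auto simp: has_weak_gradient_def intro: locally_integrable_diff)
    show "(LINT x|lebesgue. \<psi> x *\<^sub>R (G x - G' x)) = 0" if \<psi>: "\<psi> \<in> test_functions \<Omega>" for \<psi>
      using weak_gradient_test[OF assms(2,1) \<psi>] weak_gradient_test[OF assms(3,1) \<psi>]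
      by (simp add: scaleR_diff_right)
  qed
  thus ?thesis by eventually_elim auto
qed

lemma weak_gradient_diff:
  assumes "open \<Omega>" "has_weak_gradient \<Omega> u G" "has_weak_gradient \<Omega> v H"
  shows "has_weak_gradient \<Omega> (\<lambda>x. u x - v x) (\<lambda>x. G x - H x)"
  unfolding has_weak_gradient_def
proof (intro conjI ballI)
  show "locally_integrable \<Omega> (\<lambda>x. u x - v x)" "locally_integrable \<Omega> (\<lambda>x. G x - H x)"
    using assms(2,3) by (auto simp: has_weak_gradient_def intro: locally_integrable_diff)
  fix \<psi> assume \<psi>: "\<psi> \<in> test_functions \<Omega>"
  have \<Omega>: "\<Omega> \<in> sets lebesgue" using assms(1) by auto
  have out: "\<psi> x = 0" "grad \<psi> x = 0" if "x \<notin> \<Omega>" for x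
    using test_functions_outside[OF \<psi> that] by (auto simp: jet_def zero_prod_def)
  have "(LINT x|lebesgue. (u x - v x) *\<^sub>R grad \<psi> x) = - (LINT x|lebesgue. \<psi> x *\<^sub>R (G x - H x))"
    using weak_gradient_test[OF assms(2,1) \<psi>] weak_gradient_test[OF assms(3,1) \<psi>]
    by (simp add: scaleR_diff_right scaleR_diff_left)
  thus "(LINT x|lebesgue_on \<Omega>. (u x - v x) *\<^sub>R grad \<psi> x) = - (LINT x|lebesgue_on \<Omega>. \<psi> x *\<^sub>R (G x - H x))"
    using lebesgue_on_supported(1)[OF \<Omega>, of "\<lambda>x. (u x - v x) *\<^sub>R grad \<psi> x"]
      lebesgue_on_supported(1)[OF \<Omega>, of "\<lambda>x. \<psi> x *\<^sub>R (G x - H x)"] out by simp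
qed

lemma weak_gradient_C1c:
  assumes "open \<Omega>" "f \<in> C1c"
  shows "has_weak_gradient \<Omega> f (grad f)"
proof -
  have "has_weak_gradient \<Omega> (\<lambda>x. fst (jet f x)) (\<lambda>x. snd (jet f x))"
    by (rule weak_gradient_limit[OF assms(1), of "jet f" "\<lambda>k. f" 2])
      (use assms C1_measurable_lebesgue[OF C1c_C1] in \<open>auto simp: Npow_def\<close>)
  thus ?thesis by (simp add: jet_def)
qed

text \<open>Makes the arbitrary choice in \<open>weak_grad\<close> harmless: any weak gradient at
  hand may stand in for it.\<close>

lemma weak_grad_AE:
  assumes "open \<Omega>" "has_weak_gradient \<Omega> u G"
  shows "AE x in lebesgue. x \<in> \<Omega> \<longrightarrow> weak_grad \<Omega> u x = G x"
proof -
  have "has_weak_gradient \<Omega> u (weak_grad \<Omega> u)" unfolding weak_grad_def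
    using assms(2) by (rule someI[where P = "has_weak_gradient \<Omega> u"])
  thus ?thesis by (rule weak_gradient_unique[OF assms(1) _ assms(2)])
qed

text \<open>An arbitrarily chosen gradient inherits measurability from \<open>G\<close> by almost
  everywhere equality, as Lebesgue measure is complete.\<close>

lemma weak_grad_measurable:
  fixes G :: "real^'n \<Rightarrow> real^'n"
  assumes \<Omega>: "open \<Omega>" and u: "has_weak_gradient \<Omega> u G" and G: "G \<in> borel_measurable (lebesgue_on \<Omega>)"
  shows "weak_grad \<Omega> u \<in> borel_measurable (lebesgue_on \<Omega>)"
proof -
  have s: "\<Omega> \<inter> space lebesgue \<in> sets lebesgue" using \<Omega> by auto
  have "(\<lambda>x. indicator \<Omega> x *\<^sub>R G x) \<in> borel_measurable lebesgue"
    using G borel_measurable_restrict_space_iff[OF s] by blast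
  moreover have "AE x in lebesgue. indicator \<Omega> x *\<^sub>R G x = indicator \<Omega> x *\<^sub>R weak_grad \<Omega> u x"
    using weak_grad_AE[OF \<Omega> u] by eventually_elim (auto simp: indicator_def)
  ultimately have "(\<lambda>x. indicator \<Omega> x *\<^sub>R weak_grad \<Omega> u x) \<in> borel_measurable lebesgue"
    by (rule borel_measurable_AE)
  thus ?thesis using borel_measurable_restrict_space_iff[OF s] by blast
qed

lemma powr_sum_tendsto_0_iff:
  fixes x y :: "nat \<Rightarrow> real"
  assumes "\<And>k. 0 \<le> x k" "\<And>k. 0 \<le> y k" "0 < p" "0 < m"
  shows "(\<lambda>k. x k powr (1 / p) + y k powr (1 / m)) \<longlonglongrightarrow> 0 \<longleftrightarrow> x \<longlonglongrightarrow> 0 \<and> y \<longlonglongrightarrow> 0"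
proof
  assume l: "(\<lambda>k. x k powr (1 / p) + y k powr (1 / m)) \<longlonglongrightarrow> 0"
  have *: "w \<longlonglongrightarrow> 0" if w: "\<And>k. 0 \<le> w k" "\<And>k. w k powr (1 / q) \<le> x k powr (1 / p) + y k powr (1 / m)" "0 < q"
    for w :: "nat \<Rightarrow> real" and q
  proof -
    have "(\<lambda>k. w k powr (1 / q)) \<longlonglongrightarrow> 0"
      by (rule tendsto_sandwich[OF _ _ tendsto_const l]) (use w(2) in auto)
    hence "(\<lambda>k. (w k powr (1 / q)) powr q) \<longlonglongrightarrow> 0 powr q"
      by (rule tendsto_powr2[OF _ tendsto_const]) (use w(3) in auto)
    thus ?thesis using w(1,3) by (simp add: powr_powr)
  qed
  show "x \<longlonglongrightarrow> 0 \<and> y \<longlonglongrightarrow> 0"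
    using *[of x p] *[of y m] assms by auto
next
  assume l: "x \<longlonglongrightarrow> 0 \<and> y \<longlonglongrightarrow> 0"
  have "(\<lambda>k. x k powr (1 / p) + y k powr (1 / m)) \<longlonglongrightarrow> 0 powr (1 / p) + 0 powr (1 / m)"
    by (intro tendsto_add tendsto_powr2 tendsto_const) (use l assms in auto)
  thus "(\<lambda>k. x k powr (1 / p) + y k powr (1 / m)) \<longlonglongrightarrow> 0" by simp
qed

lemma enn2real_tendsto_0_iff:
  assumes "\<And>k::nat. a k < \<infinity>"
  shows "(\<lambda>k. enn2real (a k)) \<longlonglongrightarrow> 0 \<longleftrightarrow> a \<longlonglongrightarrow> 0"
proof -
  have "a = (\<lambda>k. ennreal (enn2real (a k)))" using assms by auto
  hence "a \<longlonglongrightarrow> 0 \<longleftrightarrow> (\<lambda>k. ennreal (enn2real (a k))) \<longlonglongrightarrow> ennreal 0" by simp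
  also have "\<dots> \<longleftrightarrow> (\<lambda>k. enn2real (a k)) \<longlonglongrightarrow> 0" by (rule tendsto_ennreal_iff) auto
  finally show ?thesis by blast
qed

lemma add_tendsto_0_iff_ennreal:
  fixes a b :: "nat \<Rightarrow> ennreal"
  shows "(\<lambda>k. a k + b k) \<longlonglongrightarrow> 0 \<longleftrightarrow> a \<longlonglongrightarrow> 0 \<and> b \<longlonglongrightarrow> 0"
proof
  assume l: "(\<lambda>k. a k + b k) \<longlonglongrightarrow> 0"
  have "a \<longlonglongrightarrow> 0" by (rule tendsto_sandwich[OF _ _ tendsto_const l]) auto
  moreover have "b \<longlonglongrightarrow> 0" by (rule tendsto_sandwich[OF _ _ tendsto_const l]) auto
  ultimately show "a \<longlonglongrightarrow> 0 \<and> b \<longlonglongrightarrow> 0" by blast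
next
  assume "a \<longlonglongrightarrow> 0 \<and> b \<longlonglongrightarrow> 0"
  thus "(\<lambda>k. a k + b k) \<longlonglongrightarrow> 0" using tendsto_add[of a 0 sequentially b 0] by simp
qed

text \<open>Translates convergence in the norm of the completion, built from real-valued integrals,
  into convergence of \<open>Npow\<close>. The finiteness hypotheses matter because
  \<open>enn2real\<close> sends \<infinity> to 0.\<close>

lemma W1p_D1m_norm_tendsto_0_iff:
  fixes v :: "nat \<Rightarrow> real^'n \<Rightarrow> real" and G :: "nat \<Rightarrow> real^'n \<Rightarrow> real^'n"
  assumes \<Omega>: "open \<Omega>" and v: "\<And>k. has_weak_gradient \<Omega> (v k) (G k)" and p: "1 < p" "1 < m"
    and meas: "\<And>k. v k \<in> borel_measurable (lebesgue_on \<Omega>)" "\<And>k. G k \<in> borel_measurable (lebesgue_on \<Omega>)"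
    and fin: "\<And>k. Npow p (lebesgue_on \<Omega>) (v k) < \<infinity>" "\<And>k. Npow p (lebesgue_on \<Omega>) (G k) < \<infinity>"
      "\<And>k. Npow m (lebesgue_on \<Omega>) (G k) < \<infinity>"
  shows "(\<lambda>k. W1p_D1m_norm p m \<Omega> (v k)) \<longlonglongrightarrow> 0 \<longleftrightarrow>
    (\<lambda>k. Npow p (lebesgue_on \<Omega>) (v k)) \<longlonglongrightarrow> 0 \<and> (\<lambda>k. Npow p (lebesgue_on \<Omega>) (G k)) \<longlonglongrightarrow> 0 \<and>
    (\<lambda>k. Npow m (lebesgue_on \<Omega>) (G k)) \<longlonglongrightarrow> 0"
proof -
  have \<Omega>s: "\<Omega> \<in> sets lebesgue" using \<Omega> by auto
  define W where "W = (\<lambda>k. weak_grad \<Omega> (v k))"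
  have Wm: "W k \<in> borel_measurable (lebesgue_on \<Omega>)" for k
    unfolding W_def by (rule weak_grad_measurable[OF \<Omega> v meas(2)])
  have AE: "AE x in lebesgue_on \<Omega>. W k x = G k x" for k
    unfolding AE_lebesgue_on[OF \<Omega>s] W_def by (rule weak_grad_AE[OF \<Omega> v])
  have WG: "Npow q (lebesgue_on \<Omega>) (W k) = Npow q (lebesgue_on \<Omega>) (G k)" for q k
    by (rule Npow_cong_AE[OF AE])
  have p0: "0 < p" "0 < m" using p by auto
  have "W1p_D1m_norm p m \<Omega> (v k) = (enn2real (Npow p (lebesgue_on \<Omega>) (v k)) + enn2real (Npow p (lebesgue_on \<Omega>) (G k))) powr (1 / p)
      + enn2real (Npow m (lebesgue_on \<Omega>) (G k)) powr (1 / m)" for k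
    unfolding W1p_D1m_norm_def W1p_norm_def W_def[symmetric] fun_cong[OF W_def, symmetric]
      Lp_norm_powr(2)[OF meas(1) p0(1)] Lp_norm_powr(2)[OF Wm p0(1)] Lp_norm_powr(1)[OF Wm p0(2)] WG ..
  moreover have "enn2real (Npow p (lebesgue_on \<Omega>) (v k)) + enn2real (Npow p (lebesgue_on \<Omega>) (G k))
      = enn2real (Npow p (lebesgue_on \<Omega>) (v k) + Npow p (lebesgue_on \<Omega>) (G k))" for k
    using fin[of k] by (simp add: enn2real_plus)
  ultimately have "W1p_D1m_norm p m \<Omega> (v k) = enn2real (Npow p (lebesgue_on \<Omega>) (v k) + Npow p (lebesgue_on \<Omega>) (G k)) powr (1 / p)
      + enn2real (Npow m (lebesgue_on \<Omega>) (G k)) powr (1 / m)" for k by simp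
  hence "(\<lambda>k. W1p_D1m_norm p m \<Omega> (v k)) \<longlonglongrightarrow> 0 \<longleftrightarrow>
     (\<lambda>k. enn2real (Npow p (lebesgue_on \<Omega>) (v k) + Npow p (lebesgue_on \<Omega>) (G k))) \<longlonglongrightarrow> 0 \<and>
     (\<lambda>k. enn2real (Npow m (lebesgue_on \<Omega>) (G k))) \<longlonglongrightarrow> 0"
    by (simp only: powr_sum_tendsto_0_iff[OF enn2real_nonneg enn2real_nonneg p0])
  also have "(\<lambda>k. enn2real (Npow p (lebesgue_on \<Omega>) (v k) + Npow p (lebesgue_on \<Omega>) (G k))) \<longlonglongrightarrow> 0 \<longleftrightarrow>
      (\<lambda>k. Npow p (lebesgue_on \<Omega>) (v k) + Npow p (lebesgue_on \<Omega>) (G k)) \<longlonglongrightarrow> 0"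
    by (rule enn2real_tendsto_0_iff) (use fin in simp)
  also have "(\<lambda>k. enn2real (Npow m (lebesgue_on \<Omega>) (G k))) \<longlonglongrightarrow> 0 \<longleftrightarrow> (\<lambda>k. Npow m (lebesgue_on \<Omega>) (G k)) \<longlonglongrightarrow> 0"
    by (rule enn2real_tendsto_0_iff) (rule fin(3))
  finally show ?thesis by (simp add: add_tendsto_0_iff_ennreal)
qed

section \<open>The completion of the test functions\<close>

text \<open>Members of \<open>W\<^sub>0\<^sup>1\<^sup>,\<^sup>p(\<Omega>) \<inter> D\<^sub>0\<^sup>1\<^sup>,\<^sup>m(\<Omega>)\<close> with their gradients, extended by zero to the whole space.\<close>

definition wpair :: "real \<Rightarrow> real \<Rightarrow> (real^'n) set \<Rightarrow> (real^'n \<Rightarrow> real \<times> (real^'n)) \<Rightarrow> bool" where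
  "wpair p m \<Omega> z \<longleftrightarrow> z \<in> borel_measurable lebesgue \<and> (\<forall>x. x \<notin> \<Omega> \<longrightarrow> z x = 0) \<and>
     (\<exists>\<phi>. (\<forall>k::nat. \<phi> k \<in> test_functions \<Omega>) \<and> (\<lambda>k. Npow p lebesgue (\<lambda>x. z x - jet (\<phi> k) x)) \<longlonglongrightarrow> 0 \<and>
       (\<lambda>k. Npow m lebesgue (\<lambda>x. snd (z x) - grad (\<phi> k) x)) \<longlonglongrightarrow> 0)"

lemma wpair_weak_gradient:
  assumes "open \<Omega>" "1 < p" "wpair p m \<Omega> z"
  shows "has_weak_gradient \<Omega> (\<lambda>x. fst (z x)) (\<lambda>x. snd (z x))" "Npow p lebesgue z < \<infinity>"
proof -
  obtain \<phi> where z: "z \<in> borel_measurable lebesgue" and \<phi>: "\<And>k::nat. \<phi> k \<in> test_functions \<Omega>"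
    and l: "(\<lambda>k. Npow p lebesgue (\<lambda>x. z x - jet (\<phi> k) x)) \<longlonglongrightarrow> 0"
    using assms(3) unfolding wpair_def by blast
  show "has_weak_gradient \<Omega> (\<lambda>x. fst (z x)) (\<lambda>x. snd (z x))"
    by (rule weak_gradient_limit[OF assms(1) z test_functions_C1c[OF \<phi>] assms(2) l])
  show "Npow p lebesgue z < \<infinity>"
    by (rule Npow_approx_finite[OF z test_functions_C1c[OF \<phi>] _ l]) (use assms(2) in simp)
qed

text \<open>This and its converse let the variational argument run on explicit pairs, with plain L^p
  and L^m convergence, in place of \<open>weak_grad\<close>.\<close>

lemma W1p_D1m_0_imp_wpair:
  fixes u :: "real^'n \<Rightarrow> real"
  assumes \<Omega>: "open \<Omega>" and p: "1 < p" "1 < m" and u: "u \<in> W1p_D1m_0 p m \<Omega>"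
  shows "wpair p m \<Omega> (\<lambda>x. indicator \<Omega> x *\<^sub>R (u x, weak_grad \<Omega> u x))"
proof -
  let ?M = "lebesgue_on \<Omega>" and ?W = "weak_grad \<Omega> u"
  have p0: "0 < p" "0 < m" using p by auto
  have \<Omega>s: "\<Omega> \<in> sets lebesgue" using \<Omega> by auto
  hence s: "\<Omega> \<inter> space lebesgue \<in> sets lebesgue" by auto
  obtain G where "has_weak_gradient \<Omega> u G" using u by (auto simp: W1p_D1m_0_def W1p_def)
  hence hw: "has_weak_gradient \<Omega> u ?W" unfolding weak_grad_def
    by (rule someI[where P = "has_weak_gradient \<Omega> u"])
  have um: "u \<in> borel_measurable ?M" "?W \<in> borel_measurable ?M"
    and fin: "Npow p ?M u < \<infinity>" "Npow p ?M ?W < \<infinity>" "Npow m ?M ?W < \<infinity>"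
    using u by (auto simp: W1p_D1m_0_def W1p_def Lp_iff)
  obtain \<phi> where \<phi>: "\<And>k::nat. \<phi> k \<in> test_functions \<Omega>"
    and l: "(\<lambda>k. W1p_D1m_norm p m \<Omega> (\<lambda>x. u x - \<phi> k x)) \<longlonglongrightarrow> 0"
    using u unfolding W1p_D1m_0_def by blast
  note \<phi>c = test_functions_C1c[OF \<phi>]
  have \<phi>m: "\<phi> k \<in> borel_measurable ?M" "grad (\<phi> k) \<in> borel_measurable ?M" for k
    using C1_measurable_lebesgue[OF C1c_C1[OF \<phi>c[of k]]] by (auto intro: measurable_restrict_space1)
  have \<phi>fin: "Npow q ?M (\<phi> k) < \<infinity>" "Npow q ?M (grad (\<phi> k)) < \<infinity>" if "0 < q" for q k
    using C1c_Npow_finite[OF \<phi>c that, of k] Npow_restrict_le[OF \<Omega>s, of q "\<phi> k"] Npow_restrict_le[OF \<Omega>s, of q "grad (\<phi> k)"]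
    by (auto intro: le_less_trans)
  have hd: "has_weak_gradient \<Omega> (\<lambda>x. u x - \<phi> k x) (\<lambda>x. ?W x - grad (\<phi> k) x)" for k
    by (rule weak_gradient_diff[OF \<Omega> hw weak_gradient_C1c[OF \<Omega> \<phi>c]])
  have "(\<lambda>k. Npow p ?M (\<lambda>x. u x - \<phi> k x)) \<longlonglongrightarrow> 0 \<and> (\<lambda>k. Npow p ?M (\<lambda>x. ?W x - grad (\<phi> k) x)) \<longlonglongrightarrow> 0
     \<and> (\<lambda>k. Npow m ?M (\<lambda>x. ?W x - grad (\<phi> k) x)) \<longlonglongrightarrow> 0"
  proof (rule iffD1[OF W1p_D1m_norm_tendsto_0_iff[OF \<Omega> hd p] l])
    fix k
    show "(\<lambda>x. u x - \<phi> k x) \<in> borel_measurable ?M" using um(1) \<phi>m(1) by (rule borel_measurable_diff)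
    show "(\<lambda>x. ?W x - grad (\<phi> k) x) \<in> borel_measurable ?M" using um(2) \<phi>m(2) by (rule borel_measurable_diff)
    show "Npow p ?M (\<lambda>x. u x - \<phi> k x) < \<infinity>" by (rule Npow_add_finite(2)[OF um(1) \<phi>m(1) p0(1) fin(1) \<phi>fin(1)[OF p0(1)]])
    show "Npow p ?M (\<lambda>x. ?W x - grad (\<phi> k) x) < \<infinity>" by (rule Npow_add_finite(2)[OF um(2) \<phi>m(2) p0(1) fin(2) \<phi>fin(2)[OF p0(1)]])
    show "Npow m ?M (\<lambda>x. ?W x - grad (\<phi> k) x) < \<infinity>" by (rule Npow_add_finite(2)[OF um(2) \<phi>m(2) p0(2) fin(3) \<phi>fin(2)[OF p0(2)]])
  qed
  hence l1: "(\<lambda>k. Npow p ?M (\<lambda>x. u x - \<phi> k x)) \<longlonglongrightarrow> 0" and l2: "(\<lambda>k. Npow p ?M (\<lambda>x. ?W x - grad (\<phi> k) x)) \<longlonglongrightarrow> 0"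
    and l3: "(\<lambda>k. Npow m ?M (\<lambda>x. ?W x - grad (\<phi> k) x)) \<longlonglongrightarrow> 0" by auto
  define z where "z = (\<lambda>x. indicator \<Omega> x *\<^sub>R (u x, ?W x))"
  have z0: "z x = 0" if "x \<notin> \<Omega>" for x using that by (simp add: z_def zero_prod_def)
  have zm: "z \<in> borel_measurable lebesgue"
    unfolding z_def by (rule iffD1[OF borel_measurable_restrict_space_iff[OF s] borel_measurable_Pair[OF um]])
  have j0: "jet (\<phi> k) x = 0" if "x \<notin> \<Omega>" for k x by (rule test_functions_outside[OF \<phi> that])
  have bnd: "Npow p lebesgue (\<lambda>x. z x - jet (\<phi> k) x) \<le> ennreal (2 powr p) * (Npow p ?M (\<lambda>x. u x - \<phi> k x) + Npow p ?M (\<lambda>x. ?W x - grad (\<phi> k) x))" for k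
  proof -
    have "Npow p lebesgue (\<lambda>x. z x - jet (\<phi> k) x) = Npow p ?M (\<lambda>x. z x - jet (\<phi> k) x)"
      by (rule Npow_supported[OF \<Omega>s, symmetric]) (simp add: z0 j0)
    also have "\<dots> = Npow p ?M (\<lambda>x. (u x - \<phi> k x, ?W x - grad (\<phi> k) x))"
      by (rule Npow_cong) (simp add: z_def jet_def)
    also have "\<dots> \<le> ennreal (2 powr p) * (Npow p ?M (\<lambda>x. u x - \<phi> k x) + Npow p ?M (\<lambda>x. ?W x - grad (\<phi> k) x))"
      by (rule Npow_pair_le[OF borel_measurable_diff[OF um(1) \<phi>m(1)] borel_measurable_diff[OF um(2) \<phi>m(2)] p0(1)])
    finally show ?thesis .
  qed
  have lim: "(\<lambda>k. ennreal (2 powr p) * (Npow p ?M (\<lambda>x. u x - \<phi> k x) + Npow p ?M (\<lambda>x. ?W x - grad (\<phi> k) x))) \<longlonglongrightarrow> 0"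
    using ennreal_tendsto_cmult[OF _ iffD2[OF add_tendsto_0_iff_ennreal conjI[OF l1 l2]], of "ennreal (2 powr p)"] by simp
  have L1: "(\<lambda>k. Npow p lebesgue (\<lambda>x. z x - jet (\<phi> k) x)) \<longlonglongrightarrow> 0"
    by (rule tendsto_sandwich[OF _ _ tendsto_const lim]) (use bnd in \<open>simp_all add: always_eventually\<close>)
  have "Npow m lebesgue (\<lambda>x. snd (z x) - grad (\<phi> k) x) = Npow m ?M (\<lambda>x. ?W x - grad (\<phi> k) x)" for k
  proof -
    have g0: "grad (\<phi> k) x = 0" if "x \<notin> \<Omega>" for x using j0[OF that, of k] by (simp add: jet_def zero_prod_def)
    have "Npow m lebesgue (\<lambda>x. snd (z x) - grad (\<phi> k) x) = Npow m ?M (\<lambda>x. snd (z x) - grad (\<phi> k) x)"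
      by (rule Npow_supported[OF \<Omega>s, symmetric]) (simp add: z0 g0)
    also have "\<dots> = Npow m ?M (\<lambda>x. ?W x - grad (\<phi> k) x)"
      by (rule Npow_cong) (simp add: z_def)
    finally show ?thesis .
  qed
  hence L2: "(\<lambda>k. Npow m lebesgue (\<lambda>x. snd (z x) - grad (\<phi> k) x)) \<longlonglongrightarrow> 0" using l3 by simp
  have "wpair p m \<Omega> z" unfolding wpair_def using zm z0 \<phi> L1 L2 by blast
  thus ?thesis by (simp add: z_def)
qed

lemma wpair_imp_W1p_D1m_0:
  fixes z :: "real^'n \<Rightarrow> real \<times> (real^'n)"
  assumes \<Omega>: "open \<Omega>" and p: "1 < p" "1 < m" and w: "wpair p m \<Omega> z"
  shows "(\<lambda>x. fst (z x)) \<in> W1p_D1m_0 p m \<Omega>"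
proof -
  let ?M = "lebesgue_on \<Omega>" and ?u = "\<lambda>x. fst (z x)" and ?G = "\<lambda>x. snd (z x)"
  have p0: "0 < p" "0 < m" using p by auto
  have \<Omega>s: "\<Omega> \<in> sets lebesgue" using \<Omega> by auto
  obtain \<phi> where z: "z \<in> borel_measurable lebesgue" and \<phi>: "\<And>k::nat. \<phi> k \<in> test_functions \<Omega>"
    and l1: "(\<lambda>k. Npow p lebesgue (\<lambda>x. z x - jet (\<phi> k) x)) \<longlonglongrightarrow> 0"
    and l2: "(\<lambda>k. Npow m lebesgue (\<lambda>x. snd (z x) - grad (\<phi> k) x)) \<longlonglongrightarrow> 0"
    using w unfolding wpair_def by blast
  note \<phi>c = test_functions_C1c[OF \<phi>]
  note \<phi>L = C1_measurable_lebesgue[OF C1c_C1[OF \<phi>c]]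
  note hw = wpair_weak_gradient(1)[OF \<Omega> p(1) w] and zfin = wpair_weak_gradient(2)[OF \<Omega> p(1) w]
  note zL = measurable_fst_comp[OF z] measurable_snd_comp[OF z]
  have um: "?u \<in> borel_measurable ?M" "?G \<in> borel_measurable ?M" using zL by (auto intro: measurable_restrict_space1)
  have \<phi>m: "\<phi> k \<in> borel_measurable ?M" "grad (\<phi> k) \<in> borel_measurable ?M" for k
    using \<phi>L[of k] by (auto intro: measurable_restrict_space1)
  have \<phi>fin: "Npow q ?M (\<phi> k) < \<infinity>" "Npow q ?M (grad (\<phi> k)) < \<infinity>" if "0 < q" for q k
    using C1c_Npow_finite[OF \<phi>c that, of k] Npow_restrict_le[OF \<Omega>s, of q "\<phi> k"] Npow_restrict_le[OF \<Omega>s, of q "grad (\<phi> k)"]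
    by (auto intro: le_less_trans)
  have finu: "Npow p ?M ?u < \<infinity>"
    using Npow_restrict_le[OF \<Omega>s, of p ?u] Npow_fst_le[of p lebesgue z] zfin p0 by (meson le_less_trans less_imp_le)
  have finG: "Npow p ?M ?G < \<infinity>"
    using Npow_restrict_le[OF \<Omega>s, of p ?G] Npow_snd_le[of p lebesgue z] zfin p0 by (meson le_less_trans less_imp_le)
  \<comment> \<open>A \<open>wpair\<close> only asserts that the gradient differences tend to 0 in
    L^m. One approximant at finite distance shows that the gradient itself is in L^m.\<close>
  have "\<forall>\<^sub>F k in sequentially. Npow m lebesgue (\<lambda>x. snd (z x) - grad (\<phi> k) x) < 1"
    by (rule order_tendstoD(2)[OF l2]) simp
  then obtain k0 where k0: "Npow m lebesgue (\<lambda>x. snd (z x) - grad (\<phi> k0) x) < 1" by (meson eventually_sequentially order_refl)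
  have "Npow m ?M (\<lambda>x. (snd (z x) - grad (\<phi> k0) x) + grad (\<phi> k0) x) < \<infinity>"
  proof (rule Npow_add_finite(1)[OF borel_measurable_diff[OF um(2) \<phi>m(2)] \<phi>m(2) p0(2) _ \<phi>fin(2)[OF p0(2)]])
    show "Npow m ?M (\<lambda>x. snd (z x) - grad (\<phi> k0) x) < \<infinity>"
      by (rule le_less_trans[OF Npow_restrict_le[OF \<Omega>s]], rule less_trans[OF k0]) simp
  qed
  hence finGm: "Npow m ?M ?G < \<infinity>" by simp
  have AE: "AE x in ?M. weak_grad \<Omega> ?u x = ?G x"
    unfolding AE_lebesgue_on[OF \<Omega>s] by (rule weak_grad_AE[OF \<Omega> hw])
  have Wm: "weak_grad \<Omega> ?u \<in> borel_measurable ?M" by (rule weak_grad_measurable[OF \<Omega> hw um(2)])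
  have WG: "Npow q ?M (weak_grad \<Omega> ?u) = Npow q ?M ?G" for q by (rule Npow_cong_AE[OF AE])
  have hd: "has_weak_gradient \<Omega> (\<lambda>x. ?u x - \<phi> k x) (\<lambda>x. ?G x - grad (\<phi> k) x)" for k
    by (rule weak_gradient_diff[OF \<Omega> hw weak_gradient_C1c[OF \<Omega> \<phi>c]])
  have L: "(\<lambda>k. W1p_D1m_norm p m \<Omega> (\<lambda>x. ?u x - \<phi> k x)) \<longlonglongrightarrow> 0"
  proof (rule iffD2[OF W1p_D1m_norm_tendsto_0_iff[OF \<Omega> hd p]])
    fix k
    show "(\<lambda>x. ?u x - \<phi> k x) \<in> borel_measurable ?M" using um(1) \<phi>m(1) by (rule borel_measurable_diff)
    show "(\<lambda>x. ?G x - grad (\<phi> k) x) \<in> borel_measurable ?M" using um(2) \<phi>m(2) by (rule borel_measurable_diff)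
    show "Npow p ?M (\<lambda>x. ?u x - \<phi> k x) < \<infinity>" by (rule Npow_add_finite(2)[OF um(1) \<phi>m(1) p0(1) finu \<phi>fin(1)[OF p0(1)]])
    show "Npow p ?M (\<lambda>x. ?G x - grad (\<phi> k) x) < \<infinity>" by (rule Npow_add_finite(2)[OF um(2) \<phi>m(2) p0(1) finG \<phi>fin(2)[OF p0(1)]])
    show "Npow m ?M (\<lambda>x. ?G x - grad (\<phi> k) x) < \<infinity>" by (rule Npow_add_finite(2)[OF um(2) \<phi>m(2) p0(2) finGm \<phi>fin(2)[OF p0(2)]])
  next
    have a: "Npow p ?M (\<lambda>x. ?u x - \<phi> k x) \<le> Npow p lebesgue (\<lambda>x. z x - jet (\<phi> k) x)" for k
      by (rule order_trans[OF Npow_restrict_le[OF \<Omega>s]])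
        (use Npow_fst_le[of p lebesgue "\<lambda>x. z x - jet (\<phi> k) x"] p0 in \<open>simp add: jet_def\<close>)
    have b: "Npow p ?M (\<lambda>x. ?G x - grad (\<phi> k) x) \<le> Npow p lebesgue (\<lambda>x. z x - jet (\<phi> k) x)" for k
      by (rule order_trans[OF Npow_restrict_le[OF \<Omega>s]])
        (use Npow_snd_le[of p lebesgue "\<lambda>x. z x - jet (\<phi> k) x"] p0 in \<open>simp add: jet_def\<close>)
    have c: "Npow m ?M (\<lambda>x. ?G x - grad (\<phi> k) x) \<le> Npow m lebesgue (\<lambda>x. ?G x - grad (\<phi> k) x)" for k
      by (rule Npow_restrict_le[OF \<Omega>s])
    show "(\<lambda>k. Npow p ?M (\<lambda>x. ?u x - \<phi> k x)) \<longlonglongrightarrow> 0 \<and> (\<lambda>k. Npow p ?M (\<lambda>x. ?G x - grad (\<phi> k) x)) \<longlonglongrightarrow> 0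
      \<and> (\<lambda>k. Npow m ?M (\<lambda>x. ?G x - grad (\<phi> k) x)) \<longlonglongrightarrow> 0"
      by (intro conjI tendsto_sandwich[OF _ _ tendsto_const l1] tendsto_sandwich[OF _ _ tendsto_const l2] always_eventually allI a b c zero_le)
  qed
  have "?u \<in> W1p p \<Omega>" unfolding W1p_def using hw um finu Wm finG by (auto simp: Lp_iff WG)
  moreover have "weak_grad \<Omega> ?u \<in> Lp m \<Omega>" using Wm finGm by (simp add: Lp_iff WG)
  ultimately show ?thesis unfolding W1p_D1m_0_def using \<phi> L by blast
qed

section \<open>Energies of pairs\<close>

definition energy_density :: "real \<Rightarrow> real \<Rightarrow> (real^'n \<Rightarrow> real) \<Rightarrow> (real^'n \<Rightarrow> real) \<Rightarrow> (real^'n \<Rightarrow> real) \<Rightarrow>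
    real^'n \<Rightarrow> real \<times> (real^'n) \<Rightarrow> real" where
  "energy_density p m L M V x y = L (snd y) / p + M (snd y) / m + V x / p * \<bar>fst y\<bar> powr p"

definition pair_energy :: "real \<Rightarrow> real \<Rightarrow> (real^'n \<Rightarrow> real) \<Rightarrow> (real^'n \<Rightarrow> real) \<Rightarrow> (real^'n \<Rightarrow> real) \<Rightarrow>
    (real^'n) set \<Rightarrow> (real^'n \<Rightarrow> real \<times> (real^'n)) \<Rightarrow> ennreal" where
  "pair_energy p m L M V A z = (\<integral>\<^sup>+x. ennreal (energy_density p m L M V x (z x)) \<partial>lebesgue_on A)"

lemma energy_wpair:
  assumes "open \<Omega>" "1 < p" "wpair p m \<Omega> z"
  shows "energy p m L M V \<Omega> (\<lambda>x. fst (z x)) = pair_energy p m L M V \<Omega> z"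
proof -
  have \<Omega>s: "\<Omega> \<in> sets lebesgue" using assms(1) by auto
  have "AE x in lebesgue_on \<Omega>. weak_grad \<Omega> (\<lambda>x. fst (z x)) x = snd (z x)"
    unfolding AE_lebesgue_on[OF \<Omega>s] by (rule weak_grad_AE[OF assms(1) wpair_weak_gradient(1)[OF assms]])
  thus ?thesis unfolding energy_def pair_energy_def energy_density_def
    by (intro nn_integral_cong_AE) (auto elim!: eventually_mono)
qed

lemma energy_indicator:
  "energy p m L M V \<Omega> u = pair_energy p m L M V \<Omega> (\<lambda>x. indicator \<Omega> x *\<^sub>R (u x, weak_grad \<Omega> u x))"
  unfolding energy_def pair_energy_def energy_density_def by (intro nn_integral_cong) auto

lemma constraint_set_imp_wpair:
  assumes "open \<Omega>" "1 < p" "1 < m" "0 < \<sigma>" "u \<in> constraint_set p m \<sigma> \<Omega>"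
  obtains z where "wpair p m \<Omega> z" "Npow \<sigma> lebesgue (\<lambda>x. fst (z x)) = 1"
    "energy p m L M V \<Omega> u = pair_energy p m L M V \<Omega> z"
proof (rule that)
  let ?z = "\<lambda>x. indicator \<Omega> x *\<^sub>R (u x, weak_grad \<Omega> u x)"
  have \<Omega>s: "\<Omega> \<in> sets lebesgue" using assms(1) by auto
  have u: "u \<in> W1p_D1m_0 p m \<Omega>" "u \<in> Lp \<sigma> \<Omega>" "Lp_norm \<sigma> \<Omega> u = 1" using assms(5) by (auto simp: constraint_set_def)
  show "wpair p m \<Omega> ?z" by (rule W1p_D1m_0_imp_wpair[OF assms(1-3) u(1)])
  show "energy p m L M V \<Omega> u = pair_energy p m L M V \<Omega> ?z" by (rule energy_indicator)
  have um: "u \<in> borel_measurable (lebesgue_on \<Omega>)" and fin: "Npow \<sigma> (lebesgue_on \<Omega>) u < \<infinity>" using u(2) by (auto simp: Lp_iff)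
  have "enn2real (Npow \<sigma> (lebesgue_on \<Omega>) u) = 1" using Lp_norm_powr(2)[OF um assms(4)] u(3) by simp
  hence "Npow \<sigma> (lebesgue_on \<Omega>) u = 1" using fin by (metis ennreal_1 ennreal_enn2real infinity_ennreal_def)
  moreover have "Npow \<sigma> lebesgue (\<lambda>x. fst (?z x)) = Npow \<sigma> (lebesgue_on \<Omega>) (\<lambda>x. fst (?z x))"
    by (rule Npow_supported[OF \<Omega>s, symmetric]) auto
  moreover have "Npow \<sigma> (lebesgue_on \<Omega>) (\<lambda>x. fst (?z x)) = Npow \<sigma> (lebesgue_on \<Omega>) u"
    by (rule Npow_cong) auto
  ultimately show "Npow \<sigma> lebesgue (\<lambda>x. fst (?z x)) = 1" by simp
qed

lemma wpair_imp_constraint_set: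
  assumes "open \<Omega>" "1 < p" "1 < m" "0 < \<sigma>" and w: "wpair p m \<Omega> z" and 1: "Npow \<sigma> lebesgue (\<lambda>x. fst (z x)) = 1"
  shows "(\<lambda>x. fst (z x)) \<in> constraint_set p m \<sigma> \<Omega>"
proof -
  have \<Omega>s: "\<Omega> \<in> sets lebesgue" using assms(1) by auto
  have z: "z \<in> borel_measurable lebesgue" "\<And>x. x \<notin> \<Omega> \<Longrightarrow> z x = 0" using w by (auto simp: wpair_def)
  have m: "(\<lambda>x. fst (z x)) \<in> borel_measurable (lebesgue_on \<Omega>)"
    by (intro measurable_restrict_space1 measurable_fst_comp z)
  have N: "Npow \<sigma> (lebesgue_on \<Omega>) (\<lambda>x. fst (z x)) = 1"
    using Npow_supported[OF \<Omega>s, of "\<lambda>x. fst (z x)" \<sigma>] z(2) 1 by simp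
  show ?thesis unfolding constraint_set_def
    using wpair_imp_W1p_D1m_0[OF assms(1-3) w] m N Lp_norm_powr(1)[OF m assms(4)] by (simp add: Lp_iff)
qed

section \<open>The Gagliardo-Nirenberg inequality\<close>

lemma Npow_finite_real: "Npow q M f < \<infinity> \<Longrightarrow> Npow q M f = ennreal (enn2real (Npow q M f))"
  by simp

text \<open>Normalise \<open>f\<close> in L^\<sigma> and insert it into the infimum. Stating this
  for a real \<open>s\<close> below \<open>S_RN\<close> avoids having to know that
  \<open>S_RN\<close> is finite; the factor \<open>p\<close> undoes the division by \<open>p\<close>
  in the integrand.\<close>

lemma sobolev_C1c:
  fixes f :: "real^'n \<Rightarrow> real"
  assumes p: "1 < p" and \<sigma>: "0 < \<sigma>" and s: "0 \<le> s" "ennreal s \<le> S_RN p \<sigma> TYPE('n)" and f: "f \<in> C1c"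
  shows "s * p * enn2real (Npow \<sigma> lebesgue f) powr (p / \<sigma>) \<le>
    enn2real (Npow p lebesgue (grad f)) + enn2real (Npow p lebesgue f)"
proof (cases "enn2real (Npow \<sigma> lebesgue f) = 0")
  case False
  define A where "A = enn2real (Npow \<sigma> lebesgue f)"
  define F where "F = enn2real (Npow p lebesgue f)"
  define G where "G = enn2real (Npow p lebesgue (grad f))"
  have A: "A > 0" using False unfolding A_def by (simp add: less_le)
  have p0: "0 < p" using p by simp
  note fin = C1c_Npow_finite[OF f]
  have NA: "Npow \<sigma> lebesgue f = ennreal A" unfolding A_def by (rule Npow_finite_real[OF fin(2)[OF \<sigma>]])
  have NF: "Npow p lebesgue f = ennreal F" unfolding F_def by (rule Npow_finite_real[OF fin(2)[OF p0]])
  have NG: "Npow p lebesgue (grad f) = ennreal G" unfolding G_def by (rule Npow_finite_real[OF fin(3)[OF p0]])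
  note f1 = C1c_C1[OF f]
  note fm = C1_measurable_lebesgue[OF f1]
  \<comment> \<open>The factor that gives \<open>c * f x\<close> unit norm in L^\<sigma>, since
    \<open>c powr \<sigma> * A = 1\<close>.\<close>
  define c where "c = A powr (- 1 / \<sigma>)"
  have c: "c > 0" unfolding c_def using A by simp
  define v where "v = (\<lambda>x. c * f x)"
  have v: "v \<in> C1c" and gv: "grad v = (\<lambda>x. c *\<^sub>R grad f x)"
    using C1c_lincomb[OF f f, of c 0] C1_lincomb(2)[OF f1 f1, of c 0] by (simp_all add: v_def)
  have Nv: "Npow q lebesgue v = ennreal (c powr q) * Npow q lebesgue f" for q
    using Npow_scale[OF fm(1), of q c] c by (simp add: v_def)
  have Ngv: "Npow p lebesgue (grad v) = ennreal (c powr p) * Npow p lebesgue (grad f)"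
    unfolding gv using Npow_scale[OF fm(2), of p c] c by simp
  have hw: "has_weak_gradient UNIV v (grad v)" by (rule weak_gradient_C1c[OF open_UNIV v])
  have AE: "AE x in lebesgue. weak_grad UNIV v x = grad v x" using weak_grad_AE[OF open_UNIV hw] by simp
  have U: "Npow q (lebesgue_on UNIV) h = Npow q lebesgue h" for q and h :: "real^'n \<Rightarrow> 'b::euclidean_space"
    by (rule Npow_supported) auto
  have res: "h \<in> borel_measurable (lebesgue_on UNIV)" if "h \<in> borel_measurable lebesgue" for h :: "real^'n \<Rightarrow> 'b::euclidean_space"
    using that by (rule measurable_restrict_space1)
  note vm = C1_measurable_lebesgue[OF C1c_C1[OF v]]
  have Wm: "weak_grad UNIV v \<in> borel_measurable (lebesgue_on UNIV)"
    by (rule weak_grad_measurable[OF open_UNIV hw res[OF vm(2)]])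
  have NW: "Npow p lebesgue (weak_grad UNIV v) = Npow p lebesgue (grad v)" by (rule Npow_cong_AE[OF AE])
  have "v \<in> Lp p UNIV" "weak_grad UNIV v \<in> Lp p UNIV" "v \<in> Lp \<sigma> UNIV"
    using res[OF vm(1)] Wm C1c_Npow_finite[OF v p0] C1c_Npow_finite[OF v \<sigma>] by (auto simp: Lp_iff U NW)
  hence W: "v \<in> W1p p UNIV" "v \<in> Lp \<sigma> UNIV" using hw by (auto simp: W1p_def)
  have "c powr \<sigma> = A powr (- 1)" using \<sigma> by (simp add: c_def powr_powr)
  hence "c powr \<sigma> * A = 1" using A by (simp add: powr_minus)
  hence "Npow \<sigma> lebesgue v = 1" unfolding Nv NA using c A by (simp add: ennreal_mult[symmetric])
  hence N1: "Lp_norm \<sigma> UNIV v = 1" using Lp_norm_powr(1)[OF res[OF vm(1)] \<sigma>] by (simp add: U)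
  have "ennreal s \<le> (\<integral>\<^sup>+x. ennreal (norm (weak_grad UNIV v x) powr p / p + \<bar>v x\<bar> powr p / p) \<partial>lebesgue)"
    by (rule order_trans[OF s(2)], unfold S_RN_def, rule INF_lower) (use W N1 in auto)
  also have "\<dots> = (\<integral>\<^sup>+x. ennreal (1 / p) * (ennreal (norm (grad v x) powr p) + ennreal (norm (v x) powr p)) \<partial>lebesgue)"
  proof (rule nn_integral_cong_AE, use AE in eventually_elim)
    case (elim x)
    have "norm (grad v x) powr p / p + \<bar>v x\<bar> powr p / p = 1 / p * (norm (grad v x) powr p + norm (v x) powr p)"
      by (simp add: add_divide_distrib)
    thus ?case using p0 elim by (simp add: ennreal_mult[symmetric] ennreal_plus[symmetric] del: ennreal_plus)
  qed
  also have "\<dots> = ennreal (1 / p) * (Npow p lebesgue (grad v) + Npow p lebesgue v)"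
    unfolding Npow_def using vm by (simp add: nn_integral_cmult nn_integral_add)
  also have "\<dots> = ennreal (1 / p * (c powr p * G + c powr p * F))"
    unfolding Ngv Nv NG NF using p0 c
    by (simp add: G_def F_def ennreal_mult[symmetric] ennreal_plus[symmetric] del: ennreal_plus)
  finally have "s \<le> 1 / p * (c powr p * G + c powr p * F)"
    using p0 c by (subst (asm) ennreal_le_iff) (auto simp: G_def F_def)
  hence "s * p \<le> c powr p * (G + F)" using p0 by (simp add: field_simps)
  hence "s * p * A powr (p / \<sigma>) \<le> c powr p * (G + F) * A powr (p / \<sigma>)" by (intro mult_right_mono) auto
  also have "c powr p * A powr (p / \<sigma>) = 1"
    unfolding c_def using A by (simp add: powr_powr flip: powr_add)
  hence "c powr p * (G + F) * A powr (p / \<sigma>) = G + F" by (metis mult.assoc mult.commute mult_1)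
  finally show ?thesis by (simp add: A_def G_def F_def)
qed auto

lemma Npow_lebesgue_scaled:
  fixes g :: "real^'n \<Rightarrow> 'b::euclidean_space"
  assumes [measurable]: "g \<in> borel_measurable borel" and c: "c > 0"
  shows "Npow q lebesgue (\<lambda>x. g (c *\<^sub>R x)) = ennreal (c powr (- real CARD('n))) * Npow q lebesgue g"
proof -
  have L: "Npow q lebesgue h = (\<integral>\<^sup>+x. ennreal (norm (h x) powr q) \<partial>lborel)" for h :: "real^'n \<Rightarrow> 'b"
    by (simp add: Npow_def nn_integral_completion)
  have "Npow q lebesgue g = (\<integral>\<^sup>+x. ennreal (norm (g x) powr q) \<partial>density (distr lborel borel (\<lambda>x. 0 + c *\<^sub>R x)) (\<lambda>_. ennreal (\<bar>c\<bar> ^ DIM(real^'n))))"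
    unfolding L using lborel_affine[of c "0::real^'n"] c by simp
  also have "\<dots> = (\<integral>\<^sup>+x. ennreal (c ^ CARD('n)) * ennreal (norm (g (c *\<^sub>R x)) powr q) \<partial>lborel)"
    using c by (subst nn_integral_density) (auto simp: nn_integral_distr)
  also have "\<dots> = ennreal (c ^ CARD('n)) * Npow q lebesgue (\<lambda>x. g (c *\<^sub>R x))"
    unfolding L by (subst nn_integral_cmult) auto
  finally have "ennreal (c powr (- real CARD('n))) * Npow q lebesgue g =
     (ennreal (c powr (- real CARD('n))) * ennreal (c ^ CARD('n))) * Npow q lebesgue (\<lambda>x. g (c *\<^sub>R x))"
    by (simp add: mult.assoc)
  also have "ennreal (c powr (- real CARD('n))) * ennreal (c ^ CARD('n)) = 1"
    using c by (simp add: ennreal_mult[symmetric] powr_minus powr_realpow field_simps)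
  finally show ?thesis by simp
qed

text \<open>The previous inequality applied to \<open>x \<mapsto> f (l x)\<close>. The exponent \<open>a\<close> is positive precisely below the
  critical Sobolev exponent.\<close>

lemma gagliardo_nirenberg_C1c:
  fixes f :: "real^'n \<Rightarrow> real"
  assumes p: "1 < p" and \<sigma>: "0 < \<sigma>" and s: "0 \<le> s" "ennreal s \<le> S_RN p \<sigma> TYPE('n)" and f: "f \<in> C1c" and l: "l > 0"
  defines "a \<equiv> real CARD('n) * p / \<sigma> + p - real CARD('n)"
  shows "s * p * enn2real (Npow \<sigma> lebesgue f) powr (p / \<sigma>) \<le>
    l powr a * enn2real (Npow p lebesgue (grad f)) + l powr (a - p) * enn2real (Npow p lebesgue f)"
proof -
  define N where "N = real CARD('n)"
  define A where "A = enn2real (Npow \<sigma> lebesgue f)"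
  define F where "F = enn2real (Npow p lebesgue f)"
  define G where "G = enn2real (Npow p lebesgue (grad f))"
  note f1 = C1c_C1[OF f]
  note m = C1_measurable[OF f1]
  let ?g = "\<lambda>x. f (l *\<^sub>R x)"
  have g: "?g \<in> C1c" by (rule C1c_scaled[OF f l])
  have N1: "enn2real (Npow q lebesgue ?g) = l powr (- N) * enn2real (Npow q lebesgue f)" for q
    unfolding Npow_lebesgue_scaled[OF m(1) l] N_def by (simp add: enn2real_mult)
  have "Npow p lebesgue (\<lambda>x. l *\<^sub>R grad f (l *\<^sub>R x)) = ennreal (l powr p) * Npow p lebesgue (\<lambda>x. grad f (l *\<^sub>R x))"
  proof -
    have "(\<lambda>x. grad f (l *\<^sub>R x)) \<in> borel_measurable lebesgue"
      by (rule measurable_completion) (use m in measurable)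
    from Npow_scale[OF this, of p l] show ?thesis using l by simp
  qed
  hence N2: "enn2real (Npow p lebesgue (grad ?g)) = l powr p * (l powr (- N) * G)"
    unfolding C1_scaled(2)[OF f1] Npow_lebesgue_scaled[OF m(2) l] N_def G_def by (simp add: enn2real_mult)
  have "s * p * (l powr (- N) * A) powr (p / \<sigma>) \<le> l powr p * (l powr (- N) * G) + l powr (- N) * F"
    using sobolev_C1c[OF p \<sigma> s g] unfolding N1 N2 A_def F_def .
  \<comment> \<open>This power cancels the Jacobian on the left and leaves the exponents
    \<open>a\<close> and \<open>a - p\<close> on the right.\<close>
  hence I: "l powr (N * p / \<sigma>) * (s * p * (l powr (- N) * A) powr (p / \<sigma>)) \<le> l powr (N * p / \<sigma>) * (l powr p * (l powr (- N) * G) + l powr (- N) * F)"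
    by (rule mult_left_mono) simp
  have e1: "l powr (N * p / \<sigma>) * (s * p * (l powr (- N) * A) powr (p / \<sigma>)) = s * p * A powr (p / \<sigma>)"
  proof -
    have "(l powr (- N) * A) powr (p / \<sigma>) = l powr (- (N * p / \<sigma>)) * A powr (p / \<sigma>)"
      by (simp add: powr_mult powr_powr)
    moreover have "l powr (N * p / \<sigma>) * l powr (- (N * p / \<sigma>)) = 1" using l by (simp flip: powr_add)
    ultimately show ?thesis by (simp add: mult.left_commute mult.assoc) 
  qed
  have e2: "l powr (N * p / \<sigma>) * (l powr p * (l powr (- N) * G) + l powr (- N) * F) = l powr a * G + l powr (a - p) * F"
    unfolding a_def N_def[symmetric] by (simp add: distrib_left powr_diff powr_add powr_minus field_simps)
  show ?thesis using I unfolding e1 e2 unfolding A_def F_def G_def .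
qed

text \<open>The strict bound may be arbitrarily close to the value at \<open>g\<close>, so the
  triangle inequality with factor 2^q is too weak here and the one with factor 1 + \<epsilon> is
  used.\<close>

lemma Npow_eventually_less:
  fixes f :: "nat \<Rightarrow> 'a \<Rightarrow> 'b::euclidean_space"
  assumes m: "\<And>k. f k \<in> borel_measurable M" "g \<in> borel_measurable M" and q: "0 < q"
    and lim: "(\<lambda>k. Npow q M (\<lambda>x. g x - f k x)) \<longlonglongrightarrow> 0" and G: "Npow q M g < ennreal G"
  shows "\<forall>\<^sub>F k in sequentially. Npow q M (f k) < ennreal G"
proof -
  define X where "X = enn2real (Npow q M g)"
  have fin: "Npow q M g < \<infinity>" using G by (rule less_trans) simp
  have NX: "Npow q M g = ennreal X" "0 \<le> X" using fin by (simp_all add: X_def)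
  have XG: "X < G" using G unfolding NX(1) using NX(2) by (simp add: ennreal_less_iff)
  \<comment> \<open>A quarter of the room \<open>G - X\<close> is spent on the excess factor and a
    quarter on the difference term; \<open>X + 1\<close> avoids a division by 0.\<close>
  define \<epsilon> where "\<epsilon> = (G - X) / (4 * (X + 1))"
  have \<epsilon>: "\<epsilon> > 0" unfolding \<epsilon>_def using XG NX(2) by simp
  have \<epsilon>X: "\<epsilon> * X \<le> (G - X) / 4"
  proof -
    have "\<epsilon> * X \<le> \<epsilon> * (X + 1)" using \<epsilon> by simp
    also have "\<dots> = (G - X) / 4" unfolding \<epsilon>_def using NX(2) by (simp add: field_simps)
    finally show ?thesis .
  qed
  obtain C where C: "0 < C" "\<And>a b :: 'b. norm (a + b) powr q \<le> (1 + \<epsilon>) * norm a powr q + C * norm b powr q"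
    by (rule norm_add_powr_eps[OF q \<epsilon>]) blast
  have lim': "(\<lambda>k. Npow q M (\<lambda>x. f k x - g x)) \<longlonglongrightarrow> 0" using lim by (simp add: Npow_commute[of q M g])
  have "\<forall>\<^sub>F k in sequentially. Npow q M (\<lambda>x. f k x - g x) < ennreal ((G - X) / 4 / C)"
    using XG C(1) by (intro order_tendstoD(2)[OF lim']) auto
  thus ?thesis
  proof eventually_elim
    case (elim k)
    have "Npow q M (f k) = Npow q M (\<lambda>x. g x + (f k x - g x))" by simp
    also have "\<dots> \<le> ennreal (1 + \<epsilon>) * Npow q M g + ennreal C * Npow q M (\<lambda>x. f k x - g x)"
      by (rule Npow_eps[OF m(2) borel_measurable_diff[OF m(1,2)] C(2)]) (use \<epsilon> C(1) in auto)
    also have "\<dots> \<le> ennreal (1 + \<epsilon>) * ennreal X + ennreal C * ennreal ((G - X) / 4 / C)"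
      using elim by (intro add_mono mult_left_mono) (auto simp: NX(1))
    also have "\<dots> = ennreal ((1 + \<epsilon>) * X + C * ((G - X) / 4 / C))"
      using \<epsilon> C(1) XG NX(2) by (simp add: ennreal_mult[symmetric] ennreal_plus[symmetric] del: ennreal_plus)
    also have "\<dots> < ennreal G"
    proof (rule ennreal_lessI)
      show "0 < G" using XG NX(2) by simp
      have "C * ((G - X) / 4 / C) = (G - X) / 4" using C(1) by simp
      thus "(1 + \<epsilon>) * X + C * ((G - X) / 4 / C) < G" using \<epsilon>X XG by (simp add: distrib_right)
    qed
    finally show ?case .
  qed
qed

text \<open>The closure of the C^1 functions of bounded support in the first-order Sobolev norm of
  exponent p on the whole space. This is the class for comparison with \<open>S_RN\<close>, and it
  is stable under C^1 cutoffs.\<close>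

definition sob0 :: "real \<Rightarrow> (real^'n \<Rightarrow> real \<times> (real^'n)) \<Rightarrow> bool" where
  "sob0 p z \<longleftrightarrow> z \<in> borel_measurable lebesgue \<and>
     (\<exists>f. (\<forall>k::nat. f k \<in> C1c) \<and> (\<lambda>k. Npow p lebesgue (\<lambda>x. z x - jet (f k) x)) \<longlonglongrightarrow> 0)"

lemma wpair_sob0: "wpair p m \<Omega> z \<Longrightarrow> sob0 p z"
  unfolding wpair_def sob0_def using test_functions_C1c by blast

text \<open>Strict bounds \<open>G\<close> and \<open>F\<close> are eventually inherited by the
  approximants, to which the inequality applies. Fatou along an almost everywhere convergent
  subsequence then yields L^\<sigma> integrability of the limit, which is not presupposed.\<close>

proposition gagliardo_nirenberg_sob0:
  fixes z :: "real^'n \<Rightarrow> real \<times> (real^'n)"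
  assumes p: "1 < p" and \<sigma>: "0 < \<sigma>" and s: "0 < s" "ennreal s \<le> S_RN p \<sigma> TYPE('n)" and z: "sob0 p z" and l: "l > 0"
    and G: "Npow p lebesgue (\<lambda>x. snd (z x)) < ennreal G" and F: "Npow p lebesgue (\<lambda>x. fst (z x)) < ennreal F"
  defines "a \<equiv> real CARD('n) * p / \<sigma> + p - real CARD('n)"
  shows "Npow \<sigma> lebesgue (\<lambda>x. fst (z x)) \<le> ennreal (((l powr a * G + l powr (a - p) * F) / (s * p)) powr (\<sigma> / p))"
proof -
  have p0: "0 < p" using p by simp
  obtain f where zm: "z \<in> borel_measurable lebesgue" and f: "\<And>k::nat. f k \<in> C1c"
    and lim: "(\<lambda>k. Npow p lebesgue (\<lambda>x. z x - jet (f k) x)) \<longlonglongrightarrow> 0"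
    using z unfolding sob0_def by blast
  note fm = C1_measurable_lebesgue[OF C1c_C1[OF f]]
  have lim': "(\<lambda>k. Npow p lebesgue (\<lambda>x. jet (f k) x - z x)) \<longlonglongrightarrow> 0"
    using lim by (simp add: Npow_commute[of p lebesgue z])
  have lf: "(\<lambda>k. Npow p lebesgue (\<lambda>x. fst (z x) - f k x)) \<longlonglongrightarrow> 0"
  proof (rule tendsto_sandwich[OF _ _ tendsto_const lim])
    have "Npow p lebesgue (\<lambda>x. fst (z x) - f k x) \<le> Npow p lebesgue (\<lambda>x. z x - jet (f k) x)" for k
      using Npow_fst_le[of p lebesgue "\<lambda>x. z x - jet (f k) x"] p0 by (simp add: jet_def)
    thus "\<forall>\<^sub>F k in sequentially. Npow p lebesgue (\<lambda>x. fst (z x) - f k x) \<le> Npow p lebesgue (\<lambda>x. z x - jet (f k) x)" by simp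
  qed simp
  have lg: "(\<lambda>k. Npow p lebesgue (\<lambda>x. snd (z x) - grad (f k) x)) \<longlonglongrightarrow> 0"
  proof (rule tendsto_sandwich[OF _ _ tendsto_const lim])
    have "Npow p lebesgue (\<lambda>x. snd (z x) - grad (f k) x) \<le> Npow p lebesgue (\<lambda>x. z x - jet (f k) x)" for k
      using Npow_snd_le[of p lebesgue "\<lambda>x. z x - jet (f k) x"] p0 by (simp add: jet_def)
    thus "\<forall>\<^sub>F k in sequentially. Npow p lebesgue (\<lambda>x. snd (z x) - grad (f k) x) \<le> Npow p lebesgue (\<lambda>x. z x - jet (f k) x)" by simp
  qed simp
  have "\<forall>\<^sub>F k in sequentially. Npow p lebesgue (f k) < ennreal F \<and> Npow p lebesgue (grad (f k)) < ennreal G"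
    using Npow_eventually_less[OF fm(1) measurable_fst_comp[OF zm] p0 lf F]
      Npow_eventually_less[OF fm(2) measurable_snd_comp[OF zm] p0 lg G] by eventually_elim simp
  then obtain k0 where k0: "\<And>k. k \<ge> k0 \<Longrightarrow> Npow p lebesgue (f k) < ennreal F \<and> Npow p lebesgue (grad (f k)) < ennreal G"
    unfolding eventually_sequentially by blast
  obtain r where r: "strict_mono r" "AE x in lebesgue. (\<lambda>k. jet (f (r k)) x) \<longlonglongrightarrow> z x"
    by (rule Npow_tendsto_AE_subseq[OF fm(3) zm p0 lim']) blast
  have bound: "Npow \<sigma> lebesgue (f k) \<le> ennreal (((l powr a * G + l powr (a - p) * F) / (s * p)) powr (\<sigma> / p))" if k: "k \<ge> k0" for k
  proof -
    define A where "A = enn2real (Npow \<sigma> lebesgue (f k))"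
    define X where "X = (l powr a * G + l powr (a - p) * F) / (s * p)"
    have G0: "0 < G" "0 < F" using k0[OF k] by (metis ennreal_eq_0_iff linorder_not_le not_less_zero)+
    have e: "enn2real (Npow p lebesgue (f k)) \<le> F" "enn2real (Npow p lebesgue (grad (f k))) \<le> G"
      using k0[OF k] G0 by (auto intro!: enn2real_leI)
    have "s * p * A powr (p / \<sigma>) \<le> l powr a * enn2real (Npow p lebesgue (grad (f k))) + l powr (a - p) * enn2real (Npow p lebesgue (f k))"
      unfolding A_def a_def by (rule gagliardo_nirenberg_C1c[OF p \<sigma> _ s(2) f l]) (use s in simp)
    also have "\<dots> \<le> l powr a * G + l powr (a - p) * F" using e by (intro add_mono mult_left_mono) auto
    finally have "A powr (p / \<sigma>) \<le> X" unfolding X_def using s(1) p0 by (simp add: field_simps)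
    hence "(A powr (p / \<sigma>)) powr (\<sigma> / p) \<le> X powr (\<sigma> / p)" using \<sigma> p0 by (intro powr_mono2) auto
    also have "(A powr (p / \<sigma>)) powr (\<sigma> / p) = A" using \<sigma> p0 by (simp add: powr_powr A_def)
    finally have "ennreal A \<le> ennreal (X powr (\<sigma> / p))" by (rule ennreal_leI)
    moreover have "Npow \<sigma> lebesgue (f k) = ennreal A"
      unfolding A_def by (rule Npow_finite_real[OF C1c_Npow_finite(2)[OF f \<sigma>]])
    ultimately show ?thesis by (simp add: X_def)
  qed
  show ?thesis
  proof (rule Npow_AE_limit_le[where f = "\<lambda>k x. f (r (k + k0)) x"])
    show "AE x in lebesgue. (\<lambda>k. f (r (k + k0)) x) \<longlonglongrightarrow> fst (z x)"
      using r(2)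
    proof eventually_elim
      case (elim x)
      hence "(\<lambda>k. fst (jet (f (r k)) x)) \<longlonglongrightarrow> fst (z x)" by (rule tendsto_fst)
      hence "(\<lambda>k. f (r k) x) \<longlonglongrightarrow> fst (z x)" by (simp add: jet_def)
      thus ?case by (rule LIMSEQ_ignore_initial_segment)
    qed
    show "Npow \<sigma> lebesgue (f (r (k + k0))) \<le> ennreal (((l powr a * G + l powr (a - p) * F) / (s * p)) powr (\<sigma> / p))" for k
      using seq_suble[OF r(1), of "k + k0"] by (intro bound) simp
  qed (use fm \<sigma> in auto)
qed

section \<open>Differences and cutoffs of pairs on the whole space\<close>

lemma sob0_diff:
  assumes "sob0 p z" "sob0 p w" "0 < p"
  shows "sob0 p (\<lambda>x. z x - w x)"
proof -
  obtain f where z: "z \<in> borel_measurable lebesgue" and f: "\<And>k::nat. f k \<in> C1c"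
    and lf: "(\<lambda>k. Npow p lebesgue (\<lambda>x. z x - jet (f k) x)) \<longlonglongrightarrow> 0"
    using assms(1) unfolding sob0_def by blast
  obtain g where w: "w \<in> borel_measurable lebesgue" and g: "\<And>k::nat. g k \<in> C1c"
    and lg: "(\<lambda>k. Npow p lebesgue (\<lambda>x. w x - jet (g k) x)) \<longlonglongrightarrow> 0"
    using assms(2) unfolding sob0_def by blast
  define h where "h = (\<lambda>k x. 1 * f k x + (- 1) * g k x)"
  have h: "h k \<in> C1c" for k unfolding h_def by (rule C1c_lincomb[OF f g])
  have jh: "jet (h k) x = jet (f k) x - jet (g k) x" for k x
    unfolding h_def jet_lincomb[OF C1c_C1[OF f] C1c_C1[OF g]] by simp
  have fm: "jet (f k) \<in> borel_measurable lebesgue" "jet (g k) \<in> borel_measurable lebesgue" for k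
    using C1_measurable_lebesgue(3)[OF C1c_C1[OF f]] C1_measurable_lebesgue(3)[OF C1c_C1[OF g]] by auto
  have b: "Npow p lebesgue (\<lambda>x. (z x - w x) - jet (h k) x) \<le>
     ennreal (2 powr p) * (Npow p lebesgue (\<lambda>x. z x - jet (f k) x) + Npow p lebesgue (\<lambda>x. w x - jet (g k) x))" for k
  proof -
    have "Npow p lebesgue (\<lambda>x. (z x - w x) - jet (h k) x) = Npow p lebesgue (\<lambda>x. (z x - jet (f k) x) - (w x - jet (g k) x))"
      by (rule Npow_cong) (simp add: jh algebra_simps)
    also have "\<dots> \<le> ennreal (2 powr p) * (Npow p lebesgue (\<lambda>x. (z x - jet (f k) x) - 0) + Npow p lebesgue (\<lambda>x. 0 - (w x - jet (g k) x)))"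
      by (rule Npow_triangle[OF borel_measurable_diff[OF z fm(1)] borel_measurable_const borel_measurable_diff[OF w fm(2)] assms(3)])
    finally show ?thesis by (simp add: Npow_def norm_minus_commute)
  qed
  have l: "(\<lambda>k. ennreal (2 powr p) * (Npow p lebesgue (\<lambda>x. z x - jet (f k) x) + Npow p lebesgue (\<lambda>x. w x - jet (g k) x))) \<longlonglongrightarrow> 0"
    using ennreal_tendsto_cmult[OF _ iffD2[OF add_tendsto_0_iff_ennreal conjI[OF lf lg]], of "ennreal (2 powr p)"] by simp
  have "(\<lambda>k. Npow p lebesgue (\<lambda>x. (z x - w x) - jet (h k) x)) \<longlonglongrightarrow> 0"
    by (rule tendsto_sandwich[OF _ _ tendsto_const l]) (use b in \<open>simp_all add: always_eventually\<close>)
  thus ?thesis unfolding sob0_def using h borel_measurable_diff[OF z w] by blast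
qed

text \<open>The product rule, imposed on pairs whose second component need not be a classical
  gradient.\<close>

definition jet_mult :: "(real^'n \<Rightarrow> real) \<Rightarrow> (real^'n \<Rightarrow> real \<times> (real^'n)) \<Rightarrow> real^'n \<Rightarrow> real \<times> (real^'n)" where
  "jet_mult \<eta> z x = (\<eta> x * fst (z x), \<eta> x *\<^sub>R snd (z x) + fst (z x) *\<^sub>R grad \<eta> x)"

lemma jet_mult_jet: "\<eta> \<in> C1_on_space \<Longrightarrow> f \<in> C1_on_space \<Longrightarrow> jet_mult \<eta> (jet f) = jet (\<lambda>x. \<eta> x * f x)"
  by (auto simp: jet_mult_def jet_def C1_mult(2))

lemma norm_jet_mult_le:
  assumes "\<bar>\<eta> x\<bar> \<le> B" "norm (grad \<eta> x) \<le> B"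
  shows "norm (jet_mult \<eta> z x) \<le> 3 * B * norm (z x)"
proof -
  have z: "norm (fst (z x)) \<le> norm (z x)" "norm (snd (z x)) \<le> norm (z x)"
    by (metis norm_fst_le norm_snd_le prod.collapse)+
  have B: "0 \<le> B" using assms(1) by linarith
  have 1: "norm (\<eta> x * fst (z x)) \<le> B * norm (z x)" using mult_mono[OF assms(1) z(1) B] by (simp add: abs_mult)
  have 2: "norm (\<eta> x *\<^sub>R snd (z x)) \<le> B * norm (z x)" using mult_mono[OF assms(1) z(2) B] by simp
  have 3: "norm (fst (z x) *\<^sub>R grad \<eta> x) \<le> B * norm (z x)" using mult_mono[OF assms(2) z(1) B] by (simp add: mult.commute)
  have "norm (jet_mult \<eta> z x) \<le> norm (\<eta> x * fst (z x)) + norm (\<eta> x *\<^sub>R snd (z x) + fst (z x) *\<^sub>R grad \<eta> x)"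
    unfolding jet_mult_def by (rule norm_Pair_le)
  also have "\<dots> \<le> B * norm (z x) + (B * norm (z x) + B * norm (z x))"
    using 1 2 3 norm_triangle_ineq[of "\<eta> x *\<^sub>R snd (z x)" "fst (z x) *\<^sub>R grad \<eta> x"] by linarith
  finally show ?thesis by simp
qed

lemma jet_mult_measurable:
  assumes "\<eta> \<in> C1_on_space" "z \<in> borel_measurable lebesgue"
  shows "jet_mult \<eta> z \<in> borel_measurable lebesgue"
proof -
  note [measurable] = C1_measurable_lebesgue[OF assms(1)] measurable_fst_comp[OF assms(2)] measurable_snd_comp[OF assms(2)]
  show ?thesis unfolding jet_mult_def[abs_def] by measurable
qed

lemma Npow_jet_mult_le:
  assumes "\<eta> \<in> C1_on_space" "\<And>x. \<bar>\<eta> x\<bar> \<le> B" "\<And>x. norm (grad \<eta> x) \<le> B" "z \<in> borel_measurable lebesgue" "0 < p"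
  shows "Npow p lebesgue (jet_mult \<eta> z) \<le> ennreal ((3 * B) powr p) * Npow p lebesgue z"
proof -
  have B: "0 \<le> B" using assms(2)[of 0] by linarith
  have "Npow p lebesgue (jet_mult \<eta> z) \<le> Npow p lebesgue (\<lambda>x. (3 * B) *\<^sub>R z x)"
    by (rule Npow_mono) (use norm_jet_mult_le[OF assms(2,3)] B assms(5) in \<open>auto simp: abs_mult\<close>)
  also have "\<dots> = ennreal ((3 * B) powr p) * Npow p lebesgue z"
    using Npow_scale[OF assms(4), of p "3 * B"] B by simp
  finally show ?thesis .
qed

lemma sob0_jet_mult:
  assumes \<eta>: "\<eta> \<in> C1_on_space" "\<And>x. \<bar>\<eta> x\<bar> \<le> B" "\<And>x. norm (grad \<eta> x) \<le> B" and z: "sob0 p z" "0 < p"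
  shows "sob0 p (jet_mult \<eta> z)"
proof -
  obtain f where zm: "z \<in> borel_measurable lebesgue" and f: "\<And>k::nat. f k \<in> C1c"
    and lf: "(\<lambda>k. Npow p lebesgue (\<lambda>x. z x - jet (f k) x)) \<longlonglongrightarrow> 0"
    using z(1) unfolding sob0_def by blast
  have eq: "jet_mult \<eta> z x - jet (\<lambda>x. \<eta> x * f k x) x = jet_mult \<eta> (\<lambda>x. z x - jet (f k) x) x" for k x
    unfolding jet_mult_jet[OF \<eta>(1) C1c_C1[OF f], symmetric] by (simp add: jet_mult_def algebra_simps)
  have b: "Npow p lebesgue (\<lambda>x. jet_mult \<eta> z x - jet (\<lambda>x. \<eta> x * f k x) x) \<le> ennreal ((3 * B) powr p) * Npow p lebesgue (\<lambda>x. z x - jet (f k) x)" for k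
    unfolding eq by (rule Npow_jet_mult_le[OF \<eta> borel_measurable_diff[OF zm C1_measurable_lebesgue(3)[OF C1c_C1[OF f]]] z(2)])
  have l: "(\<lambda>k. ennreal ((3 * B) powr p) * Npow p lebesgue (\<lambda>x. z x - jet (f k) x)) \<longlonglongrightarrow> 0"
    using ennreal_tendsto_cmult[OF _ lf, of "ennreal ((3 * B) powr p)"] by simp
  have "(\<lambda>k. Npow p lebesgue (\<lambda>x. jet_mult \<eta> z x - jet (\<lambda>x. \<eta> x * f k x) x)) \<longlonglongrightarrow> 0"
    by (rule tendsto_sandwich[OF _ _ tendsto_const l]) (use b in \<open>simp_all add: always_eventually\<close>)
  thus ?thesis unfolding sob0_def
    by (intro conjI jet_mult_measurable[OF \<eta>(1) zm] exI[of _ "\<lambda>k x. \<eta> x * f k x"] allI C1c_mult[OF \<eta>(1) f])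
qed

section \<open>A cutoff function\<close>

definition pos_square :: "real \<Rightarrow> real" where "pos_square t = (max 0 t)\<^sup>2"

lemma pos_square_deriv: "(pos_square has_field_derivative 2 * max 0 t) (at t)"
proof (cases t "0 :: real" rule: linorder_cases)
  case greater
  have "((\<lambda>t. t\<^sup>2) has_field_derivative 2 * max 0 t) (at t)" using greater by (auto intro!: derivative_eq_intros)
  thus ?thesis
    by (rule has_field_derivative_transform_within_open[of _ _ _ "{0<..}"]) (use greater in \<open>auto simp: pos_square_def\<close>)
next
  case less
  have "((\<lambda>t. 0) has_field_derivative 2 * max 0 t) (at t)" using less by simp
  thus ?thesis
    by (rule has_field_derivative_transform_within_open[of _ _ _ "{..<0}"]) (use less in \<open>auto simp: pos_square_def\<close>)
next
  case equal
  have "((\<lambda>h::real. max 0 h) \<longlongrightarrow> max 0 0) (at 0)" by (intro tendsto_max tendsto_const tendsto_ident_at)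
  hence "((\<lambda>h. (pos_square (0 + h) - pos_square 0) / h) \<longlongrightarrow> 0) (at 0)"
    by (auto simp: pos_square_def eventually_at_filter power2_eq_square max_def elim: Lim_transform_eventually)
  thus ?thesis using equal by (simp add: DERIV_def)
qed

text \<open>A second difference of squared positive parts is a continuously differentiable step from
  \<open>0\<close> to \<open>1\<close>.\<close>

definition C1_step :: "real \<Rightarrow> real" where
  "C1_step t = 2 * (pos_square t - 2 * pos_square (t - 1/2) + pos_square (t - 1))"

definition C1_step' :: "real \<Rightarrow> real" where
  "C1_step' t = 4 * (max 0 t - 2 * max 0 (t - 1/2) + max 0 (t - 1))"

lemma C1_step_deriv: "(C1_step has_field_derivative C1_step' t) (at t)"
proof -
  have s: "((\<lambda>t. pos_square (t - c)) has_field_derivative 2 * max 0 (t - c)) (at t)" for c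
  proof -
    have "((\<lambda>t. t - c) has_field_derivative 1) (at t)" by (auto intro!: derivative_eq_intros)
    from DERIV_chain2[where f = pos_square and g = "\<lambda>t. t - c" and x = t, OF pos_square_deriv this]
    show ?thesis by simp
  qed
  show ?thesis unfolding C1_step_def[abs_def] C1_step'_def
    by (auto intro!: derivative_eq_intros pos_square_deriv s)
qed

lemma C1_step_values:
  "t \<le> 0 \<Longrightarrow> C1_step t = 0" "1 \<le> t \<Longrightarrow> C1_step t = 1" "0 \<le> C1_step t" "C1_step t \<le> 1"
  "t \<le> 0 \<or> 1 \<le> t \<Longrightarrow> C1_step' t = 0" "\<bar>C1_step' t\<bar> \<le> 2"
proof -
  show "t \<le> 0 \<Longrightarrow> C1_step t = 0" "1 \<le> t \<Longrightarrow> C1_step t = 1"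
    by (auto simp: C1_step_def pos_square_def max_def power2_eq_square algebra_simps)
  show "t \<le> 0 \<or> 1 \<le> t \<Longrightarrow> C1_step' t = 0" "\<bar>C1_step' t\<bar> \<le> 2"
    by (auto simp: C1_step'_def max_def abs_le_iff)
  consider "t \<le> 0" | "0 < t" "t \<le> 1/2" | "1/2 < t" "t \<le> 1" | "1 < t" by linarith
  hence "0 \<le> C1_step t \<and> C1_step t \<le> 1"
  proof cases
    case 2
    hence "C1_step t = 2 * t\<^sup>2" by (simp add: C1_step_def pos_square_def max_def)
    moreover have "t\<^sup>2 \<le> (1/2)\<^sup>2" using 2 by (intro power_mono) auto
    ultimately show ?thesis by (auto simp: power2_eq_square)
  next
    case 3
    hence "C1_step t = 1 - 2 * (1 - t)\<^sup>2" by (simp add: C1_step_def pos_square_def max_def power2_eq_square algebra_simps)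
    moreover have "(1 - t)\<^sup>2 \<le> (1/2)\<^sup>2" using 3 by (intro power_mono) auto
    ultimately show ?thesis by (auto simp: power2_eq_square)
  qed (auto simp: C1_step_def pos_square_def max_def power2_eq_square algebra_simps)
  thus "0 \<le> C1_step t" "C1_step t \<le> 1" by auto
qed

text \<open>The squared norm is used because it is differentiable at the origin as well. The
  transition takes place for |x| between R and sqrt 2 R, hence before 2 R.\<close>

definition outer_cutoff :: "real \<Rightarrow> real^'n \<Rightarrow> real" where
  "outer_cutoff R x = C1_step ((x \<bullet> x) / R\<^sup>2 - 1)"

lemma outer_cutoff:
  fixes x :: "real^'n"
  assumes R: "R > 0"
  shows "(outer_cutoff R :: real^'n \<Rightarrow> real) \<in> C1_on_space"
    "norm x \<le> R \<Longrightarrow> outer_cutoff R x = 0" "2 * R \<le> norm x \<Longrightarrow> outer_cutoff R x = 1"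
    "0 \<le> outer_cutoff R x" "outer_cutoff R x \<le> 1"
    "norm (grad (outer_cutoff R) x) \<le> 8 / R" "norm x \<le> R \<Longrightarrow> grad (outer_cutoff R) x = 0"
proof -
  define g where "g = (\<lambda>x::real^'n. (C1_step' ((x \<bullet> x) / R\<^sup>2 - 1) * (2 / R\<^sup>2)) *\<^sub>R x)"
  have d: "(outer_cutoff R has_derivative (\<lambda>h. g x \<bullet> h)) (at x)" for x :: "real^'n"
  proof -
    have "((\<lambda>x::real^'n. (x \<bullet> x) * inverse (R\<^sup>2) - 1) has_derivative (\<lambda>h. 2 * (x \<bullet> h) / R\<^sup>2)) (at x)"
      by (auto intro!: derivative_eq_intros simp: inner_commute divide_inverse)
    hence "((\<lambda>x::real^'n. (x \<bullet> x) / R\<^sup>2 - 1) has_derivative (\<lambda>h. 2 * (x \<bullet> h) / R\<^sup>2)) (at x)"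
      by (simp add: divide_inverse)
    from has_derivative_compose[OF this C1_step_deriv[unfolded has_field_derivative_def]]
    show ?thesis unfolding outer_cutoff_def[abs_def] g_def by (simp add: mult_ac)
  qed
  have cs: "continuous_on UNIV C1_step'" unfolding C1_step'_def[abs_def] by (intro continuous_intros)
  have c: "continuous_on UNIV g"
    unfolding g_def by (intro continuous_intros continuous_on_compose2[OF cs]) (use R in auto)
  show "(outer_cutoff R :: real^'n \<Rightarrow> real) \<in> C1_on_space" by (rule C1I(1)[OF d c])
  have gr: "grad (outer_cutoff R) = g" by (rule C1I(2)[OF d c])
  have xx: "x \<bullet> x = (norm x)\<^sup>2" by (simp add: power2_norm_eq_inner)
  have small: "(x \<bullet> x) / R\<^sup>2 - 1 \<le> 0" if "norm x \<le> R"
    using power_mono[OF that norm_ge_zero, of 2] R unfolding xx by (simp add: field_simps)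
  have large: "1 \<le> (x \<bullet> x) / R\<^sup>2 - 1" if "2 * R \<le> norm x"
  proof -
    have "(2 * R)\<^sup>2 \<le> (norm x)\<^sup>2" using that R by (intro power_mono) auto
    moreover have "(2 * R)\<^sup>2 = 4 * R\<^sup>2" by (simp add: power_mult_distrib)
    ultimately have "2 * R\<^sup>2 \<le> (norm x)\<^sup>2" using zero_le_power2[of R] by linarith
    thus ?thesis using R unfolding xx by (simp add: field_simps)
  qed
  show "norm x \<le> R \<Longrightarrow> outer_cutoff R x = 0" "2 * R \<le> norm x \<Longrightarrow> outer_cutoff R x = 1"
    unfolding outer_cutoff_def using small large C1_step_values(1,2) by blast+
  show "0 \<le> outer_cutoff R x" "outer_cutoff R x \<le> 1"
    unfolding outer_cutoff_def by (rule C1_step_values)+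
  show "norm x \<le> R \<Longrightarrow> grad (outer_cutoff R) x = 0"
    unfolding gr g_def using small C1_step_values(5) by simp
  show "norm (grad (outer_cutoff R) x) \<le> 8 / R"
  proof (cases "2 * R \<le> norm x")
    case True
    thus ?thesis unfolding gr g_def using large C1_step_values(5) R by simp
  next
    case False
    have "norm (g x) = \<bar>C1_step' ((x \<bullet> x) / R\<^sup>2 - 1)\<bar> * ((2 / R\<^sup>2) * norm x)"
      unfolding g_def by (simp add: abs_mult)
    also have "\<dots> \<le> 2 * ((2 / R\<^sup>2) * (2 * R))"
      using False R C1_step_values(6) by (intro mult_mono) auto
    also have "\<dots> = 8 / R" using R by (simp add: power2_eq_square)
    finally show ?thesis by (simp add: gr)
  qed
qed

section \<open>Almost minimal convex combinations\<close>

text \<open>Midpoints stand in for general convex combinations.\<close>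

inductive_set midhull :: "(nat \<Rightarrow> 'a \<Rightarrow> 'b::real_vector) \<Rightarrow> nat \<Rightarrow> ('a \<Rightarrow> 'b) set" for z n where
  base: "n \<le> k \<Longrightarrow> z k \<in> midhull z n"
| mid: "f \<in> midhull z n \<Longrightarrow> g \<in> midhull z n \<Longrightarrow> (\<lambda>x. (1/2) *\<^sub>R (f x + g x)) \<in> midhull z n"

lemma midhull_antimono: "f \<in> midhull z k \<Longrightarrow> n \<le> k \<Longrightarrow> f \<in> midhull z n"
  by (induction rule: midhull.induct) (auto intro: midhull.intros)

text \<open>The infima of \<open>E\<close> over the tail hulls increase and are bounded, hence
  converge. Each \<open>w n\<close> comes within 1/(n+1) of its infimum, while a midpoint of late
  \<open>w i\<close> and \<open>w j\<close> still lies in a tail hull and cannot have much smaller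
  energy.\<close>

lemma midhull_almost_minimal:
  fixes E :: "('a \<Rightarrow> 'b::real_vector) \<Rightarrow> real"
  assumes E: "\<And>f. f \<in> midhull z 0 \<Longrightarrow> 0 \<le> E f" "\<And>f. f \<in> midhull z 0 \<Longrightarrow> E f \<le> B"
  obtains w where "\<And>n. w n \<in> midhull z n"
    "\<And>\<delta>. \<delta> > 0 \<Longrightarrow> \<exists>n0. \<forall>i\<ge>n0. \<forall>j\<ge>n0. E (w i) / 2 + E (w j) / 2 - E (\<lambda>x. (1/2) *\<^sub>R (w i x + w j x)) \<le> \<delta>"
proof -
  define a where "a = (\<lambda>n. Inf (E ` midhull z n))"
  have sub: "f \<in> midhull z 0" if "f \<in> midhull z n" for f n using midhull_antimono[OF that] by simp
  have bdd: "bdd_below (E ` midhull z n)" for n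
    by (rule bdd_belowI2[of _ 0]) (use sub E(1) in blast)
  have ne: "E ` midhull z n \<noteq> {}" for n using midhull.base[of n n z] by blast
  have lower: "a n \<le> E f" if "f \<in> midhull z n" for f n
    unfolding a_def using that bdd by (intro cInf_lower) auto
  have aB: "a n \<le> B" for n
    using lower[OF midhull.base[OF order_refl]] E(2)[OF midhull.base[of 0 n z]] by (meson le0 order_trans)
  have mono: "incseq a"
  proof (rule incseq_SucI)
    fix n
    show "a n \<le> a (Suc n)" unfolding a_def
      by (rule cInf_superset_mono[OF ne bdd]) (use midhull_antimono[of _ z "Suc n" n] in auto)
  qed
  have "\<exists>f. f \<in> midhull z n \<and> E f < a n + inverse (real (Suc n))" for n
  proof -
    have "Inf (E ` midhull z n) < a n + inverse (real (Suc n))" unfolding a_def by simp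
    from cInf_lessD[OF ne this] show ?thesis by blast
  qed
  then obtain w where w: "\<And>n. w n \<in> midhull z n" "\<And>n. E (w n) < a n + inverse (real (Suc n))" by metis
  have "convergent a" using mono aB by (auto intro: incseq_convergent simp: convergent_def)
  then obtain l where l: "a \<longlonglongrightarrow> l" by (auto simp: convergent_def)
  have al: "a n \<le> l" for n by (rule incseq_le[OF mono l])
  show thesis
  proof (rule that[OF w(1)])
    fix \<delta> :: real assume \<delta>: "\<delta> > 0"
    have "\<forall>\<^sub>F n in sequentially. l - \<delta> / 2 < a n" using \<delta> by (intro order_tendstoD(1)[OF l]) simp
    moreover have "\<forall>\<^sub>F n in sequentially. inverse (real (Suc n)) < \<delta> / 2"
      using \<delta> by (intro order_tendstoD(2)[OF LIMSEQ_inverse_real_of_nat]) simp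
    ultimately have "\<forall>\<^sub>F n in sequentially. l - \<delta> / 2 < a n \<and> inverse (real (Suc n)) < \<delta> / 2" by eventually_elim simp
    then obtain n0 where n0: "\<And>n. n \<ge> n0 \<Longrightarrow> l - \<delta> / 2 < a n \<and> inverse (real (Suc n)) < \<delta> / 2"
      unfolding eventually_sequentially by blast
    show "\<exists>n0. \<forall>i\<ge>n0. \<forall>j\<ge>n0. E (w i) / 2 + E (w j) / 2 - E (\<lambda>x. (1/2) *\<^sub>R (w i x + w j x)) \<le> \<delta>"
    proof (intro exI allI impI)
      fix i j assume ij: "n0 \<le> i" "n0 \<le> j"
      \<comment> \<open>The midpoint lies in the hull of the tail from \<open>n0\<close>, so its
        energy is at least \<open>a n0\<close>, which exceeds the limit \<open>l\<close> minus
        \<delta>/2.\<close>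
      have "a n0 \<le> E (\<lambda>x. (1/2) *\<^sub>R (w i x + w j x))"
        using ij w(1) by (intro lower midhull.mid) (auto intro: midhull_antimono)
      moreover have "E (w i) < l + \<delta> / 2" "E (w j) < l + \<delta> / 2"
        using w(2)[of i] w(2)[of j] n0[OF ij(1)] n0[OF ij(2)] al[of i] al[of j] by linarith+
      ultimately show "E (w i) / 2 + E (w j) / 2 - E (\<lambda>x. (1/2) *\<^sub>R (w i x + w j x)) \<le> \<delta>"
        using n0[of n0] by linarith
    qed
  qed
qed

text \<open>Fatou in one index: fix \<open>k\<close> in the Cauchy condition and let the other index
  run along the subsequence.\<close>

lemma Npow_Cauchy_limit:
  fixes f :: "nat \<Rightarrow> 'a \<Rightarrow> 'b::euclidean_space"
  assumes m: "\<And>k. f k \<in> borel_measurable M" and q: "0 < q"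
    and cau: "\<And>\<delta>. \<delta> > 0 \<Longrightarrow> \<exists>n0. \<forall>i\<ge>n0. \<forall>j\<ge>n0. Npow q M (\<lambda>x. f i x - f j x) \<le> ennreal \<delta>"
    and r: "strict_mono r" and AE: "AE x in M. (\<lambda>k. f (r k) x) \<longlonglongrightarrow> g x"
  shows "(\<lambda>k. Npow q M (\<lambda>x. g x - f k x)) \<longlonglongrightarrow> 0"
proof (rule tendsto_0_if_eventually_le)
  fix \<delta> :: real assume "\<delta> > 0"
  from cau[OF this] obtain n0 where n0: "\<forall>i\<ge>n0. \<forall>j\<ge>n0. Npow q M (\<lambda>x. f i x - f j x) \<le> ennreal \<delta>" by blast
  have "Npow q M (\<lambda>x. g x - f k x) \<le> ennreal \<delta>" if k: "k \<ge> n0" for k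
  proof (rule Npow_AE_limit_le[where f = "\<lambda>j x. f (r (j + n0)) x - f k x"])
    show "AE x in M. (\<lambda>j. f (r (j + n0)) x - f k x) \<longlonglongrightarrow> g x - f k x"
      using AE by eventually_elim (intro tendsto_diff tendsto_const LIMSEQ_ignore_initial_segment[where f = "\<lambda>k. f (r k) _"])
    show "Npow q M (\<lambda>x. f (r (j + n0)) x - f k x) \<le> ennreal \<delta>" for j
    proof -
      have "n0 \<le> r (j + n0)" using seq_suble[OF r, of "j + n0"] by simp
      thus ?thesis using n0 k by blast
    qed
  qed (use m q in auto)
  thus "\<forall>\<^sub>F k in sequentially. Npow q M (\<lambda>x. g x - f k x) \<le> ennreal \<delta>"
    unfolding eventually_sequentially by blast
qed

lemma wpair_midpoint:
  assumes "wpair p m \<Omega> z" "wpair p m \<Omega> w" "1 < p" "1 < m"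
  shows "wpair p m \<Omega> (\<lambda>x. (1/2) *\<^sub>R (z x + w x))"
proof -
  obtain f where z: "z \<in> borel_measurable lebesgue" "\<forall>x. x \<notin> \<Omega> \<longrightarrow> z x = 0" and f: "\<And>k::nat. f k \<in> test_functions \<Omega>"
    and lf: "(\<lambda>k. Npow p lebesgue (\<lambda>x. z x - jet (f k) x)) \<longlonglongrightarrow> 0"
      "(\<lambda>k. Npow m lebesgue (\<lambda>x. snd (z x) - grad (f k) x)) \<longlonglongrightarrow> 0"
    using assms(1) unfolding wpair_def by blast
  obtain g where w: "w \<in> borel_measurable lebesgue" "\<forall>x. x \<notin> \<Omega> \<longrightarrow> w x = 0" and g: "\<And>k::nat. g k \<in> test_functions \<Omega>"
    and lg: "(\<lambda>k. Npow p lebesgue (\<lambda>x. w x - jet (g k) x)) \<longlonglongrightarrow> 0"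
      "(\<lambda>k. Npow m lebesgue (\<lambda>x. snd (w x) - grad (g k) x)) \<longlonglongrightarrow> 0"
    using assms(2) unfolding wpair_def by blast
  note fm = C1_measurable_lebesgue[OF C1c_C1[OF test_functions_C1c[OF f]]]
  note gm = C1_measurable_lebesgue[OF C1c_C1[OF test_functions_C1c[OF g]]]
  define h where "h = (\<lambda>k x. (1/2) * f k x + (1/2) * g k x)"
  have h: "h k \<in> test_functions \<Omega>" for k unfolding h_def by (rule test_functions_lincomb[OF f g])
  have jh: "jet (h k) x = (1/2) *\<^sub>R jet (f k) x + (1/2) *\<^sub>R jet (g k) x" for k x
    unfolding h_def by (rule jet_lincomb[OF C1c_C1[OF test_functions_C1c[OF f]] C1c_C1[OF test_functions_C1c[OF g]]])
  have gh: "grad (h k) x = (1/2) *\<^sub>R grad (f k) x + (1/2) *\<^sub>R grad (g k) x" for k x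
    using jh[of k x] by (simp add: jet_def)
  have b1: "Npow p lebesgue (\<lambda>x. (1/2) *\<^sub>R (z x + w x) - jet (h k) x) \<le>
      Npow p lebesgue (\<lambda>x. z x - jet (f k) x) + Npow p lebesgue (\<lambda>x. w x - jet (g k) x)" for k
  proof -
    have "Npow p lebesgue (\<lambda>x. (1/2) *\<^sub>R (z x + w x) - jet (h k) x) = Npow p lebesgue (\<lambda>x. (1/2) *\<^sub>R ((z x - jet (f k) x) + (w x - jet (g k) x)))"
      by (rule Npow_cong) (simp add: jh algebra_simps)
    also have "\<dots> \<le> Npow p lebesgue (\<lambda>x. z x - jet (f k) x) + Npow p lebesgue (\<lambda>x. w x - jet (g k) x)"
      by (rule Npow_midpoint[OF borel_measurable_diff[OF z(1) fm(3)] borel_measurable_diff[OF w(1) gm(3)] assms(3)]) auto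
    finally show ?thesis .
  qed
  have b2: "Npow m lebesgue (\<lambda>x. snd ((1/2) *\<^sub>R (z x + w x)) - grad (h k) x) \<le>
      Npow m lebesgue (\<lambda>x. snd (z x) - grad (f k) x) + Npow m lebesgue (\<lambda>x. snd (w x) - grad (g k) x)" for k
  proof -
    have "Npow m lebesgue (\<lambda>x. snd ((1/2) *\<^sub>R (z x + w x)) - grad (h k) x) = Npow m lebesgue (\<lambda>x. (1/2) *\<^sub>R ((snd (z x) - grad (f k) x) + (snd (w x) - grad (g k) x)))"
      by (rule Npow_cong) (simp add: gh algebra_simps)
    also have "\<dots> \<le> Npow m lebesgue (\<lambda>x. snd (z x) - grad (f k) x) + Npow m lebesgue (\<lambda>x. snd (w x) - grad (g k) x)"
      by (rule Npow_midpoint[OF borel_measurable_diff[OF measurable_snd_comp[OF z(1)] fm(2)] borel_measurable_diff[OF measurable_snd_comp[OF w(1)] gm(2)] assms(4)]) auto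
    finally show ?thesis .
  qed
  have "(\<lambda>k. Npow p lebesgue (\<lambda>x. (1/2) *\<^sub>R (z x + w x) - jet (h k) x)) \<longlonglongrightarrow> 0"
    by (rule tendsto_sandwich[OF _ _ tendsto_const iffD2[OF add_tendsto_0_iff_ennreal conjI[OF lf(1) lg(1)]]])
      (use b1 in \<open>simp_all add: always_eventually\<close>)
  moreover have "(\<lambda>k. Npow m lebesgue (\<lambda>x. snd ((1/2) *\<^sub>R (z x + w x)) - grad (h k) x)) \<longlonglongrightarrow> 0"
    by (rule tendsto_sandwich[OF _ _ tendsto_const iffD2[OF add_tendsto_0_iff_ennreal conjI[OF lf(2) lg(2)]]])
      (use b2 in \<open>simp_all add: always_eventually\<close>)
  moreover have "(\<lambda>x. (1/2) *\<^sub>R (z x + w x)) \<in> borel_measurable lebesgue" using z(1) w(1) by measurable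
  moreover have "\<forall>x. x \<notin> \<Omega> \<longrightarrow> (1/2) *\<^sub>R (z x + w x) = 0" using z(2) w(2) by simp
  ultimately show ?thesis unfolding wpair_def using h by blast
qed

text \<open>Each \<open>w n\<close> is replaced by a single test function within 1/(n+1) of it in
  both senses; these test functions then approximate \<open>y\<close>.\<close>

lemma wpair_closed:
  assumes w: "\<And>n::nat. wpair p m \<Omega> (w n)" and y: "y \<in> borel_measurable lebesgue" "\<And>x. x \<notin> \<Omega> \<Longrightarrow> y x = 0"
    and p: "0 < p" "0 < m" and l: "(\<lambda>n. Npow p lebesgue (\<lambda>x. y x - w n x)) \<longlonglongrightarrow> 0"
      "(\<lambda>n. Npow m lebesgue (\<lambda>x. snd (y x) - snd (w n x))) \<longlonglongrightarrow> 0"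
  shows "wpair p m \<Omega> y"
proof -
  define e where "e = (\<lambda>n. ennreal (inverse (real (Suc n))))"
  have e0: "e \<longlonglongrightarrow> 0" unfolding e_def using tendsto_ennrealI[OF LIMSEQ_inverse_real_of_nat] by simp
  have "\<exists>\<phi>. \<phi> \<in> test_functions \<Omega> \<and> Npow p lebesgue (\<lambda>x. w n x - jet \<phi> x) < e n \<and> Npow m lebesgue (\<lambda>x. snd (w n x) - grad \<phi> x) < e n" for n
  proof -
    obtain f where f: "\<And>k::nat. f k \<in> test_functions \<Omega>"
      and lf: "(\<lambda>k. Npow p lebesgue (\<lambda>x. w n x - jet (f k) x)) \<longlonglongrightarrow> 0"
        "(\<lambda>k. Npow m lebesgue (\<lambda>x. snd (w n x) - grad (f k) x)) \<longlonglongrightarrow> 0"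
      using w[of n] unfolding wpair_def by blast
    have en: "0 < e n" unfolding e_def by simp
    have "\<forall>\<^sub>F k in sequentially. Npow p lebesgue (\<lambda>x. w n x - jet (f k) x) < e n \<and> Npow m lebesgue (\<lambda>x. snd (w n x) - grad (f k) x) < e n"
      using order_tendstoD(2)[OF lf(1) en] order_tendstoD(2)[OF lf(2) en] by eventually_elim simp
    then obtain k where "Npow p lebesgue (\<lambda>x. w n x - jet (f k) x) < e n \<and> Npow m lebesgue (\<lambda>x. snd (w n x) - grad (f k) x) < e n"
      using eventually_happens'[OF sequentially_bot] by blast
    thus ?thesis by (intro exI[of _ "f k"] conjI f) blast+
  qed
  then obtain \<phi> where \<phi>: "\<And>n. \<phi> n \<in> test_functions \<Omega>" "\<And>n. Npow p lebesgue (\<lambda>x. w n x - jet (\<phi> n) x) < e n"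
    "\<And>n. Npow m lebesgue (\<lambda>x. snd (w n x) - grad (\<phi> n) x) < e n"
    using choice[OF allI, of "\<lambda>n \<phi>. \<phi> \<in> test_functions \<Omega> \<and> Npow p lebesgue (\<lambda>x. w n x - jet \<phi> x) < e n \<and> Npow m lebesgue (\<lambda>x. snd (w n x) - grad \<phi> x) < e n"] by blast
  note \<phi>m = C1_measurable_lebesgue[OF C1c_C1[OF test_functions_C1c[OF \<phi>(1)]]]
  have wm: "w n \<in> borel_measurable lebesgue" for n using w[of n] by (simp add: wpair_def)
  have b1: "Npow p lebesgue (\<lambda>x. y x - jet (\<phi> n) x) \<le> ennreal (2 powr p) * (Npow p lebesgue (\<lambda>x. y x - w n x) + e n)" for n
    by (rule order_trans[OF Npow_triangle[OF y(1) wm[of n] \<phi>m(3)[of n] p(1)]], intro mult_left_mono add_left_mono)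
      (use \<phi>(2)[of n] in auto)
  have b2: "Npow m lebesgue (\<lambda>x. snd (y x) - grad (\<phi> n) x) \<le> ennreal (2 powr m) * (Npow m lebesgue (\<lambda>x. snd (y x) - snd (w n x)) + e n)" for n
    by (rule order_trans[OF Npow_triangle[OF measurable_snd_comp[OF y(1)] measurable_snd_comp[OF wm[of n]] \<phi>m(2)[of n] p(2)]], intro mult_left_mono add_left_mono)
      (use \<phi>(3)[of n] in auto)
  have r: "(\<lambda>n. ennreal (2 powr q) * (X n + e n)) \<longlonglongrightarrow> 0" if X: "X \<longlonglongrightarrow> 0" for X :: "nat \<Rightarrow> ennreal" and q
    using ennreal_tendsto_cmult[OF _ iffD2[OF add_tendsto_0_iff_ennreal conjI[OF X e0]], of "ennreal (2 powr q)"] by simp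
  have "(\<lambda>n. Npow p lebesgue (\<lambda>x. y x - jet (\<phi> n) x)) \<longlonglongrightarrow> 0"
    by (rule tendsto_sandwich[OF _ _ tendsto_const r[OF l(1), of p]]) (use b1 in \<open>simp_all add: always_eventually\<close>)
  moreover have "(\<lambda>n. Npow m lebesgue (\<lambda>x. snd (y x) - grad (\<phi> n) x)) \<longlonglongrightarrow> 0"
    by (rule tendsto_sandwich[OF _ _ tendsto_const r[OF l(2), of m]]) (use b2 in \<open>simp_all add: always_eventually\<close>)
  ultimately show ?thesis unfolding wpair_def using y \<phi>(1) by blast
qed

text \<open>Strict convexity is recorded at midpoints because \<open>uniform_convexity\<close>
  consumes it in that form; \<open>v0\<close> turns the potential term into control of the L^p
  norm.\<close>

locale minimization_setup =
  fixes p m :: real and \<Omega> :: "(real^'n) set" and V L M :: "real^'n \<Rightarrow> real" and v0 :: real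
  assumes m1: "1 < m" and mp: "m \<le> p" and open_\<Omega>: "open \<Omega>"
    and L_cont: "continuous_on UNIV L" and M_cont: "continuous_on UNIV M"
    and L_hom: "\<And>t \<xi>. t > 0 \<Longrightarrow> L (t *\<^sub>R \<xi>) = t powr p * L \<xi>"
    and M_hom: "\<And>t \<xi>. t > 0 \<Longrightarrow> M (t *\<^sub>R \<xi>) = t powr m * M \<xi>"
    and L_ge: "\<And>\<xi>. L \<xi> \<ge> p * norm \<xi> powr p" and M_ge: "\<And>\<xi>. M \<xi> \<ge> m * norm \<xi> powr m"
    and L_mid: "\<And>x y. x \<noteq> y \<Longrightarrow> L ((1/2) *\<^sub>R (x + y)) < L x / 2 + L y / 2"
    and M_mid: "\<And>x y. x \<noteq> y \<Longrightarrow> M ((1/2) *\<^sub>R (x + y)) < M x / 2 + M y / 2"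
    and V_cont: "continuous_on \<Omega> V" and v0: "0 < v0" and V_ge: "\<And>x. x \<in> \<Omega> \<Longrightarrow> v0 \<le> V x"
begin

abbreviation "edens \<equiv> energy_density p m L M V"
abbreviation "En \<equiv> pair_energy p m L M V"

lemma p1: "1 < p" "0 < p" "0 < m" using m1 mp by auto

lemma \<Omega>_sets: "\<Omega> \<in> sets lebesgue" using open_\<Omega> by auto

lemma L_nonneg: "0 \<le> L \<xi>" and M_nonneg: "0 \<le> M \<xi>"
  using L_ge[of \<xi>] M_ge[of \<xi>] p1 by (smt (verit) mult_nonneg_nonneg powr_ge_zero)+

lemma edens_parts:
  assumes "x \<in> \<Omega>"
  shows "0 \<le> edens x y" "norm (snd y) powr p \<le> edens x y" "norm (snd y) powr m \<le> edens x y"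
    "V x / p * \<bar>fst y\<bar> powr p \<le> edens x y" "\<bar>fst y\<bar> powr p \<le> p / v0 * edens x y"
    "L (snd y) \<le> p * edens x y" "M (snd y) \<le> m * edens x y"
    "norm (snd y) powr p + V x / p * \<bar>fst y\<bar> powr p \<le> edens x y"
proof -
  have V: "V x / p * \<bar>fst y\<bar> powr p \<ge> 0" using V_ge[OF assms] v0 p1 by simp
  have LM: "L (snd y) / p \<ge> 0" "M (snd y) / m \<ge> 0" using L_nonneg M_nonneg p1 by auto
  have LM2: "L (snd y) / p \<ge> norm (snd y) powr p" "M (snd y) / m \<ge> norm (snd y) powr m"
    using L_ge[of "snd y"] M_ge[of "snd y"] p1 by (auto simp: field_simps)
  show "0 \<le> edens x y" "norm (snd y) powr p \<le> edens x y" "norm (snd y) powr m \<le> edens x y"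
    "norm (snd y) powr p + V x / p * \<bar>fst y\<bar> powr p \<le> edens x y"
    and Ve: "V x / p * \<bar>fst y\<bar> powr p \<le> edens x y"
    using V LM LM2 unfolding energy_density_def by linarith+
  have "L (snd y) / p \<le> edens x y" "M (snd y) / m \<le> edens x y"
    using V LM unfolding energy_density_def by linarith+
  thus "L (snd y) \<le> p * edens x y" "M (snd y) \<le> m * edens x y" using p1 by (auto simp: field_simps)
  have "v0 / p * \<bar>fst y\<bar> powr p \<le> V x / p * \<bar>fst y\<bar> powr p"
    using V_ge[OF assms] p1 by (intro mult_right_mono divide_right_mono) auto
  hence "v0 / p * \<bar>fst y\<bar> powr p \<le> edens x y" using Ve by linarith
  thus "\<bar>fst y\<bar> powr p \<le> p / v0 * edens x y" using p1 v0 by (simp add: field_simps)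
qed

text \<open>The convexity defect of the density at the midpoint. It is nonnegative on \<Omega>, and
  its integral is the quantity that almost minimality makes small.\<close>

definition egap :: "real^'n \<Rightarrow> real \<times> (real^'n) \<Rightarrow> real \<times> (real^'n) \<Rightarrow> real" where
  "egap x a b = edens x a / 2 + edens x b / 2 - edens x ((1/2) *\<^sub>R (a + b))"

text \<open>The defect is the sum of the defects of \<open>L\<close>, \<open>M\<close> and the
  power, with weights 1/p, 1/m and V/p. All three are nonnegative, so each is bounded by the
  whole.\<close>

lemma egap_parts:
  assumes "x \<in> \<Omega>"
  shows "0 \<le> egap x a b"
    "L (snd a) / 2 + L (snd b) / 2 - L ((1/2) *\<^sub>R (snd a + snd b)) \<le> p * egap x a b"
    "M (snd a) / 2 + M (snd b) / 2 - M ((1/2) *\<^sub>R (snd a + snd b)) \<le> m * egap x a b"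
    "\<bar>fst a\<bar> powr p / 2 + \<bar>fst b\<bar> powr p / 2 - \<bar>(1/2) *\<^sub>R (fst a + fst b)\<bar> powr p \<le> p / v0 * egap x a b"
proof -
  define l where "l = L (snd a) / 2 + L (snd b) / 2 - L ((1/2) *\<^sub>R (snd a + snd b))"
  define k where "k = M (snd a) / 2 + M (snd b) / 2 - M ((1/2) *\<^sub>R (snd a + snd b))"
  define s where "s = \<bar>fst a\<bar> powr p / 2 + \<bar>fst b\<bar> powr p / 2 - \<bar>(1/2) *\<^sub>R (fst a + fst b)\<bar> powr p"
  have same: "(1/2) *\<^sub>R (y + y) = y" for y :: "real^'n" by (simp flip: scaleR_2)
  have l0: "0 \<le> l" unfolding l_def using L_mid[of "snd a" "snd b"] same[of "snd b"] by (cases "snd a = snd b") auto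
  have k0: "0 \<le> k" unfolding k_def using M_mid[of "snd a" "snd b"] same[of "snd b"] by (cases "snd a = snd b") auto
  have s0: "0 \<le> s" unfolding s_def using norm_midpoint_powr_le[OF p1(1), of "fst a" "fst b"] by simp
  have e: "egap x a b = l / p + k / m + V x / p * s"
  proof -
    have "(la / p + ma / m + v * sa) / 2 + (lb / p + mb / m + v * sb) / 2 - (lc / p + mc / m + v * sc) =
      (la / 2 + lb / 2 - lc) / p + (ma / 2 + mb / 2 - mc) / m + v * (sa / 2 + sb / 2 - sc)" for la lb lc ma mb mc sa sb sc v :: real
      by (simp add: diff_divide_distrib add_divide_distrib algebra_simps)
    thus ?thesis
      unfolding egap_def energy_density_def l_def k_def s_def snd_scaleR fst_scaleR snd_add fst_add by blast
  qed
  have Vs: "v0 / p * s \<le> V x / p * s" using V_ge[OF assms] p1 s0 by (intro mult_right_mono divide_right_mono) auto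
  have vs: "0 \<le> v0 / p * s" using v0 p1 s0 by simp
  have q: "0 \<le> l / p" "0 \<le> k / m" using l0 k0 p1 by auto
  show "0 \<le> egap x a b" using e q Vs vs by linarith
  have "l / p \<le> egap x a b" "k / m \<le> egap x a b" "v0 / p * s \<le> egap x a b" using e q Vs vs by linarith+
  thus "l \<le> p * egap x a b" "k \<le> m * egap x a b" "s \<le> p / v0 * egap x a b"
    using p1 v0 by (auto simp: field_simps)
qed

text \<open>Apply \<open>uniform_convexity\<close> to \<open>L\<close>, to \<open>M\<close> and to
  the p-th power on the real line. The constant does not depend on \<open>x\<close>, although
  \<open>V\<close> may be unbounded, because the potential term is only compared through
  \<open>v0\<close>.\<close>

lemma edens_uniform_convexity:
  assumes "\<epsilon> > 0"
  obtains C where "C > 0" "\<And>x a b. x \<in> \<Omega> \<Longrightarrow>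
    norm (snd a - snd b) powr p \<le> \<epsilon> * (edens x a + edens x b) + C * egap x a b \<and>
    norm (snd a - snd b) powr m \<le> \<epsilon> * (edens x a + edens x b) + C * egap x a b \<and>
    norm (fst a - fst b) powr p \<le> \<epsilon> * (edens x a + edens x b) + C * egap x a b"
proof -
  have e: "\<epsilon> / p > 0" "\<epsilon> / m > 0" "\<epsilon> / (p / v0) > 0" using assms p1 v0 by auto
  obtain C1 where C1: "C1 > 0" "\<And>a b. norm (a - b) powr p \<le> \<epsilon> / p * (L a + L b) + C1 * (L a / 2 + L b / 2 - L ((1/2) *\<^sub>R (a + b)))"
    using uniform_convexity[OF L_cont L_hom L_ge p1(2) p1(2) L_mid e(1)] by blast
  obtain C2 where C2: "C2 > 0" "\<And>a b. norm (a - b) powr m \<le> \<epsilon> / m * (M a + M b) + C2 * (M a / 2 + M b / 2 - M ((1/2) *\<^sub>R (a + b)))"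
    using uniform_convexity[OF M_cont M_hom M_ge p1(3) p1(3) M_mid e(2)] by blast
  have c: "continuous_on UNIV (\<lambda>t::real. \<bar>t\<bar> powr p)" using p1 by (intro continuous_on_powr' continuous_intros) auto
  have h: "\<bar>t *\<^sub>R x\<bar> powr p = t powr p * \<bar>x\<bar> powr p" if "0 < t" for t x :: real using that by (simp add: abs_mult powr_mult)
  have g: "1 * norm x powr p \<le> \<bar>x\<bar> powr p" for x :: real by simp
  obtain C3 where C3: "C3 > 0" "\<And>a b::real. norm (a - b) powr p \<le> \<epsilon> / (p / v0) * (\<bar>a\<bar> powr p + \<bar>b\<bar> powr p) + C3 * (\<bar>a\<bar> powr p / 2 + \<bar>b\<bar> powr p / 2 - \<bar>(1/2) *\<^sub>R (a + b)\<bar> powr p)"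
    using uniform_convexity[OF c h g zero_less_one p1(2) abs_powr_midpoint_strict[OF p1(1)] e(3)] by blast
  define C where "C = C1 * p + C2 * m + C3 * (p / v0)"
  have pos: "C1 * p > 0" "C2 * m > 0" "C3 * (p / v0) > 0" using C1 C2 C3 p1 v0 by simp_all
  have le: "C1 * p \<le> C" "C2 * m \<le> C" "C3 * (p / v0) \<le> C" unfolding C_def using pos by linarith+
  \<comment> \<open>Here \<open>r\<close> bounds the individual function by \<open>r\<close> times
    the density. Dividing \<epsilon> by it in advance gives all three estimates the same \<epsilon>,
    and \<open>C\<close> dominates the three gap constants.\<close>
  have combine: "T \<le> \<epsilon> * (edens x a + edens x b) + C * egap x a b"
    if T: "T \<le> \<epsilon> / r * (fa + fb) + D * g" and f: "fa \<le> r * edens x a" "fb \<le> r * edens x b" "g \<le> r * egap x a b"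
      and r: "0 < r" "0 < D" "D * r \<le> C" and x: "x \<in> \<Omega>" for T r fa fb D g x a b
  proof -
    have "\<epsilon> / r * (fa + fb) \<le> \<epsilon> / r * (r * edens x a + r * edens x b)"
      using f assms r by (intro mult_left_mono add_mono) auto
    also have "\<dots> = \<epsilon> * (edens x a + edens x b)" using r by (simp add: field_simps)
    finally have 1: "\<epsilon> / r * (fa + fb) \<le> \<epsilon> * (edens x a + edens x b)" .
    have "D * g \<le> D * (r * egap x a b)" using f r by (intro mult_left_mono) auto
    also have "\<dots> = D * r * egap x a b" by simp
    also have "\<dots> \<le> C * egap x a b" using r egap_parts(1)[OF x] by (intro mult_right_mono) auto
    finally show ?thesis using T 1 by linarith
  qed
  show thesis
  proof (rule that[of C])
    show "C > 0" using pos unfolding C_def by linarith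
    fix x :: "real^'n" and a b :: "real \<times> (real^'n)" assume x: "x \<in> \<Omega>"
    show "norm (snd a - snd b) powr p \<le> \<epsilon> * (edens x a + edens x b) + C * egap x a b \<and>
    norm (snd a - snd b) powr m \<le> \<epsilon> * (edens x a + edens x b) + C * egap x a b \<and>
    norm (fst a - fst b) powr p \<le> \<epsilon> * (edens x a + edens x b) + C * egap x a b"
      using combine[OF C1(2)[of "snd a" "snd b"] edens_parts(6)[OF x] edens_parts(6)[OF x] egap_parts(2)[OF x] p1(2) C1(1) le(1) x]
        combine[OF C2(2)[of "snd a" "snd b"] edens_parts(7)[OF x] edens_parts(7)[OF x] egap_parts(3)[OF x] p1(3) C2(1) le(2) x]
        combine[OF C3(2)[of "fst a" "fst b"] edens_parts(5)[OF x] edens_parts(5)[OF x] egap_parts(4)[OF x] _ C3(1) le(3) x]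
        p1 v0 by simp
  qed
qed

lemma edens_measurable:
  assumes "A \<in> sets lebesgue" "A \<subseteq> \<Omega>" "z \<in> borel_measurable lebesgue"
  shows "(\<lambda>x. edens x (z x)) \<in> borel_measurable (lebesgue_on A)"
proof -
  \<comment> \<open>\<open>V\<close> is only continuous on \<Omega>; its extension by zero is Borel
    because \<Omega> is open.\<close>
  have "(\<lambda>x. if x \<in> \<Omega> then V x else 0) \<in> borel_measurable borel"
    using borel_measurable_continuous_on_if[of \<Omega> V "\<lambda>_. 0"] open_\<Omega> V_cont by simp
  hence "(\<lambda>x. if x \<in> \<Omega> then V x else 0) \<in> borel_measurable (lebesgue_on A)"
    by (intro measurable_restrict_space1 measurable_completion) simp
  hence [measurable]: "V \<in> borel_measurable (lebesgue_on A)"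
    by (rule measurable_cong[THEN iffD1, rotated]) (use assms(2) in auto)
  have zA: "z \<in> borel_measurable (lebesgue_on A)" using assms(3) by (rule measurable_restrict_space1)
  note [measurable] = measurable_fst_comp[OF zA] measurable_snd_comp[OF zA]
  have [measurable]: "(\<lambda>x. L (snd (z x))) \<in> borel_measurable (lebesgue_on A)" "(\<lambda>x. M (snd (z x))) \<in> borel_measurable (lebesgue_on A)"
    using measurable_compose[OF measurable_snd_comp[OF zA] borel_measurable_continuous_onI[OF L_cont]]
      measurable_compose[OF measurable_snd_comp[OF zA] borel_measurable_continuous_onI[OF M_cont]] by auto
  show ?thesis unfolding energy_density_def by measurable
qed

lemma edens_continuous:
  assumes "(\<lambda>k. y k) \<longlonglongrightarrow> l"
  shows "(\<lambda>k. edens x (y k)) \<longlonglongrightarrow> edens x l"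
proof -
  have ab: "(\<lambda>k. L (snd (y k))) \<longlonglongrightarrow> L (snd l)" "(\<lambda>k. M (snd (y k))) \<longlonglongrightarrow> M (snd l)"
    using continuous_on_tendsto_compose[OF L_cont tendsto_snd[OF assms]] continuous_on_tendsto_compose[OF M_cont tendsto_snd[OF assms]] by auto
  have c: "(\<lambda>k. \<bar>fst (y k)\<bar> powr p) \<longlonglongrightarrow> \<bar>fst l\<bar> powr p"
    using p1 by (intro tendsto_powr2[OF tendsto_rabs[OF tendsto_fst[OF assms]] tendsto_const]) auto
  show ?thesis unfolding energy_density_def
    by (intro tendsto_add tendsto_divide tendsto_mult tendsto_const ab c) (use p1 in auto)
qed

text \<open>An additive form, free of subtraction in [0,\<infinity>], of the identity that
  integrates \<open>egap\<close>.\<close>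

lemma En_midpoint:
  assumes A: "A \<in> sets lebesgue" "A \<subseteq> \<Omega>" and z: "z \<in> borel_measurable lebesgue" "w \<in> borel_measurable lebesgue"
  shows "(\<integral>\<^sup>+x. ennreal (egap x (z x) (w x)) \<partial>lebesgue_on A) + En A (\<lambda>x. (1/2) *\<^sub>R (z x + w x)) = En A z / 2 + En A w / 2"
proof -
  have zw: "(\<lambda>x. (1/2) *\<^sub>R (z x + w x)) \<in> borel_measurable lebesgue" using z by measurable
  note [measurable] = edens_measurable[OF A z(1)] edens_measurable[OF A z(2)] edens_measurable[OF A zw]
  have [measurable]: "(\<lambda>x. egap x (z x) (w x)) \<in> borel_measurable (lebesgue_on A)" unfolding egap_def by measurable
  have "(\<integral>\<^sup>+x. ennreal (egap x (z x) (w x)) \<partial>lebesgue_on A) + En A (\<lambda>x. (1/2) *\<^sub>R (z x + w x)) =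
     (\<integral>\<^sup>+x. ennreal (egap x (z x) (w x)) + ennreal (edens x ((1/2) *\<^sub>R (z x + w x))) \<partial>lebesgue_on A)"
    unfolding pair_energy_def by (rule nn_integral_add[symmetric]) measurable
  also have "\<dots> = (\<integral>\<^sup>+x. ennreal (1/2) * (ennreal (edens x (z x)) + ennreal (edens x (w x))) \<partial>lebesgue_on A)"
  proof (rule nn_integral_cong)
    fix x assume "x \<in> space (lebesgue_on A)"
    hence x: "x \<in> \<Omega>" using A(2) by auto
    have "ennreal (egap x (z x) (w x)) + ennreal (edens x ((1/2) *\<^sub>R (z x + w x))) = ennreal (egap x (z x) (w x) + edens x ((1/2) *\<^sub>R (z x + w x)))"
      by (rule ennreal_plus[symmetric]) (use egap_parts(1)[OF x] edens_parts(1)[OF x] in auto)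
    also have "egap x (z x) (w x) + edens x ((1/2) *\<^sub>R (z x + w x)) = 1/2 * (edens x (z x) + edens x (w x))"
      by (simp add: egap_def)
    also have "ennreal (1/2 * (edens x (z x) + edens x (w x))) = ennreal (1/2) * (ennreal (edens x (z x)) + ennreal (edens x (w x)))"
      using edens_parts(1)[OF x] by (subst ennreal_mult) auto
    finally show "ennreal (egap x (z x) (w x)) + ennreal (edens x ((1/2) *\<^sub>R (z x + w x))) = ennreal (1/2) * (ennreal (edens x (z x)) + ennreal (edens x (w x)))" .
  qed
  also have "\<dots> = ennreal (1/2) * (En A z + En A w)"
    unfolding pair_energy_def by (subst nn_integral_cmult) (auto simp: nn_integral_add)
  also have "\<dots> = En A z / 2 + En A w / 2"
  proof -
    have "ennreal (1/2) = inverse 2" by (metis divide_ennreal_def divide_numeral_1 ennreal_divide_numeral ennreal_1 mult_1 zero_le_one)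
    thus ?thesis by (simp add: distrib_left divide_ennreal_def mult.commute)
  qed
  finally show ?thesis .
qed

lemma En_midpoint_le:
  assumes "A \<in> sets lebesgue" "A \<subseteq> \<Omega>" "z \<in> borel_measurable lebesgue" "w \<in> borel_measurable lebesgue"
    and "En A z \<le> b" "En A w \<le> b"
  shows "En A (\<lambda>x. (1/2) *\<^sub>R (z x + w x)) \<le> b"
proof -
  have "En A (\<lambda>x. (1/2) *\<^sub>R (z x + w x)) \<le> En A z / 2 + En A w / 2"
    unfolding En_midpoint[OF assms(1-4), symmetric] by simp
  also have "\<dots> \<le> b / 2 + b / 2" by (intro add_mono divide_right_mono_ennreal assms)
  also have "\<dots> = b" by (cases b rule: ennreal_cases)
      (auto simp: ennreal_divide_numeral ennreal_plus[symmetric] ennreal_top_divide simp del: ennreal_plus)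
  finally show ?thesis .
qed

text \<open>Coercivity, the source of the Sobolev bounds along a minimizing sequence.\<close>

lemma En_bounds:
  assumes z: "z \<in> borel_measurable lebesgue" "\<And>x. x \<notin> \<Omega> \<Longrightarrow> z x = 0"
  shows "Npow p lebesgue (\<lambda>x. snd (z x)) \<le> En \<Omega> z" "Npow m lebesgue (\<lambda>x. snd (z x)) \<le> En \<Omega> z"
    "Npow p lebesgue (\<lambda>x. fst (z x)) \<le> ennreal (p / v0) * En \<Omega> z"
proof -
  have e: "Npow q lebesgue (\<lambda>x. snd (z x)) = Npow q (lebesgue_on \<Omega>) (\<lambda>x. snd (z x))"
    "Npow q lebesgue (\<lambda>x. fst (z x)) = Npow q (lebesgue_on \<Omega>) (\<lambda>x. fst (z x))" for q
    using z(2) by (auto intro!: Npow_supported[OF \<Omega>_sets, symmetric])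
  show "Npow p lebesgue (\<lambda>x. snd (z x)) \<le> En \<Omega> z" "Npow m lebesgue (\<lambda>x. snd (z x)) \<le> En \<Omega> z"
    unfolding e unfolding Npow_def pair_energy_def
    by (rule nn_integral_mono, rule ennreal_leI, use edens_parts in simp)+
  have "ennreal (p / v0) * En \<Omega> z = (\<integral>\<^sup>+x. ennreal (p / v0) * ennreal (edens x (z x)) \<partial>lebesgue_on \<Omega>)"
    unfolding pair_energy_def using edens_measurable[OF \<Omega>_sets order_refl z(1)] by (intro nn_integral_cmult[symmetric]) measurable
  moreover have "Npow p (lebesgue_on \<Omega>) (\<lambda>x. fst (z x)) \<le> (\<integral>\<^sup>+x. ennreal (p / v0) * ennreal (edens x (z x)) \<partial>lebesgue_on \<Omega>)"
    unfolding Npow_def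
  proof (rule nn_integral_mono)
    fix x assume "x \<in> space (lebesgue_on \<Omega>)"
    hence x: "x \<in> \<Omega>" by simp
    have "ennreal (norm (fst (z x)) powr p) \<le> ennreal (p / v0 * edens x (z x))"
      using edens_parts(5)[OF x, of "z x"] by (intro ennreal_leI) simp
    also have "\<dots> = ennreal (p / v0) * ennreal (edens x (z x))" using p1 v0 edens_parts(1)[OF x] by (intro ennreal_mult) auto
    finally show "ennreal (norm (fst (z x)) powr p) \<le> ennreal (p / v0) * ennreal (edens x (z x))" .
  qed
  ultimately show "Npow p lebesgue (\<lambda>x. fst (z x)) \<le> ennreal (p / v0) * En \<Omega> z" unfolding e by simp
qed

end

lemma ennreal_twice_half: "0 \<le> e1 \<Longrightarrow> 0 \<le> e2 \<Longrightarrow> ennreal e1 / 2 + ennreal e2 / 2 = ennreal (e1 / 2 + e2 / 2)"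
  by (simp add: ennreal_divide_numeral ennreal_plus[symmetric] del: ennreal_plus)

context minimization_setup
begin

lemma wpair_measurable: "wpair p m \<Omega> z \<Longrightarrow> z \<in> borel_measurable lebesgue"
  and wpair_outside: "wpair p m \<Omega> z \<Longrightarrow> x \<notin> \<Omega> \<Longrightarrow> z x = 0"
  by (auto simp: wpair_def)

lemma midhull_wpair:
  assumes "\<And>k. wpair p m \<Omega> (z k)" "f \<in> midhull z n"
  shows "wpair p m \<Omega> f"
  using assms(2) by induction (use assms(1) wpair_midpoint p1 m1 in auto)

lemma midhull_En_le:
  assumes z: "\<And>k. wpair p m \<Omega> (z k)" and A: "A \<in> sets lebesgue" "A \<subseteq> \<Omega>"
    and b: "\<And>k. n \<le> k \<Longrightarrow> En A (z k) \<le> b" and f: "f \<in> midhull z n"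
  shows "En A f \<le> b"
  using f
proof induction
  case (base k)
  thus ?case by (rule b)
next
  case (mid f g)
  show ?case
    by (rule En_midpoint_le[OF A wpair_measurable[OF midhull_wpair[OF z mid.hyps(1)]] wpair_measurable[OF midhull_wpair[OF z mid.hyps(2)]] mid.IH])
qed

lemma difference_bound:
  assumes z: "z \<in> borel_measurable lebesgue" "w \<in> borel_measurable lebesgue"
    and K: "\<And>x. x \<in> \<Omega> \<Longrightarrow> K x \<le> \<epsilon> * (edens x (z x) + edens x (w x)) + C * egap x (z x) (w x)" "0 \<le> \<epsilon>" "0 \<le> C"
  shows "(\<integral>\<^sup>+x. ennreal (K x) \<partial>lebesgue_on \<Omega>) \<le>
    ennreal \<epsilon> * (En \<Omega> z + En \<Omega> w) + ennreal C * (\<integral>\<^sup>+x. ennreal (egap x (z x) (w x)) \<partial>lebesgue_on \<Omega>)"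
proof -
  have zw: "(\<lambda>x. (1/2) *\<^sub>R (z x + w x)) \<in> borel_measurable lebesgue" using z by measurable
  note [measurable] = edens_measurable[OF \<Omega>_sets order_refl z(1)] edens_measurable[OF \<Omega>_sets order_refl z(2)]
    edens_measurable[OF \<Omega>_sets order_refl zw]
  have [measurable]: "(\<lambda>x. egap x (z x) (w x)) \<in> borel_measurable (lebesgue_on \<Omega>)" unfolding egap_def by measurable
  have "(\<integral>\<^sup>+x. ennreal (K x) \<partial>lebesgue_on \<Omega>) \<le>
    (\<integral>\<^sup>+x. ennreal \<epsilon> * (ennreal (edens x (z x)) + ennreal (edens x (w x))) + ennreal C * ennreal (egap x (z x) (w x)) \<partial>lebesgue_on \<Omega>)"
  proof (rule nn_integral_mono)
    fix x assume "x \<in> space (lebesgue_on \<Omega>)"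
    hence x: "x \<in> \<Omega>" by simp
    have "ennreal (K x) \<le> ennreal (\<epsilon> * (edens x (z x) + edens x (w x)) + C * egap x (z x) (w x))"
      by (rule ennreal_leI[OF K(1)[OF x]])
    also have "\<dots> = ennreal (\<epsilon> * (edens x (z x) + edens x (w x))) + ennreal (C * egap x (z x) (w x))"
      using edens_parts(1)[OF x] egap_parts(1)[OF x] K by (intro ennreal_plus) auto
    also have "ennreal (\<epsilon> * (edens x (z x) + edens x (w x))) = ennreal \<epsilon> * (ennreal (edens x (z x)) + ennreal (edens x (w x)))"
      using edens_parts(1)[OF x] K by (subst ennreal_mult) auto
    also have "ennreal (C * egap x (z x) (w x)) = ennreal C * ennreal (egap x (z x) (w x))"
      using egap_parts(1)[OF x] K by (intro ennreal_mult) auto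
    finally show "ennreal (K x) \<le> ennreal \<epsilon> * (ennreal (edens x (z x)) + ennreal (edens x (w x))) + ennreal C * ennreal (egap x (z x) (w x))" .
  qed
  also have "\<dots> = ennreal \<epsilon> * (En \<Omega> z + En \<Omega> w) + ennreal C * (\<integral>\<^sup>+x. ennreal (egap x (z x) (w x)) \<partial>lebesgue_on \<Omega>)"
    unfolding pair_energy_def by (simp add: nn_integral_add nn_integral_cmult)
  finally show ?thesis .
qed

text \<open>For almost minimal hull elements the integrated \<open>egap\<close> is small, and
  \<open>edens_uniform_convexity\<close> converts this into the Cauchy property: in L^p for function
  and gradient, and in L^m for the gradient. The limit stays in the completion by
  \<open>wpair_closed\<close>.\<close>

proposition minimizing_limit:
  assumes z: "\<And>k. wpair p m \<Omega> (z k)" and B: "\<And>k. En \<Omega> (z k) \<le> ennreal B" "0 \<le> B"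
  shows "\<exists>y w r. wpair p m \<Omega> y \<and> (\<forall>n. w n \<in> midhull z n) \<and> (\<lambda>n. Npow p lebesgue (\<lambda>x. y x - w n x)) \<longlonglongrightarrow> 0 \<and>
    strict_mono (r :: nat \<Rightarrow> nat) \<and> (AE x in lebesgue. (\<lambda>k. w (r k) x) \<longlonglongrightarrow> y x)"
proof -
  define E where "E = (\<lambda>f. enn2real (En \<Omega> f))"
  have EB: "En \<Omega> f \<le> ennreal B" if "f \<in> midhull z 0" for f by (rule midhull_En_le[OF z \<Omega>_sets order_refl B(1) that])
  have E2: "En \<Omega> f = ennreal (E f)" "0 \<le> E f" "E f \<le> B" if f: "f \<in> midhull z 0" for f
  proof -
    have "En \<Omega> f < top" using EB[OF f] by (rule le_less_trans) simp
    thus "En \<Omega> f = ennreal (E f)" by (simp add: E_def)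
    show "0 \<le> E f" by (simp add: E_def)
    show "E f \<le> B" unfolding E_def using EB[OF f] B(2) by (rule enn2real_leI[rotated])
  qed
  obtain w where w: "\<And>n. w n \<in> midhull z n"
    and gap: "\<And>\<delta>. \<delta> > 0 \<Longrightarrow> \<exists>n0. \<forall>i\<ge>n0. \<forall>j\<ge>n0. E (w i) / 2 + E (w j) / 2 - E (\<lambda>x. (1/2) *\<^sub>R (w i x + w j x)) \<le> \<delta>"
    using midhull_almost_minimal[of z E B] E2(2,3) by blast
  have w0: "w n \<in> midhull z 0" for n using midhull_antimono[OF w] by simp
  have ww: "wpair p m \<Omega> (w n)" for n by (rule midhull_wpair[OF z w])
  note wm = wpair_measurable[OF ww] and wo = wpair_outside[OF ww]
  \<comment> \<open>Subtracting the midpoint energy in \<open>En_midpoint\<close> is legitimate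
    because energies on the hull are bounded by \<open>B\<close>, hence finite.\<close>
  have gapint: "\<exists>n0. \<forall>i\<ge>n0. \<forall>j\<ge>n0. (\<integral>\<^sup>+x. ennreal (egap x (w i x) (w j x)) \<partial>lebesgue_on \<Omega>) \<le> ennreal \<delta>" if \<delta>: "\<delta> > 0" for \<delta>
  proof -
    obtain n0 where n0: "\<forall>i\<ge>n0. \<forall>j\<ge>n0. E (w i) / 2 + E (w j) / 2 - E (\<lambda>x. (1/2) *\<^sub>R (w i x + w j x)) \<le> \<delta>" using gap[OF \<delta>] by blast
    have "(\<integral>\<^sup>+x. ennreal (egap x (w i x) (w j x)) \<partial>lebesgue_on \<Omega>) \<le> ennreal \<delta>" if ij: "i \<ge> n0" "j \<ge> n0" for i j
    proof -
      let ?f = "\<lambda>x. (1/2) *\<^sub>R (w i x + w j x)" and ?X = "\<integral>\<^sup>+x. ennreal (egap x (w i x) (w j x)) \<partial>lebesgue_on \<Omega>"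
      have f: "?f \<in> midhull z 0" by (rule midhull.mid[OF w0 w0])
      have "?X + ennreal (E ?f) = ennreal (E (w i) / 2 + E (w j) / 2)"
        using En_midpoint[OF \<Omega>_sets order_refl wm wm, of i j] unfolding E2(1)[OF f] E2(1)[OF w0]
        using ennreal_twice_half[OF E2(2)[OF w0] E2(2)[OF w0]] by simp
      also have "\<dots> \<le> ennreal (\<delta> + E ?f)" using n0 ij by (intro ennreal_leI) (simp add: algebra_simps)
      also have "\<dots> = ennreal \<delta> + ennreal (E ?f)" using \<delta> E2(2)[OF f] by (intro ennreal_plus) auto
      finally have "ennreal (E ?f) + ?X \<le> ennreal (E ?f) + ennreal \<delta>" by (simp only: add.commute)
      thus ?thesis unfolding ennreal_add_left_cancel_le by simp
    qed
    thus ?thesis by blast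
  qed
  have cau: "\<exists>n0. \<forall>i\<ge>n0. \<forall>j\<ge>n0. Npow p lebesgue (\<lambda>x. snd (w i x) - snd (w j x)) \<le> ennreal \<delta> \<and>
      Npow m lebesgue (\<lambda>x. snd (w i x) - snd (w j x)) \<le> ennreal \<delta> \<and> Npow p lebesgue (\<lambda>x. fst (w i x) - fst (w j x)) \<le> ennreal \<delta>"
    if \<delta>: "\<delta> > 0" for \<delta>
  proof -
    \<comment> \<open>The two energies sum to at most 2 B, so the \<epsilon>-term costs at most
      \<delta>/2; \<open>B + 1\<close> covers the case \<open>B = 0\<close>.\<close>
    define \<epsilon> where "\<epsilon> = \<delta> / (4 * (B + 1))"
    have \<epsilon>: "\<epsilon> > 0" "\<epsilon> * (B + B) \<le> \<delta> / 2"
    proof -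
      show e: "\<epsilon> > 0" unfolding \<epsilon>_def using \<delta> B(2) by simp
      have "\<epsilon> * (B + B) \<le> \<epsilon> * (2 * (B + 1))" using e by (intro mult_left_mono) auto
      also have "\<dots> = \<delta> / 2" unfolding \<epsilon>_def using B(2) by (simp add: field_simps)
      finally show "\<epsilon> * (B + B) \<le> \<delta> / 2" .
    qed
    obtain C where C: "C > 0" "\<And>x a b. x \<in> \<Omega> \<Longrightarrow>
      norm (snd a - snd b) powr p \<le> \<epsilon> * (edens x a + edens x b) + C * egap x a b \<and>
      norm (snd a - snd b) powr m \<le> \<epsilon> * (edens x a + edens x b) + C * egap x a b \<and>
      norm (fst a - fst b) powr p \<le> \<epsilon> * (edens x a + edens x b) + C * egap x a b"
      by (rule edens_uniform_convexity[OF \<epsilon>(1)]) blast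
    have "\<delta> / 2 / C > 0" using \<delta> C(1) by simp
    from gapint[OF this] obtain n0 where n0: "\<forall>i\<ge>n0. \<forall>j\<ge>n0. (\<integral>\<^sup>+x. ennreal (egap x (w i x) (w j x)) \<partial>lebesgue_on \<Omega>) \<le> ennreal (\<delta> / 2 / C)"
      by blast
    show ?thesis
    proof (intro exI allI impI)
      fix i j assume ij: "i \<ge> n0" "j \<ge> n0"
      have key: "(\<integral>\<^sup>+x. ennreal (K x) \<partial>lebesgue_on \<Omega>) \<le> ennreal \<delta>"
        if K: "\<And>x. x \<in> \<Omega> \<Longrightarrow> K x \<le> \<epsilon> * (edens x (w i x) + edens x (w j x)) + C * egap x (w i x) (w j x)" for K
      proof -
        have "(\<integral>\<^sup>+x. ennreal (K x) \<partial>lebesgue_on \<Omega>) \<le>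
          ennreal \<epsilon> * (En \<Omega> (w i) + En \<Omega> (w j)) + ennreal C * (\<integral>\<^sup>+x. ennreal (egap x (w i x) (w j x)) \<partial>lebesgue_on \<Omega>)"
          by (rule difference_bound[OF wm wm K]) (use \<epsilon>(1) C(1) in auto)
        also have "\<dots> \<le> ennreal \<epsilon> * (ennreal B + ennreal B) + ennreal C * ennreal (\<delta> / 2 / C)"
          using n0 ij by (intro add_mono mult_left_mono EB[OF w0]) auto
        also have "\<dots> = ennreal (\<epsilon> * (B + B) + C * (\<delta> / 2 / C))"
          using \<epsilon>(1) B(2) C(1) \<delta> by (simp add: ennreal_mult[symmetric] ennreal_plus[symmetric] del: ennreal_plus)
        also have "\<dots> \<le> ennreal \<delta>" using \<epsilon>(2) C(1) by (intro ennreal_leI) simp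
        finally show ?thesis .
      qed
      have sup: "Npow q lebesgue (\<lambda>x. snd (w i x) - snd (w j x)) = (\<integral>\<^sup>+x. ennreal (norm (snd (w i x) - snd (w j x)) powr q) \<partial>lebesgue_on \<Omega>)"
        "Npow q lebesgue (\<lambda>x. fst (w i x) - fst (w j x)) = (\<integral>\<^sup>+x. ennreal (norm (fst (w i x) - fst (w j x)) powr q) \<partial>lebesgue_on \<Omega>)" for q
        unfolding Npow_def[of q "lebesgue_on \<Omega>", symmetric]
        by (rule Npow_supported[OF \<Omega>_sets, symmetric], simp add: wo)+
      show "Npow p lebesgue (\<lambda>x. snd (w i x) - snd (w j x)) \<le> ennreal \<delta> \<and>
        Npow m lebesgue (\<lambda>x. snd (w i x) - snd (w j x)) \<le> ennreal \<delta> \<and> Npow p lebesgue (\<lambda>x. fst (w i x) - fst (w j x)) \<le> ennreal \<delta>"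
        unfolding sup by (intro conjI key) (use C(2) in blast)+
    qed
  qed
  have cp: "\<exists>n0. \<forall>i\<ge>n0. \<forall>j\<ge>n0. Npow p lebesgue (\<lambda>x. w i x - w j x) \<le> ennreal \<delta>" if \<delta>: "\<delta> > 0" for \<delta>
  proof -
    have "\<delta> / (2 * 2 powr p) > 0" using \<delta> by simp
    from cau[OF this] obtain n0 where n0: "\<forall>i\<ge>n0. \<forall>j\<ge>n0. Npow p lebesgue (\<lambda>x. snd (w i x) - snd (w j x)) \<le> ennreal (\<delta> / (2 * 2 powr p)) \<and>
      Npow m lebesgue (\<lambda>x. snd (w i x) - snd (w j x)) \<le> ennreal (\<delta> / (2 * 2 powr p)) \<and> Npow p lebesgue (\<lambda>x. fst (w i x) - fst (w j x)) \<le> ennreal (\<delta> / (2 * 2 powr p))" by blast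
    show ?thesis
    proof (intro exI allI impI)
      fix i j assume ij: "i \<ge> n0" "j \<ge> n0"
      have "Npow p lebesgue (\<lambda>x. w i x - w j x) = Npow p lebesgue (\<lambda>x. (fst (w i x) - fst (w j x), snd (w i x) - snd (w j x)))"
        by (rule Npow_cong) (simp add: prod_eq_iff)
      also have "\<dots> \<le> ennreal (2 powr p) * (Npow p lebesgue (\<lambda>x. fst (w i x) - fst (w j x)) + Npow p lebesgue (\<lambda>x. snd (w i x) - snd (w j x)))"
        by (rule Npow_pair_le[OF borel_measurable_diff[OF measurable_fst_comp[OF wm] measurable_fst_comp[OF wm]]
              borel_measurable_diff[OF measurable_snd_comp[OF wm] measurable_snd_comp[OF wm]] p1(2)])
      also have "\<dots> \<le> ennreal (2 powr p) * (ennreal (\<delta> / (2 * 2 powr p)) + ennreal (\<delta> / (2 * 2 powr p)))"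
        using n0 ij by (intro mult_left_mono add_mono) auto
      also have "\<dots> = ennreal (2 powr p * (\<delta> / (2 * 2 powr p) + \<delta> / (2 * 2 powr p)))"
        using \<delta> by (simp add: ennreal_mult[symmetric] ennreal_plus[symmetric] del: ennreal_plus)
      also have "2 powr p * (\<delta> / (2 * 2 powr p) + \<delta> / (2 * 2 powr p)) = \<delta>" by (simp add: field_simps)
      finally show "Npow p lebesgue (\<lambda>x. w i x - w j x) \<le> ennreal \<delta>" .
    qed
  qed
  have cm: "\<exists>n0. \<forall>i\<ge>n0. \<forall>j\<ge>n0. Npow m lebesgue (\<lambda>x. snd (w i x) - snd (w j x)) \<le> ennreal \<delta>" if "\<delta> > 0" for \<delta>
    using cau[OF that] by blast
  obtain r g where r: "strict_mono r" and g: "g \<in> borel_measurable lebesgue" and AE: "AE x in lebesgue. (\<lambda>k. w (r k) x) \<longlonglongrightarrow> g x"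
    using Npow_Cauchy_AE_subseq[OF wm p1(2) cp] by blast
  \<comment> \<open>The limit \<open>g\<close> is determined only up to a null set, while a
    \<open>wpair\<close> must vanish at every point outside \<Omega>.\<close>
  define y where "y = (\<lambda>x. indicator \<Omega> x *\<^sub>R g x)"
  have ym: "y \<in> borel_measurable lebesgue" unfolding y_def
    by (rule borel_measurable_scaleR[OF borel_measurable_indicator[OF \<Omega>_sets] g])
  have AEy: "AE x in lebesgue. (\<lambda>k. w (r k) x) \<longlonglongrightarrow> y x"
    using AE by eventually_elim (auto simp: y_def indicator_def wo)
  have l1: "(\<lambda>n. Npow p lebesgue (\<lambda>x. y x - w n x)) \<longlonglongrightarrow> 0"
    by (rule Npow_Cauchy_limit[OF wm p1(2) cp r AEy])
  have AEs: "AE x in lebesgue. (\<lambda>k. snd (w (r k) x)) \<longlonglongrightarrow> snd (y x)"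
    using AEy by eventually_elim (rule tendsto_snd)
  have l2: "(\<lambda>n. Npow m lebesgue (\<lambda>x. snd (y x) - snd (w n x))) \<longlonglongrightarrow> 0"
    by (rule Npow_Cauchy_limit[OF measurable_snd_comp[OF wm] p1(3) cm r AEs])
  have "wpair p m \<Omega> y"
    by (rule wpair_closed[OF ww ym _ p1(2,3) l1 l2]) (simp add: y_def)
  thus ?thesis using w l1 r AEy by blast
qed

text \<open>A bound on \<open>A\<close> that holds along a tail of \<open>z\<close> passes to the
  hull of that tail by convexity, and to \<open>y\<close> by Fatou. The sequence \<open>w\<close>
  was chosen for the energy on \<Omega>, but only its membership in the tail hulls is used, so
  \<open>A\<close> is arbitrary.\<close>

lemma En_lower_semicontinuous:
  assumes z: "\<And>k. wpair p m \<Omega> (z k)" and w: "\<And>n. w n \<in> midhull z n" and r: "strict_mono (r :: nat \<Rightarrow> nat)"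
    and AE: "AE x in lebesgue. (\<lambda>k. w (r k) x) \<longlonglongrightarrow> y x" and A: "A \<in> sets lebesgue" "A \<subseteq> \<Omega>"
    and b: "\<forall>\<^sub>F k in sequentially. En A (z k) \<le> b"
  shows "En A y \<le> b"
proof -
  obtain n where n: "\<And>k. n \<le> k \<Longrightarrow> En A (z k) \<le> b" using b unfolding eventually_sequentially by blast
  have wm: "w k \<in> borel_measurable lebesgue" for k by (rule wpair_measurable[OF midhull_wpair[OF z w]])
  show ?thesis unfolding pair_energy_def
  proof (rule nn_integral_AE_limit_le[where f = "\<lambda>k x. edens x (w (r (k + n)) x)"])
    show "(\<lambda>x. edens x (w (r (k + n)) x)) \<in> borel_measurable (lebesgue_on A)" for k
      by (rule edens_measurable[OF A wm])
    have "AE x in lebesgue. x \<in> A \<longrightarrow> (\<lambda>k. edens x (w (r (k + n)) x)) \<longlonglongrightarrow> edens x (y x)"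
      using AE by eventually_elim (intro impI edens_continuous LIMSEQ_ignore_initial_segment[where f = "\<lambda>k. w (r k) _"])
    thus "AE x in lebesgue_on A. (\<lambda>k. edens x (w (r (k + n)) x)) \<longlonglongrightarrow> edens x (y x)"
      unfolding AE_lebesgue_on[OF A(1)] .
    show "(\<integral>\<^sup>+x. ennreal (edens x (w (r (k + n)) x)) \<partial>lebesgue_on A) \<le> b" for k
    proof -
      have "n \<le> r (k + n)" using seq_suble[OF r, of "k + n"] by simp
      from midhull_En_le[OF z A n midhull_antimono[OF w this]] show ?thesis by (simp add: pair_energy_def)
    qed
  qed
qed

text \<open>On a ball the first components of the late \<open>z k\<close> are close to one another,
  hence close to those of every element of the tail hull, in particular of \<open>w n\<close>, which
  in turn is close to \<open>y\<close>. So the local limit of \<open>z\<close> is \<open>y\<close>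
  and not some other function.\<close>

lemma local_limit:
  assumes z: "\<And>k. wpair p m \<Omega> (z k)" and w: "\<And>n. w n \<in> midhull z n" and y: "y \<in> borel_measurable lebesgue"
    and l: "(\<lambda>n. Npow p lebesgue (\<lambda>x. y x - w n x)) \<longlonglongrightarrow> 0"
    and cau: "\<And>\<delta>. \<delta> > 0 \<Longrightarrow> \<exists>n0. \<forall>i\<ge>n0. \<forall>j\<ge>n0. Npow p (lebesgue_on (cball 0 R)) (\<lambda>x. fst (z i x) - fst (z j x)) \<le> ennreal \<delta>"
  shows "(\<lambda>k. Npow p (lebesgue_on (cball 0 R)) (\<lambda>x. fst (z k x) - fst (y x))) \<longlonglongrightarrow> 0"
proof (rule tendsto_0_if_eventually_le)
  let ?M = "lebesgue_on (cball (0::real^'n) R)"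
  fix \<delta> :: real assume \<delta>: "\<delta> > 0"
  define \<eta> where "\<eta> = \<delta> / (2 * 2 powr p)"
  have \<eta>: "\<eta> > 0" "2 powr p * (\<eta> + \<eta>) = \<delta>" unfolding \<eta>_def using \<delta> by (auto simp: field_simps)
  obtain n0 where n0: "\<And>i j. i \<ge> n0 \<Longrightarrow> j \<ge> n0 \<Longrightarrow> Npow p ?M (\<lambda>x. fst (z i x) - fst (z j x)) \<le> ennreal \<eta>" using cau[OF \<eta>(1)] by blast
  have mM: "(\<lambda>x. fst (f x)) \<in> borel_measurable ?M" if "f \<in> borel_measurable lebesgue" for f :: "real^'n \<Rightarrow> real \<times> (real^'n)"
    by (rule measurable_restrict_space1[OF measurable_fst_comp[OF that]])
  note zM = mM[OF wpair_measurable[OF z]]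
  have hull: "Npow p ?M (\<lambda>x. fst (f x) - fst (z k x)) \<le> ennreal \<eta>" if f: "f \<in> midhull z n0" and k: "k \<ge> n0" for f k
    using f
  proof induction
    case (base i)
    thus ?case using n0 k by blast
  next
    case (mid f g)
    have "Npow p ?M (\<lambda>x. fst ((1/2) *\<^sub>R (f x + g x)) - fst (z k x)) = Npow p ?M (\<lambda>x. (1/2) *\<^sub>R ((fst (f x) - fst (z k x)) + (fst (g x) - fst (z k x))))"
      by (rule Npow_cong) (simp add: algebra_simps)
    also have "\<dots> \<le> ennreal \<eta>"
      by (rule Npow_midpoint[OF borel_measurable_diff[OF mM[OF wpair_measurable[OF midhull_wpair[OF z mid.hyps(1)]]] zM]
            borel_measurable_diff[OF mM[OF wpair_measurable[OF midhull_wpair[OF z mid.hyps(2)]]] zM] p1(1) mid.IH])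
    finally show ?case .
  qed
  have "\<forall>\<^sub>F n in sequentially. Npow p lebesgue (\<lambda>x. y x - w n x) < ennreal \<eta>"
    using \<eta>(1) by (intro order_tendstoD(2)[OF l]) simp
  then obtain n1 where n1: "\<And>n. n \<ge> n1 \<Longrightarrow> Npow p lebesgue (\<lambda>x. y x - w n x) < ennreal \<eta>" unfolding eventually_sequentially by blast
  define n where "n = max n0 n1"
  have wm: "w n \<in> borel_measurable lebesgue" by (rule wpair_measurable[OF midhull_wpair[OF z w]])
  have "Npow p ?M (\<lambda>x. fst (y x) - fst (w n x)) \<le> Npow p lebesgue (\<lambda>x. fst (y x) - fst (w n x))" by (rule Npow_restrict_le) simp
  also have "\<dots> \<le> Npow p lebesgue (\<lambda>x. y x - w n x)" using Npow_fst_le[of p lebesgue "\<lambda>x. y x - w n x"] p1 by simp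
  also have "\<dots> \<le> ennreal \<eta>" using n1[of n] by (simp add: n_def)
  finally have 1: "Npow p ?M (\<lambda>x. fst (y x) - fst (w n x)) \<le> ennreal \<eta>" .
  have "Npow p ?M (\<lambda>x. fst (z k x) - fst (y x)) \<le> ennreal \<delta>" if k: "k \<ge> n0" for k
  proof -
    have 2: "Npow p ?M (\<lambda>x. fst (w n x) - fst (z k x)) \<le> ennreal \<eta>"
      by (rule hull[OF midhull_antimono[OF w] k]) (simp add: n_def)
    have "Npow p ?M (\<lambda>x. fst (y x) - fst (z k x)) \<le> ennreal (2 powr p * (\<eta> + \<eta>))"
      by (rule Npow_triangle_real[OF mM[OF y] mM[OF wm] zM p1(2) 1 2]) (use \<eta>(1) in auto)
    thus ?thesis unfolding \<eta>(2) by (simp add: Npow_commute[of p ?M "\<lambda>x. fst (y x)"])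
  qed
  thus "\<forall>\<^sub>F k in sequentially. Npow p ?M (\<lambda>x. fst (z k x) - fst (y x)) \<le> ennreal \<delta>"
    unfolding eventually_sequentially by blast
qed

end

text \<open>Replace each \<open>z k\<close> by a C^1 function within 1/(k+1); the errors are
  negligible for late indices.\<close>

lemma rellich_sob0:
  fixes z :: "nat \<Rightarrow> real^'n \<Rightarrow> real \<times> (real^'n)"
  assumes p: "1 < p" and z: "\<And>k. sob0 p (z k)" and K: "\<And>k. Npow p lebesgue (z k) \<le> ennreal K" "0 \<le> K"
  shows "\<exists>r :: nat \<Rightarrow> nat. strict_mono r \<and> (\<forall>R \<delta>. \<delta> > 0 \<longrightarrow> (\<exists>n0. \<forall>i\<ge>n0. \<forall>j\<ge>n0.
     Npow p (lebesgue_on (cball 0 R)) (\<lambda>x. fst (z (r i) x) - fst (z (r j) x)) \<le> ennreal \<delta>))"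
proof -
  have p0: "0 < p" using p by simp
  have zm: "z k \<in> borel_measurable lebesgue" for k using z[of k] by (simp add: sob0_def)
  have "\<exists>f. f \<in> C1c \<and> Npow p lebesgue (\<lambda>x. z k x - jet f x) < ennreal (inverse (real (Suc k)))" for k
  proof -
    obtain f where f: "\<And>i::nat. f i \<in> C1c" and l: "(\<lambda>i. Npow p lebesgue (\<lambda>x. z k x - jet (f i) x)) \<longlonglongrightarrow> 0"
      using z[of k] unfolding sob0_def by blast
    have "\<forall>\<^sub>F i in sequentially. Npow p lebesgue (\<lambda>x. z k x - jet (f i) x) < ennreal (inverse (real (Suc k)))"
      by (rule order_tendstoD(2)[OF l]) simp
    then obtain i where "Npow p lebesgue (\<lambda>x. z k x - jet (f i) x) < ennreal (inverse (real (Suc k)))"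
      using eventually_happens'[OF sequentially_bot] by blast
    thus ?thesis using f by blast
  qed
  then obtain f where f: "\<And>k. f k \<in> C1c" and zf: "\<And>k. Npow p lebesgue (\<lambda>x. z k x - jet (f k) x) < ennreal (inverse (real (Suc k)))"
    using choice[OF allI, of "\<lambda>k f. f \<in> C1c \<and> Npow p lebesgue (\<lambda>x. z k x - jet f x) < ennreal (inverse (real (Suc k)))"] by blast
  note fm = C1_measurable_lebesgue[OF C1c_C1[OF f]]
  define K' where "K' = 2 powr p * (1 + K)"
  have K'0: "0 \<le> K'" unfolding K'_def using K(2) by simp
  have jK: "Npow p lebesgue (jet (f k)) \<le> ennreal K'" for k
  proof -
    have "Npow p lebesgue (\<lambda>x. jet (f k) x - z k x) \<le> ennreal 1"
      using zf[of k] by (subst Npow_commute) (auto intro!: order_trans[OF less_imp_le[OF zf[of k]]] ennreal_leI simp: inverse_le_1_iff simp del: ennreal_1)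
    moreover have "Npow p lebesgue (\<lambda>x. z k x - 0) \<le> ennreal K" using K(1) by simp
    ultimately have "Npow p lebesgue (\<lambda>x. jet (f k) x - 0) \<le> ennreal (2 powr p * (1 + K))"
      by (rule Npow_triangle_real[OF fm(3) zm borel_measurable_const p0]) (use K(2) in auto)
    thus ?thesis by (simp add: K'_def)
  qed
  have fK: "Npow p lebesgue (f k) \<le> ennreal K'" "Npow p lebesgue (grad (f k)) \<le> ennreal K'" for k
    using Npow_fst_le[of p lebesgue "jet (f k)"] Npow_snd_le[of p lebesgue "jet (f k)"] jK[of k] p0
    by (auto simp: jet_def intro: order_trans)
  obtain r :: "nat \<Rightarrow> nat" where r: "strict_mono r"
    and rc: "\<forall>R \<delta>. \<delta> > 0 \<longrightarrow> (\<exists>n0. \<forall>i\<ge>n0. \<forall>j\<ge>n0. Npow p (lebesgue_on (cball 0 R)) (\<lambda>x. f (r i) x - f (r j) x) \<le> ennreal \<delta>)"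
    using rellich_C1c[where f = f, OF f p fK K'0] by blast
  show ?thesis
  proof (intro exI[of _ r] conjI r allI impI)
    fix R \<delta> :: real assume \<delta>: "\<delta> > 0"
    let ?M = "lebesgue_on (cball (0::real^'n) R)"
    define T where "T = (2::real) powr p"
    have T: "T > 0" unfolding T_def by simp
    define \<eta> where "\<eta> = \<delta> / (T + T * T * 2)"
    have den: "T + T * T * 2 > 0" using T by (intro add_pos_pos mult_pos_pos) auto
    have \<eta>: "\<eta> > 0" "T * (\<eta> + T * (\<eta> + \<eta>)) = \<delta>"
    proof -
      show "\<eta> > 0" unfolding \<eta>_def using \<delta> den by simp
      have "T * (\<eta> + T * (\<eta> + \<eta>)) = \<eta> * (T + T * T * 2)" by (simp add: algebra_simps)
      also have "\<dots> = \<delta>" unfolding \<eta>_def using den by simp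
      finally show "T * (\<eta> + T * (\<eta> + \<eta>)) = \<delta>" .
    qed
    obtain n0 where n0: "\<And>i j. i \<ge> n0 \<Longrightarrow> j \<ge> n0 \<Longrightarrow> Npow p ?M (\<lambda>x. f (r i) x - f (r j) x) \<le> ennreal \<eta>" using rc \<eta>(1) by blast
    have "\<forall>\<^sub>F k in sequentially. inverse (real (Suc k)) < \<eta>" by (rule order_tendstoD(2)[OF LIMSEQ_inverse_real_of_nat \<eta>(1)])
    then obtain n1 where n1: "\<And>k. k \<ge> n1 \<Longrightarrow> inverse (real (Suc k)) < \<eta>" unfolding eventually_sequentially by blast
    have fz: "Npow p ?M (\<lambda>x. fst (z (r i) x) - f (r i) x) \<le> ennreal \<eta>" if i: "i \<ge> n1" for i
    proof -
      have "Npow p ?M (\<lambda>x. fst (z (r i) x) - f (r i) x) \<le> Npow p lebesgue (\<lambda>x. fst (z (r i) x) - f (r i) x)" by (rule Npow_restrict_le) simp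
      also have "\<dots> \<le> Npow p lebesgue (\<lambda>x. z (r i) x - jet (f (r i)) x)"
        using Npow_fst_le[of p lebesgue "\<lambda>x. z (r i) x - jet (f (r i)) x"] p0 by (simp add: jet_def)
      also have "\<dots> \<le> ennreal (inverse (real (Suc (r i))))" using zf[of "r i"] by simp
      also have "\<dots> \<le> ennreal \<eta>"
        using n1[of "r i"] seq_suble[OF r, of i] i by (intro ennreal_leI) simp
      finally show ?thesis .
    qed
    have mz: "(\<lambda>x. fst (z k x)) \<in> borel_measurable ?M" for k by (rule measurable_restrict_space1[OF measurable_fst_comp[OF zm]])
    have mf: "f k \<in> borel_measurable ?M" for k by (rule measurable_restrict_space1[OF fm(1)])
    show "\<exists>n0. \<forall>i\<ge>n0. \<forall>j\<ge>n0. Npow p ?M (\<lambda>x. fst (z (r i) x) - fst (z (r j) x)) \<le> ennreal \<delta>"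
    proof (intro exI[of _ "max n0 n1"] allI impI)
      fix i j assume ij: "max n0 n1 \<le> i" "max n0 n1 \<le> j"
      have \<eta>0: "0 \<le> \<eta>" using \<eta>(1) by simp
      have a: "Npow p ?M (\<lambda>x. fst (z (r i) x) - f (r i) x) \<le> ennreal \<eta>" using fz[of i] ij by simp
      have b: "Npow p ?M (\<lambda>x. f (r j) x - fst (z (r j) x)) \<le> ennreal \<eta>" using fz[of j] ij by (simp add: Npow_commute[of p ?M "f (r j)"])
      have c: "Npow p ?M (\<lambda>x. f (r i) x - f (r j) x) \<le> ennreal \<eta>" using n0[of i j] ij by simp
      have 1: "Npow p ?M (\<lambda>x. f (r i) x - fst (z (r j) x)) \<le> ennreal (T * (\<eta> + \<eta>))"
        unfolding T_def by (rule Npow_triangle_real[OF mf mf mz p0 c b \<eta>0 \<eta>0])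
      have "Npow p ?M (\<lambda>x. fst (z (r i) x) - fst (z (r j) x)) \<le> ennreal (T * (\<eta> + T * (\<eta> + \<eta>)))"
        unfolding T_def by (rule Npow_triangle_real[OF mz mf mz p0 a 1[unfolded T_def] \<eta>0]) (use \<eta>0 in auto)
      thus "Npow p ?M (\<lambda>x. fst (z (r i) x) - fst (z (r j) x)) \<le> ennreal \<delta>" by (simp only: \<eta>(2))
    qed
  qed
qed

section \<open>Splitting of the energy\<close>

lemma Npow_split:
  fixes f :: "real^'n \<Rightarrow> 'b::euclidean_space"
  assumes A: "A \<in> sets lebesgue" and f: "f \<in> borel_measurable lebesgue"
  shows "Npow q lebesgue f = Npow q (lebesgue_on A) f + Npow q (lebesgue_on (- A)) f"
proof -
  have A': "- A \<in> sets lebesgue" using A by (simp add: Compl_in_sets_lebesgue)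
  have m: "(\<lambda>x. ennreal (norm (f x) powr q)) \<in> borel_measurable lebesgue" using f by measurable
  have "Npow q (lebesgue_on A) f + Npow q (lebesgue_on (- A)) f =
     (\<integral>\<^sup>+x. ennreal (norm (f x) powr q) * indicator A x + ennreal (norm (f x) powr q) * indicator (- A) x \<partial>lebesgue)"
    unfolding Npow_restrict[OF A] Npow_restrict[OF A']
    by (intro nn_integral_add[symmetric] borel_measurable_times_ennreal m borel_measurable_indicator A A')
  also have "\<dots> = Npow q lebesgue f" unfolding Npow_def by (intro nn_integral_cong) (auto simp: indicator_def)
  finally show ?thesis by simp
qed

context minimization_setup
begin

lemma En_split:
  assumes A: "A \<in> sets lebesgue" and z: "z \<in> borel_measurable lebesgue"
  shows "En \<Omega> z = En (\<Omega> \<inter> A) z + En (\<Omega> - A) z"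
proof -
  have s: "\<Omega> \<inter> A \<in> sets lebesgue" "\<Omega> - A \<in> sets lebesgue" using A \<Omega>_sets by auto
  have r: "En B z = (\<integral>\<^sup>+x. ennreal (edens x (z x)) * indicator B x \<partial>lebesgue)" if "B \<in> sets lebesgue" for B
    unfolding pair_energy_def using that by (subst nn_integral_restrict_space) auto
  have m: "(\<lambda>x. ennreal (edens x (z x)) * indicator B x) \<in> borel_measurable lebesgue" if B: "B \<in> sets lebesgue" "B \<subseteq> \<Omega>" for B
  proof -
    have "(\<lambda>x. indicator B x *\<^sub>R edens x (z x)) \<in> borel_measurable lebesgue"
      using edens_measurable[OF B z] borel_measurable_restrict_space_iff[of B lebesgue "\<lambda>x. edens x (z x)"] B(1) by simp
    hence "(\<lambda>x. ennreal (indicator B x *\<^sub>R edens x (z x))) \<in> borel_measurable lebesgue"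
      by (rule measurable_compose[OF _ measurable_ennreal])
    moreover have "ennreal (indicator B x *\<^sub>R edens x (z x)) = ennreal (edens x (z x)) * indicator B x" for x
      by (simp add: indicator_def)
    ultimately show ?thesis by simp
  qed
  have "En (\<Omega> \<inter> A) z + En (\<Omega> - A) z = (\<integral>\<^sup>+x. ennreal (edens x (z x)) * indicator (\<Omega> \<inter> A) x + ennreal (edens x (z x)) * indicator (\<Omega> - A) x \<partial>lebesgue)"
    unfolding r[OF s(1)] r[OF s(2)] by (intro nn_integral_add[symmetric] m s) auto
  also have "\<dots> = En \<Omega> z" unfolding r[OF \<Omega>_sets] by (intro nn_integral_cong) (auto simp: indicator_def)
  finally show ?thesis by simp
qed

text \<open>Monotone convergence along balls. The radius \<open>R0\<close> is present because the
  bounds on balls will be available only for large radii.\<close>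

lemma En_exhaust:
  assumes z: "z \<in> borel_measurable lebesgue" and b: "\<And>j::nat. R0 \<le> real j \<Longrightarrow> En (\<Omega> \<inter> cball 0 (real j)) z \<le> b"
  shows "En \<Omega> z \<le> b"
proof -
  have s: "\<Omega> \<inter> cball 0 t \<in> sets lebesgue" for t using \<Omega>_sets by auto
  obtain j0 :: nat where j0: "R0 \<le> real j0" using real_arch_simple by blast
  let ?f = "\<lambda>j x. ennreal (edens x (z x)) * indicator (cball 0 (real (j + j0))) x"
  have cm: "(\<lambda>x. ennreal (edens x (z x))) \<in> borel_measurable (lebesgue_on \<Omega>)"
    using edens_measurable[OF \<Omega>_sets order_refl z] by (rule measurable_compose[OF _ measurable_ennreal])
  have im: "indicator (cball 0 t) \<in> borel_measurable (lebesgue_on \<Omega>)" for t :: real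
    by (rule measurable_restrict_space1, rule borel_measurable_indicator) simp
  have fm: "?f j \<in> borel_measurable (lebesgue_on \<Omega>)" for j by (rule borel_measurable_times_ennreal[OF cm im])
  have sup: "ennreal (edens x (z x)) = (SUP j. ?f j x)" for x
  proof (rule antisym)
    obtain j :: nat where "norm x \<le> real j" using real_arch_simple by blast
    hence "?f j x = ennreal (edens x (z x))" by simp
    moreover have "?f j x \<le> (SUP j. ?f j x)" by (rule SUP_upper) simp
    ultimately show "ennreal (edens x (z x)) \<le> (SUP j. ?f j x)" by simp
  qed (auto intro!: SUP_least simp: indicator_def)
  have "En \<Omega> z = (\<integral>\<^sup>+x. (SUP j. ?f j x) \<partial>lebesgue_on \<Omega>)" unfolding pair_energy_def by (simp only: sup[symmetric])
  also have "\<dots> = (SUP j. \<integral>\<^sup>+x. ?f j x \<partial>lebesgue_on \<Omega>)"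
    by (rule nn_integral_monotone_convergence_SUP[OF _ fm])
      (auto intro!: incseq_SucI le_funI simp: indicator_def)
  also have "\<dots> \<le> b"
  proof (rule SUP_least)
    fix j
    have "(\<integral>\<^sup>+x. ?f j x \<partial>lebesgue_on \<Omega>) = En (\<Omega> \<inter> cball 0 (real (j + j0))) z"
      unfolding pair_energy_def using \<Omega>_sets s[of "real (j + j0)"]
      by (subst (1 2) nn_integral_restrict_space) (auto simp: indicator_def intro!: nn_integral_cong)
    also have "\<dots> \<le> b" using j0 by (intro b) simp
    finally show "(\<integral>\<^sup>+x. ?f j x \<partial>lebesgue_on \<Omega>) \<le> b" .
  qed
  finally show ?thesis .
qed

text \<open>The cut-off pair \<open>v\<close> vanishes inside radius \<open>R\<close> and agrees
  with \<open>z\<close> beyond 2 R, so it carries at least the mass \<open>c\<close>. The Sobolev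
  inequality on the whole space bounds \<open>c\<close> by its norms, which the energy outside
  \<open>R\<close> controls up to errors in \<open>t\<close>.\<close>

lemma outer_energy_bound:
  fixes s t c K R C \<sigma> :: real
  assumes \<sigma>: "0 < \<sigma>" and s: "0 < s" "ennreal s \<le> S_RN p \<sigma> TYPE('n)" and z: "wpair p m \<Omega> z" and R: "R > 0"
    and t: "0 < t" "t < 1" and V: "\<And>x. x \<in> \<Omega> \<Longrightarrow> R < norm x \<Longrightarrow> 1 - t \<le> V x"
    and K: "Npow p lebesgue (\<lambda>x. fst (z x)) \<le> ennreal K" "0 \<le> K"
    and C: "\<And>a b :: real^'n. norm (a + b) powr p \<le> p * norm a powr p + C * norm b powr p" "0 \<le> C"
    and CR: "C * ((8 / R) powr p * K) \<le> t"
    and c: "0 \<le> c" "ennreal c \<le> Npow \<sigma> (lebesgue_on (- cball 0 (2 * R))) (\<lambda>x. fst (z x))"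
    and fin: "En (\<Omega> - cball 0 R) z = ennreal e" "0 \<le> e"
  shows "(1 - t) * (s * c powr (p / \<sigma>) - 2 * t / p) \<le> e"
proof -
  let ?O = "\<Omega> - cball 0 R" and ?\<zeta> = "outer_cutoff R :: real^'n \<Rightarrow> real"
  have zm: "z \<in> borel_measurable lebesgue" by (rule wpair_measurable[OF z])
  note zfm = measurable_fst_comp[OF zm] and zsm = measurable_snd_comp[OF zm]
  have O: "?O \<in> sets lebesgue" using \<Omega>_sets by auto
  note \<zeta> = outer_cutoff[OF R, where 'n='n]
  define B where "B = max 1 (8 / R)"
  have \<zeta>B: "\<bar>?\<zeta> x\<bar> \<le> B" "norm (grad ?\<zeta> x) \<le> B" for x using \<zeta>(4,5,6)[of x] by (auto simp: B_def)
  define v where "v = jet_mult ?\<zeta> z"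
  have v: "sob0 p v" unfolding v_def by (rule sob0_jet_mult[OF \<zeta>(1) \<zeta>B wpair_sob0[OF z] p1(2)])
  define P where "P = Npow p (lebesgue_on ?O) (\<lambda>x. snd (z x))"
  define Q where "Q = Npow p (lebesgue_on ?O) (\<lambda>x. fst (z x))"
  have z0: "z x = 0" if "x \<notin> \<Omega>" for x by (rule wpair_outside[OF z that])
  have zero: "?\<zeta> x = 0" if "x \<in> cball 0 R" for x using \<zeta>(2)[of x] that by simp
  have Qv: "Npow p lebesgue (\<lambda>x. fst (v x)) \<le> Q"
  proof -
    have "Npow p lebesgue (\<lambda>x. fst (v x)) = Npow p (lebesgue_on ?O) (\<lambda>x. fst (v x))"
      by (rule Npow_supported[OF O, symmetric]) (use z0 zero in \<open>auto simp: v_def jet_mult_def\<close>)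
    also have "\<dots> \<le> Q" unfolding Q_def
    proof (rule Npow_mono)
      show "norm (fst (v x)) \<le> norm (fst (z x))" for x
        using \<zeta>(4,5)[of x] by (simp add: v_def jet_mult_def abs_mult mult_left_le_one_le)
    qed (use p1 in simp)
    finally show ?thesis .
  qed
  \<comment> \<open>The leading factor may be as large as \<open>p\<close>; the term with the
    gradient of the cutoff is of order (8/R)^p and is at most \<open>t\<close> by
    \<open>CR\<close>.\<close>
  have Pv: "Npow p lebesgue (\<lambda>x. snd (v x)) \<le> ennreal p * P + ennreal t"
  proof -
    note [measurable] = C1_measurable_lebesgue[OF \<zeta>(1)] zfm zsm
    have m: "(\<lambda>x. ?\<zeta> x *\<^sub>R snd (z x)) \<in> borel_measurable lebesgue" "(\<lambda>x. fst (z x) *\<^sub>R grad ?\<zeta> x) \<in> borel_measurable lebesgue" by measurable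
    have "Npow p lebesgue (\<lambda>x. snd (v x)) = Npow p lebesgue (\<lambda>x. ?\<zeta> x *\<^sub>R snd (z x) + fst (z x) *\<^sub>R grad ?\<zeta> x)"
      by (simp add: v_def jet_mult_def)
    also have "\<dots> \<le> ennreal p * Npow p lebesgue (\<lambda>x. ?\<zeta> x *\<^sub>R snd (z x)) + ennreal C * Npow p lebesgue (\<lambda>x. fst (z x) *\<^sub>R grad ?\<zeta> x)"
      by (rule Npow_eps[OF m C(1) _ C(2)]) (use p1 in simp)
    also have "Npow p lebesgue (\<lambda>x. ?\<zeta> x *\<^sub>R snd (z x)) \<le> P"
    proof -
      have "Npow p lebesgue (\<lambda>x. ?\<zeta> x *\<^sub>R snd (z x)) = Npow p (lebesgue_on ?O) (\<lambda>x. ?\<zeta> x *\<^sub>R snd (z x))"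
        by (rule Npow_supported[OF O, symmetric]) (use z0 zero in auto)
      also have "\<dots> \<le> P" unfolding P_def
      proof (rule Npow_mono)
        show "norm (?\<zeta> x *\<^sub>R snd (z x)) \<le> norm (snd (z x))" for x
          using \<zeta>(4,5)[of x] by (simp add: mult_left_le_one_le)
      qed (use p1 in simp)
      finally show ?thesis .
    qed
    also have "ennreal C * Npow p lebesgue (\<lambda>x. fst (z x) *\<^sub>R grad ?\<zeta> x) \<le> ennreal t"
    proof -
      have "Npow p lebesgue (\<lambda>x. fst (z x) *\<^sub>R grad ?\<zeta> x) \<le> Npow p lebesgue (\<lambda>x. (8 / R) *\<^sub>R fst (z x))"
      proof (rule Npow_mono)
        show "norm (fst (z x) *\<^sub>R grad ?\<zeta> x) \<le> norm ((8 / R) *\<^sub>R fst (z x))" for x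
          using mult_left_mono[OF \<zeta>(6)[of x], of "\<bar>fst (z x)\<bar>"] R by (simp add: abs_mult mult.commute)
      qed (use p1 in simp)
      also have "\<dots> = ennreal ((8 / R) powr p) * Npow p lebesgue (\<lambda>x. fst (z x))"
        using Npow_scale[OF zfm, of p "8 / R"] R by simp
      also have "\<dots> \<le> ennreal ((8 / R) powr p) * ennreal K" by (intro mult_left_mono K) simp
      finally have "ennreal C * Npow p lebesgue (\<lambda>x. fst (z x) *\<^sub>R grad ?\<zeta> x) \<le> ennreal C * (ennreal ((8 / R) powr p) * ennreal K)"
        by (rule mult_left_mono) simp
      also have "\<dots> = ennreal (C * ((8 / R) powr p * K))" using C(2) K(2) by (simp add: ennreal_mult)
      also have "\<dots> \<le> ennreal t" by (rule ennreal_leI[OF CR])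
      finally show ?thesis .
    qed
    finally show ?thesis by (simp add: add_mono mult_left_mono)
  qed
  \<comment> \<open>The factor \<open>p\<close> on \<open>P\<close> costs nothing: after
    multiplication by \<open>p\<close> the energy density contains p |Du|^p, while the potential is
    at least 1 - t here.\<close>
  have PQ: "ennreal (1 - t) * (ennreal p * P + Q) \<le> ennreal p * ennreal e"
  proof -
    have zO: "z \<in> borel_measurable (lebesgue_on ?O)" by (rule measurable_restrict_space1[OF zm])
    note [measurable] = measurable_fst_comp[OF zO] measurable_snd_comp[OF zO] edens_measurable[OF O Diff_subset zm]
    have "ennreal (1 - t) * (ennreal p * P + Q) = (\<integral>\<^sup>+x. ennreal (1 - t) * (ennreal p * ennreal (norm (snd (z x)) powr p) + ennreal (norm (fst (z x)) powr p)) \<partial>lebesgue_on ?O)"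
      unfolding P_def Q_def Npow_def by (simp add: nn_integral_cmult nn_integral_add)
    also have "\<dots> \<le> (\<integral>\<^sup>+x. ennreal p * ennreal (edens x (z x)) \<partial>lebesgue_on ?O)"
    proof (rule nn_integral_mono)
      fix x assume "x \<in> space (lebesgue_on ?O)"
      hence x: "x \<in> \<Omega>" "R < norm x" by auto
      let ?a = "norm (snd (z x)) powr p" and ?b = "norm (fst (z x)) powr p"
      have "ennreal (1 - t) * (ennreal p * ennreal ?a + ennreal ?b) = ennreal ((1 - t) * (p * ?a + ?b))"
        using t p1 by (simp add: ennreal_mult[symmetric] ennreal_plus[symmetric] del: ennreal_plus)
      also have "\<dots> \<le> ennreal (p * edens x (z x))"
      proof (rule ennreal_leI)
        have "(1 - t) * (p * ?a + ?b) = (1 - t) * (p * ?a) + (1 - t) * ?b" by (simp add: distrib_left)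
        also have "\<dots> \<le> 1 * (p * ?a) + V x * ?b"
          using V[OF x] t p1 by (intro add_mono mult_right_mono) auto
        also have "\<dots> = p * (?a + V x / p * \<bar>fst (z x)\<bar> powr p)" using p1 by (simp add: field_simps)
        also have "\<dots> \<le> p * edens x (z x)" using edens_parts(8)[OF x(1), of "z x"] p1 by (intro mult_left_mono) auto
        finally show "(1 - t) * (p * ?a + ?b) \<le> p * edens x (z x)" .
      qed
      also have "\<dots> = ennreal p * ennreal (edens x (z x))" using p1 edens_parts(1)[OF x(1)] by (intro ennreal_mult) auto
      finally show "ennreal (1 - t) * (ennreal p * ennreal ?a + ennreal ?b) \<le> ennreal p * ennreal (edens x (z x))" .
    qed
    also have "\<dots> = ennreal p * ennreal e" unfolding fin(1)[symmetric] pair_energy_def by (rule nn_integral_cmult) measurable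
    finally show ?thesis .
  qed
  have "P < \<infinity>" "Q < \<infinity>"
  proof -
    have "ennreal (1 - t) * (ennreal p * P + Q) < \<infinity>" using PQ by (rule le_less_trans) (simp add: ennreal_mult_less_top)
    hence "ennreal p * P + Q < \<infinity>" using t by (auto simp: ennreal_mult_less_top)
    thus "P < \<infinity>" "Q < \<infinity>" using p1 by (auto simp: ennreal_mult_less_top)
  qed
  then obtain P' Q' where PQ': "P = ennreal P'" "0 \<le> P'" "Q = ennreal Q'" "0 \<le> Q'"
    by (metis enn2real_nonneg Npow_finite_real P_def Q_def)
  have "(1 - t) * (p * P' + Q') \<le> p * e"
    using PQ unfolding PQ' using t p1 PQ'(2,4) fin(2)
    by (simp add: ennreal_mult[symmetric] ennreal_plus[symmetric] del: ennreal_plus)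
  \<comment> \<open>The scale parameter is 1, so both powers of it disappear. The inequality wants
    strict bounds, hence 3t/2 and t/2, which add up to the 2t in \<open>X\<close>.\<close>
  have GN: "Npow \<sigma> lebesgue (\<lambda>x. fst (v x)) \<le> ennreal (((1 powr (real CARD('n) * p / \<sigma> + p - real CARD('n)) * (p * P' + 3 / 2 * t)
      + 1 powr (real CARD('n) * p / \<sigma> + p - real CARD('n) - p) * (Q' + t / 2)) / (s * p)) powr (\<sigma> / p))"
  proof (rule gagliardo_nirenberg_sob0[OF p1(1) \<sigma> s v zero_less_one])
    have "ennreal p * P + ennreal t = ennreal (p * P' + t)" unfolding PQ' using p1 PQ'(2) t by (simp add: ennreal_mult)
    also have "\<dots> < ennreal (p * P' + 3 / 2 * t)" using t p1 PQ'(2) by (intro ennreal_lessI) (auto intro: add_nonneg_pos)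
    finally show "Npow p lebesgue (\<lambda>x. snd (v x)) < ennreal (p * P' + 3 / 2 * t)" using Pv by (rule le_less_trans[rotated])
    have "Q < ennreal (Q' + t / 2)" unfolding PQ' using t PQ'(4) by (intro ennreal_lessI) auto
    thus "Npow p lebesgue (\<lambda>x. fst (v x)) < ennreal (Q' + t / 2)" using Qv by (rule le_less_trans[rotated])
  qed
  define X where "X = (p * P' + Q' + 2 * t) / (s * p)"
  have X: "0 \<le> X" unfolding X_def using p1 PQ' t s by simp
  have N: "Npow \<sigma> lebesgue (\<lambda>x. fst (v x)) \<le> ennreal (X powr (\<sigma> / p))"
    using GN unfolding X_def by (simp add: algebra_simps)
  have "ennreal c \<le> Npow \<sigma> lebesgue (\<lambda>x. fst (v x))"
  proof -
    note c(2)
    also have "Npow \<sigma> (lebesgue_on (- cball 0 (2 * R))) (\<lambda>x. fst (z x)) = Npow \<sigma> (lebesgue_on (- cball 0 (2 * R))) (\<lambda>x. fst (v x))"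
      by (rule Npow_cong) (use \<zeta>(3) in \<open>auto simp: v_def jet_mult_def\<close>)
    also have "\<dots> \<le> Npow \<sigma> lebesgue (\<lambda>x. fst (v x))" by (rule Npow_restrict_le) (simp add: Compl_in_sets_lebesgue)
    finally show ?thesis .
  qed
  hence "ennreal c \<le> ennreal (X powr (\<sigma> / p))" using N by (rule order_trans)
  hence "c \<le> X powr (\<sigma> / p)" by (subst (asm) ennreal_le_iff) auto
  hence "c powr (p / \<sigma>) \<le> (X powr (\<sigma> / p)) powr (p / \<sigma>)" using c(1) p1 \<sigma> by (intro powr_mono2) auto
  also have "\<dots> = X" using X p1 \<sigma> by (simp add: powr_powr)
  finally have "c powr (p / \<sigma>) \<le> X" .
  hence "s * p * c powr (p / \<sigma>) \<le> p * P' + Q' + 2 * t" unfolding X_def using s p1 by (simp add: field_simps)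
  hence "(1 - t) * (s * p * c powr (p / \<sigma>) - 2 * t) \<le> (1 - t) * (p * P' + Q')"
    using t by (intro mult_left_mono) auto
  also have "\<dots> \<le> p * e" by fact
  finally have "(1 - t) * (s * p * c powr (p / \<sigma>) - 2 * t) / p \<le> e" using p1 by (simp add: field_simps)
  moreover have "(1 - t) * (s * p * c powr (p / \<sigma>) - 2 * t) / p = (1 - t) * (s * c powr (p / \<sigma>) - 2 * t / p)"
    using p1 by (simp add: field_simps)
  ultimately show ?thesis by simp
qed

text \<open>After a cutoff the gradients remain bounded while the L^p norms tend to 0. Positivity of
  the exponent allows a small scale at which the gradient term is below any tolerance; at that fixed
  scale the other term tends to 0.\<close>

lemma local_Lsigma_convergence:
  fixes s \<sigma> R K :: real and d :: "nat \<Rightarrow> real^'n \<Rightarrow> real \<times> (real^'n)"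
  assumes \<sigma>: "0 < \<sigma>" and s: "0 < s" "ennreal s \<le> S_RN p \<sigma> TYPE('n)"
    and a: "real CARD('n) * p / \<sigma> + p - real CARD('n) > 0"
    and d: "\<And>k. sob0 p (d k)" "\<And>k. Npow p lebesgue (d k) \<le> ennreal K" "0 \<le> K" and R: "R > 0"
    and l: "(\<lambda>k. Npow p (lebesgue_on (cball 0 (2 * R))) (\<lambda>x. fst (d k x))) \<longlonglongrightarrow> 0"
  shows "(\<lambda>k. Npow \<sigma> (lebesgue_on (cball 0 R)) (\<lambda>x. fst (d k x))) \<longlonglongrightarrow> 0"
proof (rule tendsto_0_if_eventually_le)
  fix \<delta> :: real assume \<delta>: "\<delta> > 0"
  define a' where "a' = real CARD('n) * p / \<sigma> + p - real CARD('n)"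
  \<comment> \<open>The complementary cutoff, 1 on the ball of radius R and 0 beyond 2 R, spelled as
    a linear combination so that \<open>C1_lincomb\<close> applies.\<close>
  define \<eta> where "\<eta> = (\<lambda>x::real^'n. 1 * 1 + (- 1) * outer_cutoff R x)"
  note \<zeta> = outer_cutoff[OF R, where 'n='n]
  have one: "(\<lambda>x::real^'n. 1) \<in> C1_on_space" "grad (\<lambda>x::real^'n. 1) = (\<lambda>x. 0)"
    using C1I[of "\<lambda>x::real^'n. 1" "\<lambda>x. 0"] by auto
  have \<eta>: "\<eta> \<in> C1_on_space" "grad \<eta> x = - grad (outer_cutoff R) x" for x
    using C1_lincomb[OF one(1) \<zeta>(1), of 1 "- 1"] one(2) by (simp_all add: \<eta>_def)
  define B where "B = max 1 (8 / R)"
  have \<eta>B: "\<bar>\<eta> x\<bar> \<le> B" "norm (grad \<eta> x) \<le> B" for x using \<zeta>(4,5,6)[of x] \<eta>(2)[of x] by (auto simp: B_def \<eta>_def)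
  have dm: "d k \<in> borel_measurable lebesgue" for k using d(1)[of k] by (simp add: sob0_def)
  define v where "v = (\<lambda>k. jet_mult \<eta> (d k))"
  have v: "sob0 p (v k)" for k unfolding v_def by (rule sob0_jet_mult[OF \<eta>(1) \<eta>B d(1) p1(2)])
  define G where "G = (3 * B) powr p * K + 1"
  have G: "G > 0" unfolding G_def using d(3) by (simp add: add_nonneg_pos)
  have vG: "Npow p lebesgue (\<lambda>x. snd (v k x)) < ennreal G" for k
  proof -
    have "Npow p lebesgue (\<lambda>x. snd (v k x)) \<le> Npow p lebesgue (v k)" by (rule Npow_snd_le) (use p1 in simp)
    also have "\<dots> \<le> ennreal ((3 * B) powr p) * Npow p lebesgue (d k)"
      unfolding v_def by (rule Npow_jet_mult_le[OF \<eta>(1) \<eta>B dm p1(2)])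
    also have "\<dots> \<le> ennreal ((3 * B) powr p) * ennreal K" by (intro mult_left_mono d) simp
    also have "\<dots> = ennreal ((3 * B) powr p * K)" using d(3) by (simp add: ennreal_mult)
    also have "\<dots> < ennreal G" using G unfolding G_def by (intro ennreal_lessI) auto
    finally show ?thesis .
  qed
  \<comment> \<open>Half of what the interpolation inequality may contain in order to return exactly
    \<delta>. The scale \<open>lam\<close> makes the gradient term equal to \<gamma>, and
    \<open>F\<close> then does the same for the function term.\<close>
  define \<gamma> where "\<gamma> = \<delta> powr (p / \<sigma>) * (s * p) / 2"
  have \<gamma>: "\<gamma> > 0" unfolding \<gamma>_def using \<delta> s p1 by simp
  define lam where "lam = (\<gamma> / G) powr (1 / a')"
  have lam: "lam > 0" "lam powr a' * G = \<gamma>" unfolding lam_def using \<gamma> G a by (auto simp: powr_powr a'_def[symmetric])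
  define F where "F = \<gamma> / lam powr (a' - p)"
  have F: "F > 0" "lam powr (a' - p) * F = \<gamma>" unfolding F_def using \<gamma> lam(1) by auto
  have "\<forall>\<^sub>F k in sequentially. Npow p (lebesgue_on (cball 0 (2 * R))) (\<lambda>x. fst (d k x)) < ennreal F"
    using F(1) by (intro order_tendstoD(2)[OF l]) simp
  thus "\<forall>\<^sub>F k in sequentially. Npow \<sigma> (lebesgue_on (cball 0 R)) (\<lambda>x. fst (d k x)) \<le> ennreal \<delta>"
  proof eventually_elim
    case (elim k)
    have "Npow p lebesgue (\<lambda>x. fst (v k x)) = Npow p (lebesgue_on (cball 0 (2 * R))) (\<lambda>x. fst (v k x))"
      by (rule Npow_supported[symmetric]) (use \<zeta>(3) in \<open>auto simp: v_def jet_mult_def \<eta>_def\<close>)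
    also have "\<dots> \<le> Npow p (lebesgue_on (cball 0 (2 * R))) (\<lambda>x. fst (d k x))"
    proof (rule Npow_mono)
      show "norm (fst (v k x)) \<le> norm (fst (d k x))" for x
        using \<zeta>(4,5)[of x] by (simp add: v_def jet_mult_def \<eta>_def abs_mult mult_left_le_one_le)
    qed (use p1 in simp)
    finally have vF: "Npow p lebesgue (\<lambda>x. fst (v k x)) < ennreal F" using elim by (rule le_less_trans)
    have "Npow \<sigma> lebesgue (\<lambda>x. fst (v k x)) \<le> ennreal (((lam powr a' * G + lam powr (a' - p) * F) / (s * p)) powr (\<sigma> / p))"
      unfolding a'_def by (rule gagliardo_nirenberg_sob0[OF p1(1) \<sigma> s v lam(1) vG vF])
    also have "((lam powr a' * G + lam powr (a' - p) * F) / (s * p)) powr (\<sigma> / p) = \<delta>"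
    proof -
      have "(lam powr a' * G + lam powr (a' - p) * F) / (s * p) = \<delta> powr (p / \<sigma>)"
        unfolding lam(2) F(2) \<gamma>_def using s p1 by simp
      thus ?thesis using \<delta> p1 \<sigma> by (simp add: powr_powr)
    qed
    finally have N: "Npow \<sigma> lebesgue (\<lambda>x. fst (v k x)) \<le> ennreal \<delta>" .
    have "Npow \<sigma> (lebesgue_on (cball 0 R)) (\<lambda>x. fst (d k x)) = Npow \<sigma> (lebesgue_on (cball 0 R)) (\<lambda>x. fst (v k x))"
      by (rule Npow_cong) (use \<zeta>(2) in \<open>auto simp: v_def jet_mult_def \<eta>_def\<close>)
    also have "\<dots> \<le> Npow \<sigma> lebesgue (\<lambda>x. fst (v k x))" by (rule Npow_restrict_le) simp
    finally show ?case using N by (rule order_trans)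
  qed
qed

section \<open>Multiplication by constants\<close>

lemma wpair_scale:
  assumes z: "wpair p m \<Omega> z"
  shows "wpair p m \<Omega> (\<lambda>x. c *\<^sub>R z x)"
proof -
  obtain f where zm: "z \<in> borel_measurable lebesgue" "\<forall>x. x \<notin> \<Omega> \<longrightarrow> z x = 0" and f: "\<And>k::nat. f k \<in> test_functions \<Omega>"
    and lf: "(\<lambda>k. Npow p lebesgue (\<lambda>x. z x - jet (f k) x)) \<longlonglongrightarrow> 0"
      "(\<lambda>k. Npow m lebesgue (\<lambda>x. snd (z x) - grad (f k) x)) \<longlonglongrightarrow> 0"
    using z unfolding wpair_def by blast
  note fc = C1c_C1[OF test_functions_C1c[OF f]]
  note fm = C1_measurable_lebesgue[OF fc]
  define h where "h = (\<lambda>k x. c * f k x + 0 * f k x)"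
  have h: "h k \<in> test_functions \<Omega>" for k unfolding h_def by (rule test_functions_lincomb[OF f f])
  have jh: "jet (h k) x = c *\<^sub>R jet (f k) x" for k x
    unfolding h_def using jet_lincomb[OF fc fc, where a = c and b = 0] by simp
  have gh: "grad (h k) x = c *\<^sub>R grad (f k) x" for k x using jh[of k x] by (simp add: jet_def)
  have "Npow p lebesgue (\<lambda>x. c *\<^sub>R z x - jet (h k) x) = ennreal (\<bar>c\<bar> powr p) * Npow p lebesgue (\<lambda>x. z x - jet (f k) x)" for k
    unfolding jh scaleR_diff_right[symmetric] by (rule Npow_scale[OF borel_measurable_diff[OF zm(1) fm(3)]])
  moreover have "Npow m lebesgue (\<lambda>x. snd (c *\<^sub>R z x) - grad (h k) x) = ennreal (\<bar>c\<bar> powr m) * Npow m lebesgue (\<lambda>x. snd (z x) - grad (f k) x)" for k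
    unfolding gh snd_scaleR scaleR_diff_right[symmetric] by (rule Npow_scale[OF borel_measurable_diff[OF measurable_snd_comp[OF zm(1)] fm(2)]])
  ultimately have "(\<lambda>k. Npow p lebesgue (\<lambda>x. c *\<^sub>R z x - jet (h k) x)) \<longlonglongrightarrow> 0"
    "(\<lambda>k. Npow m lebesgue (\<lambda>x. snd (c *\<^sub>R z x) - grad (h k) x)) \<longlonglongrightarrow> 0"
    using ennreal_tendsto_cmult[OF _ lf(1), of "ennreal (\<bar>c\<bar> powr p)"] ennreal_tendsto_cmult[OF _ lf(2), of "ennreal (\<bar>c\<bar> powr m)"] by simp_all
  moreover have "(\<lambda>x. c *\<^sub>R z x) \<in> borel_measurable lebesgue" using zm(1) by measurable
  ultimately show ?thesis unfolding wpair_def using h zm(2) by auto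
qed

text \<open>The terms with \<open>L\<close> and \<open>V\<close> scale with the power p exactly. The
  term with \<open>M\<close> scales with the power m, which is no larger because \<open>c\<close> is
  at least 1 and m \<le> p.\<close>

lemma En_scale:
  assumes z: "z \<in> borel_measurable lebesgue" and c: "1 \<le> c"
  shows "En \<Omega> (\<lambda>x. c *\<^sub>R z x) \<le> ennreal (c powr p) * En \<Omega> z"
proof -
  have "En \<Omega> (\<lambda>x. c *\<^sub>R z x) \<le> (\<integral>\<^sup>+x. ennreal (c powr p) * ennreal (edens x (z x)) \<partial>lebesgue_on \<Omega>)"
    unfolding pair_energy_def
  proof (rule nn_integral_mono)
    fix x assume "x \<in> space (lebesgue_on \<Omega>)"
    hence x: "x \<in> \<Omega>" by simp
    have c0: "0 < c" using c by simp
    have cm: "c powr m \<le> c powr p" using c mp by (intro powr_mono) auto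
    have "M (snd (c *\<^sub>R z x)) \<le> c powr p * M (snd (z x))"
      using mult_right_mono[OF cm M_nonneg[of "snd (z x)"]] by (simp add: M_hom[OF c0])
    hence 1: "M (snd (c *\<^sub>R z x)) / m \<le> c powr p * M (snd (z x)) / m" using p1 by (intro divide_right_mono) auto
    have 2: "L (snd (c *\<^sub>R z x)) / p = c powr p * L (snd (z x)) / p" by (simp add: L_hom[OF c0])
    have 3: "\<bar>fst (c *\<^sub>R z x)\<bar> powr p = c powr p * \<bar>fst (z x)\<bar> powr p" using c0 by (simp add: abs_mult powr_mult)
    have "edens x (c *\<^sub>R z x) \<le> c powr p * L (snd (z x)) / p + c powr p * M (snd (z x)) / m + V x / p * (c powr p * \<bar>fst (z x)\<bar> powr p)"
      unfolding energy_density_def 2 3 using 1 by linarith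
    also have "\<dots> = c powr p * edens x (z x)" unfolding energy_density_def by (simp add: distrib_left)
    finally have "edens x (c *\<^sub>R z x) \<le> c powr p * edens x (z x)" .
    hence "ennreal (edens x (c *\<^sub>R z x)) \<le> ennreal (c powr p * edens x (z x))" by (rule ennreal_leI)
    also have "\<dots> = ennreal (c powr p) * ennreal (edens x (z x))" using edens_parts(1)[OF x] by (intro ennreal_mult) auto
    finally show "ennreal (edens x (c *\<^sub>R z x)) \<le> ennreal (c powr p) * ennreal (edens x (z x))" .
  qed
  also have "\<dots> = ennreal (c powr p) * En \<Omega> z"
    unfolding pair_energy_def
    using measurable_compose[OF edens_measurable[OF \<Omega>_sets order_refl z] measurable_ennreal] by (rule nn_integral_cmult)
  finally show ?thesis .
qed

end

section \<open>Existence of a minimizer\<close>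

context minimization_setup
begin

text \<open>The real number \<open>s\<close> separates the two infima; it serves both as the Sobolev
  constant and as the cost of mass at infinity.\<close>

proposition minimizer_exists:
  fixes \<sigma> s l :: real
  assumes \<sigma>: "p < \<sigma>" and a: "real CARD('n) * p / \<sigma> + p - real CARD('n) > 0"
    and V: "\<And>t. t > 0 \<Longrightarrow> \<exists>R. \<forall>x\<in>\<Omega>. R < norm x \<longrightarrow> 1 - t \<le> V x"
    and l: "S_Omega p m \<sigma> L M V \<Omega> = ennreal l" "0 \<le> l" and s: "l < s" "ennreal s \<le> S_RN p \<sigma> TYPE('n)"
  shows "\<exists>u\<in>constraint_set p m \<sigma> \<Omega>. energy p m L M V \<Omega> u = S_Omega p m \<sigma> L M V \<Omega>"
proof -
  have \<sigma>1: "0 < \<sigma>" "1 < \<sigma>" using \<sigma> p1 by auto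
  have s0: "0 < s" using s l by simp
  have S_le: "ennreal l \<le> En \<Omega> z" if z: "wpair p m \<Omega> z" "Npow \<sigma> lebesgue (\<lambda>x. fst (z x)) = 1" for z
  proof -
    have "ennreal l \<le> energy p m L M V \<Omega> (\<lambda>x. fst (z x))"
      unfolding l(1)[symmetric] S_Omega_def
      by (rule INF_lower[OF wpair_imp_constraint_set[OF open_\<Omega> p1(1) m1 \<sigma>1(1) z]])
    thus ?thesis unfolding energy_wpair[OF open_\<Omega> p1(1) z(1)] .
  qed
  have "\<exists>z. wpair p m \<Omega> z \<and> Npow \<sigma> lebesgue (\<lambda>x. fst (z x)) = 1 \<and> En \<Omega> z \<le> ennreal (l + inverse (real (Suc k)))" for k
  proof -
    have "S_Omega p m \<sigma> L M V \<Omega> < ennreal (l + inverse (real (Suc k)))"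
      unfolding l(1) using l(2) by (intro ennreal_lessI) (auto intro: add_nonneg_pos)
    then obtain u where u: "u \<in> constraint_set p m \<sigma> \<Omega>" "energy p m L M V \<Omega> u < ennreal (l + inverse (real (Suc k)))"
      unfolding S_Omega_def INF_less_iff by blast
    obtain z where "wpair p m \<Omega> z" "Npow \<sigma> lebesgue (\<lambda>x. fst (z x)) = 1" "energy p m L M V \<Omega> u = En \<Omega> z"
      by (rule constraint_set_imp_wpair[OF open_\<Omega> p1(1) m1 \<sigma>1(1) u(1)])
    thus ?thesis using u(2) by (intro exI[of _ z]) simp
  qed
  then obtain \<zeta> where \<zeta>: "\<And>k. wpair p m \<Omega> (\<zeta> k)" "\<And>k. Npow \<sigma> lebesgue (\<lambda>x. fst (\<zeta> k x)) = 1"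
    "\<And>k. En \<Omega> (\<zeta> k) \<le> ennreal (l + inverse (real (Suc k)))"
    using choice[OF allI, of "\<lambda>k z. wpair p m \<Omega> z \<and> Npow \<sigma> lebesgue (\<lambda>x. fst (z x)) = 1 \<and> En \<Omega> z \<le> ennreal (l + inverse (real (Suc k)))"] by blast
  define B where "B = l + 1"
  have B0: "0 \<le> B" unfolding B_def using l by simp
  have EB: "En \<Omega> (\<zeta> k) \<le> ennreal B" for k
    by (rule order_trans[OF \<zeta>(3)]) (auto simp: B_def inverse_le_1_iff intro!: ennreal_leI)
  define K1 where "K1 = p / v0 * B"
  have K10: "0 \<le> K1" unfolding K1_def using p1 v0 B0 by simp
  note \<zeta>m = wpair_measurable[OF \<zeta>(1)] and \<zeta>o = wpair_outside[OF \<zeta>(1)]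
  have Nf: "Npow p lebesgue (\<lambda>x. fst (\<zeta> k x)) \<le> ennreal K1" for k
  proof -
    have "Npow p lebesgue (\<lambda>x. fst (\<zeta> k x)) \<le> ennreal (p / v0) * En \<Omega> (\<zeta> k)" by (rule En_bounds(3)[OF \<zeta>m \<zeta>o])
    also have "\<dots> \<le> ennreal (p / v0) * ennreal B" by (intro mult_left_mono EB) simp
    also have "\<dots> = ennreal K1" unfolding K1_def using p1 v0 B0 by (intro ennreal_mult[symmetric]) auto
    finally show ?thesis .
  qed
  have Ns: "Npow p lebesgue (\<lambda>x. snd (\<zeta> k x)) \<le> ennreal B" for k
    by (rule order_trans[OF En_bounds(1)[OF \<zeta>m \<zeta>o] EB])
  define K where "K = 2 powr p * (K1 + B)"
  have K0: "0 \<le> K" unfolding K_def using K10 B0 by simp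
  have NK: "Npow p lebesgue (\<zeta> k) \<le> ennreal K" for k
  proof -
    have "Npow p lebesgue (\<zeta> k) = Npow p lebesgue (\<lambda>x. (fst (\<zeta> k x), snd (\<zeta> k x)))" by simp
    also have "\<dots> \<le> ennreal (2 powr p) * (Npow p lebesgue (\<lambda>x. fst (\<zeta> k x)) + Npow p lebesgue (\<lambda>x. snd (\<zeta> k x)))"
      by (rule Npow_pair_le[OF measurable_fst_comp[OF \<zeta>m] measurable_snd_comp[OF \<zeta>m] p1(2)])
    also have "\<dots> \<le> ennreal (2 powr p) * (ennreal K1 + ennreal B)" by (intro mult_left_mono add_mono Nf Ns) simp
    also have "\<dots> = ennreal K" unfolding K_def using K10 B0
      by (simp add: ennreal_mult[symmetric] ennreal_plus[symmetric] del: ennreal_plus)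
    finally show ?thesis .
  qed
  obtain r :: "nat \<Rightarrow> nat" where r: "strict_mono r" and rc: "\<forall>R \<delta>. \<delta> > 0 \<longrightarrow> (\<exists>n0. \<forall>i\<ge>n0. \<forall>j\<ge>n0.
     Npow p (lebesgue_on (cball 0 R)) (\<lambda>x. fst (\<zeta> (r i) x) - fst (\<zeta> (r j) x)) \<le> ennreal \<delta>)"
    using rellich_sob0[where z = \<zeta>, OF p1(1) wpair_sob0[OF \<zeta>(1)] NK K0] by blast
  define z where "z = (\<lambda>k. \<zeta> (r k))"
  have zw: "wpair p m \<Omega> (z k)" and z1: "Npow \<sigma> lebesgue (\<lambda>x. fst (z k x)) = 1" and zB: "En \<Omega> (z k) \<le> ennreal B"
    and zK: "Npow p lebesgue (z k) \<le> ennreal K" and zf: "Npow p lebesgue (\<lambda>x. fst (z k x)) \<le> ennreal K1" for k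
    unfolding z_def by (rule \<zeta> EB NK Nf)+
  note zm = wpair_measurable[OF zw]
  have zl: "En \<Omega> (z k) \<le> ennreal (l + inverse (real (Suc k)))" for k
  proof -
    have "En \<Omega> (z k) \<le> ennreal (l + inverse (real (Suc (r k))))" unfolding z_def by (rule \<zeta>(3))
    also have "\<dots> \<le> ennreal (l + inverse (real (Suc k)))"
      using seq_suble[OF r, of k] by (intro ennreal_leI add_left_mono le_imp_inverse_le) auto
    finally show ?thesis .
  qed
  obtain y w r2 where yw: "wpair p m \<Omega> y" and w: "\<And>n. w n \<in> midhull z n"
    and wy: "(\<lambda>n. Npow p lebesgue (\<lambda>x. y x - w n x)) \<longlonglongrightarrow> 0"
    and r2: "strict_mono (r2 :: nat \<Rightarrow> nat)" and AE: "AE x in lebesgue. (\<lambda>k. w (r2 k) x) \<longlonglongrightarrow> y x"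
    using minimizing_limit[where z = z, OF zw zB B0] by blast
  have ym: "y \<in> borel_measurable lebesgue" by (rule wpair_measurable[OF yw])
  have lsc: "En A y \<le> b" if "A \<in> sets lebesgue" "A \<subseteq> \<Omega>" "\<forall>\<^sub>F k in sequentially. En A (z k) \<le> b" for A b
    by (rule En_lower_semicontinuous[where z = z and w = w, OF zw w r2 AE that])
  have loc: "(\<lambda>k. Npow p (lebesgue_on (cball 0 R)) (\<lambda>x. fst (z k x) - fst (y x))) \<longlonglongrightarrow> 0" for R
    by (rule local_limit[where z = z and w = w, OF zw w ym wy]) (use rc in \<open>simp add: z_def\<close>)
  \<comment> \<open>Convexity keeps the hull inside the unit ball of L^\<sigma> and Fatou carries
    this to \<open>y\<close>: mass can be lost in the limit but not gained.\<close>
  have \<theta>1: "Npow \<sigma> lebesgue (\<lambda>x. fst (y x)) \<le> 1"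
  proof -
    have hull: "Npow \<sigma> lebesgue (\<lambda>x. fst (f x)) \<le> 1" if "f \<in> midhull z n" for f n
      using that
    proof induction
      case (base k)
      show ?case by (simp add: z1)
    next
      case (mid f g)
      have "Npow \<sigma> lebesgue (\<lambda>x. fst ((1/2) *\<^sub>R (f x + g x))) = Npow \<sigma> lebesgue (\<lambda>x. (1/2) *\<^sub>R (fst (f x) + fst (g x)))" by simp
      also have "\<dots> \<le> 1"
        by (rule Npow_midpoint[OF measurable_fst_comp[OF wpair_measurable[OF midhull_wpair[OF zw mid.hyps(1)]]]
              measurable_fst_comp[OF wpair_measurable[OF midhull_wpair[OF zw mid.hyps(2)]]] \<sigma>1(2) mid.IH])
      finally show ?case .
    qed
    show ?thesis
    proof (rule Npow_AE_limit_le[where f = "\<lambda>k x. fst (w (r2 k) x)"])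
      show "AE x in lebesgue. (\<lambda>k. fst (w (r2 k) x)) \<longlonglongrightarrow> fst (y x)" using AE by eventually_elim (rule tendsto_fst)
    qed (use \<sigma>1 hull[OF w] in \<open>auto intro!: measurable_fst_comp wpair_measurable[OF midhull_wpair[OF zw w]]\<close>)
  qed
  define \<theta> where "\<theta> = enn2real (Npow \<sigma> lebesgue (\<lambda>x. fst (y x)))"
  have N\<theta>: "Npow \<sigma> lebesgue (\<lambda>x. fst (y x)) = ennreal \<theta>" unfolding \<theta>_def
    by (rule Npow_finite_real, rule le_less_trans[OF \<theta>1]) simp
  have \<theta>: "0 \<le> \<theta>" "\<theta> \<le> 1" using \<theta>1 unfolding N\<theta> by (auto simp: \<theta>_def)
  have Ey0: "En \<Omega> y \<le> ennreal B" by (rule lsc[OF \<Omega>_sets order_refl]) (simp add: zB)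
  define ey where "ey = enn2real (En \<Omega> y)"
  have Ey: "En \<Omega> y = ennreal ey" "0 \<le> ey" using le_less_trans[OF Ey0 ennreal_less_top] by (simp_all add: ey_def)
  have "\<theta> = 1"
  proof (rule ccontr)
    assume "\<theta> \<noteq> 1"
    hence \<theta>l: "\<theta> < 1" using \<theta> by simp
    define \<kappa> where "\<kappa> = (1 - \<theta>) powr (p / \<sigma>)"
    obtain Ky where Ky: "Npow p lebesgue y \<le> ennreal Ky" "0 \<le> Ky"
      using wpair_weak_gradient(2)[OF open_\<Omega> p1(1) yw] by (metis Npow_finite_real enn2real_nonneg order_refl)
    have dK: "Npow p lebesgue (\<lambda>x. z k x - y x) \<le> ennreal (2 powr p * (K + Ky))" for k
      by (rule Npow_triangle_real[OF zm borel_measurable_const[of 0] ym p1(2)]) (use zK Ky K0 in \<open>simp_all add: Npow_def\<close>)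
    have locs: "(\<lambda>k. Npow \<sigma> (lebesgue_on (cball 0 R)) (\<lambda>x. fst (z k x) - fst (y x))) \<longlonglongrightarrow> 0" if R: "R > 0" for R
    proof -
      have "(\<lambda>k. Npow \<sigma> (lebesgue_on (cball 0 R)) (\<lambda>x. fst (z k x - y x))) \<longlonglongrightarrow> 0"
      proof (rule local_Lsigma_convergence[where d = "\<lambda>k x. z k x - y x", OF \<sigma>1(1) s0 s(2) a _ dK _ R])
        show "sob0 p (\<lambda>x. z k x - y x)" for k by (rule sob0_diff[OF wpair_sob0[OF zw] wpair_sob0[OF yw] p1(2)])
        show "(\<lambda>k. Npow p (lebesgue_on (cball 0 (2 * R))) (\<lambda>x. fst (z k x - y x))) \<longlonglongrightarrow> 0" using loc by simp
      qed (use K0 Ky in simp)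
      thus ?thesis by simp
    qed
    have p\<epsilon>: "0 < p - 1" using p1 by simp
    \<comment> \<open>The constant 1 + (p - 1) is the spare factor \<open>p\<close> offered by the
      lower bound on \<open>L\<close>.\<close>
    obtain C where C: "0 < C" "\<And>a b :: real^'n. norm (a + b) powr p \<le> (1 + (p - 1)) * norm a powr p + C * norm b powr p"
      by (rule norm_add_powr_eps[OF p1(2) p\<epsilon>]) blast
    have C': "norm (a + b) powr p \<le> p * norm a powr p + C * norm b powr p" for a b :: "real^'n" using C(2)[of a b] by simp
    have upper: "ey \<le> l - s * \<kappa> + \<delta>" if \<delta>: "\<delta> > 0" for \<delta>
    proof -
      \<comment> \<open>\<open>H t\<close> is the lower bound for the outer energy at tolerance
        \<open>t\<close>, with escaping mass 1 - \<theta> - t. It tends to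
        \<open>s * \<kappa>\<close> as \<open>t\<close> decreases to 0, so some \<open>t\<close>
        loses less than \<delta>/2.\<close>
      define H where "H = (\<lambda>t. (1 - t) * (s * (1 - \<theta> - t) powr (p / \<sigma>) - 2 * t / p))"
      have "(H \<longlongrightarrow> (1 - 0) * (s * (1 - \<theta> - 0) powr (p / \<sigma>) - 2 * 0 / p)) (at_right 0)"
        unfolding H_def by (intro tendsto_intros) (use \<theta>l p1 in auto)
      hence "(H \<longlongrightarrow> s * \<kappa>) (at_right 0)" by (simp add: \<kappa>_def)
      hence "\<forall>\<^sub>F t in at_right 0. s * \<kappa> - \<delta> / 2 < H t" by (rule order_tendstoD(1)) (use \<delta> in simp)
      moreover have "\<forall>\<^sub>F t::real in at_right 0. t \<in> {0<..<min 1 (1 - \<theta>)}"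
        by (rule eventually_at_right_real) (use \<theta>l in simp)
      ultimately have "\<forall>\<^sub>F t in at_right 0. s * \<kappa> - \<delta> / 2 < H t \<and> t \<in> {0<..<min 1 (1 - \<theta>)}" by eventually_elim simp
      then obtain t where t: "s * \<kappa> - \<delta> / 2 < H t" "0 < t" "t < 1" "t < 1 - \<theta>"
        using eventually_happens'[OF trivial_limit_at_right_real] by fastforce
      obtain R0 where R0: "\<And>x. x \<in> \<Omega> \<Longrightarrow> R0 < norm x \<Longrightarrow> 1 - t \<le> V x" using V[OF t(2)] by blast
      \<comment> \<open>If (8/R)^p is at most 1/Q, the cutoff error is at most \<open>t\<close>;
        \<open>R1\<close> is the radius from which this holds, and the summand 1 keeps
        \<open>Q\<close> positive.\<close>
      define Q where "Q = C * K1 / t + 1"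
      have Q: "Q > 0" "C * K1 / Q \<le> t"
      proof -
        show q: "Q > 0" unfolding Q_def using C(1) K10 t(2) by (simp add: add_nonneg_pos)
        have "C * K1 \<le> t * Q" unfolding Q_def using t(2) by (simp add: distrib_left)
        thus "C * K1 / Q \<le> t" using q by (simp add: pos_divide_le_eq)
      qed
      define R1 where "R1 = 8 * Q powr (1 / p)"
      have R1: "C * ((8 / R) powr p * K1) \<le> t" if R: "R1 \<le> R" "0 < R" for R
      proof -
        have "8 * Q powr (1 / p) \<le> R" using R by (simp add: R1_def)
        hence "8 / R \<le> 1 / Q powr (1 / p)" using R(2) Q(1) by (simp add: field_simps)
        hence "(8 / R) powr p \<le> (1 / Q powr (1 / p)) powr p" using R(2) p1 by (intro powr_mono2) auto
        also have "\<dots> = 1 / Q" using Q(1) p1 by (simp add: powr_divide powr_powr)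
        finally have "C * ((8 / R) powr p * K1) \<le> C * (1 / Q * K1)" using C(1) K10 by (intro mult_left_mono mult_right_mono) auto
        also have "\<dots> \<le> t" using Q(2) by simp
        finally show ?thesis .
      qed
      define b where "b = l - s * \<kappa> + \<delta>"
      \<comment> \<open>The sign of \<open>b\<close> is carried along because \<open>ennreal\<close>
        truncates negative numbers to 0; without it the real inequality \<open>ey \<le> b\<close>
        could not be recovered.\<close>
      have inner: "\<forall>\<^sub>F k in sequentially. En (\<Omega> \<inter> cball 0 R) (z k) \<le> ennreal b \<and> 0 \<le> b" if R: "R0 \<le> R" "R1 \<le> R" "0 < R" for R
      proof -
        let ?M = "lebesgue_on (cball (0::real^'n) (2 * R))"
        have cb: "cball (0::real^'n) (2 * R) \<in> sets lebesgue" "cball (0::real^'n) R \<in> sets lebesgue" by auto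
        have fm: "(\<lambda>x. fst (f x)) \<in> borel_measurable ?M" if "f \<in> borel_measurable lebesgue" for f :: "real^'n \<Rightarrow> real \<times> (real^'n)"
          by (rule measurable_restrict_space1[OF measurable_fst_comp[OF that]])
        have "Npow \<sigma> ?M (\<lambda>x. fst (y x)) \<le> ennreal \<theta>" unfolding N\<theta>[symmetric] by (rule Npow_restrict_le[OF cb(1)])
        also have "\<dots> < ennreal (\<theta> + t)" using t(2) \<theta>(1) by (intro ennreal_lessI) auto
        finally have y\<theta>: "Npow \<sigma> ?M (\<lambda>x. fst (y x)) < ennreal (\<theta> + t)" .
        have lim: "(\<lambda>k. Npow \<sigma> ?M (\<lambda>x. fst (y x) - fst (z k x))) \<longlonglongrightarrow> 0"
          using locs[of "2 * R"] R(3) by (simp add: Npow_commute[of \<sigma> ?M "\<lambda>x. fst (y x)"])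
        have e1: "\<forall>\<^sub>F k in sequentially. Npow \<sigma> ?M (\<lambda>x. fst (z k x)) < ennreal (\<theta> + t)"
          by (rule Npow_eventually_less[OF fm[OF zm] fm[OF ym] \<sigma>1(1) lim y\<theta>])
        have e2: "\<forall>\<^sub>F k in sequentially. inverse (real (Suc k)) < \<delta> / 2"
          using \<delta> by (intro order_tendstoD(2)[OF LIMSEQ_inverse_real_of_nat]) simp
        show ?thesis using e1 e2
        proof eventually_elim
          case (elim k)
          let ?Y = "Npow \<sigma> (lebesgue_on (- cball 0 (2 * R))) (\<lambda>x. fst (z k x))"
          have sp: "Npow \<sigma> ?M (\<lambda>x. fst (z k x)) + ?Y = 1"
            using Npow_split[OF cb(1) measurable_fst_comp[OF zm[of k]], of \<sigma>] z1[of k] by simp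
          \<comment> \<open>The total mass is 1, and inside radius 2 R the sequence converges in
            L^\<sigma> to \<open>y\<close>, which leaves at most \<theta> + t there.\<close>
          have cY: "ennreal (1 - \<theta> - t) \<le> ?Y"
          proof (rule ccontr)
            assume "\<not> ennreal (1 - \<theta> - t) \<le> ?Y"
            hence "?Y < ennreal (1 - \<theta> - t)" by simp
            hence "Npow \<sigma> ?M (\<lambda>x. fst (z k x)) + ?Y < ennreal (\<theta> + t) + ennreal (1 - \<theta> - t)"
              using elim(1) by (intro add_strict_mono)
            also have "\<dots> = ennreal 1" using t \<theta> by (subst ennreal_plus[symmetric]) auto
            finally show False unfolding sp by simp
          qed
          have tot: "En \<Omega> (z k) = En (\<Omega> \<inter> cball 0 R) (z k) + En (\<Omega> - cball 0 R) (z k)" by (rule En_split[OF cb(2) zm])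
          have "En \<Omega> (z k) < top" using zB[of k] by (rule le_less_trans) simp
          hence "En (\<Omega> \<inter> cball 0 R) (z k) < top" "En (\<Omega> - cball 0 R) (z k) < top" unfolding tot by simp_all
          then obtain ei eo where ei: "En (\<Omega> \<inter> cball 0 R) (z k) = ennreal ei" "0 \<le> ei"
            and eo: "En (\<Omega> - cball 0 R) (z k) = ennreal eo" "0 \<le> eo"
            by (metis ennreal_enn2real enn2real_nonneg)
          have "(1 - t) * (s * (1 - \<theta> - t) powr (p / \<sigma>) - 2 * t / p) \<le> eo"
          proof (rule outer_energy_bound[OF \<sigma>1(1) s0 s(2) zw R(3) t(2,3) _ zf K10 C' _ R1[OF R(2,3)] _ cY eo])
            show "1 - t \<le> V x" if "x \<in> \<Omega>" "R < norm x" for x using R0[of x] that R(1) by simp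
          qed (use C(1) t in auto)
          hence H: "s * \<kappa> - \<delta> / 2 < eo" using t(1) by (simp add: H_def)
          have "ennreal (ei + eo) \<le> ennreal (l + inverse (real (Suc k)))"
            using zl[of k] unfolding tot ei(1) eo(1) using ei(2) eo(2) by (simp add: ennreal_plus)
          hence "ei + eo \<le> l + inverse (real (Suc k))" using l(2) by (subst (asm) ennreal_le_iff) auto
          hence "ei \<le> b" using H elim(2) unfolding b_def by linarith
          thus ?case unfolding ei(1) using ei(2) by (auto intro: ennreal_leI)
        qed
      qed
      define R2 where "R2 = max (max R0 R1) 1"
      have b0: "0 \<le> b"
        using eventually_happens'[OF sequentially_bot inner[of R2]] unfolding R2_def by auto
      \<comment> \<open>Semicontinuity is applied on each large ball, with the same bound
        \<open>b\<close>, before the radius grows.\<close>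
      have "En \<Omega> y \<le> ennreal b"
      proof (rule En_exhaust[OF ym])
        fix j :: nat assume j: "R2 \<le> real j"
        show "En (\<Omega> \<inter> cball 0 (real j)) y \<le> ennreal b"
        proof (rule lsc)
          have "\<forall>\<^sub>F k in sequentially. En (\<Omega> \<inter> cball 0 (real j)) (z k) \<le> ennreal b \<and> 0 \<le> b"
            using j by (intro inner) (auto simp: R2_def)
          thus "\<forall>\<^sub>F k in sequentially. En (\<Omega> \<inter> cball 0 (real j)) (z k) \<le> ennreal b" by eventually_elim simp
        qed (use \<Omega>_sets in auto)
      qed
      hence "ey \<le> b" unfolding Ey(1) using b0 by (subst (asm) ennreal_le_iff) auto
      thus ?thesis by (simp add: b_def)
    qed
    have up: "ey + s * \<kappa> \<le> l"
    proof (rule field_le_epsilon)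
      show "ey + s * \<kappa> \<le> l + \<delta>" if "\<delta> > 0" for \<delta> using upper[OF that] by simp
    qed
    have low: "\<theta> powr (p / \<sigma>) * l \<le> ey"
    proof (cases "\<theta> = 0")
      case True
      thus ?thesis using Ey(2) by simp
    next
      case False
      hence \<theta>0: "0 < \<theta>" using \<theta> by simp
      \<comment> \<open>Normalises \<open>y\<close> in L^\<sigma>. As \<theta> is at most 1,
        \<open>c\<close> is at least 1, as \<open>En_scale\<close> requires.\<close>
      define c where "c = \<theta> powr (- (1 / \<sigma>))"
      have c0: "0 < c" unfolding c_def using \<theta>0 by simp
      have c1: "1 \<le> c"
        unfolding c_def using powr_mono2'[of "- (1 / \<sigma>)" \<theta> 1] \<theta>0 \<theta> \<sigma>1 by simp
      have "c powr \<sigma> = \<theta> powr (- 1)" unfolding c_def using \<sigma>1 by (simp add: powr_powr)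
      hence cs: "c powr \<sigma> * \<theta> = 1" using \<theta>0 by (simp add: powr_minus)
      have cp: "c powr p * \<theta> powr (p / \<sigma>) = 1" unfolding c_def using \<theta>0 by (simp add: powr_powr flip: powr_add)
      have "Npow \<sigma> lebesgue (\<lambda>x. fst (c *\<^sub>R y x)) = ennreal (c powr \<sigma>) * ennreal \<theta>"
        using Npow_scale[OF measurable_fst_comp[OF ym], of \<sigma> c] c0 N\<theta> by simp
      also have "\<dots> = 1" using cs \<theta>(1) by (simp add: ennreal_mult[symmetric])
      finally have "ennreal l \<le> En \<Omega> (\<lambda>x. c *\<^sub>R y x)" by (intro S_le wpair_scale yw)
      also have "\<dots> \<le> ennreal (c powr p) * ennreal ey" using En_scale[OF ym c1] unfolding Ey(1) .
      also have "\<dots> = ennreal (c powr p * ey)" using Ey(2) by (simp add: ennreal_mult)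
      finally have "l \<le> c powr p * ey" using Ey(2) by (subst (asm) ennreal_le_iff) auto
      hence "\<theta> powr (p / \<sigma>) * l \<le> \<theta> powr (p / \<sigma>) * (c powr p * ey)" by (intro mult_left_mono) auto
      also have "\<dots> = (c powr p * \<theta> powr (p / \<sigma>)) * ey" by (simp add: mult_ac)
      finally show ?thesis unfolding cp by simp
    qed
    \<comment> \<open>On [0,1] an exponent below 1 increases a power. Hence l = \<theta> l + (1 -
      \<theta>) l < \<theta> l + (1 - \<theta>) s \<le> ey + s \<kappa> \<le> l, a
      contradiction.\<close>
    have e: "p / \<sigma> \<le> 1" using \<sigma> p1 by simp
    have "\<theta> powr 1 \<le> \<theta> powr (p / \<sigma>)" "(1 - \<theta>) powr 1 \<le> \<kappa>"
      unfolding \<kappa>_def using \<theta> by (intro powr_mono'[OF e]; simp)+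
    hence g: "\<theta> \<le> \<theta> powr (p / \<sigma>)" "1 - \<theta> \<le> \<kappa>" using \<theta> by simp_all
    have "\<theta> * l \<le> \<theta> powr (p / \<sigma>) * l" using g(1) l(2) by (rule mult_right_mono)
    moreover have "s * (1 - \<theta>) \<le> s * \<kappa>" using g(2) s0 by (intro mult_left_mono) auto
    moreover have "l * (1 - \<theta>) < s * (1 - \<theta>)" using s(1) \<theta>l by (intro mult_strict_right_mono) auto
    moreover have "\<theta> * l + l * (1 - \<theta>) = l" by (simp add: algebra_simps)
    ultimately show False using up low by linarith
  qed
  hence y1: "Npow \<sigma> lebesgue (\<lambda>x. fst (y x)) = 1" using N\<theta> by simp
  have "En \<Omega> y \<le> ennreal l"
  proof (rule ennreal_le_epsilon)
    fix \<delta> :: real assume \<delta>: "0 < \<delta>"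
    have "En \<Omega> y \<le> ennreal (l + \<delta>)"
    proof (rule lsc[OF \<Omega>_sets order_refl])
      have "\<forall>\<^sub>F k in sequentially. inverse (real (Suc k)) < \<delta>" by (rule order_tendstoD(2)[OF LIMSEQ_inverse_real_of_nat \<delta>])
      thus "\<forall>\<^sub>F k in sequentially. En \<Omega> (z k) \<le> ennreal (l + \<delta>)"
      proof eventually_elim
        case (elim k)
        show ?case by (rule order_trans[OF zl]) (use elim in \<open>auto intro!: ennreal_leI\<close>)
      qed
    qed
    also have "\<dots> = ennreal l + ennreal \<delta>" using l(2) \<delta> by (intro ennreal_plus) auto
    finally show "En \<Omega> y \<le> ennreal l + ennreal \<delta>" .
  qed
  hence "energy p m L M V \<Omega> (\<lambda>x. fst (y x)) = S_Omega p m \<sigma> L M V \<Omega>"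
    unfolding energy_wpair[OF open_\<Omega> p1(1) yw] l(1) using S_le[OF yw y1] by (rule antisym)
  thus ?thesis using wpair_imp_constraint_set[OF open_\<Omega> p1(1) m1 \<sigma>1(1) yw y1] by blast
qed

end

section \<open>From the stated hypotheses to the setting of the argument\<close>

lemma admissible_integrand_continuous:
  assumes "admissible_integrand m q F"
  shows "continuous_on UNIV F"
proof -
  have "\<forall>x. F differentiable (at x)"
    using assms by (cases "2 \<le> m") (auto simp: admissible_integrand_def numeral_2_eq_2)
  thus ?thesis by (auto intro!: continuous_at_imp_continuous_on differentiable_imp_continuous_within)
qed

lemma admissible_integrand_midpoint:
  assumes "admissible_integrand m q F" "x \<noteq> y"
  shows "F ((1/2) *\<^sub>R (x + y)) < F x / 2 + F y / 2"
proof -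
  have "strictly_convex F" using assms(1) by (simp add: admissible_integrand_def)
  hence "F ((1 - 1/2) *\<^sub>R x + (1/2) *\<^sub>R y) < (1 - 1/2) * F x + (1/2) * F y"
    using assms(2) unfolding strictly_convex_def by (metis divide_less_eq_1_pos half_gt_zero_iff one_less_numeral_iff semiring_norm(76) zero_less_numeral zero_less_one)
  thus ?thesis by (simp add: scaleR_add_right)
qed

theorem corollary1p8:
  fixes p m \<sigma> :: real
    and \<Omega> :: "(real^'n) set"
    and V L M :: "real^'n \<Rightarrow> real"
  assumes "1 < m" and "m \<le> p" and "p < real CARD('n)"
    and "p < \<sigma>" and "\<sigma> < sobolev_exponent (real CARD('n)) p"
    and "smooth_domain \<Omega>" and "bounded (- \<Omega>)"
    and "continuous_on \<Omega> V" and "(INF x\<in>\<Omega>. ereal (V x)) > 0"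
    and "(V \<longlongrightarrow> 1) (inf at_infinity (principal \<Omega>))"
    and "admissible_integrand m p L" and "admissible_integrand m m M"
    and "pos_homogeneous p L" and "pos_homogeneous m M"
    and "\<And>\<xi>. L \<xi> \<ge> p * norm \<xi> powr p" and "\<And>\<xi>. M \<xi> \<ge> m * norm \<xi> powr m"
    and "S_Omega p m \<sigma> L M V \<Omega>
           < ennreal (((\<sigma> - p) / (\<sigma> - m)) powr ((\<sigma> - p) / \<sigma>)) * S_RN p \<sigma> TYPE('n)"
  shows "\<exists>u\<in>constraint_set p m \<sigma> \<Omega>. energy p m L M V \<Omega> u = S_Omega p m \<sigma> L M V \<Omega>"
proof -
  have "(0 :: ereal) < (INF x\<in>\<Omega>. ereal (V x))" by fact
  \<comment> \<open>The infimum is an extended real; a positive real strictly below it serves as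
    \<open>v0\<close>.\<close>
  then obtain v where v: "0 < ereal v" "ereal v < (INF x\<in>\<Omega>. ereal (V x))" using ereal_dense2 by blast
  have vV: "v \<le> V x" if "x \<in> \<Omega>" for x
    using less_le_trans[OF v(2) INF_lower[OF that]] by simp
  interpret minimization_setup p m \<Omega> V L M v
  proof
    show "open \<Omega>" using assms(6) by (simp add: smooth_domain_def)
    show "continuous_on UNIV L" "continuous_on UNIV M"
      by (rule admissible_integrand_continuous[OF assms(11)] admissible_integrand_continuous[OF assms(12)])+
    show "L ((1/2) *\<^sub>R (x + y)) < L x / 2 + L y / 2" "M ((1/2) *\<^sub>R (x + y)) < M x / 2 + M y / 2" if "x \<noteq> y" for x y
      by (rule admissible_integrand_midpoint[OF assms(11) that] admissible_integrand_midpoint[OF assms(12) that])+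
  qed (use assms v vV in \<open>auto simp: pos_homogeneous_def\<close>)
  define N where "N = real CARD('n)"
  have N: "p < N" "\<sigma> < N * p / (N - p)" using assms(3,5) by (auto simp: N_def sobolev_exponent_def)
  \<comment> \<open>Below the critical exponent the power of the scale in front of the gradient term
    is positive.\<close>
  have "\<sigma> * (N - p) < N * p" using N by (simp add: pos_less_divide_eq)
  hence "N - p < N * p / \<sigma>" using assms(4) p1 by (simp add: pos_less_divide_eq mult.commute)
  hence a: "real CARD('n) * p / \<sigma> + p - real CARD('n) > 0" by (simp add: N_def)
  have V: "\<exists>R. \<forall>x\<in>\<Omega>. R < norm x \<longrightarrow> 1 - t \<le> V x" if t: "t > 0" for t
  proof -
    have "\<forall>\<^sub>F x in inf at_infinity (principal \<Omega>). 1 - t < V x" using t by (intro order_tendstoD(1)[OF assms(10)]) simp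
    hence "\<forall>\<^sub>F x in at_infinity. x \<in> \<Omega> \<longrightarrow> 1 - t < V x" by (simp add: eventually_inf_principal)
    then obtain R where "\<forall>x. R \<le> norm x \<longrightarrow> x \<in> \<Omega> \<longrightarrow> 1 - t < V x" unfolding eventually_at_infinity by blast
    thus ?thesis by (intro exI[of _ R]) (auto intro: less_imp_le)
  qed
  let ?q = "((\<sigma> - p) / (\<sigma> - m)) powr ((\<sigma> - p) / \<sigma>)"
  \<comment> \<open>The quotient is at most 1 since m \<le> p < \<sigma>, so the assumed gap implies
    a strict inequality between the two infima.\<close>
  have "?q \<le> 1 powr ((\<sigma> - p) / \<sigma>)" using assms(1,2,4) by (intro powr_mono2) auto
  hence "ennreal ?q \<le> 1" by simp
  hence "ennreal ?q * S_RN p \<sigma> TYPE('n) \<le> 1 * S_RN p \<sigma> TYPE('n)" by (rule mult_right_mono) simp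
  hence "S_Omega p m \<sigma> L M V \<Omega> < S_RN p \<sigma> TYPE('n)" using assms(17) by simp
  \<comment> \<open>The intermediate value is finite because it lies strictly below an element of
    [0,\<infinity>]; in turn it forces \<open>S_Omega\<close> to be finite.\<close>
  then obtain s' where s': "S_Omega p m \<sigma> L M V \<Omega> < s'" "s' < S_RN p \<sigma> TYPE('n)" using dense by blast
  obtain s where s: "s' = ennreal s" "0 \<le> s" using s'(2) by (cases s' rule: ennreal_cases) auto
  define l where "l = enn2real (S_Omega p m \<sigma> L M V \<Omega>)"
  have l: "S_Omega p m \<sigma> L M V \<Omega> = ennreal l" "0 \<le> l"
    using less_trans[OF s'(1)[unfolded s(1)] ennreal_less_top] by (simp_all add: l_def)
  have "l < s" using s'(1) l(2) unfolding l(1) s(1) by (simp add: ennreal_less_iff)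
  thus ?thesis using minimizer_exists[OF assms(4) a V l _ less_imp_le[OF s'(2)[unfolded s(1)]]] by blast
qed

end
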